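(* Let $X=K^n$, let $\mathcal M=\mathcal D_X\otimes_{A_n}(A_n^r/N)$ be a holonomic left $\mathcal D_X$-module with $N$ a left $A_n$-submodule of $A_n^r$, and let $f\in K[x]$ be a non-constant polynomial. Let $I$ be the left ideal of the Weyl algebra $A_{n+1}=K[t,x]\langle\partial_t,\partial_x\rangle$ ($t$ a single variable) generated by $t-f(x)$ and $\partial_{x_i}+(\partial f/\partial x_i)\partial_t$ ($i=1,\dots,n$). Let $b(\theta)$ be the global $b$-function, with zero shift vector, of $\mathcal D_{K\times X}\otimes_{A_{n+1}}(A_{n+1}/I)$ along $\{t=0\}$, and put $b_f(s)=b(-s-1)$. Let $J_f=\{P(s,x,\partial_x)\in A_n[s]\mid Pf^s=0\}$, let $\nu$ be the minimum integer root of $b_f(s)=0$, and put $J_f(\nu)=\{P(\nu,x,\partial_x)\mid P(s,x,\partial_x)\in J_f\}$. Then $$\mathcal O_X[f^{-1}]\simeq\mathcal D_X\otimes_{A_n}(A_n/J_f(\nu))$$ as left $\mathcal D_X$-modules. Moreover, let $G_3$ be the set of all $P(x,\partial_x)e_j$ with $P$ in a finite generating set of $J_f(\nu)$ and $1\le j\le r$, together with all $Q(y,\partial_y)$ with $Q$ in a finite generating set of $N$; let $G_4$ be obtained from $G_3$ by the coordinate substitution $y_i=x_i+z_i$ ($i=1,\dots,n$), and let $I_4$ be the left submodule generated by $G_4$ of $A_{2n}^r$, where $A_{2n}=K[z,x]\langle\partial_z,\partial_x\rangle$. Then $$\mathcal M[f^{-1}]\simeq\mathcal H^0\Big(\big(\mathcal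 D_{X\times X}\otimes_{A_{2n}}(A_{2n}^r/I_4)\big)^\bullet_{\{0\}\times X}\Big)$$ as left $\mathcal D_X$-modules, where $\{0\}\times X=\{z=0\}$.
   Context: $K$ is an algebraically closed field of characteristic zero; $\mathcal O_X$, $\mathcal D_X$ are the sheaves of regular functions and of algebraic linear differential operators; $A_n=K[x]\langle\partial_x\rangle$. $\mathcal M[f^{-1}]=\mathcal O_X[f^{-1}]\otimes_{\mathcal O_X}\mathcal M$ with its natural left $\mathcal D_X$-module structure. $e_1,\dots,e_r$ are the unit vectors of $A_n^r$. $f^s$ is the formal generator of the free $K[x,f^{-1},s]$-module $K[x,f^{-1},s]f^s$, on which $A_n[s]$ acts with $\partial_{x_i}f^s=s(\partial f/\partial x_i)f^{-1}f^s$. Global $b$-function with zero shift: on $Z=K\times X$ with coordinates $(t,x)$ and $Y=\{t=0\}$, $\mathcal J_Y=t\mathcal O_Z$ ($\mathcal J_Y^j=\mathcal O_Z$ for $j\le0$), let $F_Y^k(\mathcal D_Z)=\{P\in\mathcal D_Z|_Y:P\mathcal J_Y^j\subset\mathcal J_Y^{j-k}\ \forall j\ge k\}$. For a cyclic module $\mathcal L=\mathcal D_Zu$, $b(\theta,p)$ ($p\in Y$) is the monic polynomial of least degree with $b(t\partial_t,p)\big(F_Y^0(\mathcal D_Z)u\big)_p\subset\big(F_Y^{-1}(\mathcal D_Z)u\big)_p$ (zero if none exists), and the global $b$-function is the least common multiple of all $b(\theta,p)$, $p\in Y$. The substitution $y_i=x_i+z_i$ means rewriting operators on $X\times X$ (coordinates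 $(x,y)$) in coordinates $(z,x)$, $z_i=y_i-x_i$: $y_i\mapsto x_i+z_i$, $\partial_{y_i}\mapsto\partial_{z_i}$, old $\partial_{x_i}\mapsto\partial_{x_i}-\partial_{z_i}$. Restriction to $Y'=\{0\}\times X=\{z=0\}$ of a left $\mathcal D_{X\times X}$-module $\mathcal L$: $\mathcal L_{Y'}^\bullet=(\mathcal O_{Y'}\otimes_{\mathcal O_{X\times X}}\mathcal D_{X\times X})\otimes^L_{\mathcal D_{X\times X}}\mathcal L$, a complex of left modules over $\mathcal D_{Y'}=\mathcal D_X$. *)

theory Defs
  imports
    "HOL-Library.Poly_Mapping"
    "HOL-Library.FuncSet"
    "HOL-Computational_Algebra.Polynomial"
    "HOL-Computational_Algebra.Fraction_Field"
    "HOL-Analysis.Finite_Cartesian_Product"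
begin

section \<open>Polynomials and rational functions in several variables\<close>

text \<open>
  The variables are indexed by a finite type 'n, so K^n is the type 'n \<Rightarrow> 'k. The index type
  carries a linear order only because the library proves that polynomials have no zero divisors
  for ordered exponents. Products of affine spaces have sum types as index types.
\<close>

instantiation sum :: (linorder, linorder) linorder
begin

definition less_eq_sum :: "'a + 'b \<Rightarrow> 'a + 'b \<Rightarrow> bool" where
  "less_eq_sum u v = (case u of
      Inl a \<Rightarrow> (case v of Inl a' \<Rightarrow> a \<le> a' | Inr _ \<Rightarrow> True)
    | Inr b \<Rightarrow> (case v of Inl _ \<Rightarrow> False | Inr b' \<Rightarrow> b \<le> b'))"

definition less_sum :: "'a + 'b \<Rightarrow> 'a + 'b \<Rightarrow> bool" where
  "less_sum u v \<longleftrightarrow> u \<le> v \<and> \<not> v \<le> u"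

instance
  by standard (auto simp: less_eq_sum_def less_sum_def split: sum.splits)

end

type_synonym ('k, 'n) mpol = "('n \<Rightarrow>\<^sub>0 nat) \<Rightarrow>\<^sub>0 'k"
type_synonym ('k, 'n) ratf = "('k, 'n) mpol fract"

definition mvar :: "'n \<Rightarrow> ('k::comm_ring_1, 'n) mpol" where
  "mvar i = Poly_Mapping.single (Poly_Mapping.single i 1) 1"

definition mconst :: "'k::comm_ring_1 \<Rightarrow> ('k, 'n) mpol" where
  "mconst c = Poly_Mapping.single 0 c"

definition meval :: "('n::finite \<Rightarrow> 'k::comm_ring_1) \<Rightarrow> ('k, 'n) mpol \<Rightarrow> 'k" where
  "meval p q = (\<Sum>m\<in>Poly_Mapping.keys q.
     Poly_Mapping.lookup q m * (\<Prod>i\<in>UNIV. p i ^ Poly_Mapping.lookup m i))"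

definition msubst :: "('n::finite \<Rightarrow> ('k::comm_ring_1, 'm) mpol) \<Rightarrow> ('k, 'n) mpol \<Rightarrow> ('k, 'm) mpol" where
  "msubst \<sigma> q = (\<Sum>m\<in>Poly_Mapping.keys q.
     mconst (Poly_Mapping.lookup q m) * (\<Prod>i\<in>UNIV. \<sigma> i ^ Poly_Mapping.lookup m i))"

definition mpd :: "'n \<Rightarrow> ('k::comm_ring_1, 'n) mpol \<Rightarrow> ('k, 'n) mpol" where
  "mpd i q = (\<Sum>m\<in>Poly_Mapping.keys q.
     Poly_Mapping.single (m - Poly_Mapping.single i 1)
       (of_nat (Poly_Mapping.lookup m i) * Poly_Mapping.lookup q m))"

lemma mpd_superset:
  assumes "finite A" "Poly_Mapping.keys q \<subseteq> A"
  shows "mpd i q = (\<Sum>m\<in>A. Poly_Mapping.single (m - Poly_Mapping.single i 1)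
       (of_nat (Poly_Mapping.lookup m i) * Poly_Mapping.lookup q m))"
  unfolding mpd_def using assms
  by (intro sum.mono_neutral_left) (auto simp: in_keys_iff)

lemma mpd_add: "mpd i (p + q) = mpd i p + mpd i q"
proof -
  let ?A = "Poly_Mapping.keys p \<union> Poly_Mapping.keys q"
  have "Poly_Mapping.keys (p + q) \<subseteq> ?A" by (rule Poly_Mapping.keys_add)
  then show ?thesis
    by (simp add: mpd_superset[of ?A] sum.distrib[symmetric] lookup_add single_add[symmetric]
        distrib_left)
qed

lemma mpd_0 [simp]: "mpd i 0 = 0"
  by (simp add: mpd_def)

lemma mpd_single: "mpd i (Poly_Mapping.single m c) =
    Poly_Mapping.single (m - Poly_Mapping.single i 1) (of_nat (Poly_Mapping.lookup m i) * c)"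
  by (subst mpd_superset[of "{m}"]) auto

lemma poly_mapping_single_add_induct:
  assumes "P 0" "\<And>m c q. P q \<Longrightarrow> P (Poly_Mapping.single m c + q)"
  shows "P (q :: 'a \<Rightarrow>\<^sub>0 'b::comm_monoid_add)"
proof (induction "Poly_Mapping.keys q" arbitrary: q rule: infinite_finite_induct)
  case empty
  then show ?case using assms(1) by (metis keys_eq_empty)
next
  case (insert x F)
  define r where "r = Poly_Mapping.update x 0 q"
  have "q = Poly_Mapping.single x (Poly_Mapping.lookup q x) + r"
    by (rule poly_mapping_eqI) (auto simp: r_def lookup_add lookup_update lookup_single when_def)
  moreover have "Poly_Mapping.keys r = F"
    using insert(2,4) by (auto simp: r_def in_keys_iff lookup_update split: if_splits)
  ultimately show ?case using insert(3) assms(2) by metis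
qed auto

lemma mpd_single_mult:
  "mpd i (Poly_Mapping.single m c * Poly_Mapping.single m' d) =
   mpd i (Poly_Mapping.single m c) * Poly_Mapping.single m' d +
   Poly_Mapping.single m c * mpd i (Poly_Mapping.single m' d)"
proof -
  let ?e = "Poly_Mapping.single i (1::nat)"
  have shift: "a - ?e + b = a + b - ?e" if "Poly_Mapping.lookup a i \<noteq> 0" for a b :: "'a \<Rightarrow>\<^sub>0 nat"
    using that
    by (intro poly_mapping_eqI) (auto simp: lookup_add lookup_minus lookup_single when_def)
  have 1: "Poly_Mapping.single (m - ?e + m') (of_nat (Poly_Mapping.lookup m i) * c * d) =
      Poly_Mapping.single (m + m' - ?e) (of_nat (Poly_Mapping.lookup m i) * c * d)"
    using shift[of m m'] by (cases "Poly_Mapping.lookup m i = 0") auto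
  have 2: "Poly_Mapping.single (m + (m' - ?e)) (c * (of_nat (Poly_Mapping.lookup m' i) * d)) =
      Poly_Mapping.single (m + m' - ?e) (c * (of_nat (Poly_Mapping.lookup m' i) * d))"
    using shift[of m' m] by (cases "Poly_Mapping.lookup m' i = 0") (auto simp: add.commute)
  show ?thesis
    by (simp only: mult_single mpd_single 1 2 single_add[symmetric])
       (simp add: lookup_add algebra_simps)
qed

lemma mpd_mult: "mpd i (p * q) = mpd i p * q + p * mpd i q"
proof (induction p rule: poly_mapping_single_add_induct)
  case (2 m c p)
  have "mpd i (Poly_Mapping.single m c * q) =
      mpd i (Poly_Mapping.single m c) * q + Poly_Mapping.single m c * mpd i q"
    by (induction q rule: poly_mapping_single_add_induct)
       (simp_all add: distrib_left mpd_add mpd_single_mult algebra_simps)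
  then show ?case using 2 by (simp add: distrib_right mpd_add algebra_simps)
qed simp

lift_definition rpd :: "'n::linorder \<Rightarrow> ('k::idom, 'n) ratf \<Rightarrow> ('k, 'n) ratf"
  is "\<lambda>i (a, b). (mpd i a * b - a * mpd i b, b * b)"
proof -
  fix i :: 'n and x y :: "('k, 'n) mpol \<times> ('k, 'n) mpol"
  obtain a b a' b' where xy: "x = (a, b)" "y = (a', b')" by fastforce
  assume "fractrel x y"
  then have nz: "b \<noteq> 0" "b' \<noteq> 0" and eq: "a * b' = a' * b" by (auto simp: xy)
  have "mpd i a * b' + a * mpd i b' = mpd i a' * b + a' * mpd i b"
    using arg_cong[OF eq, of "mpd i"] by (simp add: mpd_mult)
  with eq have "(mpd i a * b - a * mpd i b) * (b' * b') = (mpd i a' * b' - a' * mpd i b') * (b * b)"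
    by algebra
  with nz show "fractrel (case x of (a, b) \<Rightarrow> (mpd i a * b - a * mpd i b, b * b))
     (case y of (a, b) \<Rightarrow> (mpd i a * b - a * mpd i b, b * b))"
    by (simp add: xy)
qed

lemma rpd_Fract: "b \<noteq> 0 \<Longrightarrow> rpd i (Fract a b) = Fract (mpd i a * b - a * mpd i b) (b * b)"
  by (simp add: Fract.abs_eq rpd.abs_eq)

lemma rpd_add:
  fixes g h :: "('k::idom, 'n::linorder) ratf"
  shows "rpd i (g + h) = rpd i g + rpd i h"
proof -
  obtain a b c d where g: "g = Fract a b" "b \<noteq> 0" and h: "h = Fract c d" "d \<noteq> 0"
    by (metis Fract_cases)
  have poly_id: "((u * d + a * w + (y * b + c * x)) * (b * d) - (a * d + c * b) * (x * d + b * w)) * ((b * b) * (d * d))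
     = ((u * b - a * x) * (d * d) + (y * d - c * w) * (b * b)) * ((b * d) * (b * d))"
    for u x y w :: "('k, 'n) mpol" by algebra
  show ?thesis
    using g h poly_id[of "mpd i a" "mpd i d" "mpd i c" "mpd i b"]
    by (simp only: rpd_Fract add_fract eq_fract mpd_add mpd_mult mult_eq_0_iff de_Morgan_disj simp_thms)
qed

definition rpol :: "('k::idom, 'n::linorder) mpol \<Rightarrow> ('k, 'n) ratf" where
  "rpol q = Fract q 1"

section \<open>Differential operators\<close>

text \<open>Additive endomorphisms, as a ring under composition.\<close>

typedef (overloaded) 'a endo = "{F :: 'a::comm_ring_1 \<Rightarrow> 'a. \<forall>x y. F (x + y) = F x + F y}"
  morphisms app Endo
  by (rule exI[of _ id]) simp

setup_lifting type_definition_endo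

instantiation endo :: (comm_ring_1) ring_1
begin

lift_definition zero_endo :: "'a endo" is "\<lambda>_. 0" by simp
lift_definition one_endo :: "'a endo" is "\<lambda>x. x" by simp
lift_definition plus_endo :: "'a endo \<Rightarrow> 'a endo \<Rightarrow> 'a endo" is "\<lambda>F G x. F x + G x"
  by (simp add: algebra_simps)
lift_definition minus_endo :: "'a endo \<Rightarrow> 'a endo \<Rightarrow> 'a endo" is "\<lambda>F G x. F x - G x"
  by (simp add: algebra_simps)
lift_definition uminus_endo :: "'a endo \<Rightarrow> 'a endo" is "\<lambda>F x. - F x"
  by simp
lift_definition times_endo :: "'a endo \<Rightarrow> 'a endo \<Rightarrow> 'a endo" is "\<lambda>F G x. F (G x)"
  by simp

instance
proof
  show "(0 :: 'a endo) \<noteq> 1"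
    by transfer (metis zero_neq_one)
qed (transfer; simp add: fun_eq_iff algebra_simps)+

end

type_synonym ('k, 'n) dop = "('k, 'n) ratf endo"

definition mulop :: "('k::idom, 'n::linorder) ratf \<Rightarrow> ('k, 'n) dop" where
  "mulop g = Endo (\<lambda>h. g * h)"

definition pdop :: "'n::linorder \<Rightarrow> ('k::idom, 'n) dop" where
  "pdop i = Endo (rpd i)"

lemma app_mulop [simp]: "app (mulop g) h = g * h"
  unfolding mulop_def by (subst Endo_inverse) (auto simp: distrib_left)

lemma app_pdop [simp]: "app (pdop i) = rpd i"
  unfolding pdop_def by (subst Endo_inverse) (auto simp: rpd_add)

definition polop :: "('k::idom, 'n::linorder) mpol \<Rightarrow> ('k, 'n) dop" where
  "polop q = mulop (rpol q)"

definition varop :: "'n::linorder \<Rightarrow> ('k::idom, 'n) dop" where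
  "varop i = polop (mvar i)"

definition monom_at :: "('n::{finite,linorder} \<Rightarrow> 'a::monoid_mult) \<Rightarrow> ('n \<Rightarrow>\<^sub>0 nat) \<Rightarrow> 'a" where
  "monom_at X \<alpha> = prod_list (map (\<lambda>i. X i ^ Poly_Mapping.lookup \<alpha> i) (sorted_list_of_set UNIV))"

definition dop_of :: "(('n::{finite,linorder} \<Rightarrow>\<^sub>0 nat) \<Rightarrow>\<^sub>0 ('k::idom, 'n) ratf) \<Rightarrow> ('k, 'n) dop" where
  "dop_of a = (\<Sum>\<alpha>\<in>Poly_Mapping.keys a. mulop (Poly_Mapping.lookup a \<alpha>) * monom_at pdop \<alpha>)"

text \<open>The coefficients are unique in characteristic zero.\<close>

definition dcoeffs :: "('k::idom, 'n::{finite,linorder}) dop \<Rightarrow> ('n \<Rightarrow>\<^sub>0 nat) \<Rightarrow>\<^sub>0 ('k, 'n) ratf" where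
  "dcoeffs P = (THE a. dop_of a = P)"

definition weyl :: "('k::idom, 'n::{finite,linorder}) dop set" where
  "weyl = {dop_of a | a. \<forall>\<alpha>. Poly_Mapping.lookup a \<alpha> \<in> range rpol}"

definition wcoeff :: "('k::idom, 'n::{finite,linorder}) dop \<Rightarrow> ('n \<Rightarrow>\<^sub>0 nat) \<Rightarrow> ('k, 'n) mpol" where
  "wcoeff P \<alpha> = (THE q. rpol q = Poly_Mapping.lookup (dcoeffs P) \<alpha>)"

text \<open>
  The result of replacing x_i by \<open>X i\<close> and \<open>\<partial>\<close>_i by \<open>Y i\<close> in the normally ordered expression of
  an element of the Weyl algebra.
\<close>

definition weyl_subst :: "('n::{finite,linorder} \<Rightarrow> ('k::idom, 'm::linorder) dop) \<Rightarrow>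
    ('n \<Rightarrow> ('k, 'm) dop) \<Rightarrow> ('k, 'n) dop \<Rightarrow> ('k, 'm) dop" where
  "weyl_subst X Y P = (\<Sum>\<alpha>\<in>Poly_Mapping.keys (dcoeffs P). \<Sum>m\<in>Poly_Mapping.keys (wcoeff P \<alpha>).
     polop (mconst (Poly_Mapping.lookup (wcoeff P \<alpha>) m)) * monom_at X m * monom_at Y \<alpha>)"

text \<open>
  The action of a differential operator on a module over rational functions (scalar
  multiplication \<open>mul\<close>) with commuting derivations \<open>nab i\<close>.
\<close>

definition conn_act :: "(('k::idom, 'n::{finite,linorder}) ratf \<Rightarrow> 'v \<Rightarrow> 'v) \<Rightarrow> ('n \<Rightarrow> 'v \<Rightarrow> 'v) \<Rightarrow>
    ('k, 'n) dop \<Rightarrow> 'v::comm_monoid_add \<Rightarrow> 'v" where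
  "conn_act mul nab P v = (\<Sum>\<alpha>\<in>Poly_Mapping.keys (dcoeffs P).
     mul (Poly_Mapping.lookup (dcoeffs P) \<alpha>)
       (fold (\<lambda>i. nab i ^^ Poly_Mapping.lookup \<alpha> i) (sorted_list_of_set UNIV) v))"

section \<open>Structure sheaf and sheaf of differential operators of affine space\<close>

definition zopen :: "('n::finite \<Rightarrow> 'k::comm_ring_1) set \<Rightarrow> bool" where
  "zopen U \<longleftrightarrow> (\<exists>S. U = {p. \<exists>q\<in>S. meval p q \<noteq> 0})"

text \<open>
  Affine space is irreducible, so \<open>\<O>\<close> and \<open>\<D>\<close> are realised as sheaves of subrings of K(x) and of
  K(x)<\<open>\<partial>\<close>>, with inclusions as restriction maps. For nonempty open U, \<open>reg U\<close> is \<open>\<O>(U)\<close> and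
  \<open>Dop U\<close> is \<open>\<D>(U)\<close>; \<open>reg {p}\<close> and \<open>Dop {p}\<close> are the stalks at p. For the empty set these are not
  the zero ring, which is harmless: all module sheaves below are sheafified, so they have exactly
  one section over the empty set.
\<close>

definition reg :: "('n::{finite,linorder} \<Rightarrow> 'k::idom) set \<Rightarrow> ('k, 'n) ratf set" where
  "reg U = {g. \<forall>p\<in>U. \<exists>a b. meval p b \<noteq> 0 \<and> g = Fract a b}"

definition Dop :: "('n::{finite,linorder} \<Rightarrow> 'k::idom) set \<Rightarrow> ('k, 'n) dop set" where
  "Dop U = {dop_of a | a. \<forall>\<alpha>. Poly_Mapping.lookup a \<alpha> \<in> reg U}"

definition mdeg :: "('n::finite \<Rightarrow>\<^sub>0 nat) \<Rightarrow> nat" where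
  "mdeg \<alpha> = (\<Sum>i\<in>UNIV. Poly_Mapping.lookup \<alpha> i)"

definition Dop_ord :: "('n::{finite,linorder} \<Rightarrow> 'k::idom) set \<Rightarrow> int \<Rightarrow> ('k, 'n) dop set" where
  "Dop_ord U k = {dop_of a | a. (\<forall>\<alpha>. Poly_Mapping.lookup a \<alpha> \<in> reg U) \<and>
     (\<forall>\<alpha>\<in>Poly_Mapping.keys a. int (mdeg \<alpha>) \<le> k)}"

definition rval :: "('n::{finite,linorder} \<Rightarrow> 'k::field) \<Rightarrow> ('k, 'n) ratf \<Rightarrow> 'k" where
  "rval p g = (THE c. \<exists>a b. meval p b \<noteq> 0 \<and> g = Fract a b \<and> c = meval p a / meval p b)"

definition symb :: "int \<Rightarrow> ('k::field, 'n::{finite,linorder}) dop \<Rightarrow> ('n \<Rightarrow> 'k) \<Rightarrow> ('n \<Rightarrow> 'k) \<Rightarrow> 'k" where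
  "symb k P p \<xi> = (\<Sum>\<alpha> | \<alpha> \<in> Poly_Mapping.keys (dcoeffs P) \<and> int (mdeg \<alpha>) = k.
     rval p (Poly_Mapping.lookup (dcoeffs P) \<alpha>) * (\<Prod>i\<in>UNIV. \<xi> i ^ Poly_Mapping.lookup \<alpha> i))"

section \<open>Modules, quotients, tensor products\<close>

record ('d, 'a) lmod =
  carr :: "'a set"
  addm :: "'a \<Rightarrow> 'a \<Rightarrow> 'a"
  zerom :: 'a
  smul :: "'d \<Rightarrow> 'a \<Rightarrow> 'a"

definition natmod :: "('d \<Rightarrow> 'a \<Rightarrow> 'a) \<Rightarrow> 'a::comm_monoid_add set \<Rightarrow> ('d, 'a) lmod" where
  "natmod sc C = \<lparr>carr = C, addm = (+), zerom = 0, smul = sc\<rparr>"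

inductive_set addspan :: "('d, 'a) lmod \<Rightarrow> 'a set \<Rightarrow> 'a set" for M T where
  zero: "zerom M \<in> addspan M T"
| add: "x \<in> T \<Longrightarrow> y \<in> addspan M T \<Longrightarrow> addm M x y \<in> addspan M T"

definition lspan :: "('d, 'a) lmod \<Rightarrow> 'd set \<Rightarrow> 'a set \<Rightarrow> 'a set" where
  "lspan M R S = addspan M {smul M r x | r x. r \<in> R \<and> x \<in> S}"

definition lsubmodule :: "('d, 'a) lmod \<Rightarrow> 'd set \<Rightarrow> 'a set \<Rightarrow> bool" where
  "lsubmodule M R N \<longleftrightarrow> N \<subseteq> carr M \<and> zerom M \<in> N \<and> (\<forall>x\<in>N. \<forall>y\<in>N. addm M x y \<in> N) \<and>
     (\<forall>r\<in>R. \<forall>x\<in>N. smul M r x \<in> N)"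

definition coset :: "('d, 'a) lmod \<Rightarrow> 'a set \<Rightarrow> 'a \<Rightarrow> 'a set" where
  "coset M S x = {addm M x s | s. s \<in> S}"

definition quot :: "('d, 'a) lmod \<Rightarrow> 'a set \<Rightarrow> ('d, 'a set) lmod" where
  "quot M S = \<lparr>carr = coset M S ` carr M,
     addm = (\<lambda>X Y. \<Union>x\<in>X. \<Union>y\<in>Y. coset M S (addm M x y)),
     zerom = coset M S (zerom M),
     smul = (\<lambda>r X. \<Union>x\<in>X. coset M S (smul M r x))\<rparr>"

text \<open>The map into \<open>quot M S\<close> induced by \<open>\<phi>\<close> on classes.\<close>

definition quot_map :: "('d, 'a) lmod \<Rightarrow> 'a set \<Rightarrow> ('c \<Rightarrow> 'a) \<Rightarrow> 'c set \<Rightarrow> 'a set" where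
  "quot_map M S \<phi> X = (\<Union>x\<in>X. coset M S (\<phi> x))"

text \<open>
  The tensor product \<open>B \<otimes>\<^sub>R M\<close> as a quotient of the free abelian group on \<open>B \<times> M\<close>. The right action
  of R on B is \<open>\<rho>\<close>; the left module structure on the tensor product is induced by \<open>\<sigma>\<close>.
\<close>

definition free_mod :: "('d \<Rightarrow> ('b \<times> 'm \<Rightarrow>\<^sub>0 int) \<Rightarrow> ('b \<times> 'm \<Rightarrow>\<^sub>0 int)) \<Rightarrow> ('e, 'b) lmod \<Rightarrow> ('r, 'm) lmod
    \<Rightarrow> ('d, 'b \<times> 'm \<Rightarrow>\<^sub>0 int) lmod" where
  "free_mod \<sigma> B M = natmod \<sigma> {c. Poly_Mapping.keys c \<subseteq> carr B \<times> carr M}"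

definition tensor_rel :: "'r set \<Rightarrow> ('e, 'b) lmod \<Rightarrow> ('b \<Rightarrow> 'r \<Rightarrow> 'b) \<Rightarrow> ('r, 'm) lmod
    \<Rightarrow> ('b \<times> 'm \<Rightarrow>\<^sub>0 int) set" where
  "tensor_rel R B \<rho> M = lspan (natmod frag_cmul UNIV) UNIV
     ({frag_of (addm B b b', m) - frag_of (b, m) - frag_of (b', m) | b b' m.
         b \<in> carr B \<and> b' \<in> carr B \<and> m \<in> carr M} \<union>
      {frag_of (b, addm M m m') - frag_of (b, m) - frag_of (b, m') | b m m'.
         b \<in> carr B \<and> m \<in> carr M \<and> m' \<in> carr M} \<union>
      {frag_of (\<rho> b r, m) - frag_of (b, smul M r m) | b r m.
         b \<in> carr B \<and> r \<in> R \<and> m \<in> carr M})"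

definition tensor :: "'r set \<Rightarrow> ('e, 'b) lmod \<Rightarrow> ('b \<Rightarrow> 'r \<Rightarrow> 'b) \<Rightarrow> ('r, 'm) lmod \<Rightarrow>
    ('d \<Rightarrow> ('b \<times> 'm \<Rightarrow>\<^sub>0 int) \<Rightarrow> ('b \<times> 'm \<Rightarrow>\<^sub>0 int)) \<Rightarrow> ('d, ('b \<times> 'm \<Rightarrow>\<^sub>0 int) set) lmod" where
  "tensor R B \<rho> M \<sigma> = quot (free_mod \<sigma> B M) (tensor_rel R B \<rho> M)"

text \<open>P(b \<open>\<otimes>\<close> m) = Pb \<open>\<otimes>\<close> m.\<close>

definition left_act :: "('d, 'b) lmod \<Rightarrow> 'd \<Rightarrow> ('b \<times> 'm \<Rightarrow>\<^sub>0 int) \<Rightarrow> ('b \<times> 'm \<Rightarrow>\<^sub>0 int)" where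
  "left_act B P = frag_extend (\<lambda>(b, m). frag_of (smul B P b, m))"

text \<open>
  a(g \<open>\<otimes>\<close> m) = ag \<open>\<otimes>\<close> m and \<open>\<partial>\<close>_i(g \<open>\<otimes>\<close> m) = \<open>\<partial>\<close>_i g \<open>\<otimes>\<close> m + g \<open>\<otimes>\<close> \<open>nab\<close>_i m, where g is a function.
\<close>

definition leibniz_act :: "('n \<Rightarrow> 'm \<Rightarrow> 'm) \<Rightarrow> ('k::idom, 'n::{finite,linorder}) dop \<Rightarrow>
    (('k, 'n) ratf \<times> 'm \<Rightarrow>\<^sub>0 int) \<Rightarrow> (('k, 'n) ratf \<times> 'm \<Rightarrow>\<^sub>0 int)" where
  "leibniz_act nab = conn_act
     (\<lambda>a. frag_extend (\<lambda>(g, m). frag_of (a * g, m)))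
     (\<lambda>i. frag_extend (\<lambda>(g, m). frag_of (rpd i g, m) + frag_of (g, nab i m)))"

section \<open>Presheaves and sheaves of D-modules\<close>

text \<open>\<open>res F U V\<close> is the restriction map from U to V.\<close>

record ('p, 'd, 'a) psh =
  sec :: "'p set \<Rightarrow> ('d, 'a) lmod"
  res :: "'p set \<Rightarrow> 'p set \<Rightarrow> 'a \<Rightarrow> 'a"

definition const_psh :: "('d, 'a) lmod \<Rightarrow> ('p, 'd, 'a) psh" where
  "const_psh M = \<lparr>sec = (\<lambda>_. M), res = (\<lambda>_ _ x. x)\<rparr>"

definition germ :: "('n::finite \<Rightarrow> 'k::comm_ring_1, 'd, 'a) psh \<Rightarrow> ('n \<Rightarrow> 'k) \<Rightarrow> ('n \<Rightarrow> 'k) set \<Rightarrow> 'a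
    \<Rightarrow> (('n \<Rightarrow> 'k) set \<times> 'a) set" where
  "germ F p U s = {(V, t). zopen V \<and> p \<in> V \<and> t \<in> carr (sec F V) \<and>
     (\<exists>W. zopen W \<and> p \<in> W \<and> W \<subseteq> U \<inter> V \<and> res F U W s = res F V W t)}"

text \<open>
  Let i : X \<open>\<rightarrow>\<close> Z be continuous and F a presheaf on Z such that F(U) is a module over
  \<open>\<D>\<close>_X(i^{-1}U). Then \<open>stalk i F p\<close> is the stalk of F at i(p), as a module over \<open>\<D>\<close>_{X,p}, and
  \<open>inv_image_sheaf i F\<close> is the \<open>\<D>\<close>_X-module i^{-1}F: its sections are the families of germs that
  locally come from sections of F. For i = id this is the sheafification of F.
\<close>

definition stalk :: "(('n::{finite,linorder} \<Rightarrow> 'k::idom) \<Rightarrow> ('m::finite \<Rightarrow> 'k)) \<Rightarrow>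
    ('m \<Rightarrow> 'k, ('k, 'n) dop, 'a) psh \<Rightarrow> ('n \<Rightarrow> 'k) \<Rightarrow> (('k, 'n) dop, (('m \<Rightarrow> 'k) set \<times> 'a) set) lmod" where
  "stalk i F p = \<lparr>
     carr = {germ F (i p) U s | U s. zopen U \<and> i p \<in> U \<and> s \<in> carr (sec F U)},
     addm = (\<lambda>A B. \<Union>{germ F (i p) U (addm (sec F U) s t) | U s t. (U, s) \<in> A \<and> (U, t) \<in> B}),
     zerom = germ F (i p) UNIV (zerom (sec F UNIV)),
     smul = (\<lambda>P A. \<Union>{germ F (i p) U (smul (sec F U) P s) | U s. (U, s) \<in> A \<and> P \<in> Dop (i -` U)})\<rparr>"

definition inv_image_sheaf :: "(('n::{finite,linorder} \<Rightarrow> 'k::idom) \<Rightarrow> ('m::finite \<Rightarrow> 'k)) \<Rightarrow>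
    ('m \<Rightarrow> 'k, ('k, 'n) dop, 'a) psh \<Rightarrow>
    ('n \<Rightarrow> 'k, ('k, 'n) dop, ('n \<Rightarrow> 'k) \<Rightarrow> (('m \<Rightarrow> 'k) set \<times> 'a) set) psh" where
  "inv_image_sheaf i F = \<lparr>
     sec = (\<lambda>V. \<lparr>
       carr = {s. s \<in> extensional V \<and>
         (\<forall>p\<in>V. \<exists>U t. zopen U \<and> i p \<in> U \<and> t \<in> carr (sec F U) \<and>
            (\<forall>q\<in>V. i q \<in> U \<longrightarrow> s q = germ F (i q) U t))},
       addm = (\<lambda>s t. \<lambda>p\<in>V. addm (stalk i F p) (s p) (t p)),
       zerom = (\<lambda>p\<in>V. zerom (stalk i F p)),
       smul = (\<lambda>P s. \<lambda>p\<in>V. smul (stalk i F p) P (s p))\<rparr>),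
     res = (\<lambda>_ W s. restrict s W)\<rparr>"

definition sheafify :: "('n::{finite,linorder} \<Rightarrow> 'k::idom, ('k, 'n) dop, 'a) psh \<Rightarrow>
    ('n \<Rightarrow> 'k, ('k, 'n) dop, ('n \<Rightarrow> 'k) \<Rightarrow> (('n \<Rightarrow> 'k) set \<times> 'a) set) psh" where
  "sheafify F = inv_image_sheaf (\<lambda>p. p) F"

definition dmod_hom :: "('n::{finite,linorder} \<Rightarrow> 'k::idom, ('k, 'n) dop, 'a) psh \<Rightarrow>
    ('n \<Rightarrow> 'k, ('k, 'n) dop, 'b) psh \<Rightarrow> (('n \<Rightarrow> 'k) set \<Rightarrow> 'a \<Rightarrow> 'b) \<Rightarrow> bool" where
  "dmod_hom F G \<phi> \<longleftrightarrow>
     (\<forall>U. zopen U \<longrightarrow>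
        \<phi> U \<in> carr (sec F U) \<rightarrow> carr (sec G U) \<and>
        (\<forall>s\<in>carr (sec F U). \<forall>t\<in>carr (sec F U).
           \<phi> U (addm (sec F U) s t) = addm (sec G U) (\<phi> U s) (\<phi> U t)) \<and>
        (\<forall>P\<in>Dop U. \<forall>s\<in>carr (sec F U). \<phi> U (smul (sec F U) P s) = smul (sec G U) P (\<phi> U s))) \<and>
     (\<forall>U V. zopen U \<longrightarrow> zopen V \<longrightarrow> V \<subseteq> U \<longrightarrow>
        (\<forall>s\<in>carr (sec F U). \<phi> V (res F U V s) = res G U V (\<phi> U s)))"

definition dmod_iso :: "('n::{finite,linorder} \<Rightarrow> 'k::idom, ('k, 'n) dop, 'a) psh \<Rightarrow>
    ('n \<Rightarrow> 'k, ('k, 'n) dop, 'b) psh \<Rightarrow> bool" where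
  "dmod_iso F G \<longleftrightarrow> (\<exists>\<phi>. dmod_hom F G \<phi> \<and>
     (\<forall>U. zopen U \<longrightarrow> bij_betw (\<phi> U) (carr (sec F U)) (carr (sec G U))))"

definition sheaf_surj :: "('n::finite \<Rightarrow> 'k::comm_ring_1, 'd, 'a) psh \<Rightarrow>
    (('n \<Rightarrow> 'k) set \<Rightarrow> 'a \<Rightarrow> 'b) \<Rightarrow> ('n \<Rightarrow> 'k, 'd, 'b) psh \<Rightarrow> bool" where
  "sheaf_surj F \<phi> G \<longleftrightarrow> (\<forall>U. zopen U \<longrightarrow> (\<forall>s\<in>carr (sec G U). \<forall>p\<in>U.
     \<exists>V. zopen V \<and> p \<in> V \<and> V \<subseteq> U \<and> (\<exists>t\<in>carr (sec F V). \<phi> V t = res G U V s)))"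

definition sheaf_exact :: "('n::finite \<Rightarrow> 'k::comm_ring_1, 'd, 'a) psh \<Rightarrow>
    (('n \<Rightarrow> 'k) set \<Rightarrow> 'a \<Rightarrow> 'b) \<Rightarrow> ('n \<Rightarrow> 'k, 'd, 'b) psh \<Rightarrow>
    (('n \<Rightarrow> 'k) set \<Rightarrow> 'b \<Rightarrow> 'c) \<Rightarrow> ('n \<Rightarrow> 'k, 'd, 'c) psh \<Rightarrow> bool" where
  "sheaf_exact F \<phi> G \<psi> H \<longleftrightarrow> (\<forall>U. zopen U \<longrightarrow> (\<forall>s\<in>carr (sec G U).
     \<psi> U s = zerom (sec H U) \<longleftrightarrow> (\<forall>p\<in>U.
       \<exists>V. zopen V \<and> p \<in> V \<and> V \<subseteq> U \<and> (\<exists>t\<in>carr (sec F V). \<phi> V t = res G U V s))))"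

text \<open>
  The presheaf U \<open>\<mapsto>\<close> B(U) \<open>\<otimes>\<close>_{R(U)} F(U). Tensor products of sheaves are its sheafification;
  sheafifying only the final result does not change it.
\<close>

definition tensor_psh :: "('p set \<Rightarrow> 'r set) \<Rightarrow> ('p, 'e, 'b) psh \<Rightarrow> ('p set \<Rightarrow> 'b \<Rightarrow> 'r \<Rightarrow> 'b) \<Rightarrow>
    ('p, 'r, 'm) psh \<Rightarrow> ('p set \<Rightarrow> 'd \<Rightarrow> ('b \<times> 'm \<Rightarrow>\<^sub>0 int) \<Rightarrow> ('b \<times> 'm \<Rightarrow>\<^sub>0 int)) \<Rightarrow>
    ('p, 'd, ('b \<times> 'm \<Rightarrow>\<^sub>0 int) set) psh" where
  "tensor_psh R B \<rho> F \<sigma> = \<lparr>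
     sec = (\<lambda>U. tensor (R U) (sec B U) (\<rho> U) (sec F U) (\<sigma> U)),
     res = (\<lambda>U V. quot_map (free_mod (\<sigma> V) (sec B V) (sec F V))
        (tensor_rel (R V) (sec B V) (\<rho> V) (sec F V))
        (frag_extend (\<lambda>(b, m). frag_of (res B U V b, res F U V m))))\<rparr>"

definition D_psh :: "('n::{finite,linorder} \<Rightarrow> 'k::idom, ('k, 'n) dop, ('k, 'n) dop) psh" where
  "D_psh = \<lparr>sec = (\<lambda>U. natmod (*) (Dop U)), res = (\<lambda>_ _ P. P)\<rparr>"

definition D_tensor_psh :: "(('k::idom, 'n::{finite,linorder}) dop, 'a) lmod \<Rightarrow>
    ('n \<Rightarrow> 'k, ('k, 'n) dop, (('k, 'n) dop \<times> 'a \<Rightarrow>\<^sub>0 int) set) psh" where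
  "D_tensor_psh M = tensor_psh (\<lambda>_. weyl) D_psh (\<lambda>_. (*)) (const_psh M) (\<lambda>U. left_act (sec D_psh U))"

text \<open>The \<open>\<D>\<close>_X-module \<open>\<D>\<close>_X \<open>\<otimes>\<close>_{A_n} M of a left A_n-module M, and its global section 1 \<open>\<otimes>\<close> m.\<close>

definition D_tensor where
  "D_tensor M = sheafify (D_tensor_psh M)"

definition D_tensor_elem where
  "D_tensor_elem M m = (\<lambda>p. germ (D_tensor_psh M) p UNIV
     (coset (free_mod (left_act (sec D_psh UNIV)) (sec D_psh UNIV) M)
        (tensor_rel weyl (sec D_psh UNIV) (*) M) (frag_of (1, m))))"

definition weyl_vecs :: "(('k::idom, 'n::{finite,linorder}) dop ^ 'r) set" where
  "weyl_vecs = {v. \<forall>j. v $ j \<in> weyl}"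

definition weyl_mod :: "(('k::idom, 'n::{finite,linorder}) dop, ('k, 'n) dop) lmod" where
  "weyl_mod = natmod (*) weyl"

definition weyl_vec_mod :: "(('k::idom, 'n::{finite,linorder}) dop, ('k, 'n) dop ^ 'r) lmod" where
  "weyl_vec_mod = natmod (\<lambda>P v. \<chi> j. P * v $ j) weyl_vecs"

section \<open>Localization\<close>

definition O_loc_psh :: "('k::field, 'n::{finite,linorder}) mpol \<Rightarrow>
    ('n \<Rightarrow> 'k, ('k, 'n) dop, ('k, 'n) ratf) psh" where
  "O_loc_psh f = \<lparr>sec = (\<lambda>U. natmod app {g / rpol f ^ k | g k. g \<in> reg U}), res = (\<lambda>_ _ g. g)\<rparr>"

text \<open>This is already a sheaf on the nonempty open sets.\<close>

definition O_loc where
  "O_loc f = sheafify (O_loc_psh f)"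

text \<open>\<open>\<O>_X[f\<close>^{-1}\<open>] \<otimes>\<close> \<open>\<M>\<close> over \<open>\<O>_X\<close>, with \<open>\<O>_X\<close> embedded in \<open>\<D>_X\<close> as the operators of order zero.\<close>

definition mod_loc :: "('k::field, 'n::{finite,linorder}) mpol \<Rightarrow> ('n \<Rightarrow> 'k, ('k, 'n) dop, 'a) psh \<Rightarrow> _" where
  "mod_loc f F = sheafify (tensor_psh (\<lambda>U. mulop ` reg U) (O_loc_psh f) (\<lambda>_ g r. app r g) F
     (\<lambda>U. leibniz_act (\<lambda>i. smul (sec F U) (pdop i))))"

section \<open>Characteristic variety and holonomicity\<close>

definition zclosed :: "('n::finite \<Rightarrow> 'k::comm_ring_1) set \<Rightarrow> bool" where
  "zclosed C \<longleftrightarrow> zopen (- C)"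

definition zirreducible :: "('n::finite \<Rightarrow> 'k::comm_ring_1) set \<Rightarrow> bool" where
  "zirreducible C \<longleftrightarrow> C \<noteq> {} \<and>
     (\<forall>A B. zclosed A \<longrightarrow> zclosed B \<longrightarrow> C \<subseteq> A \<union> B \<longrightarrow> C \<subseteq> A \<or> C \<subseteq> B)"

definition zchain :: "('n::finite \<Rightarrow> 'k::comm_ring_1) set \<Rightarrow> nat \<Rightarrow> bool" where
  "zchain S d \<longleftrightarrow> (\<exists>Z. (\<forall>j\<le>d. zclosed (Z j) \<and> zirreducible (Z j) \<and> Z j \<subseteq> S) \<and>
     (\<forall>j<d. Z j \<subset> Z (Suc j)))"

definition has_zdim :: "('n::finite \<Rightarrow> 'k::comm_ring_1) set \<Rightarrow> nat \<Rightarrow> bool" where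
  "has_zdim S d \<longleftrightarrow> zchain S d \<and> \<not> zchain S (Suc d)"

text \<open>
  For a finite set S of global sections generating F, the submodules F_j(\<open>\<D>\<close>)S form a good
  filtration. The set \<open>char_var F S\<close> is the zero set in the cotangent bundle of the (homogeneous)
  annihilator of the associated graded module: a symbol of order k annihilates it iff the
  operator maps F_j(\<open>\<D>\<close>)S into F_{j+k-1}(\<open>\<D>\<close>)S for all j. It does not depend on S.
\<close>

definition filt_stalk where
  "filt_stalk F S j p = addspan (stalk (\<lambda>p. p) F p)
     {smul (stalk (\<lambda>p. p) F p) P (germ F p UNIV u) | P u. P \<in> Dop_ord {p} j \<and> u \<in> S}"

definition char_var :: "('n::{finite,linorder} \<Rightarrow> 'k::field, ('k, 'n) dop, 'a) psh \<Rightarrow> 'a set \<Rightarrow>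
    ('n + 'n \<Rightarrow> 'k) set" where
  "char_var F S = {case_sum p \<xi> | p \<xi>. \<forall>k. \<forall>P\<in>Dop_ord {p} k.
     (\<forall>j. \<forall>m\<in>filt_stalk F S j p. smul (stalk (\<lambda>p. p) F p) P m \<in> filt_stalk F S (j + k - 1) p) \<longrightarrow>
     symb k P p \<xi> = 0}"

text \<open>To be used for quasi-coherent F only.\<close>

definition holonomic :: "('n::{finite,linorder} \<Rightarrow> 'k::field, ('k, 'n) dop, 'a) psh \<Rightarrow> bool" where
  "holonomic F \<longleftrightarrow> (\<exists>S. finite S \<and> S \<subseteq> carr (sec F UNIV) \<and>
     (\<forall>p. carr (stalk (\<lambda>p. p) F p) =
        lspan (stalk (\<lambda>p. p) F p) (Dop {p}) ((\<lambda>u. germ F p UNIV u) ` S)) \<and>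
     (char_var F S = {} \<or> has_zdim (char_var F S) CARD('n)))"

section \<open>The global b-function\<close>

text \<open>
  The coordinates (t, x) of K \<open>\<times>\<close> X are indexed by \<open>unit + 'n\<close>. \<open>V_filt k p\<close> and
  \<open>V_stalk F u k p\<close> are the stalks at p of F_Y^k(\<open>\<D>\<close>) and F_Y^k(\<open>\<D>\<close>)u, Y = {t = 0}.
\<close>

definition J_pow :: "(unit + 'n::{finite,linorder} \<Rightarrow> 'k::idom) \<Rightarrow> int \<Rightarrow> ('k, unit + 'n) ratf set" where
  "J_pow p j = (if j \<le> 0 then reg {p} else {rpol (mvar (Inl ())) ^ nat j * g | g. g \<in> reg {p}})"

definition V_filt :: "int \<Rightarrow> (unit + 'n::{finite,linorder} \<Rightarrow> 'k::idom) \<Rightarrow> ('k, unit + 'n) dop set" where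
  "V_filt k p = {P \<in> Dop {p}. \<forall>j\<ge>k. app P ` J_pow p j \<subseteq> J_pow p (j - k)}"

definition V_stalk where
  "V_stalk F u k p = {smul (stalk (\<lambda>p. p) F p) P (germ F p UNIV u) | P. P \<in> V_filt k p}"

definition theta_poly :: "'k::idom poly \<Rightarrow> ('k, unit + 'n::linorder) dop" where
  "theta_poly c = (\<Sum>k\<le>degree c.
     polop (mconst (coeff c k)) * (varop (Inl ()) * pdop (Inl ())) ^ k)"

definition b_ideal :: "(unit + 'n::{finite,linorder} \<Rightarrow> 'k::idom, ('k, unit + 'n) dop, 'a) psh \<Rightarrow>
    'a \<Rightarrow> (unit + 'n \<Rightarrow> 'k) \<Rightarrow> 'k poly set" where
  "b_ideal F u p = {c. smul (stalk (\<lambda>p. p) F p) (theta_poly c) ` V_stalk F u 0 p \<subseteq> V_stalk F u (-1) p}"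

definition is_local_b :: "(unit + 'n::{finite,linorder} \<Rightarrow> 'k::idom, ('k, unit + 'n) dop, 'a) psh \<Rightarrow>
    'a \<Rightarrow> (unit + 'n \<Rightarrow> 'k) \<Rightarrow> 'k poly \<Rightarrow> bool" where
  "is_local_b F u p b \<longleftrightarrow>
     (b \<in> b_ideal F u p \<and> lead_coeff b = 1 \<and>
        (\<forall>c\<in>b_ideal F u p. lead_coeff c = 1 \<longrightarrow> degree b \<le> degree c)) \<or>
     (b = 0 \<and> \<not> (\<exists>c\<in>b_ideal F u p. lead_coeff c = 1))"

text \<open>The least common multiple is monic, or 0 if 0 is the only common multiple.\<close>

definition is_global_b :: "(unit + 'n::{finite,linorder} \<Rightarrow> 'k::idom, ('k, unit + 'n) dop, 'a) psh \<Rightarrow>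
    'a \<Rightarrow> 'k poly \<Rightarrow> bool" where
  "is_global_b F u b \<longleftrightarrow>
     (\<forall>p c. p (Inl ()) = 0 \<longrightarrow> is_local_b F u p c \<longrightarrow> c dvd b) \<and>
     (\<forall>d. (\<forall>p c. p (Inl ()) = 0 \<longrightarrow> is_local_b F u p c \<longrightarrow> c dvd d) \<longrightarrow> b dvd d) \<and>
     (b = 0 \<or> lead_coeff b = 1)"

definition graph_ideal :: "('k::idom, 'n::{finite,linorder}) mpol \<Rightarrow> ('k, unit + 'n) dop set" where
  "graph_ideal f = lspan weyl_mod weyl
     (insert (varop (Inl ()) - polop (msubst (\<lambda>i. mvar (Inr i)) f))
        (range (\<lambda>i. pdop (Inr i) + polop (msubst (\<lambda>i. mvar (Inr i)) (mpd i f)) * pdop (Inl ()))))"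

definition is_graph_b :: "('k::idom, 'n::{finite,linorder}) mpol \<Rightarrow> 'k poly \<Rightarrow> bool" where
  "is_graph_b f b \<longleftrightarrow> (let M = quot weyl_mod (graph_ideal f) in
     is_global_b (D_tensor M) (D_tensor_elem M (coset weyl_mod (graph_ideal f) 1)) b)"

section \<open>The annihilator of the power of f\<close>

text \<open>
  The module K[x,f^{-1},s]f^s sits in K(x)[s]f^s, whose element g f^s is represented by the
  polynomial g over K(x) in the variable s. An element of A_n[s] is a polynomial in s with
  coefficients in A_n.
\<close>

definition fs_act :: "('k::field, 'n::{finite,linorder}) mpol \<Rightarrow> ('k, 'n) dop \<Rightarrow>
    ('k, 'n) ratf poly \<Rightarrow> ('k, 'n) ratf poly" where
  "fs_act f = conn_act smult
     (\<lambda>i g. map_poly (rpd i) g + [:0, 1:] * smult (rpd i (rpol f) / rpol f) g)"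

definition fs_ann :: "('k::field, 'n::{finite,linorder}) mpol \<Rightarrow> ('k, 'n) dop poly set" where
  "fs_ann f = {P. (\<forall>k. coeff P k \<in> weyl) \<and>
     (\<Sum>k\<le>degree P. monom 1 k * fs_act f (coeff P k) 1) = 0}"

definition fs_ann_at :: "('k::field, 'n::{finite,linorder}) mpol \<Rightarrow> int \<Rightarrow> ('k, 'n) dop set" where
  "fs_ann_at f \<nu> = {\<Sum>k\<le>degree P. of_int \<nu> ^ k * coeff P k | P. P \<in> fs_ann f}"

section \<open>Restriction to the diagonal\<close>

text \<open>
  On X \<open>\<times>\<close> X the index type is \<open>'n + 'n\<close>. In the coordinates (x, y), \<open>Inl i\<close> is x_i and \<open>Inr i\<close> is y_i;
  in the coordinates (z, x), \<open>Inl i\<close> is z_i and \<open>Inr i\<close> is x_i.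
\<close>

definition in_x :: "('k::idom, 'n::{finite,linorder}) dop \<Rightarrow> ('k, 'n + 'n) dop" where
  "in_x = weyl_subst (\<lambda>i. varop (Inl i)) (\<lambda>i. pdop (Inl i))"

definition in_y :: "('k::idom, 'n::{finite,linorder}) dop \<Rightarrow> ('k, 'n + 'n) dop" where
  "in_y = weyl_subst (\<lambda>i. varop (Inr i)) (\<lambda>i. pdop (Inr i))"

definition coord_change :: "('k::idom, 'n::{finite,linorder} + 'n) dop \<Rightarrow> ('k, 'n + 'n) dop" where
  "coord_change = weyl_subst
     (case_sum (\<lambda>i. varop (Inr i)) (\<lambda>i. varop (Inr i) + varop (Inl i)))
     (case_sum (\<lambda>i. pdop (Inr i) - pdop (Inl i)) (\<lambda>i. pdop (Inl i)))"

definition G3 :: "('k::idom, 'n::{finite,linorder}) dop set \<Rightarrow> (('k, 'n) dop ^ 'r) set \<Rightarrow>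
    (('k, 'n + 'n) dop ^ 'r) set" where
  "G3 SJ SN = {axis j (in_x P) | P j. P \<in> SJ} \<union> {\<chi> j. in_y (Q $ j) | Q. Q \<in> SN}"

definition G4 :: "('k::idom, 'n::{finite,linorder}) dop set \<Rightarrow> (('k, 'n) dop ^ 'r) set \<Rightarrow>
    (('k, 'n + 'n) dop ^ 'r) set" where
  "G4 SJ SN = {\<chi> j. coord_change (v $ j) | v. v \<in> G3 SJ SN}"

text \<open>The inclusion of Y' = {z = 0} = X into X \<open>\<times>\<close> X, and the restriction of functions to Y'.\<close>

definition z0 :: "('n \<Rightarrow> 'k::zero) \<Rightarrow> ('n + 'n \<Rightarrow> 'k)" where
  "z0 x = case_sum (\<lambda>_. 0) x"

definition mpol_z0 :: "('k::idom, 'n::{finite,linorder} + 'n) mpol \<Rightarrow> ('k, 'n) mpol" where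
  "mpol_z0 = msubst (case_sum (\<lambda>_. 0) mvar)"

definition ratf_z0 :: "('k::idom, 'n::{finite,linorder} + 'n) ratf \<Rightarrow> ('k, 'n) ratf" where
  "ratf_z0 g = (THE h. \<exists>a b. mpol_z0 b \<noteq> 0 \<and> g = Fract a b \<and> h = Fract (mpol_z0 a) (mpol_z0 b))"

text \<open>
  The (\<open>\<D>\<close>_{Y'}, \<open>\<D>\<close>_{X x X})-bimodule \<open>\<O>\<close>_{Y'} \<open>\<otimes>\<close> \<open>\<D>\<close>_{X x X} over \<open>\<O>\<close>_{X x X}, as a presheaf on X \<open>\<times>\<close> X,
  with its right action. The coordinate vector field \<open>\<partial>\<close>_{x_i} of Y' acts on the second factor as
  \<open>\<partial>\<close>_{x_i} in the coordinates (z, x). Only open sets that meet Y' are relevant.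
\<close>

definition OY_psh :: "('n::{finite,linorder} + 'n \<Rightarrow> 'k::idom, ('k, 'n) dop, ('k, 'n) ratf) psh" where
  "OY_psh = \<lparr>sec = (\<lambda>U. natmod app (reg (z0 -` U))), res = (\<lambda>_ _ g. g)\<rparr>"

definition OY_right :: "('k::idom, 'n::{finite,linorder}) ratf \<Rightarrow> ('k, 'n + 'n) dop \<Rightarrow> ('k, 'n) ratf" where
  "OY_right g r = g * ratf_z0 (app r 1)"

definition transfer_act :: "('k::idom, 'n::{finite,linorder}) dop \<Rightarrow>
    (('k, 'n) ratf \<times> ('k, 'n + 'n) dop \<Rightarrow>\<^sub>0 int) \<Rightarrow> (('k, 'n) ratf \<times> ('k, 'n + 'n) dop \<Rightarrow>\<^sub>0 int)" where
  "transfer_act = leibniz_act (\<lambda>i Q. pdop (Inr i) * Q)"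

definition transfer_psh :: "('n::{finite,linorder} + 'n \<Rightarrow> 'k::idom, ('k, 'n) dop,
    (('k, 'n) ratf \<times> ('k, 'n + 'n) dop \<Rightarrow>\<^sub>0 int) set) psh" where
  "transfer_psh = tensor_psh (\<lambda>U. mulop ` reg U) OY_psh (\<lambda>_. OY_right) D_psh (\<lambda>_. transfer_act)"

definition transfer_right :: "('n::{finite,linorder} + 'n \<Rightarrow> 'k::idom) set \<Rightarrow>
    (('k, 'n) ratf \<times> ('k, 'n + 'n) dop \<Rightarrow>\<^sub>0 int) set \<Rightarrow> ('k, 'n + 'n) dop \<Rightarrow>
    (('k, 'n) ratf \<times> ('k, 'n + 'n) dop \<Rightarrow>\<^sub>0 int) set" where
  "transfer_right U X Q = quot_map (free_mod transfer_act (sec OY_psh U) (sec D_psh U))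
     (tensor_rel (mulop ` reg U) (sec OY_psh U) OY_right (sec D_psh U))
     (frag_extend (\<lambda>(g, P). frag_of (g, P * Q))) X"

text \<open>The free module \<open>\<D>\<close>^m.\<close>

definition D_free where
  "D_free m = sheafify \<lparr>sec = (\<lambda>U. natmod (\<lambda>P. Poly_Mapping.map ((*) P))
       {v :: nat \<Rightarrow>\<^sub>0 _. Poly_Mapping.keys v \<subseteq> {..<m} \<and> (\<forall>i. Poly_Mapping.lookup v i \<in> Dop U)}),
     res = (\<lambda>_ _ v. v)\<rparr>"

text \<open>A resolution \<open>\<dots> \<rightarrow> \<D>^{m 1} \<rightarrow> \<D>^{m 0} \<rightarrow> F \<rightarrow> 0\<close> by free modules of finite rank.\<close>

definition free_resolution where
  "free_resolution m d \<epsilon> F \<longleftrightarrow>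
     dmod_hom (D_free (m 0)) F \<epsilon> \<and>
     (\<forall>k::nat. dmod_hom (D_free (m (Suc k))) (D_free (m k)) (d k)) \<and>
     sheaf_surj (D_free (m 0)) \<epsilon> F \<and>
     sheaf_exact (D_free (m 1)) (d 0) (D_free (m 0)) \<epsilon> F \<and>
     (\<forall>k. sheaf_exact (D_free (m (Suc (Suc k)))) (d (Suc k)) (D_free (m (Suc k))) (d k) (D_free (m k)))"

text \<open>
  The restriction complex of F to Y' in terms of such a resolution: its term in degree -k is
  (\<open>\<O>\<close>_{Y'} \<open>\<otimes>\<close> \<open>\<D>\<close>) \<open>\<otimes>\<close> \<open>\<D>\<close>^{m k} over \<open>\<D>\<close>, and its differentials are 1 \<open>\<otimes>\<close> d k.
\<close>

definition restr_term :: "nat \<Rightarrow> ('n::{finite,linorder} + 'n \<Rightarrow> 'k::idom, ('k, 'n) dop, _) psh" where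
  "restr_term m = tensor_psh Dop transfer_psh transfer_right (D_free m)
     (\<lambda>U. left_act (sec transfer_psh U))"

definition restr_diff where
  "restr_diff m d U = quot_map
     (free_mod (left_act (sec transfer_psh U)) (sec transfer_psh U) (sec (D_free m) U))
     (tensor_rel (Dop U) (sec transfer_psh U) (transfer_right U) (sec (D_free m) U))
     (frag_extend (\<lambda>(b, v). frag_of (b, d U v)))"

text \<open>
  The complex is zero in positive degrees, so its cohomology in degree 0 is the cokernel of the
  last differential.
\<close>

definition restr_H0_psh where
  "restr_H0_psh m d = (let C = restr_term (m 0);
       im = (\<lambda>U. restr_diff (m 0) (d 0) U ` carr (sec (restr_term (m (Suc 0))) U))
     in \<lparr>sec = (\<lambda>U. quot (sec C U) (im U)),
         res = (\<lambda>U V. quot_map (sec C V) (im V) (res C U V))\<rparr>)"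

definition restr_H0 where
  "restr_H0 m d = inv_image_sheaf z0 (restr_H0_psh m d)"

end

theory Submission
  imports Defs
begin

text \<open>
  Every sheaf of modules that occurs is described by the same kind of data: for each point p groups
  \<open>R p\<close>, \<open>C p\<close> of differential operators such that the stalk at p is \<open>C p\<close> modulo \<open>R p\<close>. Sheaves with
  the same data are isomorphic, so it suffices to compute stalks.

  Taking residues of t^m P along the graph t = f turns the module generated by the delta function of
  the graph into families of functions indexed by the integer m, the operator -\<open>\<partial>\<close>_t t into
  multiplication by m, and the global b-function into local functional equations
  \<open>P(m) f^(m+1) = h b_f(m) f^m\<close> with h(p) nonzero. Below the smallest integer root \<open>\<nu>\<close> the factor b_f(m) is
  invertible, hence the powers of f below \<open>f^\<nu>\<close> lie in the module generated by \<open>f^\<nu>\<close>, and an operator that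
  kills \<open>f^\<nu>\<close> extends to a family that kills \<open>f^s\<close>.

  An operator T on the product is sent to \<open>h \<mapsto> (T (f(x)^\<nu> h(y)))|y=x\<close>. On stalks this is surjective
  onto the operators with poles along f, and the operators that it sends to the localization of N are
  sums of multiples of the z_i and of elements of the localization of I_4. Since the cohomology in
  degree 0 is the cokernel of the last differential of the restricted resolution, this
  map describes its stalks.
\<close>

section \<open>Polynomials and rational functions\<close>

text \<open>The functional equations differ from point to point, so no single operator lowers the
  exponent of f globally. This is why all comparisons take place in stalks, with
  \<open>Dop {p}\<close> in place of \<open>weyl\<close>, and why denominators that are units at p
  are cleared only at the end. Elements of A_n[s] are replaced by the functions m \<mapsto> P(m) on
  the integers (\<open>pf\<close>): an operator family kills f^s as soon as it kills every f^m. The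
  delta function of the graph is represented by 1/(t - f) modulo functions regular along the graph,
  so that residues become Taylor coefficients at t = f(x). The obstacle in the second isomorphism is
  the kernel. Modulo z an operator is a sum of B(x) \<partial>_y^\<beta>, and its image has
  coefficients u = B f^\<nu>. If a multiplier w turns the image into an element n of N with
  coefficients q = w u, choose P_1 with P_1 f^\<nu> = 1/w. Then B - q P_1 kills f^\<nu>, while
  modulo z the factor q(x) may be exchanged for q(y), which commutes with P_1(x), so that the rest
  becomes P_1(x) n(y).\<close>

lemma expo_induct [case_names 0 step]:
  assumes "P 0" "!!m i. P m ==> P (m + Poly_Mapping.single i 1)"
  shows "P (m::'a \<Rightarrow>\<^sub>0 nat)"
proof (induction m rule: poly_mapping_single_add_induct)
  case (2 i c q)
  show ?case
  proof (induction c)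
    case (Suc c)
    have "Poly_Mapping.single i (Suc c) + q = (Poly_Mapping.single i c + q) + Poly_Mapping.single i 1"
      by (metis Suc_eq_plus1 add.commute add.left_commute single_add)
    then show ?case using assms(2)[OF Suc] by simp
  qed (use 2 in simp)
qed (rule assms)

lemma sum_in_set:
  assumes "0 : S" "!!x y. x : S ==> y : S ==> x + y : S" "!!x. x : A ==> f x : S"
  shows "sum f A : (S :: 'a::comm_monoid_add set)"
  using assms(3) by (induction A rule: infinite_finite_induct) (auto intro: assms)

section \<open>Ring homomorphisms and evaluation of polynomials\<close>

locale rhom =
  fixes \<kappa> :: "'a::comm_ring_1 => 'b::comm_ring_1"
  assumes hom_add: "\<kappa> (x + y) = \<kappa> x + \<kappa> y" and hom_mult: "\<kappa> (x * y) = \<kappa> x * \<kappa> y"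
    and hom_1: "\<kappa> 1 = 1"
begin
lemma hom_0: "\<kappa> 0 = 0" using hom_add[of 0 0] by simp
lemma hom_minus: "\<kappa> (- x) = - \<kappa> x" using hom_add[of x "-x"] hom_0 by (simp add: eq_neg_iff_add_eq_0 add.commute)
lemma hom_diff: "\<kappa> (x - y) = \<kappa> x - \<kappa> y" using hom_add[of x "-y"] hom_minus by simp
lemma hom_power: "\<kappa> (x ^ n) = \<kappa> x ^ n" by (induction n) (auto simp: hom_mult hom_1)
lemma hom_sum: "\<kappa> (sum g A) = (\<Sum>x\<in>A. \<kappa> (g x))"
  by (induction A rule: infinite_finite_induct) (auto simp: hom_add hom_0)
end

text \<open>Common form of \<open>meval\<close>, which keeps the coefficients, and
  \<open>msubst\<close>, which turns them into constant polynomials; the homomorphism properties of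
  both follow from one computation.\<close>

definition peval :: "('k::comm_ring_1 => 'a::comm_ring_1) => ('n::finite => 'a) => ('k, 'n) mpol => 'a" where
  "peval \<kappa> \<sigma> q = (\<Sum>m\<in>Poly_Mapping.keys q.
     \<kappa> (Poly_Mapping.lookup q m) * (\<Prod>i\<in>UNIV. \<sigma> i ^ Poly_Mapping.lookup m i))"

lemma meval_peval: "meval p = peval (%c. c) p"
  by (simp add: fun_eq_iff meval_def peval_def)

lemma msubst_peval: "msubst \<sigma> = peval mconst \<sigma>"
  by (simp add: fun_eq_iff msubst_def peval_def)

lemma rhom_mconst: "rhom mconst"
  by standard (auto simp: mconst_def single_add mult_single)

lemma rhom_id: "rhom (%c. c)" by standard auto

context rhom begin

lemma peval_superset:
  assumes "finite A" "Poly_Mapping.keys q \<subseteq> A"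
  shows "peval \<kappa> \<sigma> q = (\<Sum>m\<in>A. \<kappa> (Poly_Mapping.lookup q m) * (\<Prod>i\<in>UNIV. \<sigma> i ^ Poly_Mapping.lookup m i))"
  unfolding peval_def using assms
  by (intro sum.mono_neutral_left) (auto simp: in_keys_iff hom_0)

lemma peval_add: "peval \<kappa> \<sigma> (p + q) = peval \<kappa> \<sigma> p + peval \<kappa> \<sigma> q"
proof -
  let ?A = "Poly_Mapping.keys p \<union> Poly_Mapping.keys q"
  have "Poly_Mapping.keys (p + q) \<subseteq> ?A" by (rule Poly_Mapping.keys_add)
  then show ?thesis
    by (simp add: peval_superset[of ?A] sum.distrib[symmetric] lookup_add hom_add distrib_right)
qed

lemma peval_0: "peval \<kappa> \<sigma> 0 = 0" by (simp add: peval_def)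

lemma peval_single: "peval \<kappa> \<sigma> (Poly_Mapping.single m c) = \<kappa> c * (\<Prod>i\<in>UNIV. \<sigma> i ^ Poly_Mapping.lookup m i)"
  by (subst peval_superset[of "{m}"]) auto

lemma peval_mult: "peval \<kappa> \<sigma> (p * q) = peval \<kappa> \<sigma> p * peval \<kappa> \<sigma> q"
proof (induction p rule: poly_mapping_single_add_induct)
  case (2 m c p)
  have "peval \<kappa> \<sigma> (Poly_Mapping.single m c * q) = peval \<kappa> \<sigma> (Poly_Mapping.single m c) * peval \<kappa> \<sigma> q"
  proof (induction q rule: poly_mapping_single_add_induct)
    case (2 m' d q)
    have "peval \<kappa> \<sigma> (Poly_Mapping.single m c * Poly_Mapping.single m' d) =
       peval \<kappa> \<sigma> (Poly_Mapping.single m c) * peval \<kappa> \<sigma> (Poly_Mapping.single m' d)"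
      by (simp add: mult_single peval_single lookup_add power_add prod.distrib hom_mult)
    then show ?case using 2 by (simp add: distrib_left peval_add)
  qed (simp add: peval_0)
  then show ?case using 2 by (simp add: distrib_right peval_add)
qed (simp add: peval_0)

lemma peval_mconst: "peval \<kappa> \<sigma> (mconst c) = \<kappa> c"
  by (simp add: mconst_def peval_single)

lemma peval_mvar: "peval \<kappa> \<sigma> (mvar i) = \<sigma> i"
proof -
  have "(\<Prod>j\<in>UNIV. \<sigma> j ^ Poly_Mapping.lookup (Poly_Mapping.single i 1) j) = (\<Prod>j\<in>UNIV. if j = i then \<sigma> i else 1)"
    by (intro prod.cong) (auto simp: lookup_single when_def)
  then show ?thesis by (simp add: mvar_def peval_single hom_1)
qed

lemma rhom_peval: "rhom (peval \<kappa> \<sigma>)"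
proof
  show "peval \<kappa> \<sigma> 1 = 1"
    using peval_mconst[of \<sigma> 1] hom_1 by (simp add: mconst_def)
qed (auto simp: peval_add peval_mult)

end

lemma mpol_induct [case_names const var add mult]:
  fixes q :: "('k::comm_ring_1, 'n) mpol"
  assumes "!!c. P (mconst c)" "!!i. P (mvar i)" "!!p q. P p ==> P q ==> P (p + q)"
    "!!p q. P p ==> P q ==> P (p * q)"
  shows "P q"
proof -
  have s: "P (Poly_Mapping.single m c)" for m and c :: 'k
  proof (induction m rule: expo_induct)
    case 0 then show ?case using assms(1)[of c] by (simp add: mconst_def)
  next
    case (step m i)
    have "Poly_Mapping.single (m + Poly_Mapping.single i 1) c = Poly_Mapping.single m c * mvar i"
      by (simp add: mvar_def mult_single)
    then show ?case using assms(2,4) step by metis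
  qed
  show ?thesis
    by (induction q rule: poly_mapping_single_add_induct) (use assms(1)[of 0] s assms(3) in \<open>auto simp: mconst_def\<close>)
qed

interpretation meval: rhom "meval p" for p
  unfolding meval_peval by (rule rhom.rhom_peval[OF rhom_id])

interpretation msubst: rhom "msubst \<sigma>" for \<sigma>
  unfolding msubst_peval by (rule rhom.rhom_peval[OF rhom_mconst])

interpretation mconst: rhom mconst by (rule rhom_mconst)

lemma meval_mconst [simp]: "meval p (mconst c) = c"
  by (simp add: meval_peval rhom.peval_mconst[OF rhom_id])
lemma meval_mvar [simp]: "meval p (mvar i) = p i"
  by (simp add: meval_peval rhom.peval_mvar[OF rhom_id])
lemma msubst_mconst [simp]: "msubst \<sigma> (mconst c) = mconst c"
  by (simp add: msubst_peval rhom.peval_mconst[OF rhom_mconst])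
lemma msubst_mvar [simp]: "msubst \<sigma> (mvar i) = \<sigma> i"
  by (simp add: msubst_peval rhom.peval_mvar[OF rhom_mconst])

lemma meval_msubst: "meval p (msubst \<sigma> q) = meval (%i. meval p (\<sigma> i)) q"
  by (induction q rule: mpol_induct) (auto simp: msubst.hom_add msubst.hom_mult meval.hom_add meval.hom_mult)

lemma msubst_msubst: "msubst \<tau> (msubst \<sigma> q) = msubst (%i. msubst \<tau> (\<sigma> i)) q"
  by (induction q rule: mpol_induct) (auto simp: msubst.hom_add msubst.hom_mult)

lemma msubst_id: "msubst mvar q = q"
  by (induction q rule: mpol_induct) (auto simp: msubst.hom_add msubst.hom_mult)

lemma mpd_mconst [simp]: "mpd i (mconst c) = 0"
  by (simp add: mconst_def mpd_single)

lemma mpd_mvar: "mpd i (mvar j :: ('k::comm_ring_1, 'n) mpol) = (if i = j then 1 else 0)"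
proof -
  have [simp]: "Poly_Mapping.single (0::'n \<Rightarrow>\<^sub>0 nat) (1::'k) = 1" by simp
  show ?thesis by (auto simp: mvar_def mpd_single lookup_single)
qed

lemma mpd_1 [simp]: "mpd i 1 = 0"
  using mpd_mconst[of i 1] by (simp add: mconst.hom_1)

lemma mpd_commute: "mpd i (mpd j q) = mpd j (mpd i q)"
  by (induction q rule: mpol_induct) (auto simp: mpd_add mpd_mult mpd_mvar algebra_simps)

lemma mpd_msubst: "mpd j (msubst \<sigma> q) = (\<Sum>i\<in>UNIV. msubst \<sigma> (mpd i q) * mpd j (\<sigma> i))"
proof (induction q rule: mpol_induct)
  case (var i)
  have "(\<Sum>ia\<in>UNIV. msubst \<sigma> (mpd ia (mvar i)) * mpd j (\<sigma> ia)) = (\<Sum>ia\<in>UNIV. if ia = i then mpd j (\<sigma> ia) else 0)"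
    by (intro sum.cong) (auto simp: mpd_mvar msubst.hom_1 msubst.hom_0)
  then show ?case by simp
qed (auto simp: mpd_add mpd_mult msubst.hom_add msubst.hom_mult msubst.hom_0 algebra_simps sum.distrib sum_distrib_left)

section \<open>Rational functions and their derivations\<close>

interpretation rpol: rhom rpol
  by standard (auto simp: rpol_def One_fract_def)

lemma rpol_inj: "rpol p = rpol q \<longleftrightarrow> p = q"
  by (simp add: rpol_def eq_fract)

lemma rpol_eq_0 [simp]: "rpol p = 0 \<longleftrightarrow> p = 0"
  using rpol_inj[of p 0] by (simp add: rpol.hom_0)

lemma Fract_rpol: "Fract a b = rpol a / rpol b"
  by (simp add: rpol_def)

lemma ratf_cases:
  obtains a b where "g = rpol a / rpol b" "b ~= 0"
  by (metis Fract_cases Fract_rpol)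

lemma rpd_rpol: "rpd i (rpol q) = rpol (mpd i q)"
  by (simp add: rpol_def rpd_Fract)

lemma rpd_0 [simp]: "rpd i 0 = 0" using rpd_rpol[of i 0] by (simp add: rpol.hom_0)
lemma rpd_1 [simp]: "rpd i 1 = 0" using rpd_rpol[of i 1] by (simp add: rpol.hom_0 rpol.hom_1)
lemma rpd_minus: "rpd i (- g) = - rpd i g"
  by (metis add.inverse_unique add.right_inverse rpd_0 rpd_add)
lemma rpd_diff: "rpd i (g - h) = rpd i g - rpd i h"
  using rpd_add[of i g "-h"] by (simp add: rpd_minus)

lemma rpd_mult:
  fixes g h :: "('k::idom, 'n::linorder) ratf"
  shows "rpd i (g * h) = rpd i g * h + g * rpd i h"
proof -
  obtain a b c d where g: "g = Fract a b" "b ~= 0" and h: "h = Fract c d" "d ~= 0"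
    by (metis Fract_cases)
  then show ?thesis unfolding g h by (simp add: rpd_Fract mpd_mult eq_fract) algebra
qed

lemma rpd_power: "rpd i (g ^ n) = of_nat n * g ^ (n - 1) * rpd i g"
proof (induction n)
  case (Suc n) then show ?case by (cases n) (auto simp: rpd_mult algebra_simps)
qed simp

lemma rpd_of_int: "rpd i (of_int m) = 0"
proof -
  have "rpd i (of_nat k) = 0" for k by (induction k) (auto simp: rpd_add)
  then show ?thesis by (cases m) (auto simp: rpd_minus rpd_diff)
qed

lemma rpd_const [simp]: "rpd i (rpol (mconst c)) = 0"
  by (simp add: rpd_rpol rpol.hom_0)

lemma rpd_inverse: 
  fixes g :: "('k::field, 'n::linorder) ratf"
  shows "rpd i (inverse g) = - rpd i g * inverse g ^ 2"
proof (cases "g = 0")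
  case False
  have "rpd i (g * inverse g) = 0" using False by simp
  then have "g * rpd i (inverse g) = - rpd i g * inverse g" by (simp add: rpd_mult add_eq_0_iff2)
  then have "inverse g * (g * rpd i (inverse g)) = - rpd i g * inverse g ^ 2"
    by (simp add: power2_eq_square mult_ac)
  then show ?thesis using False by (simp flip: mult.assoc)
qed simp

lemma rpd_divide:
  fixes g :: "('k::field, 'n::linorder) ratf"
  shows "h ~= 0 ==> rpd i (g / h) = (rpd i g * h - g * rpd i h) / h ^ 2"
  by (simp add: divide_inverse rpd_mult rpd_inverse) (simp add: field_simps power2_eq_square)

lemma rpd_powi:
  fixes g :: "('k::field, 'n::linorder) ratf"
  assumes "g ~= 0"
  shows "rpd i (g powi m) = of_int m * g powi (m - 1) * rpd i g"
proof (cases "m \<ge> 0")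
  case True
  then obtain n where [simp]: "m = int n" using nonneg_int_cases by blast
  show ?thesis
  proof (cases n)
    case (Suc k)
    have "g powi m = g ^ n" "m - 1 = int k" "g powi int k = g ^ k" "of_int m = (of_nat n :: ('k, 'n) ratf)"
      using Suc by (simp_all del: of_nat_Suc add: power_int_of_nat)
    then show ?thesis by (simp only: rpd_power Suc) simp
  qed simp
next
  case False
  then obtain n where m: "m = - int n" "n > 0" using neg_int_cases by (metis linorder_not_le)
  have e: "m - 1 = - int (n + 1)" using m by simp
  have gi: "g powi m = inverse g ^ n" "g powi (m - 1) = inverse g ^ (n + 1)"
    using m e by (simp_all only: power_int_minus power_int_of_nat power_inverse)
  have "inverse g ^ (n - 1) * inverse g ^ 2 = inverse g ^ (n + 1)"
    using \<open>n > 0\<close> by (cases n) (auto simp: power2_eq_square)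
  then show ?thesis unfolding gi by (simp add: rpd_power rpd_inverse m(1) mult_ac)
qed

text \<open>Multiplying a fraction by its denominator reduces the claim to polynomials. It is
  applied to the commutator of two partial derivatives, which again obeys the Leibniz rule.\<close>

lemma derivation_zero:
  fixes D :: "('k::field, 'n::linorder) ratf => ('k, 'n) ratf"
  assumes "!!g h. D (g * h) = D g * h + g * D h" "!!q. D (rpol q) = 0"
  shows "D g = 0"
proof -
  obtain a b where g: "g = rpol a / rpol b" "b ~= 0" by (rule ratf_cases)
  have "D (g * rpol b) = D g * rpol b" using assms by simp
  moreover have "g * rpol b = rpol a" using g by simp
  ultimately show ?thesis using assms(2)[of a] g(2) by simp
qed

lemma rpd_commute:
  fixes g :: "('k::field, 'n::linorder) ratf"
  shows "rpd i (rpd j g) = rpd j (rpd i g)"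
proof -
  have "rpd i (rpd j g) - rpd j (rpd i g) = 0"
    by (rule derivation_zero[where D="%g. rpd i (rpd j g) - rpd j (rpd i g)"])
       (auto simp: rpd_mult rpd_add rpd_rpol mpd_commute algebra_simps)
  then show ?thesis by simp
qed

section \<open>Differential operators in normal form\<close>

lemma app_eqI: "(!!h. app P h = app Q h) ==> P = Q"
  by (metis app_inject ext)

lemma app_zero [simp]: "app 0 h = 0" and app_one [simp]: "app 1 h = h"
  and app_plus: "app (P + Q) h = app P h + app Q h"
  and app_diff: "app (P - Q) h = app P h - app Q h"
  and app_uminus: "app (- P) h = - app P h"
  and app_times: "app (P * Q) h = app P (app Q h)"
  by (simp_all add: zero_endo.rep_eq one_endo.rep_eq plus_endo.rep_eq minus_endo.rep_eq
      uminus_endo.rep_eq times_endo.rep_eq)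

lemma app_add: "app P (g + h) = app P g + app P h"
  using app[of P] by simp
lemma app_0 [simp]: "app P 0 = 0" using app_add[of P 0 0] by simp
lemma app_sum: "app (sum P A) h = (\<Sum>x\<in>A. app (P x) h)"
  by (induction A rule: infinite_finite_induct) (auto simp: app_plus)
lemma app_Endo: "(!!x y. F (x + y) = F x + F y) ==> app (Endo F) = F"
  by (rule Endo_inverse) auto

lemma mulop_add: "mulop (g + h) = mulop g + mulop h"
  and mulop_mult: "mulop (g * h) = mulop g * mulop h"
  and mulop_1 [simp]: "mulop 1 = 1" and mulop_0 [simp]: "mulop 0 = 0"
  and mulop_minus: "mulop (- g) = - mulop g" and mulop_diff: "mulop (g - h) = mulop g - mulop h"
  by (rule app_eqI; simp add: app_plus app_times app_uminus app_diff algebra_simps)+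

lemma mulop_commute: "mulop g * mulop h = mulop h * mulop g"
  by (metis mult.commute mulop_mult)

lemma mulop_of_int: "mulop (of_int m) = of_int m"
proof -
  have "mulop (of_nat k) = of_nat k" for k by (induction k) (auto simp: mulop_add)
  then show ?thesis by (cases m) (auto simp: mulop_minus mulop_diff)
qed

lemma of_int_central: "of_int m * P = P * (of_int m :: 'a::ring_1)"
proof -
  have "of_nat k * P = P * (of_nat k :: 'a)" for k by (rule mult_of_nat_commute)
  then show ?thesis by (cases m rule: int_cases2) auto
qed

lemma pdop_mulop: "pdop i * mulop g = mulop (rpd i g) + mulop g * pdop i"
  by (rule app_eqI) (simp add: app_plus app_times rpd_mult)

lemma pdop_commute: "pdop i * pdop j = pdop j * (pdop i :: ('k::field, 'n::linorder) dop)"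
  by (rule app_eqI) (simp add: app_times rpd_commute)

lemma polop_eq: "polop q = mulop (rpol q)" by (simp add: polop_def)

section \<open>Ordered products of commuting families\<close>

definition comfam :: "('n => 'a::monoid_mult) => bool" where
  "comfam X \<longleftrightarrow> (\<forall>i j. X i * X j = X j * X i)"

lemma commute_power: "(y::'a::monoid_mult) * x = x * y ==> y * x ^ n = x ^ n * y"
proof (induction n)
  case (Suc n)
  then show ?case by (metis mult.assoc power_Suc)
qed simp

lemma commute_prod_list:
  fixes y :: "'a::monoid_mult"
  assumes "!!i. y * X i = X i * y"
  shows "y * prod_list (map (%i. X i ^ a i) xs) = prod_list (map (%i. X i ^ a i) xs) * y"
proof (induction xs)
  case (Cons x xs)
  have "y * (X x ^ a x * prod_list (map (%i. X i ^ a i) xs)) = (X x ^ a x * y) * prod_list (map (%i. X i ^ a i) xs)"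
    by (simp only: mult.assoc[symmetric] commute_power[OF assms, of x "a x"])
  then show ?case using Cons by (simp add: mult.assoc)
qed simp

lemma commute_monom_at:
  fixes y :: "'a::monoid_mult"
  assumes "!!i. y * X i = X i * y"
  shows "y * monom_at X \<alpha> = monom_at X \<alpha> * y"
  unfolding monom_at_def by (rule commute_prod_list[OF assms])

lemma comfam_pdop: "comfam (pdop :: 'n::linorder => ('k::field, 'n) dop)"
  by (simp add: comfam_def pdop_commute)

lemma prod_list_power_add:
  fixes X :: "'n => 'a::monoid_mult"
  assumes "comfam X"
  shows "prod_list (map (%i. X i ^ (a i + b i)) xs) =
    prod_list (map (%i. X i ^ a i) xs) * prod_list (map (%i. X i ^ b i) xs)"
proof (induction xs)
  case (Cons x xs)
  have c: "X x ^ n * prod_list (map (%i. X i ^ a i) xs) = prod_list (map (%i. X i ^ a i) xs) * X x ^ n" for n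
    by (rule commute_prod_list) (metis assms comfam_def commute_power)
  let ?A = "prod_list (map (%i. X i ^ a i) xs)" and ?B = "prod_list (map (%i. X i ^ b i) xs)"
  have "X x ^ a x * (X x ^ b x * (?A * ?B)) = X x ^ a x * ((X x ^ b x * ?A) * ?B)" by (simp add: mult.assoc)
  also have "\<dots> = X x ^ a x * ?A * (X x ^ b x * ?B)" by (simp only: c[of "b x"] mult.assoc)
  finally show ?case using Cons by (simp add: power_add mult.assoc)
qed simp

lemma monom_at_add: "comfam X ==> monom_at X (\<alpha> + \<beta>) = monom_at X \<alpha> * monom_at X \<beta>"
  unfolding monom_at_def lookup_add by (rule prod_list_power_add)

lemma monom_at_0 [simp]: "monom_at X 0 = 1"
  unfolding monom_at_def by (simp add: map_replicate_const)

lemma monom_at_single: "monom_at X (Poly_Mapping.single i k) = X i ^ k"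
proof -
  have "prod_list (map (%j. X j ^ Poly_Mapping.lookup (Poly_Mapping.single i k) j) xs) =
    (if i : set xs then X i ^ k else 1)" if "distinct xs" for xs
    using that by (induction xs) (auto simp: lookup_single when_def)
  then show ?thesis by (simp add: monom_at_def)
qed

lemma monom_at_step: "comfam X ==> monom_at X (\<alpha> + Poly_Mapping.single i 1) = X i * monom_at X \<alpha>"
  by (simp add: monom_at_add monom_at_single add.commute[of \<alpha>])

lemma monom_at_step': "comfam X ==> monom_at X (\<alpha> + Poly_Mapping.single i 1) = monom_at X \<alpha> * X i"
  by (simp add: monom_at_add monom_at_single)

section \<open>Coefficients of normally ordered operators\<close>

lemma dop_of_superset:
  assumes "finite A" "Poly_Mapping.keys a \<subseteq> A"
  shows "dop_of a = (\<Sum>\<alpha>\<in>A. mulop (Poly_Mapping.lookup a \<alpha>) * monom_at pdop \<alpha>)"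
  unfolding dop_of_def using assms
  by (intro sum.mono_neutral_left) (auto simp: in_keys_iff)

lemma dop_of_add: "dop_of (a + b) = dop_of a + dop_of b"
proof -
  let ?A = "Poly_Mapping.keys a \<union> Poly_Mapping.keys b"
  have "Poly_Mapping.keys (a + b) \<subseteq> ?A" by (rule Poly_Mapping.keys_add)
  then show ?thesis
    by (simp add: dop_of_superset[of ?A] sum.distrib[symmetric] lookup_add mulop_add distrib_right)
qed

lemma dop_of_0 [simp]: "dop_of 0 = 0" by (simp add: dop_of_def)

lemma dop_of_single: "dop_of (Poly_Mapping.single \<alpha> g) = mulop g * monom_at pdop \<alpha>"
  by (subst dop_of_superset[of "{\<alpha>}"]) auto

lemma dop_of_minus: "dop_of (- a) = - dop_of a"
  using dop_of_add[of a "-a"] by (simp add: eq_neg_iff_add_eq_0 add.commute)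

lemma dop_of_diff: "dop_of (a - b) = dop_of a - dop_of b"
  using dop_of_add[of a "-b"] by (simp add: dop_of_minus)

text \<open>The scalar k is a product of falling factorials. It vanishes exactly when some exponent
  of \<alpha> exceeds that of \<gamma>, that is, whenever the truncated difference
  \<open>\<gamma> - \<alpha>\<close> would be wrong.\<close>

lemma app_pd_monom:
  fixes \<alpha> \<gamma> :: "'n::{finite,linorder} \<Rightarrow>\<^sub>0 nat"
  shows "\<exists>k. (\<forall>c::'k::field_char_0. app (monom_at pdop \<alpha>) (rpol (Poly_Mapping.single \<gamma> c)) =
     rpol (Poly_Mapping.single (\<gamma> - \<alpha>) (of_nat k * c))) &
    (k ~= 0 \<longleftrightarrow> (\<forall>i. Poly_Mapping.lookup \<alpha> i \<le> Poly_Mapping.lookup \<gamma> i))"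
proof (induction \<alpha> arbitrary: \<gamma> rule: expo_induct)
  case 0 show ?case by (rule exI[of _ 1]) simp
next
  case (step \<alpha> i)
  let ?e = "Poly_Mapping.single i (1::nat)"
  obtain k where k: "!!c::'k. app (monom_at pdop \<alpha>) (rpol (Poly_Mapping.single (\<gamma> - ?e) c)) =
     rpol (Poly_Mapping.single (\<gamma> - ?e - \<alpha>) (of_nat k * c))"
    "k ~= 0 \<longleftrightarrow> (\<forall>j. Poly_Mapping.lookup \<alpha> j \<le> Poly_Mapping.lookup (\<gamma> - ?e) j)"
    using step[of "\<gamma> - ?e"] by blast
  have e: "\<gamma> - ?e - \<alpha> = \<gamma> - (\<alpha> + ?e)"
    by (rule poly_mapping_eqI) (simp add: lookup_minus lookup_add)
  have "app (monom_at pdop (\<alpha> + ?e)) (rpol (Poly_Mapping.single \<gamma> c)) =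
     rpol (Poly_Mapping.single (\<gamma> - (\<alpha> + ?e)) (of_nat (k * Poly_Mapping.lookup \<gamma> i) * c))" for c :: 'k
    unfolding monom_at_step'[OF comfam_pdop] app_times app_pdop rpd_rpol mpd_single k(1) e
    by (simp add: mult_ac)
  moreover have "k * Poly_Mapping.lookup \<gamma> i ~= 0 \<longleftrightarrow>
     (\<forall>j. Poly_Mapping.lookup (\<alpha> + ?e) j \<le> Poly_Mapping.lookup \<gamma> j)"
  proof -
    have "k * Poly_Mapping.lookup \<gamma> i ~= 0 \<longleftrightarrow> Poly_Mapping.lookup \<gamma> i ~= 0 &
      (\<forall>j. Poly_Mapping.lookup \<alpha> j \<le> Poly_Mapping.lookup (\<gamma> - ?e) j)"
      using k(2) by auto
    also have "\<dots> \<longleftrightarrow> (\<forall>j. Poly_Mapping.lookup (\<alpha> + ?e) j \<le> Poly_Mapping.lookup \<gamma> j)"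
    proof (intro iffI allI conjI)
      fix j assume a: "Poly_Mapping.lookup \<gamma> i ~= 0 & (\<forall>j. Poly_Mapping.lookup \<alpha> j \<le> Poly_Mapping.lookup (\<gamma> - ?e) j)"
      then have "Poly_Mapping.lookup \<alpha> j \<le> Poly_Mapping.lookup (\<gamma> - ?e) j" by blast
      then show "Poly_Mapping.lookup (\<alpha> + ?e) j \<le> Poly_Mapping.lookup \<gamma> j"
        using a by (cases "i = j") (auto simp: lookup_add lookup_minus lookup_single when_def)
    next
      assume a: "\<forall>j. Poly_Mapping.lookup (\<alpha> + ?e) j \<le> Poly_Mapping.lookup \<gamma> j"
      show "Poly_Mapping.lookup \<gamma> i ~= 0" using a[rule_format, of i] by (simp add: lookup_add)
      fix j show "Poly_Mapping.lookup \<alpha> j \<le> Poly_Mapping.lookup (\<gamma> - ?e) j"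
        using a[rule_format, of j] by (cases "i = j") (auto simp: lookup_add lookup_minus lookup_single when_def)
    qed
    finally show ?thesis .
  qed
  ultimately show ?case by blast
qed

text \<open>The coefficients of an operator are recovered, by induction on the degree, from its values
  on the monomials.\<close>

lemma dop_of_coeff_mem:
  fixes a :: "('n::{finite,linorder} \<Rightarrow>\<^sub>0 nat) \<Rightarrow>\<^sub>0 ('k::field_char_0, 'n) ratf"
  assumes S0: "!!\<gamma>. 0 : S \<gamma>" and Sadd: "!!\<gamma> g h. g : S \<gamma> ==> h : S \<gamma> ==> g + h : S \<gamma>"
    and Sc: "!!\<gamma> g c. g : S \<gamma> ==> g * rpol (mconst c) : S \<gamma>"
    and Sm: "!!\<alpha> \<delta> g. g : S \<alpha> ==> g * rpol (Poly_Mapping.single \<delta> 1) : S (\<alpha> + \<delta>)"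
    and app: "!!\<gamma>. app (dop_of a) (rpol (Poly_Mapping.single \<gamma> 1)) : S \<gamma>"
  shows "Poly_Mapping.lookup a \<gamma> : S \<gamma>"
proof (induction "mdeg \<gamma>" arbitrary: \<gamma> rule: less_induct)
  case less
  let ?x = "rpol (Poly_Mapping.single \<gamma> (1::'k))"
  let ?t = "%\<alpha>. Poly_Mapping.lookup a \<alpha> * app (monom_at pdop \<alpha>) ?x"
  let ?A = "insert \<gamma> (Poly_Mapping.keys a)"
  have "app (dop_of a) ?x = (\<Sum>\<alpha>\<in>?A. ?t \<alpha>)"
    by (subst dop_of_superset[of ?A]) (auto simp: app_sum app_times)
  also have "\<dots> = ?t \<gamma> + (\<Sum>\<alpha>\<in>?A - {\<gamma>}. ?t \<alpha>)"
    by (rule sum.remove) auto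
  \<comment> \<open>The sign is written as a constant factor because the sets
    \<open>S \<gamma>\<close> are closed under sums and constant multiples.\<close>
  finally have eq: "?t \<gamma> = app (dop_of a) ?x + (\<Sum>\<alpha>\<in>?A - {\<gamma>}. ?t \<alpha>) * rpol (mconst (-1))"
    by (simp add: mconst.hom_minus mconst.hom_1 rpol.hom_minus rpol.hom_1)
  \<comment> \<open>An \<alpha> that is not below \<gamma> contributes 0; one that is below has
    smaller degree, so its coefficient is covered by the induction.\<close>
  have "?t \<alpha> : S \<gamma>" if "\<alpha> : ?A - {\<gamma>}" for \<alpha>
  proof -
    obtain k where k: "!!c::'k. app (monom_at pdop \<alpha>) (rpol (Poly_Mapping.single \<gamma> c)) =
       rpol (Poly_Mapping.single (\<gamma> - \<alpha>) (of_nat k * c))"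
      "k ~= 0 \<longleftrightarrow> (\<forall>i. Poly_Mapping.lookup \<alpha> i \<le> Poly_Mapping.lookup \<gamma> i)"
      using app_pd_monom[of \<alpha> \<gamma>] by blast
    show ?thesis
    proof (cases "k = 0")
      case True then show ?thesis using k(1)[of 1] S0 by (simp add: rpol.hom_0)
    next
      case False
      then have le: "!!i. Poly_Mapping.lookup \<alpha> i \<le> Poly_Mapping.lookup \<gamma> i" using k by auto
      have ad: "\<alpha> + (\<gamma> - \<alpha>) = \<gamma>" by (rule poly_mapping_eqI) (simp add: lookup_add lookup_minus le)
      have "\<exists>i. Poly_Mapping.lookup \<alpha> i ~= Poly_Mapping.lookup \<gamma> i"
        using that poly_mapping_eqI by (metis Diff_iff singletonI)
      then have "mdeg \<alpha> < mdeg \<gamma>"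
        unfolding mdeg_def by (intro sum_strict_mono_ex1) (use le in \<open>auto simp: order.strict_iff_order\<close>)
      then have "Poly_Mapping.lookup a \<alpha> : S \<alpha>" using less by blast
      then have "Poly_Mapping.lookup a \<alpha> * rpol (Poly_Mapping.single (\<gamma> - \<alpha>) 1) * rpol (mconst (of_nat k)) : S \<gamma>"
        using Sm[of _ \<alpha> "\<gamma> - \<alpha>"] Sc ad by metis
      moreover have "rpol (Poly_Mapping.single (\<gamma> - \<alpha>) 1) * rpol (mconst (of_nat k)) = rpol (Poly_Mapping.single (\<gamma> - \<alpha>) (of_nat k :: 'k))"
        by (simp only: rpol.hom_mult[symmetric] mconst_def mult_single add_0_right mult_1)
      ultimately show ?thesis using k(1)[of 1] by (simp add: mult.assoc)
    qed
  qed
  then have "(\<Sum>\<alpha>\<in>?A - {\<gamma>}. ?t \<alpha>) : S \<gamma>"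
    using S0 Sadd by (intro sum_in_set) auto
  then have t: "?t \<gamma> : S \<gamma>" unfolding eq by (intro Sadd app Sc)
  obtain k where k: "!!c::'k. app (monom_at pdop \<gamma>) (rpol (Poly_Mapping.single \<gamma> c)) =
       rpol (Poly_Mapping.single (\<gamma> - \<gamma>) (of_nat k * c))" "k ~= 0"
    using app_pd_monom[of \<gamma> \<gamma>] by blast
  have tk: "?t \<gamma> = Poly_Mapping.lookup a \<gamma> * rpol (mconst (of_nat k))"
    using k(1)[of 1] by (simp add: mconst_def)
  \<comment> \<open>The remaining scalar is the factorial of \<gamma>, which is invertible in
    characteristic zero.\<close>
  then have "Poly_Mapping.lookup a \<gamma> * rpol (mconst (of_nat k)) * rpol (mconst (inverse (of_nat k))) : S \<gamma>"
    by (intro Sc t[unfolded tk])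
  then show ?case using k(2)
    by (simp add: mult.assoc rpol.hom_mult[symmetric] mconst.hom_mult[symmetric] mconst.hom_1 rpol.hom_1)
qed

text \<open>The case in which every \<open>S \<gamma>\<close> is zero. The general form with sets
  depending on \<gamma> serves the V-filtration.\<close>

lemma dop_of_inj:
  fixes a :: "('n::{finite,linorder} \<Rightarrow>\<^sub>0 nat) \<Rightarrow>\<^sub>0 ('k::field_char_0, 'n) ratf"
  shows "dop_of a = dop_of b \<longleftrightarrow> a = b"
proof
  assume "dop_of a = dop_of b"
  then have z: "dop_of (a - b) = 0" by (simp add: dop_of_diff)
  have "Poly_Mapping.lookup (a - b) \<gamma> : {0}" for \<gamma>
    by (rule dop_of_coeff_mem[where S="%_. {0}"]) (auto simp: z)
  then show "a = b" by (auto intro!: poly_mapping_eqI simp: lookup_minus)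
qed simp

lemma dcoeffs_dop_of [simp]:
  fixes a :: "('n::{finite,linorder} \<Rightarrow>\<^sub>0 nat) \<Rightarrow>\<^sub>0 ('k::field_char_0, 'n) ratf"
  shows "dcoeffs (dop_of a) = a"
  unfolding dcoeffs_def using dop_of_inj by blast

section \<open>Operators with coefficients in a differential ring\<close>

definition dopS :: "('k::idom, 'n::{finite,linorder}) ratf set => ('k, 'n) dop set" where
  "dopS S = {dop_of a | a. \<forall>\<alpha>. Poly_Mapping.lookup a \<alpha> : S}"

lemma Dop_dopS: "Dop U = dopS (reg U)" and weyl_dopS: "weyl = dopS (range rpol)"
  by (auto simp: Dop_def weyl_def dopS_def)

lemma dopS_mono: "S \<subseteq> S' ==> dopS S \<subseteq> dopS S'" by (auto simp: dopS_def)

lemma dopS_coeffs: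
  fixes P :: "('k::field_char_0, 'n::{finite,linorder}) dop"
  assumes "P : dopS S"
  shows "dop_of (dcoeffs P) = P" "Poly_Mapping.lookup (dcoeffs P) \<alpha> : S"
  using assms by (auto simp: dopS_def)

text \<open>Closure under partial derivatives lets coefficients pass to the left of \<partial>,
  which makes \<open>dopS S\<close> a ring. The cases used are polynomials, functions regular on U,
  functions with poles along f, functions that restrict to the diagonal, and all of K(x).\<close>

locale dring =
  fixes S :: "('k::field, 'n::{finite,linorder}) ratf set"
  assumes S0: "0 : S" and S1: "1 : S" and Sadd: "!!g h. g : S ==> h : S ==> g + h : S"
    and Smult: "!!g h. g : S ==> h : S ==> g * h : S" and Sneg: "!!g. g : S ==> - g : S"
    and Sd: "!!g i. g : S ==> rpd i g : S"
begin

lemma Sdiff: "g : S ==> h : S ==> g - h : S"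
  using Sadd[of g "-h"] Sneg by simp

lemma Spow: "g : S ==> g ^ n : S"
  by (induction n) (auto simp: S1 Smult)

lemma dopS_0: "0 : dopS S" unfolding dopS_def using S0 by (auto intro!: exI[of _ 0])

lemma dopS_add: "P : dopS S ==> Q : dopS S ==> P + Q : dopS S"
  unfolding dopS_def by clarify (metis dop_of_add lookup_add Sadd)

lemma dopS_minus: "P : dopS S ==> - P : dopS S"
  unfolding dopS_def by clarify (metis dop_of_minus lookup_uminus Sneg)

lemma dopS_diff: "P : dopS S ==> Q : dopS S ==> P - Q : dopS S"
  using dopS_add[of P "-Q"] dopS_minus by simp

lemma dopS_sum: "(!!x. x : A ==> P x : dopS S) ==> sum P A : dopS S"
  by (rule sum_in_set) (auto intro: dopS_0 dopS_add)

lemma dopS_monom: "g : S ==> mulop g * monom_at pdop \<alpha> : dopS S"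
  unfolding dopS_def dop_of_single[symmetric] using S0 by (auto simp: lookup_single when_def)

lemma dopS_induct [consumes 1, case_names zero add monom]:
  assumes "P : dopS S" "Pr 0" "!!P Q. P : dopS S ==> Q : dopS S ==> Pr P ==> Pr Q ==> Pr (P + Q)"
    "!!g \<alpha>. g : S ==> Pr (mulop g * monom_at pdop \<alpha>)"
  shows "Pr P"
proof -
  obtain a where a: "P = dop_of a" "!!\<alpha>. Poly_Mapping.lookup a \<alpha> : S" using assms(1) by (auto simp: dopS_def)
  have "dop_of a : {P : dopS S. Pr P}" unfolding dop_of_def
    by (rule sum_in_set) (use a assms in \<open>auto intro: dopS_0 dopS_add dopS_monom\<close>)
  then show ?thesis using a by auto
qed

lemma dopS_mulop: "g : S ==> mulop g : dopS S"
  using dopS_monom[of g 0] by simp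

lemma dopS_1: "1 : dopS S" using dopS_mulop[OF S1] by simp

lemma dopS_pdmonom: "monom_at pdop \<alpha> : dopS S" using dopS_monom[OF S1] by simp

lemma dopS_pdop: "pdop i : dopS S"
  using dopS_pdmonom[of "Poly_Mapping.single i 1"] by (simp only: monom_at_single power_one_right)

lemma dopS_mulop_mult: "Q : dopS S ==> g : S ==> mulop g * Q : dopS S"
proof (induction Q rule: dopS_induct)
  case (monom h \<alpha>)
  then show ?case using dopS_monom[of "g * h" \<alpha>] Smult by (simp add: mulop_mult mult.assoc)
qed (auto simp: distrib_left intro: dopS_0 dopS_add)

lemma dopS_pdop_mult: "Q : dopS S ==> pdop i * Q : dopS S"
proof (induction Q rule: dopS_induct)
  case (monom h \<alpha>)
  have "pdop i * (mulop h * monom_at pdop \<alpha>) = mulop (rpd i h) * monom_at pdop \<alpha> + mulop h * monom_at pdop (\<alpha> + Poly_Mapping.single i 1)"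
    unfolding monom_at_step[OF comfam_pdop] mult.assoc[symmetric] pdop_mulop by (simp add: algebra_simps)
  then show ?case using monom by (simp only:) (intro dopS_add dopS_monom Sd)
qed (auto simp: distrib_left intro: dopS_0 dopS_add)

lemma dopS_pdmonom_mult: "Q : dopS S ==> monom_at pdop \<alpha> * Q : dopS S"
  by (induction \<alpha> rule: expo_induct)
     (simp_all add: monom_at_step[OF comfam_pdop] mult.assoc dopS_pdop_mult del: One_nat_def)

lemma dopS_mult: "P : dopS S ==> Q : dopS S ==> P * Q : dopS S"
proof (induction P rule: dopS_induct)
  case (monom h \<alpha>)
  then show ?case by (simp add: mult.assoc dopS_mulop_mult dopS_pdmonom_mult)
qed (auto simp: distrib_right intro: dopS_0 dopS_add)

lemma dopS_power: "P : dopS S ==> P ^ n : dopS S"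
  by (induction n) (auto intro: dopS_1 dopS_mult)

lemma S_of_int: "of_int m : S"
proof -
  have "of_nat k : S" for k by (induction k) (auto intro: S0 S1 Sadd)
  then show ?thesis by (cases m) (auto intro!: Sneg Sdiff S1 simp del: of_nat_Suc)
qed

lemma dopS_of_int: "of_int m : dopS S"
  using dopS_mulop[OF S_of_int] by (simp add: mulop_of_int)

lemma dopS_app: "P : dopS S ==> g : S ==> app P g : S"
proof (induction P rule: dopS_induct)
  case (monom h \<alpha>)
  have "app (monom_at pdop \<alpha>) g : S"
    by (induction \<alpha> rule: expo_induct)
       (use monom in \<open>simp_all add: monom_at_step[OF comfam_pdop] app_times Sd del: One_nat_def\<close>)
  then show ?case using monom by (simp add: app_times Smult)
qed (auto simp: app_plus intro: S0 Sadd)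

end

lemma dring_rpol: "dring (range rpol)"
proof
  fix g h :: "('k::field, 'n::{finite,linorder}) ratf"
  show "g : range rpol ==> h : range rpol ==> g + h : range rpol"
    "g : range rpol ==> h : range rpol ==> g * h : range rpol"
    "g : range rpol ==> - g : range rpol" "g : range rpol ==> rpd i g : range rpol" for i
    by (auto simp: rpd_rpol simp flip: rpol.hom_add rpol.hom_mult rpol.hom_minus)
qed (auto simp: image_iff intro: exI[of _ 0] exI[of _ 1] simp: rpol.hom_1)

lemmas weyl_0 = dring.dopS_0[OF dring_rpol, folded weyl_dopS]
  and weyl_1 = dring.dopS_1[OF dring_rpol, folded weyl_dopS]
  and weyl_add = dring.dopS_add[OF dring_rpol, folded weyl_dopS]
  and weyl_minus = dring.dopS_minus[OF dring_rpol, folded weyl_dopS]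
  and weyl_mult = dring.dopS_mult[OF dring_rpol, folded weyl_dopS]
  and weyl_of_int = dring.dopS_of_int[OF dring_rpol, folded weyl_dopS]
  and weyl_pdop = dring.dopS_pdop[OF dring_rpol, folded weyl_dopS]

lemma weyl_polop: "polop (q :: ('k::field, 'n::{finite,linorder}) mpol) : weyl"
  unfolding polop_eq weyl_dopS by (rule dring.dopS_mulop[OF dring_rpol]) simp

section \<open>Regular functions\<close>

lemma zopen_basic: "zopen {p. meval p q ~= 0}"
  unfolding zopen_def by (rule exI[of _ "{q}"]) auto

lemma zopen_UNIV: "zopen (UNIV :: ('n::finite => 'k::comm_ring_1) set)"
  unfolding zopen_def by (rule exI[of _ "{1}"]) (auto simp: meval.hom_1)

lemma zopen_Int:
  fixes U V :: "('n::finite => 'k::idom) set"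
  assumes "zopen U" "zopen V" shows "zopen (U \<inter> V)"
proof -
  obtain S T where "U = {p. \<exists>q\<in>S. meval p q ~= 0}" "V = {p. \<exists>q\<in>T. meval p q ~= 0}"
    using assms by (auto simp: zopen_def)
  then have "U \<inter> V = {p. \<exists>q\<in>{a * b | a b. a : S & b : T}. meval p q ~= 0}"
  proof -
    have "(\<exists>q\<in>{a * b | a b. a : S & b : T}. meval p q ~= 0) \<longleftrightarrow> (\<exists>a\<in>S. \<exists>b\<in>T. meval p (a * b) ~= 0)" for p
      by blast
    then show ?thesis using \<open>U = _\<close> \<open>V = _\<close> by (simp add: meval.hom_mult set_eq_iff)
  qed
  then show ?thesis unfolding zopen_def by blast
qed

lemma reg_iff: "g : reg U \<longleftrightarrow> (\<forall>p\<in>U. g : reg {p})"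
  by (auto simp: reg_def)

lemma reg_antimono: "V \<subseteq> U ==> reg U \<subseteq> reg V"
  by (auto simp: reg_def)

lemma reg_pt:
  fixes g :: "('k::field, 'n::{finite,linorder}) ratf"
  shows "g : reg {p} \<longleftrightarrow> (\<exists>a b. meval p b ~= 0 & g = rpol a / rpol b)"
  by (auto simp: reg_def Fract_rpol)

lemma meval_nz [simp]: "meval p b ~= 0 ==> b ~= 0"
  by (auto simp: meval.hom_0)

lemma rpol_reg: "rpol (q :: ('k::field, 'n::{finite,linorder}) mpol) : reg U"
proof -
  have "\<exists>a b. meval p b ~= 0 & rpol q = rpol a / rpol b" for p
    by (rule exI[of _ q], rule exI[of _ 1]) (simp add: meval.hom_1 rpol.hom_1)
  then show ?thesis unfolding reg_iff[of _ U] reg_pt by blast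
qed

lemma inverse_reg:
  fixes b :: "('k::field, 'n::{finite,linorder}) mpol"
  assumes "!!p. p : U ==> meval p b ~= 0"
  shows "inverse (rpol b) : reg U"
proof -
  have "\<exists>c d. meval p d ~= 0 & inverse (rpol b) = rpol c / rpol d" if "p : U" for p
    by (rule exI[of _ 1], rule exI[of _ b]) (simp add: assms that rpol.hom_1 divide_inverse)
  then show ?thesis unfolding reg_iff[of _ U] reg_pt by blast
qed

lemma dring_reg: "dring (reg U :: ('k::field, 'n::{finite,linorder}) ratf set)"
proof
  show "0 : reg U" "1 : reg U"
    using rpol_reg[of 0 U] rpol_reg[of 1 U] by (simp_all add: rpol.hom_0 rpol.hom_1)
next
  fix g h :: "('k, 'n) ratf" assume g: "g : reg U" and h: "h : reg U"
  { fix p assume "p : U"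
    then obtain a b c d where *: "meval p b ~= 0" "g = rpol a / rpol b" "meval p d ~= 0" "h = rpol c / rpol d"
      using g h unfolding reg_iff[of _ U] reg_pt by metis
    then have "b ~= 0" "d ~= 0" by auto
    then have "g + h = rpol (a * d + c * b) / rpol (b * d)" "g * h = rpol (a * c) / rpol (b * d)"
      by (simp_all add: * rpol.hom_add rpol.hom_mult add_frac_eq)
    moreover have "meval p (b * d) ~= 0" using * by (simp add: meval.hom_mult)
    ultimately have "g + h : reg {p} & g * h : reg {p}" unfolding reg_pt by blast }
  then show "g + h : reg U" "g * h : reg U" unfolding reg_iff[of _ U] by auto
next
  fix g :: "('k, 'n) ratf" and i assume g: "g : reg U"
  { fix p assume "p : U"
    then obtain a b where *: "meval p b ~= 0" "g = rpol a / rpol b"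
      using g unfolding reg_iff[of _ U] reg_pt by metis
    then have "b ~= 0" by auto
    then have "rpd i g = rpol (mpd i a * b - a * mpd i b) / rpol (b * b)" "- g = rpol (- a) / rpol b"
      by (simp_all add: * rpd_divide rpd_rpol rpol.hom_diff rpol.hom_mult rpol.hom_minus power2_eq_square)
    moreover have "meval p (b * b) ~= 0" using * by (simp add: meval.hom_mult)
    ultimately have "- g : reg {p} & rpd i g : reg {p}" unfolding reg_pt using * by blast }
  then show "- g : reg U" "rpd i g : reg U" unfolding reg_iff[of _ U] by auto
qed

lemmas Dop_0 = dring.dopS_0[OF dring_reg, folded Dop_dopS]
  and Dop_1 = dring.dopS_1[OF dring_reg, folded Dop_dopS]
  and Dop_add = dring.dopS_add[OF dring_reg, folded Dop_dopS]
  and Dop_minus = dring.dopS_minus[OF dring_reg, folded Dop_dopS]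
  and Dop_diff = dring.dopS_diff[OF dring_reg, folded Dop_dopS]
  and Dop_sum = dring.dopS_sum[OF dring_reg, folded Dop_dopS]
  and Dop_mult = dring.dopS_mult[OF dring_reg, folded Dop_dopS]
  and Dop_pdop = dring.dopS_pdop[OF dring_reg, folded Dop_dopS]
  and Dop_mulop = dring.dopS_mulop[OF dring_reg, folded Dop_dopS]
  and Dop_of_int = dring.dopS_of_int[OF dring_reg, folded Dop_dopS]
  and Dop_power = dring.dopS_power[OF dring_reg, folded Dop_dopS]
  and Dop_app = dring.dopS_app[OF dring_reg, folded Dop_dopS]
  and Dop_induct = dring.dopS_induct[OF dring_reg, folded Dop_dopS, consumes 1, case_names zero add monom]

lemma Dop_antimono: "V \<subseteq> U ==> Dop U \<subseteq> Dop V"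
  unfolding Dop_dopS by (intro dopS_mono reg_antimono)

lemma weyl_Dop: "P : weyl ==> P : Dop (U :: ('n::{finite,linorder} => 'k::field) set)"
  unfolding Dop_dopS weyl_dopS using dopS_mono[of "range rpol" "reg U"] rpol_reg by blast

lemma Dop_polop: "polop q : Dop (U :: ('n::{finite,linorder} => 'k::field) set)"
  by (rule weyl_Dop[OF weyl_polop])

lemma polop_mult: "polop (p * q) = polop p * polop q"
  by (simp add: polop_eq rpol.hom_mult mulop_mult)

lemma polop_add: "polop (p + q) = polop p + polop q"
  by (simp add: polop_eq rpol.hom_add mulop_add)

lemma polop_1 [simp]: "polop 1 = 1" by (simp add: polop_eq rpol.hom_1)

lemma polop_commute: "polop p * polop q = polop q * polop p"
  by (simp add: polop_eq mulop_commute)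

lemma mulop_inverse: "(b :: ('k::field, 'n::linorder) mpol) ~= 0 ==> mulop (inverse (rpol b)) * polop b = 1"
  "(b :: ('k::field, 'n::linorder) mpol) ~= 0 ==> polop b * mulop (inverse (rpol b)) = 1"
  by (simp_all add: polop_eq mulop_mult[symmetric])

text \<open>Coefficients stand on the left, so their common denominator, a polynomial that does not
  vanish at p, is removed by left multiplication.\<close>

lemma Dop_clear:
  fixes P :: "('k::field, 'n::{finite,linorder}) dop"
  assumes "P : Dop {p}"
  shows "\<exists>h. meval p h ~= 0 & polop h * P : weyl"
  using assms
proof (induction P rule: Dop_induct)
  case zero show ?case by (rule exI[of _ 1]) (simp add: meval.hom_1 weyl_0)
next
  case (add P Q)
  then obtain h h' where h: "meval p h ~= 0" "polop h * P : weyl" "meval p h' ~= 0" "polop h' * Q : weyl" by blast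
  have "polop (h * h') * (P + Q) = polop h' * (polop h * P) + polop h * (polop h' * Q)"
    by (simp only: polop_mult distrib_left mult.assoc[symmetric] polop_commute[of h h'])
  then show ?case using h
    by (intro exI[of _ "h * h'"]) (auto simp: meval.hom_mult intro!: weyl_add weyl_mult weyl_polop)
next
  case (monom g \<alpha>)
  then obtain a b where *: "meval p b ~= 0" "g = rpol a / rpol b" unfolding reg_pt by blast
  then have "polop b * (mulop g * monom_at pdop \<alpha>) = mulop (rpol a) * monom_at pdop \<alpha>"
    by (simp add: polop_eq mulop_mult[symmetric] mult.assoc[symmetric])
  then show ?case using * unfolding weyl_dopS
    by (intro exI[of _ b]) (auto intro: dring.dopS_monom[OF dring_rpol])
qed

lemma Dop_unclear:
  fixes P :: "('k::field, 'n::{finite,linorder}) dop"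
  assumes "polop h * P : Dop U" "!!p. p : U ==> meval p h ~= 0" "h ~= 0"
  shows "P : Dop U"
proof -
  have "P = mulop (inverse (rpol h)) * (polop h * P)"
    by (simp add: mult.assoc[symmetric] mulop_inverse assms(3))
  also have "\<dots> : Dop U" by (rule Dop_mult[OF Dop_mulop[OF inverse_reg] assms(1)]) (rule assms(2))
  finally show ?thesis .
qed

text \<open>The denominator cleared at p has no zeros in a neighbourhood, so \<open>Dop {p}\<close>
  really is the stalk of the sheaf of operators.\<close>

lemma Dop_germ:
  fixes P :: "('k::field, 'n::{finite,linorder}) dop"
  assumes "P : Dop {p}"
  shows "\<exists>U. zopen U & p : U & P : Dop U"
proof -
  obtain h where h: "meval p h ~= 0" "polop h * P : weyl" using Dop_clear[OF assms] by blast
  have "P : Dop {q. meval q h ~= 0}"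
    by (rule Dop_unclear[of h]) (use h in \<open>auto intro: weyl_Dop\<close>)
  with h show ?thesis using zopen_basic by blast
qed

section \<open>Functions with poles along f\<close>

definition Oloc :: "('k::field, 'n::{finite,linorder}) mpol => ('n => 'k) set => ('k, 'n) ratf set" where
  "Oloc f U = {g / rpol f ^ k | g k. g : reg U}"

lemma Oloc_antimono: "V \<subseteq> U ==> Oloc f U \<subseteq> Oloc f V"
  using reg_antimono[of V U] by (auto simp: Oloc_def)

lemma dring_Oloc:
  assumes "f ~= 0" shows "dring (Oloc f U)"
proof -
  interpret reg: dring "reg U" by (rule dring_reg)
  note F = reg.Spow[OF rpol_reg[of f U]]
  have nz: "rpol f ~= 0" using assms by simp
  have I: "g : Oloc f U" if "g * rpol f ^ k : reg U" for g k
    unfolding Oloc_def using that nz by (auto intro!: exI[of _ "g * rpol f ^ k"] exI[of _ k])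
  have E: "\<exists>k. g * rpol f ^ k : reg U" if gO: "g : Oloc f U" for g
  proof -
    obtain h k where "g = h / rpol f ^ k" "h : reg U" using gO unfolding Oloc_def by blast
    then have "g * rpol f ^ k : reg U" using nz by simp
    then show ?thesis by blast
  qed
  show ?thesis
  proof
    show "0 : Oloc f U" "1 : Oloc f U" using reg.S0 reg.S1 by (auto intro: I[of _ 0])
  next
    fix g h assume "g : Oloc f U" "h : Oloc f U"
    then obtain k l where kl: "g * rpol f ^ k : reg U" "h * rpol f ^ l : reg U" using E by blast
    have "(g + h) * rpol f ^ (k + l) = (g * rpol f ^ k) * rpol f ^ l + (h * rpol f ^ l) * rpol f ^ k"
      "(g * h) * rpol f ^ (k + l) = (g * rpol f ^ k) * (h * rpol f ^ l)"
      by (simp_all add: power_add algebra_simps)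
    then show "g + h : Oloc f U" "g * h : Oloc f U"
      using kl F by (metis I reg.Sadd reg.Smult)+
  next
    fix g i assume "g : Oloc f U"
    then obtain k where k: "g * rpol f ^ k : reg U" using E by blast
    have "rpd i g * rpol f ^ (k + 1) = rpd i (g * rpol f ^ k) * rpol f - of_nat k * (g * rpol f ^ k) * rpd i (rpol f)"
    proof -
      \<comment> \<open>For k = 0 the truncated exponent \<open>k - 1\<close> is made harmless by
        the factor k.\<close>
      have e: "of_nat k * rpol f ^ (k - 1) * rpol f = of_nat k * rpol f ^ k" by (cases k) auto
      have "n * F1 * F = n * Fk ==> a * (Fk * F) = (a * Fk + g * (n * F1 * d)) * F - n * (g * Fk) * d"
        for a n F1 F Fk d by algebra
      from this[OF e, of "rpd i g" "rpd i (rpol f)"] show ?thesis by (simp only: rpd_mult rpd_power power_add power_one_right)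
    qed
    also have "\<dots> : reg U" using k reg.S_of_int[of "int k"]
      by (auto intro!: reg.Sdiff[OF reg.Smult[OF reg.Sd[OF k] rpol_reg] reg.Smult[OF reg.Smult[OF _ k] reg.Sd[OF rpol_reg]]])
    finally show "rpd i g : Oloc f U" by (rule I)
    have "- g * rpol f ^ k : reg U" using reg.Sneg[OF k] by simp
    then show "- g : Oloc f U" by (rule I)
  qed
qed

lemma reg_Oloc: "reg U \<subseteq> Oloc f U"
proof
  fix g assume "g : reg U"
  then show "g : Oloc f U" unfolding Oloc_def by (intro CollectI exI[of _ g] exI[of _ 0]) simp
qed

section \<open>Quotients and tensor products\<close>

text \<open>Module records carry no axioms. These predicates collect the group laws on the carrier
  and the closure of a subset on which cosets rely.\<close>

definition agrp :: "('d, 'a) lmod => bool" where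
  "agrp M \<longleftrightarrow> zerom M : carr M & (\<forall>x\<in>carr M. \<forall>y\<in>carr M. addm M x y : carr M & addm M x y = addm M y x) &
     (\<forall>x\<in>carr M. \<forall>y\<in>carr M. \<forall>z\<in>carr M. addm M (addm M x y) z = addm M x (addm M y z)) &
     (\<forall>x\<in>carr M. addm M (zerom M) x = x) & (\<forall>x\<in>carr M. \<exists>y\<in>carr M. addm M x y = zerom M)"

definition asub :: "('d, 'a) lmod => 'a set => bool" where
  "asub M S \<longleftrightarrow> S \<subseteq> carr M & zerom M : S & (\<forall>x\<in>S. \<forall>y\<in>S. addm M x y : S) &
     (\<forall>x\<in>S. \<exists>y\<in>S. addm M x y = zerom M)"

locale quotient =
  fixes M :: "('d, 'a) lmod" and S :: "'a set"
  assumes M: "agrp M" and S: "asub M S"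
begin

lemma m: "zerom M : carr M" "x : carr M ==> y : carr M ==> addm M x y : carr M"
  "x : carr M ==> y : carr M ==> addm M x y = addm M y x"
  "x : carr M ==> y : carr M ==> z : carr M ==> addm M (addm M x y) z = addm M x (addm M y z)"
  "x : carr M ==> addm M (zerom M) x = x" "x : carr M ==> addm M x (zerom M) = x"
  using M by (auto simp: agrp_def)

lemma s: "s : S ==> s : carr M" "zerom M : S" "s : S ==> t : S ==> addm M s t : S"
  "s : S ==> \<exists>t\<in>S. addm M s t = zerom M"
  using S by (auto simp: asub_def)

lemma coset_self: "x : carr M ==> x : coset M S x"
  unfolding coset_def using m(6) s(2) by force

lemma coset_add: assumes "x : carr M" "s : S" shows "coset M S (addm M x s) = coset M S x"
proof -
  obtain t where t: "t : S" "addm M s t = zerom M" using s(4) assms by blast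
  note c = assms(1) s(1)[OF assms(2)] s(1)[OF t(1)]
  have "addm M x u = addm M (addm M x s) (addm M t u)" if "u : S" for u
  proof -
    have "addm M (addm M x s) (addm M t u) = addm M x (addm M s (addm M t u))"
      by (rule m(4)) (use c s(1)[OF that] m(2) in auto)
    also have "addm M s (addm M t u) = addm M (addm M s t) u"
      by (rule m(4)[symmetric]) (use c s(1)[OF that] in auto)
    finally show ?thesis using t m(5) s(1)[OF that] by simp
  qed
  moreover have "addm M (addm M x s) u = addm M x (addm M s u)" if "u : S" for u
    using m(4)[OF c(1,2) s(1)[OF that]] .
  ultimately show ?thesis unfolding coset_def using s(3) t assms by blast
qed

lemma coset_eq: "y : coset M S x ==> x : carr M ==> coset M S y = coset M S x"
proof -
  assume "y : coset M S x" "x : carr M"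
  then obtain u where "y = addm M x u" "u : S" unfolding coset_def by blast
  then show ?thesis using coset_add \<open>x : carr M\<close> by simp
qed

lemma coset_eq_iff: "x : carr M ==> y : carr M ==> coset M S x = coset M S y \<longleftrightarrow> (\<exists>s\<in>S. y = addm M x s)"
proof -
  assume c: "x : carr M" "y : carr M"
  have "coset M S x = coset M S y \<longleftrightarrow> y : coset M S x"
    using coset_self[OF c(2)] coset_eq[of y x] c by auto
  then show ?thesis by (auto simp: coset_def)
qed

lemma quot_carr: "carr (quot M S) = coset M S ` carr M" by (simp add: quot_def)
lemma quot_zero: "zerom (quot M S) = coset M S (zerom M)" by (simp add: quot_def)

text \<open>In \<open>quot\<close> the sum is a union over all pairs of representatives. All members
  of the union are the same coset, and the union is not empty, so it collapses.\<close>

lemma quot_add: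
  assumes "x : carr M" "y : carr M"
  shows "addm (quot M S) (coset M S x) (coset M S y) = coset M S (addm M x y)"
proof -
  have "coset M S (addm M a b) = coset M S (addm M x y)" if ab: "a : coset M S x" "b : coset M S y" for a b
  proof -
    obtain s t where st: "a = addm M x s" "b = addm M y t" "s : S" "t : S" using ab by (auto simp: coset_def)
    have "addm M a b = addm M (addm M x y) (addm M s t)"
    proof -
      note c = assms s(1)[OF st(3)] s(1)[OF st(4)]
      have "addm M a b = addm M x (addm M s (addm M y t))"
        unfolding st by (rule m(4)) (use c m(2) in auto)
      also have "addm M s (addm M y t) = addm M (addm M s y) t" by (rule m(4)[symmetric]) (use c in auto)
      also have "addm M s y = addm M y s" by (rule m(3)) (use c in auto)
      also have "addm M (addm M y s) t = addm M y (addm M s t)" by (rule m(4)) (use c in auto)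
      also have "addm M x (addm M y (addm M s t)) = addm M (addm M x y) (addm M s t)"
        by (rule m(4)[symmetric]) (use c m(2) in auto)
      finally show ?thesis .
    qed
    then show ?thesis using coset_add[of "addm M x y" "addm M s t"] st s(3) assms m(2) by simp
  qed
  then have "(\<Union>a\<in>coset M S x. \<Union>b\<in>coset M S y. coset M S (addm M a b)) =
      (\<Union>a\<in>coset M S x. \<Union>b\<in>coset M S y. coset M S (addm M x y))"
    by (intro SUP_cong refl)
  also have "\<dots> = coset M S (addm M x y)"
    using coset_self[OF assms(1)] coset_self[OF assms(2)] by (metis SUP_const empty_iff)
  finally show ?thesis by (simp add: quot_def)
qed

lemma quot_agrp: "agrp (quot M S)"
proof -
  let ?Q = "quot M S"
  have c: "\<exists>a\<in>carr M. x = coset M S a" if "x : carr ?Q" for x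
    using that unfolding quot_carr by blast
  have cc: "coset M S a : carr ?Q" if "a : carr M" for a
    using that unfolding quot_carr by blast
  have "zerom ?Q : carr ?Q" unfolding quot_zero by (rule cc[OF m(1)])
  moreover have "addm ?Q x y : carr ?Q & addm ?Q x y = addm ?Q y x" if xy: "x : carr ?Q" "y : carr ?Q" for x y
  proof -
    obtain a b where a: "a : carr M" "b : carr M" and e: "x = coset M S a" "y = coset M S b" using c xy by blast
    show ?thesis unfolding e quot_add[OF a] quot_add[OF a(2,1)] using cc[OF m(2)[OF a]] m(3)[OF a] by metis
  qed
  moreover have "addm ?Q (addm ?Q x y) z = addm ?Q x (addm ?Q y z)"
    if xy: "x : carr ?Q" "y : carr ?Q" "z : carr ?Q" for x y z
  proof -
    obtain a b d where e: "x = coset M S a" "y = coset M S b" "z = coset M S d"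
      and a: "a : carr M" "b : carr M" "d : carr M" using c[OF xy(1)] c[OF xy(2)] c[OF xy(3)] by metis
    show ?thesis unfolding e quot_add[OF a(1,2)] quot_add[OF a(2,3)] quot_add[OF m(2)[OF a(1,2)] a(3)]
        quot_add[OF a(1) m(2)[OF a(2,3)]] m(4)[OF a] by (rule refl)
  qed
  moreover have "addm ?Q (zerom ?Q) x = x" if x: "x : carr ?Q" for x
  proof -
    obtain a where a: "a : carr M" "x = coset M S a" using c x by blast
    show ?thesis unfolding a(2) quot_zero quot_add[OF m(1) a(1)] m(5)[OF a(1)] by (rule refl)
  qed
  moreover have "\<exists>y\<in>carr ?Q. addm ?Q x y = zerom ?Q" if x: "x : carr ?Q" for x
  proof -
    obtain a where a: "a : carr M" "x = coset M S a" using c x by blast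
    obtain b where b: "b : carr M" "addm M a b = zerom M" using M a(1) unfolding agrp_def by blast
    show ?thesis unfolding a(2) quot_zero b(2)[symmetric] quot_add[OF a(1) b(1), symmetric] using cc[OF b(1)] by blast
  qed
  ultimately show ?thesis unfolding agrp_def by (intro conjI ballI) (simp_all only:)
qed

text \<open>\<open>quot_map\<close> is a union over representatives too; it collapses when moving
  the argument by S' moves the value by S.\<close>

lemma quot_map_coset:
  assumes M': "quotient M' S'" and x: "x : carr M'" and c: "!!x. x : carr M' ==> \<phi> x : carr M"
    and a: "!!x s. x : carr M' ==> s : S' ==> \<exists>t\<in>S. \<phi> (addm M' x s) = addm M (\<phi> x) t"
  shows "quot_map M S \<phi> (coset M' S' x) = coset M S (\<phi> x)"
proof -
  have "coset M S (\<phi> y) = coset M S (\<phi> x)" if y: "y : coset M' S' x" for y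
  proof -
    obtain s where s: "s : S'" "y = addm M' x s" using y by (auto simp: coset_def)
    then obtain t where "t : S" "\<phi> y = addm M (\<phi> x) t" using a[OF x] by blast
    then show ?thesis using coset_add c[OF x] by simp
  qed
  then have "quot_map M S \<phi> (coset M' S' x) = (\<Union>y\<in>coset M' S' x. coset M S (\<phi> x))"
    unfolding quot_map_def by (intro SUP_cong refl)
  also have "\<dots> = coset M S (\<phi> x)"
    using quotient.coset_self[OF M' x] by (metis SUP_const empty_iff)
  finally show ?thesis .
qed

lemma smul_quot_map: "smul (quot M S) r = quot_map M S (smul M r)"
  by (simp add: quot_def quot_map_def fun_eq_iff)

end

section \<open>Subgroups, free abelian groups on pairs, and tensor relations\<close>

definition nsub :: "'a::ab_group_add set => bool" where
  "nsub C \<longleftrightarrow> 0 : C & (\<forall>x\<in>C. \<forall>y\<in>C. x + y : C) & (\<forall>x\<in>C. - x : C)"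

lemma nsubD: assumes "nsub C" shows "0 : C" "x : C ==> y : C ==> x + y : C" "x : C ==> - x : C"
  "x : C ==> y : C ==> x - y : C"
  using assms unfolding nsub_def by (auto simp: diff_conv_add_uminus simp del: add_uminus_conv_diff)

lemma natmod_sel [simp]: "carr (natmod sc C) = C" "addm (natmod sc C) = (+)" "zerom (natmod sc C) = 0"
  "smul (natmod sc C) = sc"
  by (simp_all add: natmod_def)

lemma quotient_natmod: "nsub C ==> nsub S ==> S \<subseteq> C ==> quotient (natmod sc C) S"
  unfolding quotient_def agrp_def asub_def
  by (auto simp: nsubD add.assoc add.commute) (metis add.right_inverse nsubD(3))+

lemma coset_natmod_eq:
  assumes "nsub C" "nsub S" "S \<subseteq> C" "x : C" "y : C"
  shows "coset (natmod sc C) S x = coset (natmod sc C) S y \<longleftrightarrow> x - y : S"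
proof -
  interpret quotient "natmod sc C" S using quotient_natmod assms by blast
  have "(\<exists>s\<in>S. y = x + s) \<longleftrightarrow> x - y : S"
    using nsubD(3)[OF assms(2), of "x - y"] nsubD(3)[OF assms(2)] by force
  then show ?thesis using coset_eq_iff[of x y] assms by simp
qed

definition frags :: "'b set => 'm set => ('b \<times> 'm \<Rightarrow>\<^sub>0 int) set" where
  "frags B M = {c. Poly_Mapping.keys c \<subseteq> B \<times> M}"

lemma nsub_frags: "nsub (frags B M)"
proof -
  have "Poly_Mapping.keys (- x) = Poly_Mapping.keys x" for x :: "'a \<times> 'b \<Rightarrow>\<^sub>0 int"
    by (rule set_eqI) (simp only: in_keys_iff lookup_uminus neg_equal_0_iff_equal)
  moreover have "Poly_Mapping.keys (x + y) \<subseteq> B \<times> M"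
    if "Poly_Mapping.keys x \<subseteq> B \<times> M" "Poly_Mapping.keys y \<subseteq> B \<times> M" for x y :: "'a \<times> 'b \<Rightarrow>\<^sub>0 int"
    by (rule subset_trans[OF Poly_Mapping.keys_add]) (use that in simp)
  ultimately show ?thesis unfolding nsub_def frags_def by simp
qed

lemma free_mod_frags: "free_mod \<sigma> B M = natmod \<sigma> (frags (carr B) (carr M))"
  by (simp add: free_mod_def frags_def)

lemma frags_of: "b : B ==> m : M ==> frag_of (b, m) : frags B M"
  by (simp add: frags_def keys_frag_of)

lemma frags_induct [consumes 1, case_names zero one diff]:
  assumes "x : frags B M" "P 0" "!!b m. b : B ==> m : M ==> P (frag_of (b, m))"
    "!!x y. x : frags B M ==> y : frags B M ==> P x ==> P y ==> P (x - y)"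
  shows "P x"
proof -
  have "P x & x : frags B M"
  proof (rule frag_induction[of x "B \<times> M" "%x. P x & x : frags B M"])
    show "Poly_Mapping.keys x \<subseteq> B \<times> M" using assms(1) by (simp add: frags_def)
  qed (use assms nsubD[OF nsub_frags] in \<open>auto intro: frags_of\<close>)
  then show ?thesis by simp
qed

lemma frag_extend_in:
  assumes "x : frags B M" "nsub T" "!!b m. b : B ==> m : M ==> g (b, m) : T"
  shows "frag_extend g x : T"
  using assms(1) by (induction x rule: frags_induct) (use assms nsubD[OF assms(2)] in \<open>auto simp: frag_extend_diff\<close>)

definition bilin_gens :: "'r set => ('e, 'b) lmod => ('b => 'r => 'b) => ('r, 'm) lmod => ('b \<times> 'm \<Rightarrow>\<^sub>0 int) set" where
  "bilin_gens R B \<rho> M =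
     ({frag_of (addm B b b', m) - frag_of (b, m) - frag_of (b', m) | b b' m.
         b : carr B & b' : carr B & m : carr M} \<union>
      {frag_of (b, addm M m m') - frag_of (b, m) - frag_of (b, m') | b m m'.
         b : carr B & m : carr M & m' : carr M} \<union>
      {frag_of (\<rho> b r, m) - frag_of (b, smul M r m) | b r m.
         b : carr B & r : R & m : carr M})"

text \<open>\<open>addspan\<close> forms sums only, so inverses have to come from generators that
  are closed under negation.\<close>

lemma addspan_natmod_nsub:
  assumes "!!x. x : T ==> - x : T"
  shows "nsub (addspan (natmod sc C) T)"
proof -
  have add: "x + y : addspan (natmod sc C) T" if "x : addspan (natmod sc C) T" "y : addspan (natmod sc C) T" for x y
    using that by (induction x rule: addspan.induct)
      (auto simp: add.assoc intro: addspan.add[where M="natmod sc C", simplified])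
  have "- x : addspan (natmod sc C) T" if "x : addspan (natmod sc C) T" for x
    using that
  proof (induction x rule: addspan.induct)
    case zero then show ?case using addspan.zero[of "natmod sc C" T] by simp
  next
    case (add x y)
    then show ?case using assms addspan.add[of "-x" T "-y" "natmod sc C"] by (simp add: algebra_simps)
  qed
  then show ?thesis unfolding nsub_def using add addspan.zero[of "natmod sc C" T] by auto
qed

lemma addspan_gen: "x : T ==> x : addspan (natmod sc C) T"
  using addspan.add[of x T 0 "natmod sc C"] addspan.zero[of "natmod sc C" T] by simp

lemma addspan_sub:
  assumes "x : addspan (natmod sc C) T" "nsub V" "T \<subseteq> V"
  shows "x : V"
  using assms(1) by (induction rule: addspan.induct) (use assms nsubD[OF assms(2)] in auto)

lemma tensor_rel_addspan: "tensor_rel R B \<rho> M =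
  addspan (natmod frag_cmul UNIV) {frag_cmul n g | n g. g : bilin_gens R B \<rho> M}"
  unfolding tensor_rel_def lspan_def bilin_gens_def by simp

lemma nsub_tensor_rel: "nsub (tensor_rel R B \<rho> M)"
  unfolding tensor_rel_addspan
proof (rule addspan_natmod_nsub)
  fix x assume "x : {frag_cmul n g | n g. g : bilin_gens R B \<rho> M}"
  then show "- x : {frag_cmul n g | n g. g : bilin_gens R B \<rho> M}" by (smt (verit) mem_Collect_eq minus_frag_cmul)
qed

lemma tensor_rel_gen: "g : bilin_gens R B \<rho> M ==> g : tensor_rel R B \<rho> M"
  unfolding tensor_rel_addspan by (rule addspan_gen) (auto intro!: exI[of _ 1])

lemma tensor_rel_sub:
  assumes "nsub V" "bilin_gens R B \<rho> M \<subseteq> V" shows "tensor_rel R B \<rho> M \<subseteq> V"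
proof
  fix x assume x: "x : tensor_rel R B \<rho> M"
  have "frag_cmul n g : V" if g: "g : V" for n g
  proof -
    have "frag_cmul (int k) g : V" for k
      by (induction k) (use g nsubD[OF assms(1)] in \<open>auto simp: frag_cmul_distrib\<close>)
    then show ?thesis using nsubD(3)[OF assms(1)] by (cases n rule: int_cases2) (auto, metis minus_frag_cmul)
  qed
  then show "x : V"
    using x assms unfolding tensor_rel_addspan by (elim addspan_sub) auto
qed

lemma tr_addl: "b : carr B ==> b' : carr B ==> m : carr M ==>
    frag_of (addm B b b', m) - frag_of (b, m) - frag_of (b', m) : tensor_rel R B \<rho> M"
  and tr_addr: "b : carr B ==> m : carr M ==> m' : carr M ==>
    frag_of (b, addm M m m') - frag_of (b, m) - frag_of (b, m') : tensor_rel R B \<rho> M"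
  and tr_bal: "b : carr B ==> r : R ==> m : carr M ==>
    frag_of (\<rho> b r, m) - frag_of (b, smul M r m) : tensor_rel R B \<rho> M"
  by (rule tensor_rel_gen; auto simp: bilin_gens_def)+

text \<open>Universal property of the tensor product relative to a subgroup V. The slack V is
  essential: evaluations depend on chosen representatives and are biadditive and balanced only
  modulo such a subgroup.\<close>

lemma tensor_rel_induct [consumes 1, case_names addl addr bal]:
  assumes x: "x : tensor_rel R B \<rho> M" and e: "nsub V" "!!x y. e (x - y) = e x - e y"
    and "!!b b' m. b : carr B ==> b' : carr B ==> m : carr M ==>
      e (frag_of (addm B b b', m)) - e (frag_of (b, m)) - e (frag_of (b', m)) : V"
    "!!b m m'. b : carr B ==> m : carr M ==> m' : carr M ==>
      e (frag_of (b, addm M m m')) - e (frag_of (b, m)) - e (frag_of (b, m')) : V"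
    "!!b r m. b : carr B ==> r : R ==> m : carr M ==>
      e (frag_of (\<rho> b r, m)) - e (frag_of (b, smul M r m)) : V"
  shows "e x : (V :: 'v::ab_group_add set)"
proof -
  have e0: "e 0 = 0" using e(2)[of 0 0] by simp
  have em: "e (- x) = - e x" for x using e(2)[of 0 x] e0 by simp
  have ea: "e (x + y) = e x + e y" for x y using e(2)[of x "-y"] em by simp
  have "tensor_rel R B \<rho> M \<subseteq> {x. e x : V}"
    by (rule tensor_rel_sub) (use assms nsubD[OF e(1)] in \<open>auto simp: nsub_def bilin_gens_def e0 em ea e(2)\<close>)
  then show ?thesis using x by auto
qed

text \<open>Closure under sums and actions is what places the tensor relations inside the free group
  on the carriers.\<close>

locale bimod =
  fixes R :: "'r set" and B :: "('e, 'b) lmod" and \<rho> :: "'b => 'r => 'b" and M :: "('r, 'm) lmod"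
  assumes B_add: "b : carr B ==> b' : carr B ==> addm B b b' : carr B"
    and B_act: "b : carr B ==> r : R ==> \<rho> b r : carr B"
    and M_add: "m : carr M ==> m' : carr M ==> addm M m m' : carr M"
    and M_act: "m : carr M ==> r : R ==> smul M r m : carr M"
begin

abbreviation "Fr \<equiv> frags (carr B) (carr M)"
abbreviation "TR \<equiv> tensor_rel R B \<rho> M"

lemma TR_Fr: "TR \<subseteq> Fr"
  by (rule tensor_rel_sub[OF nsub_frags])
     (auto simp: bilin_gens_def intro!: nsubD[OF nsub_frags] frags_of B_add B_act M_add M_act)

lemma quotient_tensor: "quotient (free_mod \<sigma> B M) TR"
  unfolding free_mod_frags by (rule quotient_natmod[OF nsub_frags nsub_tensor_rel TR_Fr])

lemma tensor_coset_eq: "x : Fr ==> y : Fr ==>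
    coset (free_mod \<sigma> B M) TR x = coset (free_mod \<sigma> B M) TR y \<longleftrightarrow> x - y : TR"
  unfolding free_mod_frags by (rule coset_natmod_eq[OF nsub_frags nsub_tensor_rel TR_Fr])

lemma tensor_carr: "carr (tensor R B \<rho> M \<sigma>) = coset (free_mod \<sigma> B M) TR ` Fr"
  by (simp add: tensor_def quotient.quot_carr[OF quotient_tensor]) (simp add: free_mod_frags)

lemma tensor_add: "x : Fr ==> y : Fr ==> addm (tensor R B \<rho> M \<sigma>) (coset (free_mod \<sigma> B M) TR x) (coset (free_mod \<sigma> B M) TR y)
    = coset (free_mod \<sigma> B M) TR (x + y)"
  unfolding tensor_def by (subst quotient.quot_add[OF quotient_tensor]) (auto simp: free_mod_frags)

lemma tensor_zero: "zerom (tensor R B \<rho> M \<sigma>) = coset (free_mod \<sigma> B M) TR 0"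
  by (simp add: tensor_def quotient.quot_zero[OF quotient_tensor]) (simp add: free_mod_frags)

lemma tensor_quot_map:
  assumes "bimod R' B' \<rho>' M'" "x : frags (carr B') (carr M')"
    "!!x y. \<phi> (x + y) = \<phi> x + \<phi> y"
    "!!x. x : frags (carr B') (carr M') ==> \<phi> x : Fr" "!!x. x : tensor_rel R' B' \<rho>' M' ==> \<phi> x : TR"
  shows "quot_map (free_mod \<sigma> B M) TR \<phi> (coset (free_mod \<sigma>' B' M') (tensor_rel R' B' \<rho>' M') x) = coset (free_mod \<sigma> B M) TR (\<phi> x)"
  by (rule quotient.quot_map_coset[OF quotient_tensor bimod.quotient_tensor[OF assms(1)]])
     (use assms in \<open>auto simp: free_mod_frags\<close>)

lemma tensor_smul:
  assumes "x : Fr" "!!x y. \<sigma> P (x + y) = \<sigma> P x + \<sigma> P y"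
    "!!x. x : Fr ==> \<sigma> P x : Fr" "!!x. x : TR ==> \<sigma> P x : TR"
  shows "smul (tensor R B \<rho> M \<sigma>) P (coset (free_mod \<sigma> B M) TR x) = coset (free_mod \<sigma> B M) TR (\<sigma> P x)"
  unfolding tensor_def quotient.smul_quot_map[OF quotient_tensor]
  using tensor_quot_map[OF bimod_axioms assms(1), of "\<sigma> P" \<sigma> \<sigma>] assms by (simp add: free_mod_frags)

end

section \<open>Actions of differential operators\<close>

text \<open>The instances are functions, operators under left multiplication, vectors of operators,
  and finite sequences of operators.\<close>

locale dact =
  fixes act :: "('k::field_char_0, 'n::{finite,linorder}) dop => 'c::ab_group_add => 'c"
  assumes act_addl: "act (P + Q) c = act P c + act Q c" and act_addr: "act P (c + d) = act P c + act P d"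
    and act_mult: "act (P * Q) c = act P (act Q c)" and act_1 [simp]: "act 1 c = c"
begin

lemma act_0r [simp]: "act P 0 = 0" using act_addr[of P 0 0] by simp
lemma act_0l [simp]: "act 0 c = 0" using act_addl[of 0 0 c] by simp
lemma act_minusr: "act P (- c) = - act P c" using act_addr[of P c "-c"] by (simp add: eq_neg_iff_add_eq_0 add.commute)
lemma act_minusl: "act (- P) c = - act P c" using act_addl[of P "-P" c] by (simp add: eq_neg_iff_add_eq_0 add.commute)
lemma act_diffr: "act P (c - d) = act P c - act P d" using act_addr[of P c "-d"] by (simp add: act_minusr)
lemma act_suml: "act (sum P A) c = (\<Sum>x\<in>A. act (P x) c)"
  by (induction A rule: infinite_finite_induct) (auto simp: act_addl)

text \<open>Additive extension of a map on generators to the free abelian group; integer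
  coefficients act as constant operators.\<close>

definition fev :: "('x => 'c) => ('x \<Rightarrow>\<^sub>0 int) => 'c" where
  "fev \<phi> x = (\<Sum>k\<in>Poly_Mapping.keys x. act (of_int (Poly_Mapping.lookup x k)) (\<phi> k))"

lemma fev_superset: "finite A ==> Poly_Mapping.keys x \<subseteq> A ==>
    fev \<phi> x = (\<Sum>k\<in>A. act (of_int (Poly_Mapping.lookup x k)) (\<phi> k))"
  unfolding fev_def by (intro sum.mono_neutral_left) (auto simp: in_keys_iff)

lemma fev_add: "fev \<phi> (x + y) = fev \<phi> x + fev \<phi> y"
proof -
  let ?A = "Poly_Mapping.keys x \<union> Poly_Mapping.keys y"
  have "Poly_Mapping.keys (x + y) \<subseteq> ?A" by (rule Poly_Mapping.keys_add)
  then show ?thesis by (simp add: fev_superset[of ?A] sum.distrib[symmetric] lookup_add act_addl)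
qed

lemma fev_0 [simp]: "fev \<phi> 0 = 0" by (simp add: fev_def)
lemma fev_minus: "fev \<phi> (- x) = - fev \<phi> x" using fev_add[of \<phi> x "-x"] by (simp add: eq_neg_iff_add_eq_0 add.commute)
lemma fev_diff: "fev \<phi> (x - y) = fev \<phi> x - fev \<phi> y" using fev_add[of \<phi> x "-y"] by (simp add: fev_minus)
lemma fev_of [simp]: "fev \<phi> (frag_of k) = \<phi> k"
  by (subst fev_superset[of "{k}"]) auto

lemma fev_extend_cong:
  assumes "x : frags B M" "nsub T" "!!b m. b : B ==> m : M ==> fev \<psi> (g (b, m)) - \<phi> (b, m) : T"
  shows "fev \<psi> (frag_extend g x) - fev \<phi> x : T"
  using assms(1)
proof (induction x rule: frags_induct)
  case (diff x y)
  have "fev \<psi> (frag_extend g (x - y)) - fev \<phi> (x - y) =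
    (fev \<psi> (frag_extend g x) - fev \<phi> x) - (fev \<psi> (frag_extend g y) - fev \<phi> y)"
    by (simp add: frag_extend_diff fev_diff)
  then show ?case using diff nsubD(4)[OF assms(2)] by metis
qed (use assms nsubD[OF assms(2)] in auto)

lemma fev_extend_act:
  assumes "x : frags B M" "nsub T" "!!c. c : T ==> act P c : T"
    "!!b m. b : B ==> m : M ==> fev \<phi> (g (b, m)) - act P (\<phi> (b, m)) : T"
  shows "fev \<phi> (frag_extend g x) - act P (fev \<phi> x) : T"
  using assms(1)
proof (induction x rule: frags_induct)
  case (diff x y)
  have "fev \<phi> (frag_extend g (x - y)) - act P (fev \<phi> (x - y)) =
    (fev \<phi> (frag_extend g x) - act P (fev \<phi> x)) - (fev \<phi> (frag_extend g y) - act P (fev \<phi> y))"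
    by (simp add: frag_extend_diff fev_diff act_diffr)
  then show ?case using diff nsubD(4)[OF assms(2)] by metis
qed (use assms nsubD[OF assms(2)] in auto)

lemma fev_in:
  assumes "x : frags B M" "nsub T" "!!b m. b : B ==> m : M ==> \<phi> (b, m) : T"
  shows "fev \<phi> x : T"
  using assms(1) by (induction x rule: frags_induct) (use assms nsubD[OF assms(2)] in \<open>auto simp: fev_diff\<close>)

text \<open>\<open>conn_act\<close> is assembled from iterated derivations and coefficients. An
  error in R made at one stage remains in R, because R is stable under the operators applied
  afterwards.\<close>

lemma conn_act_cong:
  fixes E :: "'v::ab_group_add => 'c"
  assumes S: "dring S" and R: "nsub R" "!!P c. P : dopS S ==> c : R ==> act P c : R"
    and E: "!!v w. E (v + w) = E v + E w"
    and A: "!!v i. v : A ==> nab i v : A & E (nab i v) - act (pdop i) (E v) : R"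
      "!!v g. v : A ==> g : S ==> E (mul g v) - act (mulop g) (E v) : R"
    and P: "P : dopS S" and v: "v : A"
  shows "E (conn_act mul nab P v) - act P (E v) : R"
proof -
  interpret S: dring S by (rule S)
  note Rd = nsubD[OF R(1)]
  have E0: "E 0 = 0" using E[of 0 0] by simp
  have Esum: "E (sum g I) = (\<Sum>x\<in>I. E (g x))" for g :: "'x => 'v" and I
    by (induction I rule: infinite_finite_induct) (auto simp: E E0)
  have trans: "a - c : R" if "a - b : R" "b - c : R" for a b c
    using Rd(2)[OF that] by simp
  have pw: "(nab i ^^ k) v : A & E ((nab i ^^ k) v) - act (pdop i ^ k) (E v) : R" if "v : A" for i k v
  proof (induction k)
    case (Suc k)
    have "act (pdop i) (E ((nab i ^^ k) v) - act (pdop i ^ k) (E v)) : R"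
      using Suc R(2) S.dopS_pdop by blast
    then show ?case using trans[of "E (nab i ((nab i ^^ k) v))" "act (pdop i) (E ((nab i ^^ k) v))"] Suc A(1)[of "(nab i ^^ k) v" i]
      by (simp add: act_mult act_diffr)
  qed (use that Rd in auto)
  have fold: "E (fold (%i. nab i ^^ Poly_Mapping.lookup \<alpha> i) xs v) -
      act (prod_list (map (%i. pdop i ^ Poly_Mapping.lookup \<alpha> i) xs)) (E v) : R" if "v : A" for xs v \<alpha>
    using that
  proof (induction xs arbitrary: v)
    case (Cons x xs)
    let ?pl = "prod_list (map (%i. pdop i ^ Poly_Mapping.lookup \<alpha> i) xs) :: ('k, 'n) dop"
    let ?w = "(nab x ^^ Poly_Mapping.lookup \<alpha> x) v"
    have pl: "?pl : dopS S" by (induction xs) (auto intro: S.dopS_1 S.dopS_mult S.dopS_power S.dopS_pdop)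
    \<comment> \<open>\<open>fold\<close> applies the derivation of the first index first, whereas
      the product of operators applies it last; commutation of the derivatives reconciles the two
      orders.\<close>
    have c: "pdop x ^ Poly_Mapping.lookup \<alpha> x * ?pl = ?pl * pdop x ^ Poly_Mapping.lookup \<alpha> x"
      by (rule commute_prod_list) (metis comfam_pdop comfam_def commute_power)
    have "act ?pl (E ?w - act (pdop x ^ Poly_Mapping.lookup \<alpha> x) (E v)) : R"
      using R(2)[OF pl] pw[OF Cons(2)] by blast
    then show ?case using Cons.IH[of ?w] pw[OF Cons(2), of "Poly_Mapping.lookup \<alpha> x" x]
        trans[of _ "act ?pl (E ?w)"] by (simp add: c act_mult act_diffr)
  qed (use Rd in auto)
  have fA: "fold (%i. nab i ^^ Poly_Mapping.lookup \<alpha> i) xs v : A" if "v : A" for \<alpha> xs v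
    using that by (induction xs arbitrary: v) (auto simp: pw)
  have tm: "E (mul (Poly_Mapping.lookup (dcoeffs P) \<alpha>) (fold (%i. nab i ^^ Poly_Mapping.lookup \<alpha> i) (sorted_list_of_set UNIV) v))
     - act (mulop (Poly_Mapping.lookup (dcoeffs P) \<alpha>) * monom_at pdop \<alpha>) (E v) : R" for \<alpha>
  proof -
    let ?g = "Poly_Mapping.lookup (dcoeffs P) \<alpha>" and ?w = "fold (%i. nab i ^^ Poly_Mapping.lookup \<alpha> i) (sorted_list_of_set UNIV) v"
    have g: "?g : S" using dopS_coeffs(2)[OF P] .
    have "act (mulop ?g) (E ?w - act (monom_at pdop \<alpha>) (E v)) : R"
      unfolding monom_at_def by (rule R(2)[OF S.dopS_mulop[OF g] fold[OF v]])
    then show ?thesis using A(2)[OF fA[OF v] g] trans[of _ "act (mulop ?g) (E ?w)"] by (simp add: act_mult act_diffr)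
  qed
  have "act P (E v) = (\<Sum>\<alpha>\<in>Poly_Mapping.keys (dcoeffs P).
      act (mulop (Poly_Mapping.lookup (dcoeffs P) \<alpha>) * monom_at pdop \<alpha>) (E v))"
    by (subst dopS_coeffs(1)[OF P, symmetric]) (simp add: dop_of_def act_suml)
  then have "E (conn_act mul nab P v) - act P (E v) = (\<Sum>\<alpha>\<in>Poly_Mapping.keys (dcoeffs P).
     E (mul (Poly_Mapping.lookup (dcoeffs P) \<alpha>) (fold (%i. nab i ^^ Poly_Mapping.lookup \<alpha> i) (sorted_list_of_set UNIV) v))
     - act (mulop (Poly_Mapping.lookup (dcoeffs P) \<alpha>) * monom_at pdop \<alpha>) (E v))"
    by (simp add: conn_act_def Esum sum_subtractf)
  also have "\<dots> : R" by (rule sum_in_set) (use tm Rd in auto)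
  finally show ?thesis .
qed

end

lemma conn_act_closed:
  fixes v :: "'v::ab_group_add" and P :: "('k::field_char_0, 'n::{finite,linorder}) dop"
  assumes "nsub A" "!!i v. v : A ==> nab i v : A" "!!g v. g : S ==> v : A ==> mul g v : A"
    "P : dopS S" "v : A"
  shows "conn_act mul nab P v : A"
proof -
  have pw: "(nab i ^^ k) v : A" if "v : A" for i k v
    by (induction k) (use that assms in auto)
  have fA: "fold (%i. nab i ^^ Poly_Mapping.lookup \<alpha> i) xs v : A" if "v : A" for \<alpha> xs v
    using that by (induction xs arbitrary: v) (auto simp: pw)
  show ?thesis unfolding conn_act_def
    by (rule sum_in_set) (use assms fA nsubD[OF assms(1)] dopS_coeffs(2)[OF assms(4)] in auto)
qed

lemma conn_act_additive:
  fixes v :: "'v::ab_group_add"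
  assumes "!!i v w. nab i (v + w) = nab i v + nab i w" "!!g v w. mul g (v + w) = mul g v + mul g w"
  shows "conn_act mul nab P (v + w) = conn_act mul nab P v + conn_act mul nab P w"
proof -
  have pw: "(nab i ^^ k) (v + w) = (nab i ^^ k) v + (nab i ^^ k) w" for i k v w
    by (induction k) (auto simp: assms)
  have "fold (%i. nab i ^^ Poly_Mapping.lookup \<alpha> i) xs (v + w) =
    fold (%i. nab i ^^ Poly_Mapping.lookup \<alpha> i) xs v + fold (%i. nab i ^^ Poly_Mapping.lookup \<alpha> i) xs w" for \<alpha> xs v w
    by (induction xs arbitrary: v w) (auto simp: pw)
  then show ?thesis by (simp add: conn_act_def assms sum.distrib)
qed

section \<open>Concrete descriptions of germs\<close>

text \<open>\<open>Rl p U s c\<close> says that the germ at p of the section s over U is the class modulo \<open>R p\<close> of the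
  concrete object c. Two sheaves with such descriptions by the same data C, R, \<open>act\<close> are isomorphic.\<close>

locale model =
  fixes i :: "('n::{finite,linorder} => 'k::field) => ('m::finite => 'k)"
    and F :: "('m => 'k, ('k, 'n) dop, 'a) psh"
    and C :: "('n => 'k) => 'c::ab_group_add set" and R :: "('n => 'k) => 'c set"
    and act :: "('k, 'n) dop => 'c => 'c"
    and Rl :: "('n => 'k) => ('m => 'k) set => 'a => 'c => bool"
  assumes R_nsub: "nsub (R p)"
    and i_ind: "zopen V0 ==> \<exists>U. zopen U & i -` U = V0"
    and i_cont: "zopen U ==> zopen (i -` U)"
    and M0: "Rl p U s c ==> zopen U & i p : U & s : carr (sec F U)"
    and M1: "zopen U ==> i p : U ==> s : carr (sec F U) ==>
      \<exists>U' c. zopen U' & i p : U' & U' \<subseteq> U & c : C p & (\<forall>q. i q : U' --> Rl q U s c)"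
    and M2: "c : C p ==> \<exists>U s. zopen U & i p : U & (\<forall>q. i q : U --> Rl q U s c)"
    and M3: "Rl p U s c ==> Rl p V t c' ==> c - c' : R p \<longleftrightarrow>
      (\<exists>W. zopen W & i p : W & W \<subseteq> U \<inter> V & res F U W s = res F V W t)"
    and M4: "Rl p U s c ==> Rl p U t c' ==> Rl p U (addm (sec F U) s t) (c + c')"
    and M5: "Rl p U s c ==> P : Dop (i -` U) ==> Rl p U (smul (sec F U) P s) (act P c)"
    and M6: "Rl p UNIV (zerom (sec F UNIV)) 0"
    and M7: "Rl p U s c ==> zopen V ==> i p : V ==> V \<subseteq> U ==> Rl p V (res F U V s) c"
begin

text \<open>The germ described by c, in the encoding of \<open>germ\<close> as the set of all
  sections that represent it.\<close>

definition gcl :: "('n => 'k) => 'c => (('m => 'k) set \<times> 'a) set" where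
  "gcl p c = {(U, s). \<exists>c'. Rl p U s c' & c - c' : R p}"

definition rel :: "('n => 'k) => 'c => bool" where "rel p c \<longleftrightarrow> (\<exists>U s. Rl p U s c)"

lemma R_sym: "c - c' : R p ==> c' - c : R p"
  using nsubD(3)[OF R_nsub, of "c - c'" p] by simp

lemma R_trans: "a - b : R p ==> b - c : R p ==> a - c : R p"
  using nsubD(2)[OF R_nsub, of "a - b" p "b - c"] by simp

lemma R_refl: "a - a : R p" using nsubD(1)[OF R_nsub] by simp

lemma Rl_uniq: "Rl p U s c ==> Rl p U s c' ==> c - c' : R p"
  using M3[of p U s c U s c'] M0[of p U s c] by blast

lemma germ_gcl:
  assumes "Rl p U s c" shows "germ F (i p) U s = gcl p c"
proof (rule set_eqI, clarify)
  fix V t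
  show "(V, t) : germ F (i p) U s \<longleftrightarrow> (V, t) : gcl p c"
  proof
    assume "(V, t) : germ F (i p) U s"
    then have *: "zopen V" "i p : V" "t : carr (sec F V)"
      "\<exists>W. zopen W & i p : W & W \<subseteq> U \<inter> V & res F U W s = res F V W t"
      by (auto simp: germ_def)
    then obtain c' where c': "Rl p V t c'" using M1 by blast
    then have "c - c' : R p" using M3[OF assms c'] * by blast
    then show "(V, t) : gcl p c" using c' by (auto simp: gcl_def)
  next
    assume "(V, t) : gcl p c"
    then obtain c' where c': "Rl p V t c'" "c - c' : R p" by (auto simp: gcl_def)
    then show "(V, t) : germ F (i p) U s"
      using M3[OF assms c'(1)] M0[OF c'(1)] by (auto simp: germ_def)
  qed
qed

lemma gcl_cong: "c - c' : R p ==> gcl p c = gcl p c'"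
  unfolding gcl_def using R_trans R_sym by blast

lemma gcl_mem: "Rl p U s c ==> (U, s) : gcl p c"
  unfolding gcl_def using R_refl by blast

lemma gcl_eq: assumes "rel p c" shows "gcl p c = gcl p c' \<longleftrightarrow> c - c' : R p"
proof
  assume e: "gcl p c = gcl p c'"
  obtain U s where s: "Rl p U s c" using assms by (auto simp: rel_def)
  then have "(U, s) : gcl p c'" using gcl_mem e by blast
  then obtain c'' where "Rl p U s c''" "c' - c'' : R p" by (auto simp: gcl_def)
  then show "c - c' : R p" using Rl_uniq[OF s] R_trans R_sym by blast
qed (rule gcl_cong)

lemma C_rel: "c : C p ==> rel p c" using M2 unfolding rel_def by blast

lemma rel_C: assumes "rel p c" shows "\<exists>c'\<in>C p. c - c' : R p"
proof -
  obtain U s where s: "Rl p U s c" using assms by (auto simp: rel_def)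
  then obtain c' where "c' : C p" "Rl p U s c'" using M0[OF s] M1[of U p s] by blast
  then show ?thesis using Rl_uniq[OF s] by blast
qed

lemma Rl_inter:
  assumes "Rl p U s c" "Rl p V t c'"
  shows "Rl p (U \<inter> V) (res F U (U \<inter> V) s) c" "Rl p (U \<inter> V) (res F V (U \<inter> V) t) c'"
  using M0[OF assms(1)] M0[OF assms(2)] by (auto intro!: M7 assms zopen_Int)

lemma rel_add: "rel p c ==> rel p c' ==> rel p (c + c')"
  unfolding rel_def using Rl_inter M4 by metis

text \<open>The operator lives on X and the section on the target of i; \<open>i_ind\<close> turns
  the neighbourhood in X where P is regular into one in the target.\<close>

lemma Rl_smaller:
  assumes "Rl p U s c" "P : Dop {p}"
  shows "\<exists>V. zopen V & i p : V & V \<subseteq> U & P : Dop (i -` V)"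
proof -
  obtain V0 where V0: "zopen V0" "p : V0" "P : Dop V0" using Dop_germ[OF assms(2)] by blast
  obtain W where W: "zopen W" "i -` W = V0" using i_ind[OF V0(1)] by blast
  have "P : Dop (i -` (U \<inter> W))" using Dop_antimono[of "i -` (U \<inter> W)" V0] W V0(3) by auto
  then show ?thesis using M0[OF assms(1)] W V0 by (intro exI[of _ "U \<inter> W"]) (auto intro: zopen_Int)
qed

lemma Rl_smul:
  assumes "Rl p U s c" "P : Dop {p}"
  shows "\<exists>V t. Rl p V t c & P : Dop (i -` V) & Rl p V (smul (sec F V) P t) (act P c)"
  using Rl_smaller[OF assms] M7[OF assms(1)] M5 by blast

lemma rel_smul: "rel p c ==> P : Dop {p} ==> rel p (act P c)"
  unfolding rel_def using Rl_smul by blast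

text \<open>Two descriptions of one germ describe the same section after shrinking. Applying M5 to
  that section with either description shows that both images are equivalent, so stability of R
  under the action comes out of the other axioms.\<close>

lemma R_act:
  assumes "rel p c" "rel p c'" "c - c' : R p" "P : Dop {p}"
  shows "act P c - act P c' : R p"
proof -
  obtain U s V t where s: "Rl p U s c" and t: "Rl p V t c'" using assms by (auto simp: rel_def)
  obtain W where W: "zopen W" "i p : W" "W \<subseteq> U \<inter> V" "res F U W s = res F V W t"
    using M3[OF s t] assms(3) by blast
  have w: "Rl p W (res F U W s) c" "Rl p W (res F U W s) c'"
    using M7[OF s, of W] M7[OF t, of W] W by auto
  obtain W' where W': "zopen W'" "i p : W'" "W' \<subseteq> W" "P : Dop (i -` W')"
    using Rl_smaller[OF w(1) assms(4)] by blast
  show ?thesis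
    by (rule Rl_uniq[OF M5[OF M7[OF w(1) W'(1-3)] W'(4)] M5[OF M7[OF w(2) W'(1-3)] W'(4)]])
qed

text \<open>The union in \<open>stalk\<close> runs over pairs of sections on a common open set. All
  such pairs give the same germ, and restriction to an intersection provides one.\<close>

lemma stalk_add:
  assumes "rel p c" "rel p c'"
  shows "addm (stalk i F p) (gcl p c) (gcl p c') = gcl p (c + c')"
proof -
  have sub: "germ F (i p) U (addm (sec F U) s t) = gcl p (c + c')"
    if st: "(U, s) : gcl p c" "(U, t) : gcl p c'" for U s t
  proof -
    obtain d d' where d: "Rl p U s d" "c - d : R p" "Rl p U t d'" "c' - d' : R p"
      using st by (auto simp: gcl_def)
    have "(c - d) + (c' - d') : R p" using d nsubD(2)[OF R_nsub] by blast
    then have "(c + c') - (d + d') : R p" by (simp add: algebra_simps)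
    then show ?thesis using germ_gcl[OF M4[OF d(1,3)]] gcl_cong by metis
  qed
  obtain U s V t where s: "Rl p U s c" and t: "Rl p V t c'" using assms by (auto simp: rel_def)
  note m = gcl_mem[OF Rl_inter(1)[OF s t]] gcl_mem[OF Rl_inter(2)[OF s t]]
  have "addm (stalk i F p) (gcl p c) (gcl p c') =
    \<Union>{germ F (i p) U (addm (sec F U) s t) | U s t. (U, s) : gcl p c & (U, t) : gcl p c'}"
    by (simp add: stalk_def)
  also have "{germ F (i p) U (addm (sec F U) s t) | U s t. (U, s) : gcl p c & (U, t) : gcl p c'} = {gcl p (c + c')}"
    using sub m by blast
  finally show ?thesis by simp
qed

lemma stalk_smul:
  assumes c: "rel p c" and P: "P : Dop {p}"
  shows "smul (stalk i F p) P (gcl p c) = gcl p (act P c)"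
proof -
  have sub: "germ F (i p) U (smul (sec F U) P s) = gcl p (act P c)"
    if st: "(U, s) : gcl p c" "P : Dop (i -` U)" for U s
  proof -
    obtain d where d: "Rl p U s d" "c - d : R p" using st by (auto simp: gcl_def)
    then have "act P c - act P d : R p" using R_act[OF c _ d(2) P] by (auto simp: rel_def)
    then show ?thesis using germ_gcl[OF M5[OF d(1) st(2)]] gcl_cong by metis
  qed
  obtain V t where t: "Rl p V t c" "P : Dop (i -` V)" using c Rl_smul[OF _ P] unfolding rel_def by blast
  have "smul (stalk i F p) P (gcl p c) =
    \<Union>{germ F (i p) U (smul (sec F U) P s) | U s. (U, s) : gcl p c & P : Dop (i -` U)}"
    by (simp add: stalk_def)
  also have "{germ F (i p) U (smul (sec F U) P s) | U s. (U, s) : gcl p c & P : Dop (i -` U)} = {gcl p (act P c)}"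
    using sub gcl_mem[OF t(1)] t(2) by blast
  finally show ?thesis by simp
qed

lemma stalk_zero: "zerom (stalk i F p) = gcl p 0"
  using germ_gcl[OF M6] by (simp add: stalk_def)

lemma rel_0: "rel p 0" unfolding rel_def using M6 by blast

abbreviation "Sh \<equiv> inv_image_sheaf i F"

lemma Sh_sel:
  "carr (sec Sh V) = {s. s : extensional V &
         (\<forall>p\<in>V. \<exists>U t. zopen U & i p : U & t : carr (sec F U) &
            (\<forall>q\<in>V. i q : U --> s q = germ F (i q) U t))}"
  "addm (sec Sh V) s t = (\<lambda>p\<in>V. addm (stalk i F p) (s p) (t p))"
  "zerom (sec Sh V) = (\<lambda>p\<in>V. zerom (stalk i F p))"
  "smul (sec Sh V) P s = (\<lambda>p\<in>V. smul (stalk i F p) P (s p))"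
  "res Sh U V s = restrict s V"
  by (simp_all add: inv_image_sheaf_def)

lemma sec_D:
  assumes "s : carr (sec Sh V)" "p : V"
  shows "\<exists>U c t. zopen U & i p : U & c : C p & (\<forall>q. i q : U --> Rl q U t c) &
    (\<forall>q\<in>V. i q : U --> s q = gcl q c)"
proof -
  obtain U t where U: "zopen U" "i p : U" "t : carr (sec F U)" "\<forall>q\<in>V. i q : U --> s q = germ F (i q) U t"
    using assms unfolding Sh_sel by blast
  obtain U' c where U': "zopen U'" "i p : U'" "U' \<subseteq> U" "c : C p" "!!q. i q : U' ==> Rl q U t c"
    using M1[OF U(1-3)] by blast
  have "Rl q U' (res F U U' t) c" if "i q : U'" for q
    using M7[OF U'(5)[OF that] U'(1) that U'(3)] .
  moreover have "s q = gcl q c" if "q : V" "i q : U'" for q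
    using U(4) that germ_gcl[OF U'(5)[OF that(2)]] U'(3) by auto
  ultimately show ?thesis using U'(1,2,4) by blast
qed

text \<open>The local section t may live on a larger open set U' and is restricted to U, so that the
  same t can serve on smaller neighbourhoods.\<close>

lemma sec_I:
  assumes "s : extensional V" "!!p. p : V ==> \<exists>U U' c t. zopen U & i p : U & U \<subseteq> U' & (\<forall>q. q : V --> i q : U --> Rl q U' t c & s q = gcl q c)"
  shows "s : carr (sec Sh V)"
proof -
  have "\<exists>U t. zopen U & i p : U & t : carr (sec F U) & (\<forall>q\<in>V. i q : U --> s q = germ F (i q) U t)" if p: "p : V" for p
  proof -
    obtain U U' c t where U: "zopen U" "i p : U" "U \<subseteq> U'" "!!q. q : V ==> i q : U ==> Rl q U' t c & s q = gcl q c"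
      using assms(2)[OF p] by blast
    have *: "Rl q U (res F U' U t) c & s q = gcl q c" if "q : V" "i q : U" for q
      using U(4)[OF that] M7[of q U' t c U] U(1,3) that by blast
    then have "s q = germ F (i q) U (res F U' U t)" if "q : V" "i q : U" for q
      using that germ_gcl by metis
    moreover have "res F U' U t : carr (sec F U)" using *[OF p U(2)] M0 by blast
    ultimately show ?thesis using U(1,2) by blast
  qed
  then show ?thesis using assms(1) unfolding Sh_sel by blast
qed

lemma sec_ext: "s : carr (sec Sh V) ==> s : extensional V"
  unfolding Sh_sel by blast

lemma sec_pt: "s : carr (sec Sh V) ==> p : V ==> \<exists>c\<in>C p. s p = gcl p c"
proof -
  assume s: "s : carr (sec Sh V)" "p : V"
  obtain U c t where "i p : U" "c : C p" "\<forall>q\<in>V. i q : U --> s q = gcl q c" using sec_D[OF s] by blast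
  then show ?thesis using s(2) by blast
qed

end

section \<open>Comparison of two sheaves with the same description\<close>

locale two_models = F: model i F C R act RlF + G: model j G C R act RlG
  for i :: "('n::{finite,linorder} => 'k::field) => ('m::finite => 'k)"
    and F :: "('m => 'k, ('k, 'n) dop, 'a) psh"
    and j :: "('n::{finite,linorder} => 'k::field) => ('l::finite => 'k)"
    and G :: "('l => 'k, ('k, 'n) dop, 'b) psh"
    and C :: "('n => 'k) => 'c::ab_group_add set" and R act RlF RlG
begin

text \<open>Passes through a concrete description: any c in \<open>C p\<close> with the given germ
  for F determines the germ for G, and by \<open>gcl_eq\<close> the choice of c is
  immaterial.\<close>

definition theta :: "('n => 'k) => (('m => 'k) set \<times> 'a) set => (('l => 'k) set \<times> 'b) set" where
  "theta p A = G.gcl p (SOME c. c : C p & F.gcl p c = A)"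

lemma theta_gcl: assumes "F.rel p c" shows "theta p (F.gcl p c) = G.gcl p c"
proof -
  obtain c' where c': "c' : C p" "F.gcl p c' = F.gcl p c"
    using F.rel_C[OF assms] F.gcl_cong by metis
  have "(SOME c'. c' : C p & F.gcl p c' = F.gcl p c) : C p & F.gcl p (SOME c'. c' : C p & F.gcl p c' = F.gcl p c) = F.gcl p c"
    by (rule someI[of "%c'. c' : C p & F.gcl p c' = F.gcl p c" c']) (use c' in simp)
  then have "c - (SOME c'. c' : C p & F.gcl p c' = F.gcl p c) : R p"
    using F.gcl_eq[OF assms] by metis
  then show ?thesis unfolding theta_def by (rule G.gcl_cong[symmetric])
qed

lemma theta_C: "c : C p ==> theta p (F.gcl p c) = G.gcl p c"
  by (rule theta_gcl[OF F.C_rel])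

lemma theta_sec:
  assumes s: "s : carr (sec F.Sh V)" and V: "zopen V"
  shows "(\<lambda>p\<in>V. theta p (s p)) : carr (sec G.Sh V)"
proof (rule G.sec_I)
  fix p assume p: "p : V"
  obtain U c t where U: "zopen U" "i p : U" "c : C p" "!!q. i q : U ==> RlF q U t c"
    "!!q. q : V ==> i q : U ==> s q = F.gcl q c" using F.sec_D[OF s p] by metis
  obtain U2 t2 where U2: "zopen U2" "j p : U2" "!!q. j q : U2 ==> RlG q U2 t2 c"
    using G.M2[OF U(3)] by blast
  \<comment> \<open>F and G may live on different spaces. The neighbourhood supplied by F is pulled
    back to X and is induced there by an open set on the side of G.\<close>
  obtain W where W: "zopen W" "j -` W = i -` U" using G.i_ind[OF F.i_cont[OF U(1)]] by blast
  show "\<exists>U U' c t. zopen U & j p : U & U \<subseteq> U' &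
      (\<forall>q. q : V --> j q : U --> RlG q U' t c & (\<lambda>p\<in>V. theta p (s p)) q = G.gcl q c)"
  proof (intro exI conjI allI impI)
    show "zopen (U2 \<inter> W)" using U2 W by (intro zopen_Int)
    show "j p : U2 \<inter> W" using U2 W U(2) by auto
    show "U2 \<inter> W \<subseteq> U2" by auto
    fix q assume q: "q : V" "j q : U2 \<inter> W"
    then show "RlG q U2 t2 c" using U2 by auto
    have "i q : U" using q(2) W(2) by auto
    then show "(\<lambda>p\<in>V. theta p (s p)) q = G.gcl q c"
      using U(5)[OF q(1)] q(1) theta_gcl[of q c] U(4)[of q] unfolding F.rel_def by (metis restrict_apply')
  qed
qed simp

lemma theta_hom:
  shows "dmod_hom F.Sh G.Sh (%V s. \<lambda>p\<in>V. theta p (s p))"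
  unfolding dmod_hom_def
proof (intro conjI allI impI ballI Pi_I)
  fix V :: "('n => 'k) set" assume V: "zopen V"
  fix s assume s: "s : carr (sec F.Sh V)"
  show "(\<lambda>p\<in>V. theta p (s p)) : carr (sec G.Sh V)" by (rule theta_sec[OF s V])
  { fix t assume t: "t : carr (sec F.Sh V)"
    have "theta p (addm (stalk i F p) (s p) (t p)) = addm (stalk j G p) (theta p (s p)) (theta p (t p))" if p: "p : V" for p
    proof -
      obtain c d where c: "c : C p" "s p = F.gcl p c" and d: "d : C p" "t p = F.gcl p d"
        using F.sec_pt[OF s p] F.sec_pt[OF t p] by blast
      show ?thesis unfolding c d F.stalk_add[OF F.C_rel[OF c(1)] F.C_rel[OF d(1)]] theta_C[OF c(1)] theta_C[OF d(1)]
          theta_gcl[OF F.rel_add[OF F.C_rel[OF c(1)] F.C_rel[OF d(1)]]]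
          G.stalk_add[OF G.C_rel[OF c(1)] G.C_rel[OF d(1)]] ..
    qed
    then show "(\<lambda>p\<in>V. theta p (addm (sec F.Sh V) s t p)) =
        addm (sec G.Sh V) (\<lambda>p\<in>V. theta p (s p)) (\<lambda>p\<in>V. theta p (t p))"
      unfolding F.Sh_sel G.Sh_sel by (intro restrict_ext) simp }
  { fix P assume P: "P : Dop V"
    have "theta p (smul (stalk i F p) P (s p)) = smul (stalk j G p) P (theta p (s p))" if p: "p : V" for p
    proof -
      obtain c where c: "c : C p" "s p = F.gcl p c" using F.sec_pt[OF s p] by blast
      have Pp: "P : Dop {p}" using P Dop_antimono[of "{p}" V] p by blast
      show ?thesis unfolding c F.stalk_smul[OF F.C_rel[OF c(1)] Pp] theta_C[OF c(1)]
          theta_gcl[OF F.rel_smul[OF F.C_rel[OF c(1)] Pp]] G.stalk_smul[OF G.C_rel[OF c(1)] Pp] ..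
    qed
    then show "(\<lambda>p\<in>V. theta p (smul (sec F.Sh V) P s p)) = smul (sec G.Sh V) P (\<lambda>p\<in>V. theta p (s p))"
      unfolding F.Sh_sel G.Sh_sel by (intro restrict_ext) simp }
next
  fix U V :: "('n => 'k) set" and s
  assume "V \<subseteq> U"
  then show "(\<lambda>p\<in>V. theta p (res F.Sh U V s p)) = res G.Sh U V (\<lambda>p\<in>U. theta p (s p))"
    unfolding F.Sh_sel G.Sh_sel by (auto simp: restrict_def fun_eq_iff)
qed

end

context two_models begin

interpretation inv: two_models j G i F C R act RlG RlF ..

lemma dmod_iso: "dmod_iso (inv_image_sheaf i F) (inv_image_sheaf j G)"
  unfolding dmod_iso_def
proof (intro exI conjI allI impI)
  show "dmod_hom F.Sh G.Sh (%V s. \<lambda>p\<in>V. theta p (s p))" by (rule theta_hom)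
  fix V :: "('n => 'k) set" assume V: "zopen V"
  show "bij_betw (%s. \<lambda>p\<in>V. theta p (s p)) (carr (sec F.Sh V)) (carr (sec G.Sh V))"
  proof (rule bij_betw_byWitness[where f'="%s. \<lambda>p\<in>V. inv.theta p (s p)"])
    show "\<forall>s\<in>carr (sec F.Sh V). (\<lambda>p\<in>V. inv.theta p ((\<lambda>p\<in>V. theta p (s p)) p)) = s"
    proof
      fix s assume s: "s : carr (sec F.Sh V)"
      have "inv.theta p (theta p (s p)) = s p" if "p : V" for p
        using F.sec_pt[OF s that] theta_C inv.theta_C by auto
      then show "(\<lambda>p\<in>V. inv.theta p ((\<lambda>p\<in>V. theta p (s p)) p)) = s"
        by (intro extensionalityI[OF restrict_extensional F.sec_ext[OF s]]) simp
    qed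
    show "\<forall>s\<in>carr (sec G.Sh V). (\<lambda>p\<in>V. theta p ((\<lambda>p\<in>V. inv.theta p (s p)) p)) = s"
    proof
      fix s assume s: "s : carr (sec G.Sh V)"
      have "theta p (inv.theta p (s p)) = s p" if "p : V" for p
        using G.sec_pt[OF s that] theta_C inv.theta_C by auto
      then show "(\<lambda>p\<in>V. theta p ((\<lambda>p\<in>V. inv.theta p (s p)) p)) = s"
        by (intro extensionalityI[OF restrict_extensional G.sec_ext[OF s]]) simp
    qed
  qed (use theta_sec inv.theta_sec V in auto)
qed

end

lemma dmod_iso_models:
  assumes "model i F C R act RlF" "model j G C R act RlG"
  shows "dmod_iso (inv_image_sheaf i F) (inv_image_sheaf j G)"
  by (rule two_models.dmod_iso[OF two_models.intro[OF assms]])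

section \<open>Sheafification preserves the description\<close>

context
  fixes F :: "('n::{finite,linorder} => 'k::field, ('k, 'n) dop, 'a) psh" and C R act Rl
  assumes mo: "model (%p. p) F C R act Rl"
begin

interpretation model "%p. p" F C R act Rl by (rule mo)

definition RlS :: "('n => 'k) => ('n => 'k) set => _ => _ => bool" where
  "RlS p U s c \<longleftrightarrow> zopen U & p : U & s : carr (sec (sheafify F) U) & s p = gcl p c & rel p c"

text \<open>M3 turns equivalence at p into equality of two restrictions on an open set, and then
  reads this equality back at every point of that set.\<close>

lemma spread:
  assumes "c : C p" "d : C p" "c - d : R p"
  shows "\<exists>W. zopen W & p : W & (\<forall>q\<in>W. c - d : R q)"
proof -
  obtain U s where U: "zopen U" "p : U" "!!q. q : U ==> Rl q U s c" using M2[OF assms(1)] by blast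
  obtain V t where V: "zopen V" "p : V" "!!q. q : V ==> Rl q V t d" using M2[OF assms(2)] by blast
  obtain W where W: "zopen W" "p : W" "W \<subseteq> U \<inter> V" "res F U W s = res F V W t"
    using M3[OF U(3)[OF U(2)] V(3)[OF V(2)]] assms(3) by blast
  have "c - d : R q" if "q : W" for q
    by (rule M3[THEN iffD2, OF U(3) V(3)]) (use W that in auto)
  then show ?thesis using W by blast
qed

lemma sheaf_eq_iff:
  assumes "s : carr (sec (sheafify F) U)" "t : carr (sec (sheafify F) V)" "p : U" "p : V" "zopen U" "zopen V"
  shows "s p = t p \<longleftrightarrow> (\<exists>W. zopen W & p : W & W \<subseteq> U \<inter> V & restrict s W = restrict t W)"
proof
  assume e: "s p = t p"
  obtain U1 c where c: "zopen U1" "p : U1" "c : C p" "!!q. q : U ==> q : U1 ==> s q = gcl q c"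
    using sec_D[of s U p] assms unfolding sheafify_def by blast
  obtain V1 d where d: "zopen V1" "p : V1" "d : C p" "!!q. q : V ==> q : V1 ==> t q = gcl q d"
    using sec_D[of t V p] assms unfolding sheafify_def by blast
  have "c - d : R p" using gcl_eq[OF C_rel[OF c(3)]] c d e assms by metis
  then obtain W where W: "zopen W" "p : W" "!!q. q : W ==> c - d : R q" using spread[OF c(3) d(3)] by blast
  let ?W = "W \<inter> (U \<inter> U1) \<inter> (V \<inter> V1)"
  have "restrict s ?W = restrict t ?W"
    using c(4) d(4) gcl_cong[OF W(3)] by (intro restrict_ext) auto
  moreover have "zopen ?W" using W c d assms by (intro zopen_Int) auto
  ultimately show "\<exists>W. zopen W & p : W & W \<subseteq> U \<inter> V & restrict s W = restrict t W"
    using W c d assms by (intro exI[of _ ?W]) auto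
next
  assume "\<exists>W. zopen W & p : W & W \<subseteq> U \<inter> V & restrict s W = restrict t W"
  then show "s p = t p" by (metis restrict_apply')
qed

lemma sec_gcl:
  assumes "zopen U" "c : C p" "p : U"
  shows "\<exists>V. zopen V & p : V & V \<subseteq> U & (\<lambda>q\<in>V. gcl q c) : carr (sec (sheafify F) V) & (\<forall>q\<in>V. rel q c)"
proof -
  obtain U1 s where U: "zopen U1" "p : U1" "!!q. q : U1 ==> Rl q U1 s c" using M2[OF assms(2)] by blast
  have "(\<lambda>q\<in>U1 \<inter> U. gcl q c) : carr (sec (sheafify F) (U1 \<inter> U))"
    unfolding sheafify_def
  proof (rule sec_I)
    fix p assume "p : U1 \<inter> U"
    then show "\<exists>W U' d t. zopen W & p : W & W \<subseteq> U' &
        (\<forall>q. q : U1 \<inter> U --> q : W --> Rl q U' t d & (\<lambda>q\<in>U1 \<inter> U. gcl q c) q = gcl q d)"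
      using U by (intro exI[of _ U1] exI[of _ c] exI[of _ s]) auto
  qed simp
  then show ?thesis using U assms zopen_Int unfolding rel_def by (intro exI[of _ "U1 \<inter> U"]) blast
qed

text \<open>A sheaf such as \<open>D_tensor\<close> enters further tensor products as a factor, so
  its sections need a description by the same C and R as those of the presheaf.\<close>

lemma model_sheafify: "model (%p. p) (sheafify F) C R act RlS"
proof
  fix p c assume "c : C p"
  then obtain V where V: "zopen V" "p : V" "(\<lambda>q\<in>V. gcl q c) : carr (sec (sheafify F) V)" "\<forall>q\<in>V. rel q c"
    using sec_gcl[OF zopen_UNIV] by blast
  then show "\<exists>U s. zopen U & p : U & (\<forall>q. q : U --> RlS q U s c)"
    by (intro exI[of _ V] exI[of _ "\<lambda>q\<in>V. gcl q c"]) (auto simp: RlS_def)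
next
  fix U p s assume s: "zopen U" "p : U" "s : carr (sec (sheafify F) U)"
  then obtain U1 c where c: "zopen U1" "p : U1" "c : C p" "!!q. q : U ==> q : U1 ==> s q = gcl q c"
    using sec_D[of s U p] unfolding sheafify_def by blast
  obtain V where V: "zopen V" "p : V" "V \<subseteq> U \<inter> U1" "\<forall>q\<in>V. rel q c"
    using sec_gcl[OF zopen_Int[OF s(1) c(1)] c(3)] s c by blast
  then show "\<exists>U' c. zopen U' & p : U' & U' \<subseteq> U & c : C p & (\<forall>q. q : U' --> RlS q U s c)"
    using c s by (intro exI[of _ V] exI[of _ c]) (auto simp: RlS_def)
next
  fix p U s c V t c' assume s: "RlS p U s c" and t: "RlS p V t c'"
  have "c - c' : R p \<longleftrightarrow> s p = t p" using s t gcl_eq[of p c c'] unfolding RlS_def by auto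
  also have "\<dots> \<longleftrightarrow> (\<exists>W. zopen W & p : W & W \<subseteq> U \<inter> V & restrict s W = restrict t W)"
    by (rule sheaf_eq_iff) (use s t in \<open>auto simp: RlS_def\<close>)
  finally show "c - c' : R p \<longleftrightarrow> (\<exists>W. zopen W & p : W & W \<subseteq> U \<inter> V &
      res (sheafify F) U W s = res (sheafify F) V W t)"
    by (simp add: sheafify_def Sh_sel)
next
  fix p U s c t c' assume s: "RlS p U s c" and t: "RlS p U t c'"
  have "addm (sec (sheafify F) U) s t : carr (sec (sheafify F) U)"
    unfolding sheafify_def
  proof (rule sec_I)
    fix q assume q: "q : U"
    obtain U1 c1 t1 where c: "zopen U1" "q : U1" "!!r. r : U1 ==> Rl r U1 t1 c1" "!!r. r : U ==> r : U1 ==> s r = gcl r c1"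
      using s sec_D[of s U q] q unfolding sheafify_def RlS_def by blast
    obtain U2 c2 t2 where d: "zopen U2" "q : U2" "!!r. r : U2 ==> Rl r U2 t2 c2" "!!r. r : U ==> r : U2 ==> t r = gcl r c2"
      using t sec_D[of t U q] q unfolding sheafify_def RlS_def by blast
    let ?W = "U1 \<inter> U2"
    let ?t = "addm (sec F ?W) (res F U1 ?W t1) (res F U2 ?W t2)"
    have "Rl r ?W ?t (c1 + c2) & addm (sec Sh U) s t r = gcl r (c1 + c2)" if r: "r : U" "r : ?W" for r
    proof -
      have 1: "Rl r U1 t1 c1" "Rl r U2 t2 c2" using r c(3) d(3) by auto
      have "addm (sec Sh U) s t r = addm (stalk (%p. p) F r) (gcl r c1) (gcl r c2)"
        using r c(4) d(4) by (simp add: Sh_sel)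
      also have "\<dots> = gcl r (c1 + c2)" by (rule stalk_add) (use 1 in \<open>auto simp: rel_def\<close>)
      finally show ?thesis using M4[OF Rl_inter[OF 1]] by simp
    qed
    then show "\<exists>W U' c t'. zopen W & q : W & W \<subseteq> U' & (\<forall>r. r : U --> r : W -->
        Rl r U' t' c & addm (sec Sh U) s t r = gcl r c)"
      using c d by (intro exI[of _ ?W] exI[of _ "c1 + c2"] exI[of _ ?t]) (auto intro: zopen_Int)
  qed (simp add: Sh_sel)
  moreover have "addm (sec (sheafify F) U) s t p = gcl p (c + c')"
    using s t by (simp add: RlS_def sheafify_def Sh_sel(2) stalk_add)
  ultimately show "RlS p U (addm (sec (sheafify F) U) s t) (c + c')"
    using s t by (simp add: RlS_def rel_add)
next
  fix p U s c P assume s: "RlS p U s c" and "P : Dop ((%p. p) -` U)"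
  then have P: "P : Dop U" by simp
  have Pp: "P : Dop {r}" if "r : U" for r using P Dop_antimono[of "{r}" U] that by blast
  have "smul (sec (sheafify F) U) P s : carr (sec (sheafify F) U)"
    unfolding sheafify_def
  proof (rule sec_I)
    fix q assume q: "q : U"
    obtain U1 c1 t1 where c: "zopen U1" "q : U1" "!!r. r : U1 ==> Rl r U1 t1 c1" "!!r. r : U ==> r : U1 ==> s r = gcl r c1"
      using s sec_D[of s U q] q unfolding sheafify_def RlS_def by blast
    let ?W = "U1 \<inter> U"
    let ?t = "smul (sec F ?W) P (res F U1 ?W t1)"
    have zW: "zopen ?W" using c s by (auto intro: zopen_Int simp: RlS_def)
    have PW: "P : Dop ((%p. p) -` ?W)" using P Dop_antimono[of ?W U] by auto
    have "Rl r ?W ?t (act P c1) & smul (sec Sh U) P s r = gcl r (act P c1)" if r: "r : U" "r : ?W" for r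
    proof -
      have 1: "Rl r U1 t1 c1" using r c(3) by auto
      have "smul (sec Sh U) P s r = smul (stalk (%p. p) F r) P (gcl r c1)"
        using r c(4) by (simp add: Sh_sel)
      also have "\<dots> = gcl r (act P c1)" by (rule stalk_smul) (use 1 Pp r in \<open>auto simp: rel_def\<close>)
      finally show ?thesis using M5[OF M7[OF 1 zW] PW] r by simp
    qed
    then show "\<exists>W U' c t'. zopen W & q : W & W \<subseteq> U' & (\<forall>r. r : U --> r : W -->
        Rl r U' t' c & smul (sec Sh U) P s r = gcl r c)"
      using c q zW by (intro exI[of _ ?W] exI[of _ "act P c1"] exI[of _ ?t]) auto
  qed (simp add: Sh_sel)
  moreover have "smul (sec (sheafify F) U) P s p = gcl p (act P c)"
    using s Pp by (simp add: RlS_def sheafify_def Sh_sel(4) stalk_smul)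
  ultimately show "RlS p U (smul (sec (sheafify F) U) P s) (act P c)"
    using s Pp by (simp add: RlS_def rel_smul)
next
  fix p
  have "zerom (sec (sheafify F) UNIV) : carr (sec (sheafify F) UNIV)"
    unfolding sheafify_def
  proof (rule sec_I)
    fix q :: "'n => 'k"
    show "\<exists>W U' c t'. zopen W & q : W & W \<subseteq> U' & (\<forall>r. r : UNIV --> r : W -->
        Rl r U' t' c & zerom (sec Sh UNIV) r = gcl r c)"
      using M6 zopen_UNIV stalk_zero
      by (intro exI[of _ UNIV] exI[of _ 0] exI[of _ "zerom (sec F UNIV)"]) (auto simp: Sh_sel)
  qed (simp add: Sh_sel)
  then show "RlS p UNIV (zerom (sec (sheafify F) UNIV)) 0"
    using rel_0 by (simp add: RlS_def zopen_UNIV sheafify_def Sh_sel(3) stalk_zero)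
next
  fix p U s c V assume s: "RlS p U s c" and V: "zopen V" "p : V" "V \<subseteq> U"
  have "res (sheafify F) U V s : carr (sec (sheafify F) V)"
    unfolding sheafify_def
  proof (rule sec_I)
    fix q assume q: "q : V"
    then obtain U1 c1 t1 where c: "zopen U1" "q : U1" "!!r. r : U1 ==> Rl r U1 t1 c1" "!!r. r : U ==> r : U1 ==> s r = gcl r c1"
      using s sec_D[of s U q] V unfolding sheafify_def RlS_def by blast
    then show "\<exists>W U' c t'. zopen W & q : W & W \<subseteq> U' & (\<forall>r. r : V --> r : W -->
        Rl r U' t' c & res Sh U V s r = gcl r c)"
      using V by (intro exI[of _ U1] exI[of _ c1] exI[of _ t1]) (auto simp: Sh_sel)
  qed (simp add: Sh_sel)
  then show "RlS p V (res (sheafify F) U V s) c"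
    using s V by (simp add: RlS_def sheafify_def Sh_sel(5))
qed (auto simp: R_nsub RlS_def)

lemma sheaf_eqI:
  assumes "s : carr (sec (sheafify F) U)" "t : carr (sec (sheafify F) U)"
    "!!p. p : U ==> \<exists>c c'. RlS p U s c & RlS p U t c' & c - c' : R p"
  shows "s = t"
proof (rule extensionalityI)
  show "s : extensional U" "t : extensional U" using assms(1,2) sec_ext unfolding sheafify_def by auto
  fix p assume "p : U"
  then show "s p = t p" using assms(3) gcl_cong unfolding RlS_def by metis
qed

lemma sheaf_res: "res (sheafify F) U V s = restrict s V"
  by (simp add: sheafify_def Sh_sel)

end

text \<open>Presheaves whose sections are classes of elements of an explicit group.\<close>

locale classes = dact act
  for act :: "('k::field_char_0, 'n::{finite,linorder}) dop => 'c::ab_group_add => 'c" +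
  fixes i :: "('n => 'k) => ('m::finite => 'k)"
    and F :: "('m => 'k, ('k, 'n) dop, 'a) psh"
    and C :: "('n => 'k) => 'c set" and R :: "('n => 'k) => 'c set"
    and A K :: "('m => 'k) set => 'x::ab_group_add set" and cl :: "('m => 'k) set => 'x => 'a"
    and rs :: "('m => 'k) set => ('m => 'k) set => 'x => 'x"
    and e :: "('n => 'k) => ('m => 'k) set => 'x => 'c"
    and sg :: "('m => 'k) set => ('k, 'n) dop => 'x => 'x"
  assumes R_nsub: "nsub (R p)" and R_act: "P : Dop {p} ==> c : R p ==> act P c : R p"
    and i_ind: "zopen V0 ==> \<exists>U. zopen U & i -` U = V0"
    and i_cont: "zopen U ==> zopen (i -` U)"
    and A_nsub: "zopen U ==> i p : U ==> nsub (A U)"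
    and carr: "zopen U ==> i p : U ==> carr (sec F U) = cl U ` A U"
    and cl_eq: "zopen U ==> i p : U ==> x : A U ==> y : A U ==> cl U x = cl U y \<longleftrightarrow> x - y : K U"
    and cl_add: "zopen U ==> i p : U ==> x : A U ==> y : A U ==> addm (sec F U) (cl U x) (cl U y) = cl U (x + y)"
    and cl_zero: "zerom (sec F UNIV) = cl UNIV 0"
    and sg_A: "zopen U ==> i p : U ==> x : A U ==> P : Dop (i -` U) ==> sg U P x : A U"
    and cl_smul: "zopen U ==> i p : U ==> x : A U ==> P : Dop (i -` U) ==> smul (sec F U) P (cl U x) = cl U (sg U P x)"
    and rs_A: "zopen U ==> zopen V ==> i p : V ==> V \<subseteq> U ==> x : A U ==> rs U V x : A V"
    and cl_res: "zopen U ==> zopen V ==> i p : V ==> V \<subseteq> U ==> x : A U ==> res F U V (cl U x) = cl V (rs U V x)"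
    and rs_diff: "rs U V (x - y) = rs U V x - rs U V y"
    and rs_rs: "zopen U ==> zopen V ==> zopen W ==> i p : W ==> V \<subseteq> U ==> W \<subseteq> V ==> x : A U ==> rs V W (rs U V x) = rs U W x"
    and e_diff: "e p U (x - y) = e p U x - e p U y"
    and e_K: "zopen U ==> i p : U ==> x : K U ==> e p U x : R p"
    and e_rs: "zopen U ==> zopen V ==> i p : V ==> V \<subseteq> U ==> x : A U ==> e p V (rs U V x) - e p U x : R p"
    and e_sg: "zopen U ==> i p : U ==> x : A U ==> P : Dop (i -` U) ==> e p U (sg U P x) - act P (e p U x) : R p"
    and e_loc: "zopen U ==> i p : U ==> x : A U ==>
      \<exists>V c. zopen V & i p : V & V \<subseteq> U & c : C p & (\<forall>q. i q : V --> e q U x - c : R q)"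
    and e_surj: "c : C p ==> \<exists>U x. zopen U & i p : U & x : A U & (\<forall>q. i q : U --> e q U x - c : R q)"
    and e_inj: "zopen U ==> i p : U ==> x : A U ==> e p U x : R p ==>
      \<exists>W. zopen W & i p : W & W \<subseteq> U & rs U W x : K W"
begin

text \<open>Agreement is asked modulo \<open>R p\<close> because the evaluation e respects
  restriction and the action only up to \<open>R p\<close>.\<close>

definition RlC :: "('n => 'k) => ('m => 'k) set => 'a => 'c => bool" where
  "RlC p U s c \<longleftrightarrow> zopen U & i p : U & (\<exists>x\<in>A U. s = cl U x & e p U x - c : R p)"

lemma Rt: "a - b : R p ==> b - c : R p ==> a - c : R p" "a - b : R p ==> b - a : R p"
  "a - b : R p ==> c - d : R p ==> (a + c) - (b + d) : R p"
  "a - b : R p ==> c - d : R p ==> (a - c) - (b - d) : R p" "a - a : R p"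
  using nsubD(2)[OF R_nsub, of "a - b" p "b - c"] nsubD(3)[OF R_nsub, of "a - b" p]
    nsubD(2)[OF R_nsub, of "a - b" p "c - d"] nsubD(4)[OF R_nsub, of "a - b" p "c - d"] nsubD(1)[OF R_nsub]
  by (simp_all add: algebra_simps)

lemma e_add: "e p U (x + y) = e p U x + e p U y"
  using e_diff[of p U x "-y"] e_diff[of p U 0 y] e_diff[of p U 0 0] by simp

lemma e_0: "e p U 0 = 0" using e_diff[of p U 0 0] by simp

sublocale model i F C R act RlC
proof
  fix p U s c V t c'
  assume "RlC p U s c" "RlC p V t c'"
  then obtain x y where U: "zopen U" "i p : U" "x : A U" "s = cl U x" "e p U x - c : R p"
    and V: "zopen V" "i p : V" "y : A V" "t = cl V y" "e p V y - c' : R p" by (auto simp: RlC_def)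
  have iff: "c - c' : R p \<longleftrightarrow> e p U x - e p V y : R p"
    using Rt(1,2) U(5) V(5) by blast
  have resK: "res F U W s = res F V W t \<longleftrightarrow> rs U W x - rs V W y : K W" if "zopen W" "i p : W" "W \<subseteq> U \<inter> V" for W
    using that U V cl_res[of U W p x] cl_res[of V W p y] cl_eq[of W p] rs_A[of U W p x] rs_A[of V W p y] by simp
  show "c - c' : R p \<longleftrightarrow> (\<exists>W. zopen W & i p : W & W \<subseteq> U \<inter> V & res F U W s = res F V W t)"
    unfolding iff
  proof
    assume d: "e p U x - e p V y : R p"
    \<comment> \<open>\<open>e_inj\<close> concerns a single section, so both are moved to the
      intersection and subtracted there.\<close>
    let ?W = "U \<inter> V"
    have W: "zopen ?W" "i p : ?W" using U V by (auto intro: zopen_Int)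
    have x: "rs U ?W x : A ?W" and y: "rs V ?W y : A ?W" using rs_A U V W by auto
    have "e p ?W (rs U ?W x) - e p U x : R p" "e p ?W (rs V ?W y) - e p V y : R p" using e_rs U V W by auto
    then have "e p ?W (rs U ?W x - rs V ?W y) : R p" using d Rt(1,2) unfolding e_diff by blast
    then obtain W' where W': "zopen W'" "i p : W'" "W' \<subseteq> ?W" "rs ?W W' (rs U ?W x - rs V ?W y) : K W'"
      using e_inj[OF W] nsubD(4)[OF A_nsub[OF W] x y] by blast
    have "rs ?W W' (rs U ?W x) = rs U W' x" "rs ?W W' (rs V ?W y) = rs V W' y"
      by (rule rs_rs; use U V W W' in auto)+
    then show "\<exists>W. zopen W & i p : W & W \<subseteq> U \<inter> V & res F U W s = res F V W t"
      using W' resK[of W'] by (auto simp: rs_diff)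
  next
    assume "\<exists>W. zopen W & i p : W & W \<subseteq> U \<inter> V & res F U W s = res F V W t"
    then obtain W where W: "zopen W" "i p : W" "W \<subseteq> U \<inter> V" "rs U W x - rs V W y : K W" using resK by blast
    then have "e p W (rs U W x) - e p W (rs V W y) : R p" using e_K[OF W(1,2,4)] by (metis e_diff)
    moreover have "e p W (rs U W x) - e p U x : R p" "e p W (rs V W y) - e p V y : R p" using e_rs U V W by auto
    ultimately show "e p U x - e p V y : R p" using Rt(1,2) by blast
  qed
next
  fix U p s assume U: "zopen U" "i p : U" "s : carr (sec F U)"
  then obtain x where x: "x : A U" "s = cl U x" using carr by auto
  then show "\<exists>U' c. zopen U' & i p : U' & U' \<subseteq> U & c : C p & (\<forall>q. i q : U' --> RlC q U s c)"
    using e_loc[OF U(1,2) x(1)] U unfolding RlC_def by blast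
next
  fix c p assume "c : C p"
  then obtain U x where "zopen U" "i p : U" "x : A U" "\<forall>q. i q : U --> e q U x - c : R q" using e_surj by blast
  then show "\<exists>U s. zopen U & i p : U & (\<forall>q. i q : U --> RlC q U s c)"
    unfolding RlC_def by blast
next
  fix p U s c assume "RlC p U s c"
  then show "zopen U & i p : U & s : carr (sec F U)" using carr[of U p] by (auto simp: RlC_def)
next
  fix p U s c t c' assume "RlC p U s c" "RlC p U t c'"
  then obtain x y where U: "zopen U" "i p : U" "x : A U" "s = cl U x" "e p U x - c : R p"
    and V: "y : A U" "t = cl U y" "e p U y - c' : R p" by (auto simp: RlC_def)
  then show "RlC p U (addm (sec F U) s t) (c + c')"
    unfolding RlC_def using cl_add[OF U(1,2)] Rt(3)[OF U(5) V(3)] nsubD(2)[OF A_nsub[OF U(1,2)]]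
    by (metis e_add)
next
  fix p U s c P assume "RlC p U s c" and P: "P : Dop (i -` U)"
  then obtain x where U: "zopen U" "i p : U" "x : A U" "s = cl U x" "e p U x - c : R p" by (auto simp: RlC_def)
  have "P : Dop {p}" using P Dop_antimono[of "{p}" "i -` U"] U(2) by auto
  then have "act P (e p U x) - act P c : R p" using R_act[OF _ U(5)] by (simp add: act_diffr)
  then show "RlC p U (smul (sec F U) P s) (act P c)"
    unfolding RlC_def using U cl_smul[OF U(1-3) P] sg_A[OF U(1-3) P] Rt(1)[OF e_sg[OF U(1-3) P]] by blast
next
  fix p show "RlC p UNIV (zerom (sec F UNIV)) 0"
    unfolding RlC_def cl_zero using zopen_UNIV nsubD(1)[OF A_nsub[OF zopen_UNIV]] e_0 nsubD(1)[OF R_nsub] by force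
next
  fix p U s c V assume "RlC p U s c" and V: "zopen V" "i p : V" "V \<subseteq> U"
  then obtain x where U: "zopen U" "i p : U" "x : A U" "s = cl U x" "e p U x - c : R p" by (auto simp: RlC_def)
  then show "RlC p V (res F U V s) c"
    unfolding RlC_def using V cl_res[OF U(1) V U(3)] rs_A[OF U(1) V U(3)] Rt(1)[OF e_rs[OF U(1) V U(3)] U(5)] by blast
qed (auto simp: R_nsub i_ind i_cont)

lemmas model = model_axioms

end

section \<open>The sheaf of modules of a module over the Weyl algebra\<close>

locale weyl_quot = dact act
  for act :: "('k::field_char_0, 'n::{finite,linorder}) dop => 'c::ab_group_add => 'c" +
  fixes W N :: "'c set"
  assumes W_nsub: "nsub W" and W_act: "P : weyl ==> w : W ==> act P w : W"
    and N_nsub: "nsub N" and N_act: "P : weyl ==> w : N ==> act P w : N" and NW: "N \<subseteq> W"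
begin

definition "Q = quot (natmod act W) N"

text \<open>Localizations of W and N at p inside the ambient group, where division by h makes sense
  because all operators act on it. The stalk of the sheaf attached to W/N is \<open>CQ p\<close>
  modulo \<open>RQ p\<close>.\<close>

definition CQ :: "('n => 'k) => 'c set" where
  "CQ p = {act (mulop (inverse (rpol h))) w | h w. meval p h ~= 0 & w : W}"

definition RQ :: "('n => 'k) => 'c set" where
  "RQ p = {c. \<exists>h. meval p h ~= 0 & act (polop h) c : N}"

abbreviation "cs \<equiv> coset (natmod act W) N"

sublocale q: quotient "natmod act W" N
  by (rule quotient_natmod[OF W_nsub N_nsub NW])

lemma Wd: "w : W ==> v : W ==> w + v : W" "w : W ==> v : W ==> w - v : W" "0 : W"
  using nsubD[OF W_nsub] by auto

lemma Q_carr: "carr Q = cs ` W" by (simp add: Q_def q.quot_carr)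

lemma cs_Q: "w : W ==> cs w : carr Q" by (simp add: Q_carr)

lemma cs_eq: "w : W ==> v : W ==> cs w = cs v \<longleftrightarrow> w - v : N"
  by (rule coset_natmod_eq[OF W_nsub N_nsub NW])

lemma Q_add: "w : W ==> v : W ==> addm Q (cs w) (cs v) = cs (w + v)"
  unfolding Q_def using q.quot_add[of w v] by simp

lemma Q_smul: assumes "P : weyl" "w : W" shows "smul Q P (cs w) = cs (act P w)"
  unfolding Q_def q.smul_quot_map
proof (subst q.quot_map_coset[OF q.quotient_axioms])
  fix x s assume "s : N"
  then show "\<exists>t\<in>N. smul (natmod act W) P (addm (natmod act W) x s) = addm (natmod act W) (smul (natmod act W) P x) t"
    using N_act[OF assms(1)] by (auto simp: act_addr)
qed (use assms W_act in auto)

definition \<eta> :: "'c set => 'c" where "\<eta> X = (SOME w. w : W & X = cs w)"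

lemma eta: assumes "X : carr Q" shows "\<eta> X : W" "cs (\<eta> X) = X"
proof -
  have "\<exists>w. w : W & X = cs w" using assms Q_carr by auto
  then have "\<eta> X : W & X = cs (\<eta> X)" unfolding \<eta>_def by (rule someI_ex)
  then show "\<eta> X : W" "cs (\<eta> X) = X" by auto
qed

lemma eta_cs: "w : W ==> \<eta> (cs w) - w : N"
  using eta[OF cs_Q] cs_eq by blast

lemma N_RQ: "c : N ==> c : RQ p"
  unfolding RQ_def by (auto intro!: exI[of _ 1] simp: meval.hom_1)

text \<open>An Ore argument: P c = (P h^{-1})(h c) with h c in N, and the denominator of P h^{-1} is
  cleared from the left.\<close>

lemma RQ_act: assumes "P : Dop {p}" "c : RQ p" shows "act P c : RQ p"
proof -
  obtain h where h: "meval p h ~= 0" "act (polop h) c : N" using assms by (auto simp: RQ_def)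
  have "P * mulop (inverse (rpol h)) : Dop {p}"
    using assms(1) h by (intro Dop_mult Dop_mulop inverse_reg) auto
  then obtain h' where h': "meval p h' ~= 0" "polop h' * (P * mulop (inverse (rpol h))) : weyl"
    using Dop_clear by blast
  have "act (polop h') (act P c) = act (polop h' * P * (mulop (inverse (rpol h)) * polop h)) c"
    using h(1) by (simp add: mulop_inverse act_mult)
  also have "\<dots> = act (polop h' * (P * mulop (inverse (rpol h)))) (act (polop h) c)"
    by (simp add: act_mult mult.assoc)
  also have "\<dots> : N" by (rule N_act[OF h'(2) h(2)])
  finally show ?thesis using h'(1) by (auto simp: RQ_def)
qed

lemma RQ_nsub: "nsub (RQ p)"
  unfolding nsub_def
proof (intro conjI ballI)
  show "0 : RQ p" by (rule N_RQ[OF nsubD(1)[OF N_nsub]])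
  fix c assume "c : RQ p"
  then obtain h where h: "meval p h ~= 0" "act (polop h) c : N" by (auto simp: RQ_def)
  then show "- c : RQ p" using nsubD(3)[OF N_nsub h(2)] by (auto simp: RQ_def act_minusr)
  fix d assume "d : RQ p"
  then obtain h' where h': "meval p h' ~= 0" "act (polop h') d : N" by (auto simp: RQ_def)
  have "act (polop (h * h')) (c + d) = act (polop h') (act (polop h) c) + act (polop h) (act (polop h') d)"
    by (simp add: act_addr act_mult[symmetric] polop_mult polop_commute[of h h'])
  also have "\<dots> : N"
    by (rule nsubD(2)[OF N_nsub N_act[OF weyl_polop h(2)] N_act[OF weyl_polop h'(2)]])
  finally show "c + d : RQ p" using h h' by (auto simp: RQ_def meval.hom_mult intro!: exI[of _ "h * h'"])
qed

lemma CQ_act: assumes "P : Dop {p}" "w : W" shows "act P w : CQ p"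
proof -
  obtain h where h: "meval p h ~= 0" "polop h * P : weyl" using Dop_clear[OF assms(1)] by blast
  have "act P w = act (mulop (inverse (rpol h)) * polop h) (act P w)" using h by (simp add: mulop_inverse)
  also have "\<dots> = act (mulop (inverse (rpol h))) (act (polop h * P) w)" by (simp add: act_mult)
  finally show ?thesis using h W_act[OF h(2) assms(2)] unfolding CQ_def by blast
qed

lemma inv_mult: "h ~= 0 ==> h' ~= 0 ==> mulop (inverse (rpol (h * h'))) * polop h' = mulop (inverse (rpol h))"
  "h ~= 0 ==> h' ~= 0 ==> mulop (inverse (rpol (h * h'))) * polop h = mulop (inverse (rpol h'))"
  for h h' :: "('k, 'n) mpol"
proof -
  assume nz: "h ~= 0" "h' ~= 0"
  have "inverse (rpol (h * h')) * rpol h' = inverse (rpol h)" "inverse (rpol (h * h')) * rpol h = inverse (rpol h')"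
    using nz by (simp_all add: rpol.hom_mult field_simps)
  then show "mulop (inverse (rpol (h * h'))) * polop h' = mulop (inverse (rpol h))"
    "mulop (inverse (rpol (h * h'))) * polop h = mulop (inverse (rpol h'))"
    by (simp_all add: polop_eq flip: mulop_mult)
qed

lemma CQ_nsub: "nsub (CQ p)"
  unfolding nsub_def
proof (intro conjI ballI)
  show "0 : CQ p" using CQ_act[OF Dop_1 Wd(3)] by simp
  fix c assume "c : CQ p"
  then obtain h w where h: "meval p h ~= 0" "w : W" "c = act (mulop (inverse (rpol h))) w" by (auto simp: CQ_def)
  have "- c = act (mulop (inverse (rpol h))) (- w)" by (simp add: h act_minusr)
  then show "- c : CQ p" using h nsubD(3)[OF W_nsub] unfolding CQ_def by blast
  fix d assume "d : CQ p"
  then obtain h' w' where h': "meval p h' ~= 0" "w' : W" "d = act (mulop (inverse (rpol h'))) w'" by (auto simp: CQ_def)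
  have "h ~= 0" "h' ~= 0" using h h' by auto
  then have "c + d = act (mulop (inverse (rpol (h * h')))) (act (polop h') w + act (polop h) w')"
    by (simp add: h(3) h'(3) act_addr act_mult[symmetric] inv_mult)
  moreover have "act (polop h') w + act (polop h) w' : W" using h h' by (intro Wd W_act weyl_polop)
  moreover have "meval p (h * h') ~= 0" using h h' by (simp add: meval.hom_mult)
  ultimately show "c + d : CQ p" unfolding CQ_def by blast
qed

section \<open>The tensor product of the sheaf of operators with a module over the Weyl
  algebra\<close>

abbreviation "FP \<equiv> D_tensor_psh Q"
abbreviation "DU U \<equiv> natmod (*) (Dop (U :: ('n => 'k) set)) :: (('k, 'n) dop, ('k, 'n) dop) lmod"

definition TK :: "('n => 'k) set => (('k, 'n) dop \<times> 'c set \<Rightarrow>\<^sub>0 int) set" where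
  "TK U = tensor_rel weyl (DU U) (*) Q"
definition tcl :: "('n => 'k) set => (('k, 'n) dop \<times> 'c set \<Rightarrow>\<^sub>0 int) => (('k, 'n) dop \<times> 'c set \<Rightarrow>\<^sub>0 int) set" where
  "tcl U = coset (free_mod (left_act (DU U)) (DU U) Q) (TK U)"

lemma FP_sec: "sec FP U = tensor weyl (DU U) (*) Q (left_act (DU U))"
  by (simp add: D_tensor_psh_def tensor_psh_def D_psh_def const_psh_def)

lemma FP_res: "res FP U V = quot_map (free_mod (left_act (DU V)) (DU V) Q) (TK V) (%x. x)"
proof -
  have "frag_extend (%(b, m). frag_of (b, m)) = (%x :: ('k, 'n) dop \<times> 'c set \<Rightarrow>\<^sub>0 int. x)"
  proof (rule ext)
    fix x :: "('k, 'n) dop \<times> 'c set \<Rightarrow>\<^sub>0 int"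
    have "(%(b, m). frag_of (b, m)) = (frag_of :: ('k, 'n) dop \<times> 'c set => _)" by (simp add: fun_eq_iff)
    then show "frag_extend (%(b, m). frag_of (b, m)) x = x" using frag_expansion[of x] by metis
  qed
  then show ?thesis by (simp add: D_tensor_psh_def tensor_psh_def D_psh_def const_psh_def TK_def)
qed

lemma bimod: "bimod weyl (DU U) (*) Q"
proof
  fix m m' r assume "m : carr Q" "m' : carr Q"
  then show "addm Q m m' : carr Q" using Q_add Wd unfolding Q_carr by auto
next
  fix m r assume "m : carr Q" "r : (weyl :: ('k, 'n) dop set)"
  then show "smul Q r m : carr Q" using Q_smul W_act unfolding Q_carr by auto
qed (auto intro: Dop_add Dop_mult weyl_Dop)

text \<open>Evaluation of P \<otimes> X at a chosen representative of X; another choice changes the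
  value by an element of \<open>RQ p\<close>.\<close>

definition \<phi> :: "('k, 'n) dop \<times> 'c set => 'c" where "\<phi> = (%(P, X). act P (\<eta> X))"

lemma TK_mono: assumes "V \<subseteq> U" shows "TK U \<subseteq> TK V"
  unfolding TK_def
  by (rule tensor_rel_sub[OF nsub_tensor_rel])
     (auto simp: bilin_gens_def intro!: tr_addl[where B="DU V", simplified] tr_addr[where B="DU V", simplified]
        tr_bal[where B="DU V", simplified] subsetD[OF Dop_antimono[OF assms]])

lemma fev_TK: assumes "x : TK U" "p : U" shows "fev \<phi> x : RQ p"
  using assms(1) unfolding TK_def
proof (rule tensor_rel_induct[OF _ RQ_nsub fev_diff])
  note Dp = subsetD[OF Dop_antimono[of "{p}" U]]
  fix b m m' assume b: "b : carr (DU U)" "m : carr Q" "m' : carr Q"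
  have "\<eta> (addm Q m m') - (\<eta> m + \<eta> m') : N"
    using eta_cs[of "\<eta> m + \<eta> m'"] Q_add[of "\<eta> m" "\<eta> m'"] eta b Wd by simp
  then have "act b (\<eta> (addm Q m m') - (\<eta> m + \<eta> m')) : RQ p"
    using b assms(2) by (intro RQ_act N_RQ Dp) auto
  then show "fev \<phi> (frag_of (b, addm Q m m')) - fev \<phi> (frag_of (b, m)) - fev \<phi> (frag_of (b, m')) : RQ p"
    by (simp add: \<phi>_def act_addr act_diffr algebra_simps)
next
  note Dp = subsetD[OF Dop_antimono[of "{p}" U]]
  fix b and r :: "('k, 'n) dop" and m assume b: "b : carr (DU U)" "r : weyl" "m : carr Q"
  have "\<eta> (smul Q r m) - act r (\<eta> m) : N"
    using eta_cs[of "act r (\<eta> m)"] Q_smul[OF b(2) eta(1)[OF b(3)]] eta[OF b(3)] W_act b by simp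
  then have "act b (\<eta> (smul Q r m) - act r (\<eta> m)) : RQ p"
    using b assms(2) by (intro RQ_act N_RQ Dp) auto
  then have "- act b (\<eta> (smul Q r m) - act r (\<eta> m)) : RQ p" by (rule nsubD(3)[OF RQ_nsub])
  then show "fev \<phi> (frag_of (b * r, m)) - fev \<phi> (frag_of (b, smul Q r m)) : RQ p"
    by (simp add: \<phi>_def act_mult act_diffr)
qed (use nsubD(1)[OF RQ_nsub] in \<open>auto simp: \<phi>_def act_addl\<close>)

lemma nsub_TK: "nsub (TK U)"
  unfolding TK_def by (rule nsub_tensor_rel)

lemmas TKd = nsubD(2)[OF nsub_TK] nsubD(4)[OF nsub_TK] nsubD(3)[OF nsub_TK] nsubD(1)[OF nsub_TK]

lemma TK_bal: "b : Dop U ==> r : weyl ==> w : W ==> frag_of (b * r, cs w) - frag_of (b, cs (act r w)) : TK U"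
  using tr_bal[of b "DU U" r weyl "cs w" Q "(*)"] Q_smul[of r w] cs_Q[of w] unfolding TK_def by simp

lemma TK_sub: "b : Dop U ==> w : W ==> v : W ==> frag_of (b, cs w) - frag_of (b, cs v) - frag_of (b, cs (w - v)) : TK U"
  using tr_addr[of b "DU U" "cs v" Q "cs (w - v)" weyl "(*)"] Q_add[of v "w - v"] cs_Q[of v] cs_Q[of "w - v"] Wd
  unfolding TK_def by simp

lemma TK_zero: assumes "b : Dop U" shows "frag_of (b, cs 0) : TK U"
  using TK_sub[OF assms Wd(3) Wd(3)] TKd(3) by fastforce

text \<open>Over a common denominator every element becomes a single tensor h^{-1} \<otimes> w.
  Keeping V arbitrary below the locus where h does not vanish allows later shrinking without
  repeating the reduction.\<close>

lemma normal_form: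
  assumes "x : frags (Dop U) (carr Q)" "p : U"
  shows "\<exists>h w. meval p h ~= 0 & w : W & (\<forall>V\<subseteq>U. (\<forall>q\<in>V. meval q h ~= 0) -->
     x - frag_of (mulop (inverse (rpol h)), cs w) : TK V)"
  using assms(1)
proof (induction x rule: frags_induct)
  case zero
  have "frag_of (1, cs 0) : TK V" for V by (rule TK_zero[OF Dop_1])
  then show ?case by (intro exI[of _ 1] exI[of _ 0]) (auto simp: meval.hom_1 rpol.hom_1 Wd intro: TKd(3))
next
  case (one b m)
  obtain h where h: "meval p h ~= 0" "polop h * b : weyl"
    using Dop_clear[of b p] Dop_antimono[of "{p}" U] one assms(2) by blast
  then have hn: "h ~= 0" by auto
  obtain w where w: "w : W" "m = cs w" using one Q_carr by auto
  have "mulop (inverse (rpol h)) * (polop h * b) = b" using mulop_inverse(1)[OF hn] by (simp flip: mult.assoc)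
  then have "frag_of (b, m) - frag_of (mulop (inverse (rpol h)), cs (act (polop h * b) w)) : TK V"
    if "\<forall>q\<in>V. meval q h ~= 0" for V
    using TK_bal[OF Dop_mulop[OF inverse_reg[of V h]] h(2) w(1)] that w(2) \<open>_ = b\<close> by simp
  then show ?case using h W_act[OF h(2) w(1)] by blast
next
  case (diff x y)
  obtain h w where h: "meval p h ~= 0" "w : W" "!!V. V \<subseteq> U ==> \<forall>q\<in>V. meval q h ~= 0 ==> x - frag_of (mulop (inverse (rpol h)), cs w) : TK V"
    using diff(3) by blast
  obtain h' w' where h': "meval p h' ~= 0" "w' : W" "!!V. V \<subseteq> U ==> \<forall>q\<in>V. meval q h' ~= 0 ==> y - frag_of (mulop (inverse (rpol h')), cs w') : TK V"
    using diff(4) by blast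
  have nz: "h ~= 0" "h' ~= 0" using h h' by auto
  \<comment> \<open>Numerator of h^{-1} w - h'^{-1} w' over the common denominator h h'.\<close>
  let ?w = "act (polop h') w - act (polop h) w'" and ?g = "mulop (inverse (rpol (h * h')))"
  have W: "act (polop h') w : W" "act (polop h) w' : W" using W_act[OF weyl_polop h(2)] W_act[OF weyl_polop h'(2)] by blast+
  have "x - y - frag_of (?g, cs ?w) : TK V" if V: "V \<subseteq> U" "\<forall>q\<in>V. meval q (h * h') ~= 0" for V
  proof -
    have g: "?g : Dop V" using V by (intro Dop_mulop inverse_reg) auto
    have 1: "frag_of (mulop (inverse (rpol h)), cs w) - frag_of (?g, cs (act (polop h') w)) : TK V"
      "frag_of (mulop (inverse (rpol h')), cs w') - frag_of (?g, cs (act (polop h) w')) : TK V"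
      using TK_bal[OF g weyl_polop h(2), of h'] TK_bal[OF g weyl_polop h'(2), of h] by (simp_all add: inv_mult nz)
    have 2: "x - frag_of (mulop (inverse (rpol h)), cs w) : TK V" "y - frag_of (mulop (inverse (rpol h')), cs w') : TK V"
      using V h(3)[of V] h'(3)[of V] by (auto simp: meval.hom_mult)
    show ?thesis
      using TKd(1)[OF TKd(2)[OF TKd(1)[OF 2(1) 1(1)] TKd(1)[OF 2(2) 1(2)]] TK_sub[OF g W]]
      by (simp add: algebra_simps)
  qed
  moreover have "meval p (h * h') ~= 0" using h h' by (simp add: meval.hom_mult)
  moreover have "?w : W" using W Wd by auto
  ultimately show ?case by blast
qed

lemma fev_left_act:
  "fev \<phi> (frag_extend (%(b, m). frag_of (P * b, m)) x) = act P (fev \<phi> x)"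
proof -
  have "x : frags UNIV UNIV" by (simp add: frags_def)
  then have "fev \<phi> (frag_extend (%(b, m). frag_of (P * b, m)) x) - act P (fev \<phi> x) : {0}"
    by (rule fev_extend_act) (auto simp: nsub_def \<phi>_def act_mult)
  then show ?thesis by simp
qed

lemma left_act_DU: "left_act (DU U) P = frag_extend (%(b, m). frag_of (P * b, m))"
  by (simp add: left_act_def)

lemma left_act_frags: "P : Dop U ==> x : frags (Dop U) (carr Q) ==> left_act (DU U) P x : frags (Dop U) (carr Q)"
  unfolding left_act_DU by (erule frag_extend_in[OF _ nsub_frags]) (auto intro: frags_of Dop_mult)

lemma left_act_TK: assumes "P : Dop U" "x : TK U" shows "left_act (DU U) P x : TK U"
  using assms(2) unfolding TK_def
proof (rule tensor_rel_induct[OF _ nsub_tensor_rel])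
  fix b b' m assume "b : carr (DU U)" "b' : carr (DU U)" "m : carr Q"
  then show "left_act (DU U) P (frag_of (addm (DU U) b b', m)) - left_act (DU U) P (frag_of (b, m)) -
        left_act (DU U) P (frag_of (b', m)) : tensor_rel weyl (DU U) (*) Q"
    using tr_addl[of "P * b" "DU U" "P * b'" m Q weyl "(*)"] assms(1) by (simp add: left_act_DU distrib_left Dop_mult)
next
  fix b m m' assume "b : carr (DU U)" "m : carr Q" "m' : carr Q"
  then show "left_act (DU U) P (frag_of (b, addm Q m m')) - left_act (DU U) P (frag_of (b, m)) -
        left_act (DU U) P (frag_of (b, m')) : tensor_rel weyl (DU U) (*) Q"
    using tr_addr[of "P * b" "DU U" m Q m' weyl "(*)"] assms(1) by (simp add: left_act_DU Dop_mult)
next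
  fix b and r :: "('k, 'n) dop" and m assume "b : carr (DU U)" "r : weyl" "m : carr Q"
  then show "left_act (DU U) P (frag_of (b * r, m)) - left_act (DU U) P (frag_of (b, smul Q r m))
      : tensor_rel weyl (DU U) (*) Q"
    using tr_bal[of "P * b" "DU U" r weyl m Q "(*)"] assms(1) by (simp add: left_act_DU mult.assoc Dop_mult)
qed (simp add: left_act_DU frag_extend_diff)

sublocale T: classes act "%p. p" FP CQ RQ "%U. frags (Dop U) (carr Q)" TK tcl "%U V x. x" "%p U x. fev \<phi> x"
  "%U. left_act (DU U)"
proof
  fix U :: "('n => 'k) set" and p :: "'n => 'k" and x and y assume "x : frags (Dop U) (carr Q)" "y : frags (Dop U) (carr Q)"
  then show "tcl U x = tcl U y \<longleftrightarrow> x - y : TK U"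
    unfolding tcl_def TK_def using bimod.tensor_coset_eq[OF bimod, of x U y] by simp
next
  fix U :: "('n => 'k) set" and p :: "'n => 'k" and x and y assume "x : frags (Dop U) (carr Q)" "y : frags (Dop U) (carr Q)"
  then show "addm (sec FP U) (tcl U x) (tcl U y) = tcl U (x + y)"
    unfolding FP_sec tcl_def TK_def using bimod.tensor_add[OF bimod, of x U y] by simp
next
  fix U :: "('n => 'k) set" and p :: "'n => 'k" and x and P assume "x : frags (Dop U) (carr Q)" "P : Dop ((%p. p) -` U)"
  then show "smul (sec FP U) P (tcl U x) = tcl U (left_act (DU U) P x)"
    unfolding FP_sec tcl_def TK_def
    by (intro bimod.tensor_smul[OF bimod])
       (auto simp: left_act_frags left_act_TK[unfolded TK_def], auto simp: left_act_DU frag_extend_add)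
next
  fix U :: "('n => 'k) set" and V :: "('n => 'k) set" and p :: "'n => 'k" and x assume a: "V \<subseteq> U" "x : frags (Dop U) (carr Q)"
  have fr: "frags (Dop U) (carr Q) \<subseteq> frags (Dop V) (carr Q)"
    using Dop_antimono[OF a(1)] by (auto simp: frags_def)
  then show "x : frags (Dop V) (carr Q)" using a by auto
  show "res FP U V (tcl U x) = tcl V x"
    unfolding FP_res tcl_def TK_def
    by (rule bimod.tensor_quot_map[OF bimod bimod])
      (use a fr TK_mono[OF a(1)] in \<open>auto simp: TK_def\<close>)
next
  fix U :: "('n => 'k) set" and p :: "'n => 'k" and x assume a: "zopen U" "p : U" "x : frags (Dop U) (carr Q)"
  have "fev \<phi> x : CQ p"
    using a(3) by (rule fev_in[OF _ CQ_nsub]) (use a Dop_antimono[of "{p}" U] eta in \<open>auto simp: \<phi>_def intro!: CQ_act\<close>)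
  then show "\<exists>V c. zopen V & p : V & V \<subseteq> U & c : CQ p & (\<forall>q. q : V --> fev \<phi> x - c : RQ q)"
    using a nsubD(1)[OF RQ_nsub] by (intro exI[of _ U] exI[of _ "fev \<phi> x"]) auto
next
  fix p c assume "c : CQ p"
  then obtain h w where h: "meval p h ~= 0" "w : W" "c = act (mulop (inverse (rpol h))) w" by (auto simp: CQ_def)
  let ?U = "{q. meval q h ~= 0}"
  have "fev \<phi> (frag_of (mulop (inverse (rpol h)), cs w)) - c : RQ q" if "q : ?U" for q
    using RQ_act[OF Dop_mulop[OF inverse_reg] N_RQ[OF eta_cs[OF h(2)]], of q h] that
    by (simp add: \<phi>_def h(3) act_diffr)
  then show "\<exists>U x. zopen U & p : U & x : frags (Dop U) (carr Q) & (\<forall>q. q : U --> fev \<phi> x - c : RQ q)"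
    using h zopen_basic[of h] cs_Q[OF h(2)]
    by (intro exI[of _ ?U] exI[of _ "frag_of (mulop (inverse (rpol h)), cs w)"])
       (auto intro!: frags_of Dop_mulop inverse_reg)
next
  fix U :: "('n => 'k) set" and p :: "'n => 'k" and x assume a: "zopen U" "p : U" "x : frags (Dop U) (carr Q)" "fev \<phi> x : RQ p"
  obtain h w where h: "meval p h ~= 0" "w : W" "!!V. V \<subseteq> U ==> \<forall>q\<in>V. meval q h ~= 0 ==> x - frag_of (mulop (inverse (rpol h)), cs w) : TK V"
    using normal_form[OF a(3,2)] by blast
  have hn: "h ~= 0" using h by auto
  let ?V = "U \<inter> {q. meval q h ~= 0}" and ?g = "mulop (inverse (rpol h))"
  have "fev \<phi> (x - frag_of (?g, cs w)) : RQ p"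
    by (rule fev_TK[OF h(3)[of ?V]]) (use a h in auto)
  then have "act ?g (\<eta> (cs w)) : RQ p"
    using nsubD(4)[OF RQ_nsub a(4)] by (fastforce simp: fev_diff \<phi>_def)
  then have "act (polop h) (act ?g (\<eta> (cs w))) : RQ p" by (rule RQ_act[OF Dop_polop])
  then have "\<eta> (cs w) : RQ p" using mulop_inverse(2)[OF hn] by (simp flip: act_mult)
  then have "w : RQ p" using nsubD(4)[OF RQ_nsub _ N_RQ[OF eta_cs[OF h(2)]]] by fastforce
  then obtain h' where h': "meval p h' ~= 0" "act (polop h') w : N" by (auto simp: RQ_def)
  have hn': "h' ~= 0" using h' by auto
  \<comment> \<open>The element h' w lies in N, so moving h' into the second factor kills the
    tensor; for this the first factor must be divided by h', whence the smaller open set.\<close>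
  let ?W = "U \<inter> {q. meval q (h * h') ~= 0}"
  have g: "mulop (inverse (rpol (h * h'))) : Dop ?W" by (intro Dop_mulop inverse_reg) auto
  have "x - frag_of (?g, cs w) : TK ?W" by (rule h(3)) (auto simp: meval.hom_mult)
  moreover have "frag_of (?g, cs w) - frag_of (mulop (inverse (rpol (h * h'))), cs (act (polop h') w)) : TK ?W"
    using TK_bal[OF g weyl_polop h(2), of h'] by (simp add: inv_mult hn hn')
  moreover have "cs (act (polop h') w) = cs 0" using cs_eq[of "act (polop h') w" 0] h' NW Wd by auto
  then have "frag_of (mulop (inverse (rpol (h * h'))), cs (act (polop h') w)) : TK ?W"
    using TK_zero[OF g] by simp
  ultimately have xW: "x : TK ?W" using TKd(1) by (metis diff_add_cancel)
  have zW: "zopen ?W" by (rule zopen_Int[OF a(1) zopen_basic])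
  then show "\<exists>W. zopen W & p : W & W \<subseteq> U & x : TK W"
    using a h h' by (intro exI[of _ ?W] conjI zW xW) (auto simp: meval.hom_mult)
next
  fix U :: "('n => 'k) set" and p :: "'n => 'k" show "carr (sec FP U) = tcl U ` frags (Dop U) (carr Q)"
    unfolding FP_sec tcl_def TK_def using bimod.tensor_carr[OF bimod] by simp
next
  show "zerom (sec FP UNIV) = tcl UNIV 0"
    unfolding FP_sec tcl_def TK_def by (rule bimod.tensor_zero[OF bimod])
qed (use nsubD(1)[OF RQ_nsub] in \<open>auto simp: RQ_nsub RQ_act nsub_frags fev_diff fev_TK left_act_frags, auto simp: left_act_DU fev_left_act\<close>)

lemma Dt_sheafify: "D_tensor Q = sheafify FP" by (simp add: D_tensor_def)

definition RlD where "RlD = RlS FP RQ T.RlC"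

lemma D_model: "model (%p. p) (D_tensor Q) CQ RQ act RlD"
  unfolding Dt_sheafify RlD_def by (rule model_sheafify[OF T.model])

text \<open>Identifies the global generator 1 \<otimes> w by its concrete description; this is how
  the cyclic generator in the definition of the b-function becomes the operator 1.\<close>

lemma D_tensor_elem_Rl:
  assumes "w : W" shows "RlD p UNIV (D_tensor_elem Q (cs w)) w"
proof -
  let ?x = "frag_of (1 :: ('k, 'n) dop, cs w)"
  have x: "?x : frags (Dop UNIV) (carr Q)" by (intro frags_of Dop_1 cs_Q assms)
  have "fev \<phi> ?x - w : RQ q" for q using N_RQ[OF eta_cs[OF assms]] by (simp add: \<phi>_def)
  then have Rl: "T.RlC q UNIV (tcl UNIV ?x) w" for q
    unfolding T.RlC_def using zopen_UNIV x by blast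
  have e: "D_tensor_elem Q (cs w) = (%q. germ FP q UNIV (tcl UNIV ?x))"
    by (simp add: D_tensor_elem_def tcl_def TK_def D_psh_def)
  have g: "germ FP q UNIV (tcl UNIV ?x) = T.gcl q w" for q by (rule T.germ_gcl[OF Rl])
  have "D_tensor_elem Q (cs w) : carr (sec (sheafify FP) UNIV)"
    unfolding sheafify_def
  proof (rule T.sec_I)
    fix p :: "'n => 'k"
    show "\<exists>U U' c t. zopen U & p : U & U \<subseteq> U' & (\<forall>q. q : UNIV --> q : U -->
        T.RlC q U' t c & D_tensor_elem Q (cs w) q = T.gcl q c)"
      using Rl g zopen_UNIV unfolding e by (intro exI[of _ UNIV] exI[of _ w] exI[of _ "tcl UNIV ?x"]) auto
  qed simp
  then show ?thesis unfolding RlD_def RlS_def[OF T.model] using Rl g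
    by (auto simp: zopen_UNIV T.rel_def e)
qed

end

section \<open>Localization\<close>

lemma leibniz_additive: "leibniz_act nab P (x + y) = leibniz_act nab P x + leibniz_act nab P y"
  unfolding leibniz_act_def by (rule conn_act_additive) (auto simp: frag_extend_add)

text \<open>The Leibniz rule defines an action on the tensor product when the derivations of both factors
  are compatible with the action of R.\<close>

locale leibniz = bimod R B \<rho> M
  for R :: "'r set" and B :: "('e, ('k::field_char_0, 'n::{finite,linorder}) ratf) lmod" and \<rho> and M :: "('r, 'm) lmod" +
  fixes nab :: "'n => 'm => 'm" and S :: "('k, 'n) ratf set" and \<delta> :: "'n => 'r => 'r"
  assumes B_plus: "addm B = (+)" and B_d: "b : carr B ==> rpd i b : carr B"
    and B_S: "a : S ==> b : carr B ==> a * b : carr B"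
    and nab_carr: "m : carr M ==> nab i m : carr M"
    and nab_add: "m : carr M ==> m' : carr M ==> nab i (addm M m m') = addm M (nab i m) (nab i m')"
    and rho_S: "a : S ==> b : carr B ==> r : R ==> a * \<rho> b r = \<rho> (a * b) r"
    and del: "r : R ==> \<delta> i r : R"
    and rho_d: "b : carr B ==> r : R ==> rpd i (\<rho> b r) = \<rho> (rpd i b) r + \<rho> b (\<delta> i r)"
    and nab_smul: "m : carr M ==> r : R ==> nab i (smul M r m) = addm M (smul M (\<delta> i r) m) (smul M r (nab i m))"
begin

abbreviation "nabf i \<equiv> frag_extend (%(g, m). frag_of (rpd i g, m) + frag_of (g, nab i m))"
abbreviation "mulf a \<equiv> frag_extend (%(g, m). frag_of (a * g, m))"

lemma nabf_Fr: "x : Fr ==> nabf i x : Fr"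
  by (erule frag_extend_in[OF _ nsub_frags]) (auto intro!: nsubD(2)[OF nsub_frags] frags_of B_d nab_carr)

lemma mulf_Fr: "x : Fr ==> a : S ==> mulf a x : Fr"
  by (erule frag_extend_in[OF _ nsub_frags]) (auto intro!: frags_of B_S)

lemma addl: "b : carr B ==> b' : carr B ==> m : carr M ==> frag_of (b + b', m) - frag_of (b, m) - frag_of (b', m) : TR"
  using tr_addl[of b B b' m M R \<rho>] by (simp add: B_plus)

lemma nabf_TR: "x : TR ==> nabf i x : TR"
proof (erule tensor_rel_induct[OF _ nsub_tensor_rel])
  note T = nsubD[OF nsub_tensor_rel]
  fix b b' m assume b: "b : carr B" "b' : carr B" "m : carr M"
  show "nabf i (frag_of (addm B b b', m)) - nabf i (frag_of (b, m)) - nabf i (frag_of (b', m)) : TR"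
    using T(2)[OF addl[OF B_d[OF b(1)] B_d[OF b(2)] b(3), of i i] addl[OF b(1,2) nab_carr[OF b(3)], of i]]
    by (simp add: B_plus rpd_add algebra_simps)
next
  note T = nsubD[OF nsub_tensor_rel]
  fix b m m' assume b: "b : carr B" "m : carr M" "m' : carr M"
  show "nabf i (frag_of (b, addm M m m')) - nabf i (frag_of (b, m)) - nabf i (frag_of (b, m')) : TR"
    using T(2)[OF tr_addr[OF B_d[OF b(1)] b(2,3), of i] tr_addr[OF b(1) nab_carr[OF b(2)] nab_carr[OF b(3)], of i i]]
    by (simp add: nab_add b algebra_simps)
next
  note T = nsubD[OF nsub_tensor_rel]
  fix b r m assume b: "b : carr B" "r : R" "m : carr M"
  \<comment> \<open>The Leibniz rule gives three terms on each side of the relation, which match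
    pairwise; the middle pair carries the derivative of r.\<close>
  have 1: "frag_of (\<rho> (rpd i b) r, m) - frag_of (rpd i b, smul M r m) : TR"
    "frag_of (\<rho> b (\<delta> i r), m) - frag_of (b, smul M (\<delta> i r) m) : TR"
    "frag_of (\<rho> b r, nab i m) - frag_of (b, smul M r (nab i m)) : TR"
    by (rule tr_bal; use b B_d del nab_carr in auto)+
  have 2: "frag_of (\<rho> (rpd i b) r + \<rho> b (\<delta> i r), m) - frag_of (\<rho> (rpd i b) r, m) - frag_of (\<rho> b (\<delta> i r), m) : TR"
    by (rule addl) (use b B_d del B_act in auto)
  have 3: "frag_of (b, addm M (smul M (\<delta> i r) m) (smul M r (nab i m))) - frag_of (b, smul M (\<delta> i r) m) - frag_of (b, smul M r (nab i m)) : TR"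
    by (rule tr_addr) (use b B_d del M_act nab_carr in auto)
  show "nabf i (frag_of (\<rho> b r, m)) - nabf i (frag_of (b, smul M r m)) : TR"
    using T(4)[OF T(2)[OF 2 T(2)[OF T(2)[OF 1(1,2)] 1(3)]] 3]
    by (simp add: rho_d nab_smul b algebra_simps)
qed (simp add: frag_extend_diff)

lemma mulf_TR: "x : TR ==> a : S ==> mulf a x : TR"
proof (erule tensor_rel_induct[OF _ nsub_tensor_rel])
  fix b b' m assume b: "b : carr B" "b' : carr B" "m : carr M" and a: "a : S"
  show "mulf a (frag_of (addm B b b', m)) - mulf a (frag_of (b, m)) - mulf a (frag_of (b', m)) : TR"
    using addl[OF B_S[OF a b(1)] B_S[OF a b(2)] b(3)] by (simp add: B_plus distrib_left)
next
  fix b m m' assume b: "b : carr B" "m : carr M" "m' : carr M" and a: "a : S"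
  show "mulf a (frag_of (b, addm M m m')) - mulf a (frag_of (b, m)) - mulf a (frag_of (b, m')) : TR"
    using tr_addr[OF B_S[OF a b(1)] b(2,3)] by simp
next
  fix b r m assume b: "b : carr B" "r : R" "m : carr M" and a: "a : S"
  show "mulf a (frag_of (\<rho> b r, m)) - mulf a (frag_of (b, smul M r m)) : TR"
    using tr_bal[OF B_S[OF a b(1)] b(2,3), of \<rho>] by (simp add: rho_S a b)
qed (simp add: frag_extend_diff)

lemma leibniz_Fr: "P : dopS S ==> x : Fr ==> leibniz_act nab P x : Fr"
  unfolding leibniz_act_def by (rule conn_act_closed[OF nsub_frags]) (auto intro: nabf_Fr mulf_Fr)

lemma leibniz_TR: "P : dopS S ==> x : TR ==> leibniz_act nab P x : TR"
  unfolding leibniz_act_def by (rule conn_act_closed[OF nsub_tensor_rel]) (auto intro: nabf_TR mulf_TR)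

end

text \<open>Poles along f are cleared on all of U at once by a power of f, in contrast to the
  pointwise \<open>Dop_clear\<close>.\<close>

lemma Oloc_clear:
  fixes P :: "('k::field, 'n::{finite,linorder}) dop"
  assumes f: "f ~= 0" and P: "P : dopS (Oloc f U)"
  shows "\<exists>k. polop (f ^ k) * P : Dop U"
proof -
  interpret L: dring "Oloc f U" by (rule dring_Oloc[OF f])
  show ?thesis using P
  proof (induction P rule: L.dopS_induct)
    case (add P Q)
    then obtain k l where kl: "polop (f ^ k) * P : Dop U" "polop (f ^ l) * Q : Dop U" by blast
    have "polop (f ^ (k + l)) * (P + Q) = polop (f ^ l) * (polop (f ^ k) * P) + polop (f ^ k) * (polop (f ^ l) * Q)"
      by (simp only: power_add polop_mult distrib_left mult.assoc[symmetric] polop_commute[of "f ^ k" "f ^ l"])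
    also have "\<dots> : Dop U" by (rule Dop_add[OF Dop_mult[OF Dop_polop kl(1)] Dop_mult[OF Dop_polop kl(2)]])
    finally show ?case by blast
  next
    case (monom g \<alpha>)
    then obtain h k where h: "h : reg U" "g = h / rpol f ^ k" unfolding Oloc_def by blast
    have "polop (f ^ k) * (mulop g * monom_at pdop \<alpha>) = mulop h * monom_at pdop \<alpha>"
      using f by (simp add: h polop_eq rpol.hom_power flip: mult.assoc mulop_mult)
    then show ?case using dring.dopS_monom[OF dring_reg h(1)] unfolding Dop_dopS by (intro exI[of _ k]) simp
  qed (auto simp: Dop_0)
qed

locale localized = weyl_quot act W N
  for act :: "('k::field_char_0, 'n::{finite,linorder}) dop => 'c::ab_group_add => 'c" and W N +
  fixes f :: "('k, 'n) mpol" assumes f0: "f ~= 0"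
begin

definition fi :: "nat => ('k, 'n) ratf" where "fi k = inverse (rpol f ^ k)"

text \<open>The pair that describes the stalks after inverting f: fractions f^{-k} c, modulo those
  that some power of f moves into \<open>RQ p\<close>.\<close>

definition CL :: "('n => 'k) => 'c set" where "CL p = {act (mulop (fi k)) c | c k. c : CQ p}"
definition RL :: "('n => 'k) => 'c set" where "RL p = {c. \<exists>k. act (polop (f ^ k)) c : RQ p}"

lemma fi_mult: "fi (k + l) * rpol (f ^ l) = fi k" "rpol (f ^ l) * fi (k + l) = fi k" "rpol (f ^ k) * fi k = 1" "fi k * rpol (f ^ k) = 1" "fi 0 = 1"
  using f0 by (simp_all add: fi_def rpol.hom_power power_add field_simps)

lemma fi_Oloc: "fi k : Oloc f U"
proof -
  have "fi k = 1 / rpol f ^ k" by (simp add: fi_def divide_inverse)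
  then show ?thesis unfolding Oloc_def using dring.S1[OF dring_reg] by blast
qed

lemma Oloc_fi: "g : Oloc f U ==> \<exists>h k. h : reg U & g = h * fi k"
  by (auto simp: Oloc_def fi_def divide_inverse)

lemma RQ_RL: "RQ p \<subseteq> RL p" unfolding RL_def by (auto intro!: exI[of _ 0])

lemma RL_act: assumes "P : dopS (Oloc f {p})" "c : RL p" shows "act P c : RL p"
proof -
  interpret L: dring "Oloc f {p}" by (rule dring_Oloc[OF f0])
  obtain k where k: "act (polop (f ^ k)) c : RQ p" using assms(2) by (auto simp: RL_def)
  obtain l where l: "polop (f ^ l) * (P * mulop (fi k)) : Dop {p}"
    using Oloc_clear[OF f0 L.dopS_mult[OF assms(1) L.dopS_mulop[OF fi_Oloc]]] by blast
  have "act (polop (f ^ l)) (act P c) = act (polop (f ^ l) * P * (mulop (fi k) * polop (f ^ k))) c"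
    using fi_mult(4)[of k] by (simp add: polop_eq act_mult flip: mulop_mult)
  also have "\<dots> = act (polop (f ^ l) * (P * mulop (fi k))) (act (polop (f ^ k)) c)"
    by (simp add: act_mult mult.assoc)
  also have "\<dots> : RQ p" by (rule RQ_act[OF l k])
  finally show ?thesis unfolding RL_def by blast
qed

lemma Dop_L: "Dop U \<subseteq> dopS (Oloc f U)"
  unfolding Dop_dopS by (rule dopS_mono[OF reg_Oloc])

lemma mulop_L: "g : Oloc f U ==> p : U ==> mulop g : dopS (Oloc f {p})"
  using dring.dopS_mulop[OF dring_Oloc[OF f0], of g "{p}"] Oloc_antimono[of "{p}" U f] by auto

lemma RL_nsub: "nsub (RL p)"
  unfolding nsub_def
proof (intro conjI ballI)
  show "0 : RL p" using nsubD(1)[OF RQ_nsub] RQ_RL by blast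
  fix c assume "c : RL p"
  then obtain k where k: "act (polop (f ^ k)) c : RQ p" by (auto simp: RL_def)
  then show "- c : RL p" using nsubD(3)[OF RQ_nsub k] by (auto simp: RL_def act_minusr)
  fix d assume "d : RL p"
  then obtain l where l: "act (polop (f ^ l)) d : RQ p" by (auto simp: RL_def)
  have "act (polop (f ^ (k + l))) (c + d) = act (polop (f ^ l)) (act (polop (f ^ k)) c) + act (polop (f ^ k)) (act (polop (f ^ l)) d)"
    by (simp add: act_addr power_add polop_mult polop_commute[of "f ^ k" "f ^ l"] flip: act_mult)
  also have "\<dots> : RQ p"
    by (rule nsubD(2)[OF RQ_nsub RQ_act[OF Dop_polop k] RQ_act[OF Dop_polop l]])
  finally show "c + d : RL p" unfolding RL_def by blast
qed

section \<open>The tensor product of O[f^{-1}] with the sheaf of modules\<close>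

abbreviation "MS \<equiv> D_tensor Q"

sublocale MD: model "%p. p" MS CQ RQ act RlD by (rule D_model)

lemma MS_eqI:
  assumes "s : carr (sec MS U)" "t : carr (sec MS U)"
    "!!p. p : U ==> \<exists>c c'. RlD p U s c & RlD p U t c' & c - c' : RQ p"
  shows "s = t"
  using assms unfolding Dt_sheafify RlD_def by (rule sheaf_eqI[OF T.model])

text \<open>Sections of the sheaf are families of germs; choosing a description at p reduces
  statements on sections to statements on concrete elements modulo \<open>RQ p\<close>.\<close>

definition rep :: "('n => 'k) => ('n => 'k) set => _ => 'c" where
  "rep p U s = (SOME c. c : CQ p & RlD p U s c)"

lemma rep:
  assumes "zopen U" "p : U" "s : carr (sec MS U)"
  shows "rep p U s : CQ p" "RlD p U s (rep p U s)"
proof -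
  have "\<exists>c. c : CQ p & RlD p U s c" using MD.M1[OF assms] by blast
  then have "rep p U s : CQ p & RlD p U s (rep p U s)" unfolding rep_def by (rule someI_ex)
  then show "rep p U s : CQ p" "RlD p U s (rep p U s)" by auto
qed

lemma rep_cong: "RlD p U s c ==> rep p U s - c : RQ p"
  using MD.M0[of p U s c] rep(2)[of U p s] MD.Rl_uniq by blast

lemma MS_closed:
  assumes "zopen U" "p : U" "s : carr (sec MS U)"
  shows "t : carr (sec MS U) ==> addm (sec MS U) s t : carr (sec MS U)"
    "P : Dop U ==> smul (sec MS U) P s : carr (sec MS U)"
  using MD.M4[OF rep(2)[OF assms] rep(2)[OF assms(1,2)], of t] MD.M5[OF rep(2)[OF assms], of P] MD.M0 by auto

lemma MS_rep_add: "zopen U ==> p : U ==> s : carr (sec MS U) ==> t : carr (sec MS U) ==>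
    RlD p U (addm (sec MS U) s t) (rep p U s + rep p U t)"
  by (intro MD.M4 rep)

lemma MS_rep_smul: "zopen U ==> p : U ==> s : carr (sec MS U) ==> P : Dop U ==>
    RlD p U (smul (sec MS U) P s) (act P (rep p U s))"
  using MD.M5[OF rep(2)] by simp

abbreviation "OL U \<equiv> natmod app (Oloc f U) :: (('k, 'n) dop, ('k, 'n) ratf) lmod"
abbreviation "RO U \<equiv> mulop ` reg (U :: ('n => 'k) set) :: ('k, 'n) dop set"
abbreviation "TL U \<equiv> tensor_rel (RO U) (OL U) (%g r. app r g) (sec MS U)"
abbreviation "FL U \<equiv> frags (Oloc f U) (carr (sec MS U))"
abbreviation "nbM U i \<equiv> smul (sec MS U) (pdop i)"
abbreviation "LP \<equiv> tensor_psh (%U. mulop ` reg U) (O_loc_psh f) (%_ g r. app r g) MS (%U. leibniz_act (nbM U))"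

lemma RO_Dop: "r : RO U ==> r : Dop U" by (auto intro: Dop_mulop)

text \<open>The required identities between sections are equalities in a sheaf, so they are checked
  point by point on representatives with \<open>MS_eqI\<close>.\<close>

lemma leib: assumes U: "zopen U" "p : U"
  shows "leibniz (RO U) (OL U) (%g r. app r g) (sec MS U) (nbM U) (reg U) (%i r. mulop (rpd i (app r 1)))"
proof -
  interpret L: dring "Oloc f U" by (rule dring_Oloc[OF f0])
  note c = MS_closed[OF U]
  have regL: "g : reg U ==> g : Oloc f U" for g using reg_Oloc by blast
  show ?thesis
  proof
    fix m m' i assume m: "m : carr (sec MS U)" "m' : carr (sec MS U)"
    show "nbM U i (addm (sec MS U) m m') = addm (sec MS U) (nbM U i m) (nbM U i m')"
    proof (rule MS_eqI)
      fix q assume q: "q : U"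
      show "\<exists>c c'. RlD q U (nbM U i (addm (sec MS U) m m')) c & RlD q U (addm (sec MS U) (nbM U i m) (nbM U i m')) c' & c - c' : RQ q"
        using MD.M5[OF MS_rep_add[OF U(1) q m], of "pdop i"] MD.M4[OF MS_rep_smul[OF U(1) q m(1) Dop_pdop[of i]] MS_rep_smul[OF U(1) q m(2) Dop_pdop[of i]]]
          nsubD(1)[OF RQ_nsub]
        by (intro exI conjI) (auto simp: act_addr Dop_pdop)
    qed (rule c(2)[OF c(1)[OF m] Dop_pdop], rule c(1)[OF c(2)[OF m(1) Dop_pdop] c(2)[OF m(2) Dop_pdop]])
  next
    fix m r i assume m: "m : carr (sec MS U)" and "r : RO U"
    then obtain g where g: "g : reg U" "r = mulop g" by auto
    have D: "mulop (rpd i g) : Dop U" "mulop g : Dop U" "pdop i : Dop U"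
      using g dring.Sd[OF dring_reg] by (auto intro: Dop_mulop Dop_pdop)
    show "nbM U i (smul (sec MS U) r m) = addm (sec MS U) (smul (sec MS U) (mulop (rpd i (app r 1))) m) (smul (sec MS U) r (nbM U i m))"
    proof (rule MS_eqI)
      fix q assume q: "q : U"
      have "RlD q U (nbM U i (smul (sec MS U) r m)) (act (pdop i) (act r (rep q U m)))"
        using MD.M5[OF MS_rep_smul[OF U(1) q m D(2)], of "pdop i"] D g by simp
      moreover have "RlD q U (addm (sec MS U) (smul (sec MS U) (mulop (rpd i (app r 1))) m) (smul (sec MS U) r (nbM U i m)))
         (act (mulop (rpd i g)) (rep q U m) + act r (act (pdop i) (rep q U m)))"
        using MD.M4[OF MS_rep_smul[OF U(1) q m D(1)] MD.M5[OF MS_rep_smul[OF U(1) q m D(3)], of r]] D g by simp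
      moreover have "act (pdop i) (act r (rep q U m)) - (act (mulop (rpd i g)) (rep q U m) + act r (act (pdop i) (rep q U m))) = 0"
        by (simp add: g pdop_mulop act_addl flip: act_mult)
      ultimately show "\<exists>c c'. RlD q U (nbM U i (smul (sec MS U) r m)) c &
        RlD q U (addm (sec MS U) (smul (sec MS U) (mulop (rpd i (app r 1))) m) (smul (sec MS U) r (nbM U i m))) c' & c - c' : RQ q"
        using nsubD(1)[OF RQ_nsub] by metis
    qed (use m c D g in auto)
  next
    fix m r assume "m : carr (sec MS U)" "r : RO U"
    then show "smul (sec MS U) r m : carr (sec MS U)" using c(2) RO_Dop by blast
  next
    fix m i assume "m : carr (sec MS U)"
    then show "nbM U i m : carr (sec MS U)" using c(2) Dop_pdop by blast
  next
    fix r i assume "r : RO U"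
    then show "mulop (rpd i (app r 1)) : RO U" using dring.Sd[OF dring_reg, of _ U i] by auto
  next
    fix a b assume "a : reg U" "b : carr (OL U)"
    then show "a * b : carr (OL U)" using L.Smult[OF regL] by simp
  next
    fix b r assume "b : carr (OL U)" "r : RO U"
    then show "app r b : carr (OL U)" using L.Smult[OF regL] by auto
  qed (use c(1) in \<open>auto intro: L.Sadd L.Sd simp: rpd_mult\<close>)
qed

definition lcl :: "('n => 'k) set => _ => _" where
  "lcl U = coset (free_mod (leibniz_act (nbM U)) (OL U) (sec MS U)) (TL U)"
definition lrs :: "('n => 'k) set => ('n => 'k) set => _ => _" where
  "lrs U V = frag_extend (%(b, m). frag_of (b, res MS U V m))"
definition \<psi> :: "('n => 'k) => ('n => 'k) set => _ => 'c" where
  "\<psi> p U = (%(g, m). act (mulop g) (rep p U m))"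

lemma O_loc_psh_sec: "sec (O_loc_psh f) U = OL U" "res (O_loc_psh f) U V g = g"
  by (simp_all add: O_loc_psh_def Oloc_def)

lemma LP_sec: "sec LP U = tensor (RO U) (OL U) (%g r. app r g) (sec MS U) (leibniz_act (nbM U))"
  by (simp add: tensor_psh_def O_loc_psh_sec)

lemma LP_res: "res LP U V = quot_map (free_mod (leibniz_act (nbM V)) (OL V) (sec MS V)) (TL V) (lrs U V)"
  by (simp add: tensor_psh_def O_loc_psh_sec lrs_def)

lemma bimodL: "zopen U ==> p : U ==> bimod (RO U) (OL U) (%g r. app r g) (sec MS U)"
  using leib[of U p] unfolding leibniz_def by blast

lemma RL_mulop: "g : Oloc f U ==> p : U ==> c : RQ p ==> act (mulop g) c : RL p"
  using RL_act[OF mulop_L] RQ_RL by blast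

lemma fev_TL: assumes "x : TL U" "zopen U" "p : U" shows "fev (\<psi> p U) x : RL p"
  using assms(1)
proof (rule tensor_rel_induct[OF _ RL_nsub fev_diff])
  fix b m m' assume b: "b : carr (OL U)" "m : carr (sec MS U)" "m' : carr (sec MS U)"
  have "act (mulop b) (rep p U (addm (sec MS U) m m') - (rep p U m + rep p U m')) : RL p"
    using b assms by (intro RL_mulop rep_cong MS_rep_add) auto
  then show "fev (\<psi> p U) (frag_of (b, addm (sec MS U) m m')) - fev (\<psi> p U) (frag_of (b, m)) - fev (\<psi> p U) (frag_of (b, m')) : RL p"
    by (simp add: \<psi>_def act_addr act_diffr algebra_simps)
next
  fix b r m assume b: "b : carr (OL U)" "r : RO U" "m : carr (sec MS U)"
  then obtain g where g: "g : reg U" "r = mulop g" by auto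
  have "act (mulop b) (rep p U (smul (sec MS U) r m) - act r (rep p U m)) : RL p"
    using b assms RO_Dop by (intro RL_mulop[of b U] rep_cong MS_rep_smul) auto
  then have "- act (mulop b) (rep p U (smul (sec MS U) r m) - act r (rep p U m)) : RL p" by (rule nsubD(3)[OF RL_nsub])
  then show "fev (\<psi> p U) (frag_of (app r b, m)) - fev (\<psi> p U) (frag_of (b, smul (sec MS U) r m)) : RL p"
    by (simp add: \<psi>_def g act_diffr mulop_mult act_mult[symmetric] mulop_commute[of g b])
qed (use nsubD(1)[OF RL_nsub] in \<open>auto simp: \<psi>_def mulop_add act_addl\<close>)

lemma nsub_TL: "nsub (TL U)" by (rule nsub_tensor_rel)
lemmas TLd = nsubD[OF nsub_TL]

lemma TL_bal: "b : Oloc f U ==> g : reg U ==> m : carr (sec MS U) ==>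
    frag_of (g * b, m) - frag_of (b, smul (sec MS U) (mulop g) m) : TL U"
  using tr_bal[of b "OL U" "mulop g" "RO U" m "sec MS U" "%g r. app r g"] by simp

lemma TL_0l: assumes "m : carr (sec MS U)" shows "frag_of (0, m) : TL U"
proof -
  have "0 : Oloc f U" by (rule dring.S0[OF dring_Oloc[OF f0]])
  then have "- frag_of (0, m) : TL U"
    using tr_addl[of 0 "OL U" 0 m "sec MS U" "RO U" "%g r. app r g"] assms by simp
  then show ?thesis using TLd(3) by fastforce
qed

lemma TL_zero:
  assumes "b : Oloc f U" "zopen U" "p : U" "m : carr (sec MS U)" "!!q. q : U ==> RlD q U m 0"
  shows "frag_of (b, m) : TL U"
proof -
  have D0: "0 : Dop U" by (rule Dop_0)
  \<comment> \<open>A section with zero germs equals 0 acting on itself, and the operator 0 can be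
    moved to the first factor.\<close>
  have "m = smul (sec MS U) 0 m"
  proof (rule MS_eqI)
    fix q assume "q : U"
    then have "RlD q U m 0" "RlD q U (smul (sec MS U) 0 m) 0"
      using assms(5)[of q] MD.M5[OF assms(5)[of q], of 0] D0 by auto
    then show "\<exists>c c'. RlD q U m c & RlD q U (smul (sec MS U) 0 m) c' & c - c' : RQ q"
      using nsubD(1)[OF RQ_nsub] by (intro exI[of _ 0]) simp
  qed (use assms MS_closed(2)[OF assms(2,3,4) D0] in auto)
  moreover have "frag_of (0, m) - frag_of (b, smul (sec MS U) (mulop 0) m) : TL U"
    using TL_bal[of b U 0 m] assms dring.S0[OF dring_reg, of U] by simp
  ultimately have "frag_of (0, m) - frag_of (b, m) : TL U" by simp
  then show ?thesis using TLd(4)[OF TL_0l[OF assms(4)]] by fastforce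
qed

text \<open>The difference of sections is formed as s + (-1) t, and the factor -1 is then moved
  across the tensor sign.\<close>

lemma TL_sub:
  assumes "b : Oloc f U" "zopen U" "p : U" "s : carr (sec MS U)" "t : carr (sec MS U)"
  shows "\<exists>u\<in>carr (sec MS U). frag_of (b, s) - frag_of (b, t) - frag_of (b, u) : TL U"
proof -
  let ?t = "smul (sec MS U) (mulop (- 1)) t"
  have m1: "- 1 : reg U" using dring.Sneg[OF dring_reg dring.S1[OF dring_reg]] .
  have t: "?t : carr (sec MS U)" by (rule MS_closed(2)[OF assms(2,3,5) Dop_mulop[OF m1]])
  have b: "- b : Oloc f U" using dring.Sneg[OF dring_Oloc[OF f0] assms(1)] .
  have A: "frag_of (- b, t) - frag_of (b, ?t) : TL U" using TL_bal[OF assms(1) m1 assms(5)] by simp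
  have B: "frag_of (0, t) - frag_of (b, t) - frag_of (- b, t) : TL U"
    using tr_addl[of b "OL U" "- b" t "sec MS U"] assms b by simp
  have "frag_of (b, addm (sec MS U) s ?t) - frag_of (b, s) - frag_of (b, ?t) : TL U"
    by (rule tr_addr) (use assms t in auto)
  from TLd(4)[OF TLd(3)[OF this] TLd(4)[OF TLd(4)[OF TL_0l[OF assms(5)] B] A]]
  have "frag_of (b, s) - frag_of (b, t) - frag_of (b, addm (sec MS U) s ?t) : TL U" by (simp add: algebra_simps)
  then show ?thesis using MS_closed(1)[OF assms(2-4) t] by blast
qed

lemma MS_zero:
  assumes "zopen U" "p : U"
  shows "\<exists>z\<in>carr (sec MS U). \<forall>q\<in>U. RlD q U z 0"
proof -
  let ?z = "res MS UNIV U (zerom (sec MS UNIV))"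
  have "RlD q U ?z 0" if "q : U" for q by (rule MD.M7[OF MD.M6]) (use assms that in auto)
  then show ?thesis using MD.M0 assms(2) by blast
qed

lemma TL_fi: "s : carr (sec MS U) ==> frag_of (fi k, s) - frag_of (fi (k + l), smul (sec MS U) (polop (f ^ l)) s) : TL U"
  using TL_bal[OF fi_Oloc rpol_reg, of s U "f ^ l" "k + l"] by (simp add: fi_mult polop_eq)

text \<open>A section of O[f^{-1}] over U is h f^{-k} with h regular on U itself, so a single tensor
  f^{-k} \<otimes> s is reached without shrinking.\<close>

lemma normal_formL:
  assumes "x : FL U" "zopen U" "p : U"
  shows "\<exists>k s. s : carr (sec MS U) & x - frag_of (fi k, s) : TL U"
  using assms(1)
proof (induction x rule: frags_induct)
  case zero
  obtain z where z: "z : carr (sec MS U)" "!!q. q : U ==> RlD q U z 0" using MS_zero[OF assms(2,3)] by blast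
  then show ?case using TLd(3)[OF TL_zero[OF fi_Oloc assms(2,3) z]] by (intro exI[of _ 0] exI[of _ z]) simp
next
  case (one b m)
  obtain h k where h: "h : reg U" "b = h * fi k" using Oloc_fi[OF one(1)] by blast
  show ?case using TL_bal[OF fi_Oloc h(1) one(2), of k] MS_closed(2)[OF assms(2,3) one(2) Dop_mulop[OF h(1)]]
    unfolding h(2) by blast
next
  case (diff x y)
  obtain k s where s: "s : carr (sec MS U)" "x - frag_of (fi k, s) : TL U" using diff(3) by blast
  obtain l t where t: "t : carr (sec MS U)" "y - frag_of (fi l, t) : TL U" using diff(4) by blast
  let ?s = "smul (sec MS U) (polop (f ^ l)) s" and ?t = "smul (sec MS U) (polop (f ^ k)) t" and ?g = "fi (k + l)"
  have st: "?s : carr (sec MS U)" "?t : carr (sec MS U)" by (rule MS_closed(2)[OF assms(2,3)]; use s t Dop_polop in auto)+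
  obtain u where u: "u : carr (sec MS U)" "frag_of (?g, ?s) - frag_of (?g, ?t) - frag_of (?g, u) : TL U"
    using TL_sub[OF fi_Oloc assms(2,3) st] by blast
  have "x - frag_of (?g, ?s) : TL U" "y - frag_of (?g, ?t) : TL U"
    using TLd(2)[OF s(2) TL_fi[OF s(1), of k l]] TLd(2)[OF t(2) TL_fi[OF t(1), of l k]] by (simp_all add: add.commute)
  then have "(x - frag_of (?g, ?s)) - (y - frag_of (?g, ?t)) + (frag_of (?g, ?s) - frag_of (?g, ?t) - frag_of (?g, u)) : TL U"
    by (rule TLd(2)[OF TLd(4) u(2)])
  then have "x - y - frag_of (?g, u) : TL U" by (simp add: algebra_simps)
  then show ?case using u(1) by blast
qed

lemma MS_res: "res MS U V s = restrict s V"
  unfolding Dt_sheafify by (rule sheaf_res[OF T.model])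

lemma MS_res_op:
  assumes "V \<subseteq> U"
  shows "res MS U V (addm (sec MS U) s t) = addm (sec MS V) (res MS U V s) (res MS U V t)"
    "res MS U V (smul (sec MS U) P s) = smul (sec MS V) P (res MS U V s)"
  unfolding Dt_sheafify sheafify_def T.Sh_sel using assms by (auto simp: restrict_def fun_eq_iff)

lemma MS_res_carr: "zopen U ==> zopen V ==> p : V ==> V \<subseteq> U ==> s : carr (sec MS U) ==> res MS U V s : carr (sec MS V)"
  "zopen U ==> zopen V ==> p : V ==> V \<subseteq> U ==> s : carr (sec MS U) ==> rep p V (res MS U V s) - rep p U s : RQ p"
  using MD.M7[OF rep(2)[of U p s], of V] MD.M0 rep_cong by auto

lemma lrs_FL:
  assumes "zopen U" "zopen V" "p : V" "V \<subseteq> U" "x : FL U" shows "lrs U V x : FL V"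
  unfolding lrs_def using assms(5)
proof (rule frag_extend_in[OF _ nsub_frags])
  fix b m assume "b : Oloc f U" "m : carr (sec MS U)"
  then show "(case (b, m) of (b, m) => frag_of (b, res MS U V m)) : FL V"
    using frags_of[OF subsetD[OF Oloc_antimono[OF assms(4)]] MS_res_carr(1)[OF assms(1-4)]] by simp
qed

lemma lrs_TL: assumes "zopen U" "zopen V" "p : V" "V \<subseteq> U" "x : TL U" shows "lrs U V x : TL V"
  using assms(5)
proof (rule tensor_rel_induct[OF _ nsub_TL])
  note r = MS_res_carr(1)[OF assms(1-4)] subsetD[OF Oloc_antimono[OF assms(4)]] subsetD[OF reg_antimono[OF assms(4)]]
  { fix b b' m assume "b : carr (OL U)" "b' : carr (OL U)" "m : carr (sec MS U)"
    then show "lrs U V (frag_of (addm (OL U) b b', m)) - lrs U V (frag_of (b, m)) - lrs U V (frag_of (b', m)) : TL V"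
      using tr_addl[of b "OL V" b' "res MS U V m" "sec MS V"] r by (simp add: lrs_def) }
  { fix b m m' assume "b : carr (OL U)" "m : carr (sec MS U)" "m' : carr (sec MS U)"
    then show "lrs U V (frag_of (b, addm (sec MS U) m m')) - lrs U V (frag_of (b, m)) - lrs U V (frag_of (b, m')) : TL V"
      using tr_addr[of b "OL V" "res MS U V m" "sec MS V" "res MS U V m'"] r by (simp add: lrs_def MS_res_op[OF assms(4)]) }
  { fix b g m assume "b : carr (OL U)" "g : RO U" "m : carr (sec MS U)"
    then show "lrs U V (frag_of (app g b, m)) - lrs U V (frag_of (b, smul (sec MS U) g m)) : TL V"
      using TL_bal[of b V _ "res MS U V m"] r by (auto simp: lrs_def MS_res_op[OF assms(4)]) }
qed (simp add: lrs_def frag_extend_diff)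

lemma fev_psi_loc:
  assumes "x - frag_of (fi k, s) : TL U" "zopen U" "q : U" "s : carr (sec MS U)"
  shows "fev (\<psi> q U) x - act (mulop (fi k)) (rep q U s) : RL q"
  using fev_TL[OF assms(1-3)] by (simp add: fev_diff \<psi>_def)

sublocale L: classes act "%p. p" LP CL RL FL TL lcl lrs "%p U. fev (\<psi> p U)" "%U. leibniz_act (nbM U)"
proof
  fix P :: "('k, 'n) dop" and p c assume "P : Dop {p}" "c : RL p"
  then show "act P c : RL p" using RL_act Dop_L by blast
next
  fix U :: "('n => 'k) set" and p assume U: "zopen U" "p : U"
  note bL = bimodL[OF U]
  show "carr (sec LP U) = lcl U ` FL U"
    unfolding LP_sec lcl_def using bimod.tensor_carr[OF bL] by simp
  { fix x y assume "x : FL U" "y : FL U"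
    then show "lcl U x = lcl U y \<longleftrightarrow> x - y : TL U" "addm (sec LP U) (lcl U x) (lcl U y) = lcl U (x + y)"
      unfolding LP_sec lcl_def using bimod.tensor_coset_eq[OF bL, of x y] bimod.tensor_add[OF bL, of x y] by simp_all }
  { fix x P assume x: "x : FL U" and "P : Dop ((%p. p) -` U)"
    then have P: "P : dopS (reg U)" "P : Dop U" by (simp_all add: Dop_dopS)
    interpret lb: leibniz "RO U" "OL U" "%g r. app r g" "sec MS U" "nbM U" "reg U" "%i r. mulop (rpd i (app r 1))"
      by (rule leib[OF U])
    show "leibniz_act (nbM U) P x : FL U" using lb.leibniz_Fr[OF P(1)] x by simp
    show "smul (sec LP U) P (lcl U x) = lcl U (leibniz_act (nbM U) P x)"
      unfolding LP_sec lcl_def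
      by (rule lb.tensor_smul) (use x P lb.leibniz_Fr[OF P(1)] lb.leibniz_TR[OF P(1)] in \<open>auto simp: leibniz_additive\<close>)
    show "fev (\<psi> p U) (leibniz_act (nbM U) P x) - act P (fev (\<psi> p U) x) : RL p"
      unfolding leibniz_act_def
    proof (rule conn_act_cong[OF dring_reg RL_nsub _ fev_add _ _ P(1), where A="FL U"])
      fix v i assume v: "v : FL U"
      have "fev (\<psi> p U) (lb.nabf i v) - act (pdop i) (fev (\<psi> p U) v) : RL p"
        using v
      proof (rule fev_extend_act[OF _ RL_nsub])
        fix c assume "c : RL p" then show "act (pdop i) c : RL p"
          using RL_act[OF subsetD[OF Dop_L Dop_pdop]] by blast
      next
        fix b m assume b: "b : Oloc f U" "m : carr (sec MS U)"
        have "act (mulop b) (rep p U (nbM U i m) - act (pdop i) (rep p U m)) : RL p"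
          using b U by (intro RL_mulop[of b U] rep_cong MS_rep_smul Dop_pdop) auto
        then show "fev (\<psi> p U) (case (b, m) of (g, m) => frag_of (rpd i g, m) + frag_of (g, nbM U i m)) - act (pdop i) (\<psi> p U (b, m)) : RL p"
          by (simp add: \<psi>_def fev_add act_diffr pdop_mulop act_addl act_mult[symmetric])
      qed
      then show "lb.nabf i v : FL U & fev (\<psi> p U) (lb.nabf i v) - act (pdop i) (fev (\<psi> p U) v) : RL p"
        using lb.nabf_Fr v by simp
    next
      fix v g assume v: "v : FL U" "g : reg U"
      show "fev (\<psi> p U) (lb.mulf g v) - act (mulop g) (fev (\<psi> p U) v) : RL p"
        using v(1)
      proof (rule fev_extend_act[OF _ RL_nsub])
        fix c assume "c : RL p" then show "act (mulop g) c : RL p"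
          using RL_act[OF mulop_L[of g U]] v(2) U(2) reg_Oloc by blast
      qed (use nsubD(1)[OF RL_nsub] in \<open>auto simp: \<psi>_def mulop_mult act_mult\<close>)
    next
      fix Q c assume "Q : dopS (reg U)" "c : RL p"
      then show "act Q c : RL p" using RL_act Dop_L Dop_antimono[of "{p}" U] U(2) unfolding Dop_dopS by blast
    qed (rule x) }
  { fix x assume x: "x : FL U"
    obtain k s where s: "s : carr (sec MS U)" "x - frag_of (fi k, s) : TL U" using normal_formL[OF x U] by blast
    obtain V c where V: "zopen V" "p : V" "V \<subseteq> U" "c : CQ p" "!!q. q : V ==> RlD q U s c"
      using MD.M1[OF U s(1)] by blast
    have "fev (\<psi> q U) x - act (mulop (fi k)) c : RL q" if q: "q : V" for q
    proof -
      have qU: "q : U" using q V by blast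
      have "act (mulop (fi k)) (rep q U s - c) : RL q"
        by (rule RL_mulop[OF fi_Oloc[of k U] qU rep_cong[OF V(5)[OF q]]])
      then show ?thesis using nsubD(2)[OF RL_nsub fev_psi_loc[OF s(2) U(1) qU s(1)]] by (fastforce simp: act_diffr)
    qed
    then show "\<exists>V c. zopen V & p : V & V \<subseteq> U & c : CL p & (\<forall>q. q : V --> fev (\<psi> q U) x - c : RL q)"
      using V unfolding CL_def by blast
    assume R: "fev (\<psi> p U) x : RL p"
    have "act (mulop (fi k)) (rep p U s) : RL p"
      using nsubD(4)[OF RL_nsub R fev_psi_loc[OF s(2) U s(1)]] by simp
    then have "act (polop (f ^ k)) (act (mulop (fi k)) (rep p U s)) : RL p"
      by (rule RL_act[OF subsetD[OF Dop_L Dop_polop]])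
    then have "rep p U s : RL p" by (simp add: polop_eq fi_mult flip: act_mult mulop_mult)
    then obtain l where l: "act (polop (f ^ l)) (rep p U s) : RQ p" by (auto simp: RL_def)
    \<comment> \<open>The germ of f^l s at p is zero. Near p the tensor is rewritten as f^{-k-l}
      \<otimes> f^l s, whose second factor vanishes.\<close>
    let ?s = "smul (sec MS U) (polop (f ^ l)) s"
    have 1: "RlD p U ?s (act (polop (f ^ l)) (rep p U s))" by (rule MS_rep_smul[OF U s(1) Dop_polop])
    obtain W where W: "zopen W" "p : W" "W \<subseteq> U" "res MS U W ?s = res MS UNIV W (zerom (sec MS UNIV))"
      using MD.M3[OF 1 MD.M6] l by auto
    have "RlD q W (res MS U W ?s) 0" if "q : W" for q
      unfolding W(4) by (rule MD.M7[OF MD.M6]) (use W that in auto)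
    then have "frag_of (fi (k + l), res MS U W ?s) : TL W"
      using MS_res_carr(1)[OF U(1) W(1-3)] MS_closed(2)[OF U s(1) Dop_polop] by (intro TL_zero[OF fi_Oloc W(1,2)]) auto
    moreover have "frag_of (fi k, res MS U W s) - frag_of (fi (k + l), res MS U W ?s) : TL W"
      unfolding MS_res_op[OF W(3)] by (rule TL_fi[OF MS_res_carr(1)[OF U(1) W(1-3) s(1)]])
    moreover have "lrs U W x - frag_of (fi k, res MS U W s) : TL W"
      using lrs_TL[OF U(1) W(1-3) s(2)] by (simp add: lrs_def frag_extend_diff)
    ultimately have *: "(lrs U W x - frag_of (fi k, res MS U W s)) + (frag_of (fi k, res MS U W s) - frag_of (fi (k + l), res MS U W ?s))
       + frag_of (fi (k + l), res MS U W ?s) : TL W" by (intro TLd(2)) simp_all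
    from * have "lrs U W x : TL W" by simp
    then show "\<exists>W. zopen W & p : W & W \<subseteq> U & lrs U W x : TL W" using W by blast }
next
  show "zerom (sec LP UNIV) = lcl UNIV 0"
    unfolding LP_sec lcl_def by (rule bimod.tensor_zero[OF bimodL[OF zopen_UNIV UNIV_I]])
next
  fix U V :: "('n => 'k) set" and p x assume U: "zopen U" "zopen V" "p : V" "V \<subseteq> U" and x: "x : FL U"
  show "lrs U V x : FL V" by (rule lrs_FL[OF U x])
  have pU: "p : U" using U by blast
  show "res LP U V (lcl U x) = lcl V (lrs U V x)"
    unfolding LP_res lcl_def
    by (rule bimod.tensor_quot_map[OF bimodL[OF U(2,3)] bimodL[OF U(1) pU]])
      (use x lrs_FL[OF U] lrs_TL[OF U] in \<open>auto simp: lrs_def frag_extend_add\<close>)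
  show "fev (\<psi> p V) (lrs U V x) - fev (\<psi> p U) x : RL p"
    unfolding lrs_def using x
  proof (rule fev_extend_cong[OF _ RL_nsub])
    fix b m assume b: "b : Oloc f U" "m : carr (sec MS U)"
    have "act (mulop b) (rep p V (res MS U V m) - rep p U m) : RL p"
      by (rule RL_mulop[OF b(1) pU MS_res_carr(2)[OF U b(2)]])
    then show "fev (\<psi> p V) (case (b, m) of (b, m) => frag_of (b, res MS U V m)) - \<psi> p U (b, m) : RL p"
      by (simp add: \<psi>_def act_diffr)
  qed
next
  fix U V W :: "('n => 'k) set" and x
  assume "W \<subseteq> V" "V \<subseteq> U" and x: "x : FL U"
  then have r: "res MS V W (res MS U V m) = res MS U W m" for m
    by (auto simp: MS_res restrict_def fun_eq_iff)
  show "lrs V W (lrs U V x) = lrs U W x"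
    using x by (induction x rule: frags_induct) (simp_all add: lrs_def r frag_extend_diff)
next
  fix p c assume "c : CL p"
  then obtain k d where d: "d : CQ p" "c = act (mulop (fi k)) d" by (auto simp: CL_def)
  obtain U s where U: "zopen U" "p : U" "!!q. q : U ==> RlD q U s d" using MD.M2[OF d(1)] by blast
  have s: "s : carr (sec MS U)" using MD.M0[OF U(3)[OF U(2)]] by blast
  have "fev (\<psi> q U) (frag_of (fi k, s)) - c : RL q" if "q : U" for q
    using RL_mulop[OF fi_Oloc[of k U] that rep_cong[OF U(3)[OF that]]] by (simp add: \<psi>_def d act_diffr)
  then show "\<exists>U x. zopen U & p : U & x : FL U & (\<forall>q. q : U --> fev (\<psi> q U) x - c : RL q)"
    using U s by (intro exI[of _ U] exI[of _ "frag_of (fi k, s)"]) (auto intro: frags_of fi_Oloc)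
qed (auto simp: RL_nsub nsub_frags fev_diff fev_TL, auto simp: lrs_def frag_extend_diff)

lemma mod_loc_model: "model (%p. p) LP CL RL act L.RlC" by (rule L.model)

lemma mod_loc_eq: "mod_loc f MS = sheafify LP" by (simp add: mod_loc_def)

end

section \<open>Substitution in rational functions\<close>

text \<open>Functions that have no pole along the whole image of \<sigma>, so that substitution
  makes sense; \<open>rsub\<close> is the substitution.\<close>

definition regS :: "('n::{finite,linorder} => ('k::field, 'm::{finite,linorder}) mpol) => ('k, 'n) ratf set" where
  "regS \<sigma> = {rpol a / rpol b | a b. msubst \<sigma> b ~= 0}"

definition rsub :: "('n::{finite,linorder} => ('k::field, 'm::{finite,linorder}) mpol) => ('k, 'n) ratf => ('k, 'm) ratf" where
  "rsub \<sigma> g = (THE h. \<exists>a b. msubst \<sigma> b ~= 0 & g = Fract a b & h = Fract (msubst \<sigma> a) (msubst \<sigma> b))"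

lemma msubst_nz [dest]: "msubst \<sigma> b ~= 0 ==> b ~= 0"
  by (auto simp: msubst.hom_0)

lemma rsub_frac:
  assumes "msubst \<sigma> b ~= 0" shows "rsub \<sigma> (rpol a / rpol b) = rpol (msubst \<sigma> a) / rpol (msubst \<sigma> b)"
  unfolding rsub_def Fract_rpol
proof (rule the_equality)
  fix h assume "\<exists>a' b'. msubst \<sigma> b' ~= 0 & rpol a / rpol b = rpol a' / rpol b' & h = rpol (msubst \<sigma> a') / rpol (msubst \<sigma> b')"
  then obtain a' b' where *: "msubst \<sigma> b' ~= 0" "rpol a / rpol b = rpol a' / rpol b'" "h = rpol (msubst \<sigma> a') / rpol (msubst \<sigma> b')" by blast
  have "b ~= 0" "b' ~= 0" using assms * by auto
  then have "rpol (a * b') = rpol (a' * b)" using *(2) by (simp add: rpol.hom_mult frac_eq_eq)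
  then have "msubst \<sigma> a * msubst \<sigma> b' = msubst \<sigma> a' * msubst \<sigma> b"
    by (simp add: rpol_inj flip: msubst.hom_mult)
  then show "h = rpol (msubst \<sigma> a) / rpol (msubst \<sigma> b)"
    using * assms by (simp add: frac_eq_eq flip: rpol.hom_mult)
qed (use assms in blast)

lemma regS_cases:
  assumes "g : regS \<sigma>"
  obtains a b where "msubst \<sigma> b ~= 0" "b ~= 0" "g = rpol a / rpol b" "rsub \<sigma> g = rpol (msubst \<sigma> a) / rpol (msubst \<sigma> b)"
  using assms rsub_frac unfolding regS_def by blast

lemma rsub_rpol [simp]: "rsub \<sigma> (rpol q) = rpol (msubst \<sigma> q)"
  using rsub_frac[of \<sigma> 1 q] by (simp add: msubst.hom_1 rpol.hom_1)

lemma rpol_regS: "rpol q : regS \<sigma>"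
  unfolding regS_def by (intro CollectI exI[of _ q] exI[of _ 1]) (simp add: msubst.hom_1 rpol.hom_1)

lemma frac_regS: "msubst \<sigma> b ~= 0 ==> rpol a / rpol b : regS \<sigma>" unfolding regS_def by blast

lemma rsub_ring:
  assumes "g : regS \<sigma>" "h : regS \<sigma>"
  shows "g + h : regS \<sigma>" "rsub \<sigma> (g + h) = rsub \<sigma> g + rsub \<sigma> h"
    "g * h : regS \<sigma>" "rsub \<sigma> (g * h) = rsub \<sigma> g * rsub \<sigma> h"
proof -
  obtain a b where g: "msubst \<sigma> b ~= 0" "b ~= 0" "g = rpol a / rpol b" "rsub \<sigma> g = rpol (msubst \<sigma> a) / rpol (msubst \<sigma> b)"
    by (rule regS_cases[OF assms(1)])
  obtain c d where h: "msubst \<sigma> d ~= 0" "d ~= 0" "h = rpol c / rpol d" "rsub \<sigma> h = rpol (msubst \<sigma> c) / rpol (msubst \<sigma> d)"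
    by (rule regS_cases[OF assms(2)])
  have bd: "msubst \<sigma> (b * d) ~= 0" using g h by (simp add: msubst.hom_mult)
  have s: "g + h = rpol (a * d + c * b) / rpol (b * d)" and m: "g * h = rpol (a * c) / rpol (b * d)"
    unfolding g(3) h(3) using g h by (simp_all add: rpol.hom_add rpol.hom_mult add_frac_eq)
  show "g + h : regS \<sigma>" "g * h : regS \<sigma>" unfolding s m by (rule frac_regS[OF bd])+
  show "rsub \<sigma> (g + h) = rsub \<sigma> g + rsub \<sigma> h" "rsub \<sigma> (g * h) = rsub \<sigma> g * rsub \<sigma> h"
    unfolding g(4) h(4) unfolding s m rsub_frac[OF bd] using g h
    by (simp_all add: rpol.hom_add rpol.hom_mult msubst.hom_add msubst.hom_mult add_frac_eq)
qed

lemma rsub_1 [simp]: "rsub \<sigma> 1 = 1" and rsub_0 [simp]: "rsub \<sigma> 0 = 0"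
  using rsub_rpol[of \<sigma> 1] rsub_rpol[of \<sigma> 0] by (simp_all add: msubst.hom_1 msubst.hom_0 rpol.hom_1 rpol.hom_0)

lemma regS_1: "1 : regS \<sigma>" and regS_0: "0 : regS \<sigma>"
  using rpol_regS[of 1 \<sigma>] rpol_regS[of 0 \<sigma>] by (simp_all add: rpol.hom_1 rpol.hom_0)

lemma rsub_neg: assumes "g : regS \<sigma>" shows "- g : regS \<sigma>" "rsub \<sigma> (- g) = - rsub \<sigma> g"
proof -
  have m1: "- 1 : regS \<sigma>" "rsub \<sigma> (- 1) = - 1"
    using rpol_regS[of "-1" \<sigma>] rsub_rpol[of \<sigma> "-1"] by (simp_all add: rpol.hom_minus msubst.hom_minus rpol.hom_1 msubst.hom_1)
  show "- g : regS \<sigma>" "rsub \<sigma> (- g) = - rsub \<sigma> g" using rsub_ring(3,4)[OF m1(1) assms] m1(2) by simp_all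
qed

lemma rsub_diff: "g : regS \<sigma> ==> h : regS \<sigma> ==> rsub \<sigma> (g - h) = rsub \<sigma> g - rsub \<sigma> h"
  using rsub_ring(2)[of g \<sigma> "-h"] rsub_neg[of h \<sigma>] by simp

lemma dring_regS: "dring (regS \<sigma>)"
proof
  fix g and i :: 'a assume "g : regS \<sigma>"
  then obtain a b where g: "msubst \<sigma> b ~= 0" "b ~= 0" "g = rpol a / rpol b" by (rule regS_cases)
  have "rpd i g = rpol (mpd i a * b - a * mpd i b) / rpol (b * b)"
    by (simp add: g rpd_divide rpd_rpol rpol.hom_diff rpol.hom_mult power2_eq_square)
  moreover have "msubst \<sigma> (b * b) ~= 0" using g by (simp add: msubst.hom_mult)
  ultimately show "rpd i g : regS \<sigma>" using frac_regS by metis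
qed (auto intro: rsub_ring rsub_neg regS_0 regS_1)

lemma rsub_power: "g : regS \<sigma> ==> g ^ n : regS \<sigma> & rsub \<sigma> (g ^ n) = rsub \<sigma> g ^ n"
  by (induction n) (auto simp: rsub_ring regS_1)

lemma rsub_inverse:
  assumes "g : regS \<sigma>" "rsub \<sigma> g ~= 0" shows "inverse g : regS \<sigma>" "rsub \<sigma> (inverse g) = inverse (rsub \<sigma> g)"
proof -
  obtain a b where g: "msubst \<sigma> b ~= 0" "b ~= 0" "g = rpol a / rpol b" "rsub \<sigma> g = rpol (msubst \<sigma> a) / rpol (msubst \<sigma> b)"
    by (rule regS_cases[OF assms(1)])
  have a: "msubst \<sigma> a ~= 0" using assms(2) g by auto
  have e: "inverse g = rpol b / rpol a" by (simp add: g)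
  show "inverse g : regS \<sigma>" "rsub \<sigma> (inverse g) = inverse (rsub \<sigma> g)"
    unfolding g(4) unfolding e rsub_frac[OF a] by (rule frac_regS[OF a]) simp
qed

lemma rsub_chain:
  fixes \<sigma> :: "'n::{finite,linorder} => ('k::field, 'm::{finite,linorder}) mpol"
  assumes "g : regS \<sigma>"
  shows "rpd j (rsub \<sigma> g) = (\<Sum>i\<in>UNIV. rsub \<sigma> (rpd i g) * rpol (mpd j (\<sigma> i)))"
proof -
  \<comment> \<open>\<open>D\<close> measures the failure of the chain rule. It is a derivation
    along the substitution and vanishes on polynomials, hence on fractions.\<close>
  define D where "D u = rpd j (rsub \<sigma> u) - (\<Sum>i\<in>UNIV. rsub \<sigma> (rpd i u) * rpol (mpd j (\<sigma> i)))" for u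
  have Dm: "D (u * v) = D u * rsub \<sigma> v + rsub \<sigma> u * D v" if "u : regS \<sigma>" "v : regS \<sigma>" for u v
  proof -
    have d: "rpd i u : regS \<sigma>" "rpd i v : regS \<sigma>" for i using that dring.Sd[OF dring_regS] by auto
    show ?thesis unfolding D_def using that d
      by (simp add: rpd_mult rsub_ring sum.distrib algebra_simps sum_distrib_left)
  qed
  have Dp: "D (rpol q) = 0" for q
    by (simp add: D_def rpd_rpol mpd_msubst rpol.hom_sum rpol.hom_mult)
  obtain a b where g: "msubst \<sigma> b ~= 0" "b ~= 0" "g = rpol a / rpol b" by (rule regS_cases[OF assms])
  have "D (g * rpol b) = D g * rpol (msubst \<sigma> b)" using Dm[OF assms rpol_regS] Dp by simp
  moreover have "g * rpol b = rpol a" using g by simp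
  ultimately have "D g = 0" using Dp[of a] g by simp
  then show ?thesis by (simp add: D_def)
qed

lemma rsub_reg:
  assumes "g : reg {%i. meval p (\<sigma> i)}" shows "g : regS \<sigma>" "rsub \<sigma> g : reg {p}"
proof -
  obtain a b where g: "meval (%i. meval p (\<sigma> i)) b ~= 0" "g = rpol a / rpol b" using assms unfolding reg_pt by blast
  then have b: "meval p (msubst \<sigma> b) ~= 0" by (simp add: meval_msubst)
  then have b0: "msubst \<sigma> b ~= 0" by auto
  show "g : regS \<sigma>" "rsub \<sigma> g : reg {p}" unfolding g(2) rsub_frac[OF b0] using frac_regS[OF b0] b reg_pt by blast+
qed

text \<open>A left inverse makes the substitution injective on polynomials, so no denominator
  becomes zero.\<close>

lemma regS_UNIV:
  fixes \<sigma> :: "'n::{finite,linorder} => ('k::field, 'm::{finite,linorder}) mpol"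
  assumes i: "!!q. msubst \<tau> (msubst \<sigma> q) = q" shows "regS \<sigma> = UNIV"
proof (intro equalityI subset_UNIV subsetI)
  fix g :: "('k, 'n) ratf"
  obtain a b where g: "g = rpol a / rpol b" "b ~= 0" by (rule ratf_cases)
  then have "msubst \<sigma> b ~= 0" using i[of b] by (auto simp: msubst.hom_0)
  then show "g : regS \<sigma>" using g frac_regS by metis
qed

lemma rsub_rsub:
  assumes "!!q. msubst \<tau> (msubst \<sigma> q) = q" shows "rsub \<sigma> g : regS \<tau>" "rsub \<tau> (rsub \<sigma> g) = g"
proof -
  have "g : regS \<sigma>" using regS_UNIV[of \<tau> \<sigma>] assms by blast
  then obtain a b where g: "msubst \<sigma> b ~= 0" "b ~= 0" "g = rpol a / rpol b" "rsub \<sigma> g = rpol (msubst \<sigma> a) / rpol (msubst \<sigma> b)"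
    by (rule regS_cases)
  have b: "msubst \<tau> (msubst \<sigma> b) ~= 0" using assms g by simp
  show "rsub \<sigma> g : regS \<tau>" "rsub \<tau> (rsub \<sigma> g) = g"
    unfolding g(4) rsub_frac[OF b] assms using frac_regS[OF b] g by auto
qed

section \<open>Homomorphisms of rings of differential operators\<close>

definition dmap :: "(('k::field_char_0, 'n::{finite,linorder}) ratf => ('k, 'm::{finite,linorder}) ratf) => ('n => ('k, 'm) dop) =>
    ('k, 'n) dop => ('k, 'm) dop" where
  "dmap \<xi> Y P = (\<Sum>\<alpha>\<in>Poly_Mapping.keys (dcoeffs P). mulop (\<xi> (Poly_Mapping.lookup (dcoeffs P) \<alpha>)) * monom_at Y \<alpha>)"

lemma dring_UNIV: "dring UNIV" by standard auto

text \<open>The hypotheses are the relations between functions and derivations transported by \<xi>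
  and Y. They make the replacement in normally ordered expressions a ring homomorphism on operators
  of finite order.\<close>

locale dhom =
  fixes \<xi> :: "('k::field_char_0, 'n::{finite,linorder}) ratf => ('k, 'm::{finite,linorder}) ratf" and Y :: "'n => ('k, 'm) dop"
  assumes chi: "rhom \<xi>" and Ycom: "comfam Y"
    and Yd: "Y i * mulop (\<xi> g) = mulop (\<xi> (rpd i g)) + mulop (\<xi> g) * Y i"
begin

interpretation chi: rhom \<xi> by (rule chi)

abbreviation "H \<equiv> dmap \<xi> Y"

lemma H_superset: "finite A ==> Poly_Mapping.keys a \<subseteq> A ==> H (dop_of a) = (\<Sum>\<alpha>\<in>A. mulop (\<xi> (Poly_Mapping.lookup a \<alpha>)) * monom_at Y \<alpha>)"
  unfolding dmap_def dcoeffs_dop_of by (intro sum.mono_neutral_left) (auto simp: in_keys_iff chi.hom_0)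

lemma H_monom: "H (mulop g * monom_at pdop \<alpha>) = mulop (\<xi> g) * monom_at Y \<alpha>"
  unfolding dop_of_single[symmetric] by (subst H_superset[of "{\<alpha>}"]) auto

lemma H_0: "H 0 = 0" using H_monom[of 0 0] by (simp add: chi.hom_0)

lemma H_add:
  assumes "P : dopS UNIV" "Q : dopS UNIV" shows "H (P + Q) = H P + H Q"
proof -
  obtain a b where ab: "P = dop_of a" "Q = dop_of b" using assms by (auto simp: dopS_def)
  let ?A = "Poly_Mapping.keys a \<union> Poly_Mapping.keys b"
  have "Poly_Mapping.keys (a + b) \<subseteq> ?A" by (rule Poly_Mapping.keys_add)
  then show ?thesis unfolding ab dop_of_add[symmetric]
    by (simp add: H_superset[of ?A] sum.distrib[symmetric] lookup_add chi.hom_add mulop_add distrib_right)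
qed

lemma H_minus: "P : dopS UNIV ==> H (- P) = - H P"
  using H_add[of P "- P"] dring.dopS_minus[OF dring_UNIV, of P] H_0 by (simp add: eq_neg_iff_add_eq_0 add.commute)

lemma H_diff: "P : dopS UNIV ==> Q : dopS UNIV ==> H (P - Q) = H P - H Q"
  using H_add[of P "- Q"] dring.dopS_minus[OF dring_UNIV, of Q] H_minus by simp

lemma H_mulop: "H (mulop g) = mulop (\<xi> g)"
  using H_monom[of g 0] by simp

lemma H_pdop: "H (pdop i) = Y i"
  using H_monom[of 1 "Poly_Mapping.single i 1"] by (simp only: monom_at_single power_one_right chi.hom_1 mulop_1 mult_1)

lemma H_1: "H 1 = 1" using H_mulop[of 1] by (simp add: chi.hom_1)

lemma H_mulop_mult: "P : dopS UNIV ==> H (mulop g * P) = mulop (\<xi> g) * H P"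
proof (induction P rule: dring.dopS_induct[OF dring_UNIV, consumes 1, case_names zero add monom])
  case (add P Q)
  then show ?case using dring.dopS_mulop_mult[OF dring_UNIV, of _ g]
    by (simp add: distrib_left H_add)
next
  case (monom h \<alpha>)
  then show ?case using H_monom[of "g * h" \<alpha>] by (simp add: H_monom mulop_mult chi.hom_mult mult.assoc)
qed (simp add: H_0)

lemma H_pdop_mult: "P : dopS UNIV ==> H (pdop i * P) = Y i * H P"
proof (induction P rule: dring.dopS_induct[OF dring_UNIV, consumes 1, case_names zero add monom])
  case (add P Q)
  then show ?case using dring.dopS_pdop_mult[OF dring_UNIV add(1), of i] dring.dopS_pdop_mult[OF dring_UNIV add(2), of i]
    by (simp add: distrib_left H_add)
next
  case (monom h \<alpha>)
  have "pdop i * (mulop h * monom_at pdop \<alpha>) = mulop (rpd i h) * monom_at pdop \<alpha> + mulop h * monom_at pdop (\<alpha> + Poly_Mapping.single i 1)"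
    unfolding monom_at_step[OF comfam_pdop] mult.assoc[symmetric] pdop_mulop by (simp add: algebra_simps)
  then have "H (pdop i * (mulop h * monom_at pdop \<alpha>)) = mulop (\<xi> (rpd i h)) * monom_at Y \<alpha> + mulop (\<xi> h) * monom_at Y (\<alpha> + Poly_Mapping.single i 1)"
    using H_add[OF dring.dopS_monom[OF dring_UNIV] dring.dopS_monom[OF dring_UNIV]] H_monom by simp
  also have "\<dots> = (mulop (\<xi> (rpd i h)) + mulop (\<xi> h) * Y i) * monom_at Y \<alpha>"
    unfolding monom_at_step[OF Ycom] by (simp only: distrib_right mult.assoc)
  also have "\<dots> = Y i * H (mulop h * monom_at pdop \<alpha>)"
    unfolding H_monom Yd[symmetric] by (simp only: mult.assoc)
  finally show ?case .
qed (simp add: H_0)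

lemma H_monom_mult: "P : dopS UNIV ==> H (monom_at pdop \<alpha> * P) = monom_at Y \<alpha> * H P"
  by (induction \<alpha> rule: expo_induct)
     (simp_all add: monom_at_step[OF comfam_pdop] monom_at_step[OF Ycom] mult.assoc H_pdop_mult
       dring.dopS_pdmonom_mult[OF dring_UNIV] del: One_nat_def)

lemma H_mult: "P : dopS UNIV ==> Q : dopS UNIV ==> H (P * Q) = H P * H Q"
proof (induction P rule: dring.dopS_induct[OF dring_UNIV, consumes 1, case_names zero add monom])
  case (add P P')
  then show ?case using dring.dopS_mult[OF dring_UNIV, of _ Q] by (simp add: distrib_right H_add)
next
  case (monom h \<alpha>)
  then show ?case using dring.dopS_pdmonom_mult[OF dring_UNIV, of Q \<alpha>]
    by (simp add: mult.assoc H_mulop_mult H_monom_mult H_monom)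
qed (simp add: H_0)

lemma H_sum: "(!!x. x : A ==> P x : dopS UNIV) ==> H (sum P A) = (\<Sum>x\<in>A. H (P x))"
  by (induction A rule: infinite_finite_induct) (auto simp: H_0 H_add dring.dopS_sum[OF dring_UNIV])

text \<open>Determines the transported operator on the test functions \<theta> u only. This is
  enough for products u(x) h(y), which are all that the restriction map sees.\<close>

lemma H_app:
  assumes "!!u v. \<theta> (u + v) = \<theta> u + \<theta> v" "!!g u. \<xi> g * \<theta> u = \<theta> (g * u)" "!!i u. app (Y i) (\<theta> u) = \<theta> (rpd i u)"
    "P : dopS UNIV"
  shows "app (H P) (\<theta> u) = \<theta> (app P u)"
  using assms(4)
proof (induction P rule: dring.dopS_induct[OF dring_UNIV, consumes 1, case_names zero add monom])
  case zero
  have "\<theta> 0 = 0" by (metis add_0 add_left_imp_eq add.right_neutral assms(1))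
  then show ?case by (simp add: H_0)
next
  case (add P Q) then show ?case by (simp add: H_add app_plus assms(1))
next
  case (monom h \<alpha>)
  have "app (monom_at Y \<alpha>) (\<theta> u) = \<theta> (app (monom_at pdop \<alpha>) u)"
    by (induction \<alpha> rule: expo_induct)
      (simp_all add: monom_at_step[OF comfam_pdop] monom_at_step[OF Ycom] app_times assms(3) del: One_nat_def)
  then show ?case by (simp add: H_monom app_times assms(2))
qed

end

lemma prod_list_UNIV: "prod_list (map g (sorted_list_of_set (UNIV :: 'n::{finite,linorder} set))) = (\<Prod>i\<in>UNIV. g i :: 'a::comm_monoid_mult)"
  using prod.distinct_set_conv_list[of "sorted_list_of_set (UNIV :: 'n set)" g] by simp

lemma monom_at_polop: "monom_at (%i. polop (\<sigma> i)) m = polop (\<Prod>i\<in>UNIV. \<sigma> i ^ Poly_Mapping.lookup m i)"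
  for \<sigma> :: "'n::{finite,linorder} => ('k::field, 'm::{finite,linorder}) mpol"
proof -
  have pw: "polop q ^ n = polop (q ^ n)" for q :: "('k, 'm) mpol" and n
    by (induction n) (auto simp: polop_mult)
  have "prod_list (map (%i. polop (\<sigma> i) ^ Poly_Mapping.lookup m i) xs) = polop (prod_list (map (%i. \<sigma> i ^ Poly_Mapping.lookup m i) xs))" for xs
    by (induction xs) (auto simp: polop_mult pw)
  then show ?thesis by (simp add: monom_at_def prod_list_UNIV)
qed

lemma polop_sum: "polop (sum g A) = (\<Sum>x\<in>A. polop (g x))"
  by (induction A rule: infinite_finite_induct) (auto simp: polop_add, simp_all add: polop_eq rpol.hom_0)

text \<open>\<open>weyl_subst\<close> expands each coefficient into monomials; summing these first
  gives the substituted coefficient.\<close>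

lemma weyl_subst_dmap:
  fixes \<sigma> :: "'n::{finite,linorder} => ('k::field_char_0, 'm::{finite,linorder}) mpol"
  assumes "P : weyl"
  shows "weyl_subst (%i. polop (\<sigma> i)) Y P = dmap (rsub \<sigma>) Y P"
proof -
  have w: "rpol (wcoeff P \<alpha>) = Poly_Mapping.lookup (dcoeffs P) \<alpha>" for \<alpha>
  proof -
    obtain q where q: "Poly_Mapping.lookup (dcoeffs P) \<alpha> = rpol q"
      using dopS_coeffs(2)[of P "range rpol" \<alpha>] assms by (auto simp: weyl_dopS)
    then show ?thesis unfolding wcoeff_def by (simp add: rpol_inj)
  qed
  have "(\<Sum>m\<in>Poly_Mapping.keys q. polop (mconst (Poly_Mapping.lookup q m)) * monom_at (%i. polop (\<sigma> i)) m * T) = polop (msubst \<sigma> q) * T" for q T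
  proof -
    have "polop (msubst \<sigma> q) = (\<Sum>m\<in>Poly_Mapping.keys q. polop (mconst (Poly_Mapping.lookup q m)) * monom_at (%i. polop (\<sigma> i)) m)"
      unfolding msubst_def monom_at_polop polop_mult[symmetric]
      by (rule polop_sum)
    then show ?thesis by (simp add: sum_distrib_right)
  qed
  then show ?thesis unfolding weyl_subst_def dmap_def by (simp add: w[symmetric] polop_eq)
qed

lemma sum_UNIV_sum: "(\<Sum>j\<in>UNIV. g j) = (\<Sum>i\<in>UNIV. g (Inl i)) + (\<Sum>i\<in>UNIV. g (Inr i))"
  for g :: "'a::finite + 'b::finite => 'c::comm_monoid_add"
  by (simp add: UNIV_Plus_UNIV[symmetric] sum.Plus del: UNIV_Plus_UNIV)

subsection \<open>The coordinates (z, x) on the product\<close>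

text \<open>\<open>s0\<close> is the restriction to the diagonal; \<open>sx\<close> and \<open>sy\<close> express functions of the old coordinates
  x and y in the coordinates (z, x), where the old \<open>\<partial>\<close>_x is \<open>xo\<close> and the old \<open>\<partial>\<close>_y is \<open>zo\<close>.\<close>

definition s0 :: "'n + 'n => ('k::field_char_0, 'n::{finite,linorder}) mpol" where "s0 = case_sum (%_. 0) mvar"
definition sx :: "'n => ('k::field_char_0, 'n::{finite,linorder} + 'n) mpol" where "sx i = mvar (Inr i)"
definition sy :: "'n => ('k::field_char_0, 'n::{finite,linorder} + 'n) mpol" where "sy i = mvar (Inr i) + mvar (Inl i)"
definition xo :: "'n => ('k::field_char_0, 'n::{finite,linorder} + 'n) dop" where "xo i = pdop (Inr i) - pdop (Inl i)"
definition zo :: "'n => ('k::field_char_0, 'n::{finite,linorder} + 'n) dop" where "zo i = pdop (Inl i)"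
definition sxy :: "'n + 'n => ('k::field_char_0, 'n::{finite,linorder} + 'n) mpol" where "sxy = case_sum sx sy"

lemma s0_sx: "msubst s0 (msubst sx q) = q" and s0_sy: "msubst s0 (msubst sy q) = q"
  by (simp_all add: msubst_msubst s0_def sx_def sy_def msubst.hom_add msubst_id)

lemma sxy_inv:
  fixes q :: "('k::field_char_0, 'n::{finite,linorder} + 'n) mpol"
  shows "msubst (case_sum (%i. mvar (Inr i) - mvar (Inl i)) (%i. mvar (Inl i))) (msubst sxy q) = q"
proof -
  have "(%j. msubst (case_sum (%i. mvar (Inr i) - mvar (Inl i)) (%i. mvar (Inl i))) (sxy j :: ('k, 'n + 'n) mpol)) = mvar"
    by (auto simp: fun_eq_iff sxy_def sx_def sy_def msubst.hom_add split: sum.splits)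
  then show ?thesis by (simp add: msubst_msubst msubst_id)
qed

lemma chain_sx: "rpd (Inr i) (rsub sx g) = rsub sx (rpd i g)" "rpd (Inl i) (rsub sx g) = 0"
proof -
  have g: "g : regS sx" using regS_UNIV[of s0 sx] s0_sx by blast
  show "rpd (Inr i) (rsub sx g) = rsub sx (rpd i g)"
    unfolding rsub_chain[OF g] by (subst sum.remove[of _ i]) (auto simp: sx_def mpd_mvar rpol.hom_1 rpol.hom_0 intro!: sum.neutral)
  show "rpd (Inl i) (rsub sx g) = 0"
    unfolding rsub_chain[OF g] by (auto simp: sx_def mpd_mvar rpol.hom_0 intro!: sum.neutral)
qed

lemma chain_sy: "rpd (Inr i) (rsub sy g) = rsub sy (rpd i g)" "rpd (Inl i) (rsub sy g) = rsub sy (rpd i g)"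
proof -
  have g: "g : regS sy" using regS_UNIV[of s0 sy] s0_sy by blast
  show "rpd (Inr i) (rsub sy g) = rsub sy (rpd i g)" "rpd (Inl i) (rsub sy g) = rsub sy (rpd i g)"
    unfolding rsub_chain[OF g] by (subst sum.remove[of _ i]; auto simp: sy_def mpd_add mpd_mvar rpol.hom_1 rpol.hom_0 intro!: sum.neutral)+
qed

lemma chain_s0: "g : regS s0 ==> rpd i (rsub s0 g) = rsub s0 (rpd (Inr i) g)"
  unfolding rsub_chain sum_UNIV_sum
  by (subst (2) sum.remove[of _ i]) (auto simp: s0_def mpd_mvar rpol.hom_1 rpol.hom_0 intro!: sum.neutral)

lemma chain_sxy: "rpd (Inr i) (rsub sxy g) = rsub sxy (rpd (Inl i) g) + rsub sxy (rpd (Inr i) g)"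
  "rpd (Inl i) (rsub sxy g) = rsub sxy (rpd (Inr i) g)"
proof -
  have g: "g : regS sxy" using regS_UNIV[of _ sxy] sxy_inv by blast
  have s: "(\<Sum>j\<in>UNIV. (if i = j then g j else 0)) = g i" "(\<Sum>j\<in>UNIV. (if i = j then g j else 0) * h j) = g i * h i"
    for g h :: "'a => ('b, 'a + 'a) ratf" by (auto simp: if_distrib[where f="%x. x * _"] cong: if_cong)
  have t: "x * rpol (if i = j then 1 else 0) = (if i = j then x else 0)" for x :: "('b, 'a + 'a) ratf" and j
    by (auto simp: rpol.hom_1 rpol.hom_0)
  show "rpd (Inr i) (rsub sxy g) = rsub sxy (rpd (Inl i) g) + rsub sxy (rpd (Inr i) g)"
    "rpd (Inl i) (rsub sxy g) = rsub sxy (rpd (Inr i) g)"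
    unfolding rsub_chain[OF g] sum_UNIV_sum
    by (simp_all add: sxy_def sx_def sy_def mpd_add mpd_mvar t s rpol.hom_0)
qed

lemma rhom_rsub: "regS \<sigma> = UNIV ==> rhom (rsub \<sigma>)"
  by standard (auto simp: rsub_ring)

lemma comfam_xo: "comfam xo" and comfam_zo: "comfam zo"
  unfolding comfam_def xo_def zo_def by (auto simp: algebra_simps pdop_commute)

lemma xo_zo: "xo i * zo j = zo j * xo i"
  unfolding xo_def zo_def by (simp add: algebra_simps pdop_commute)

lemma xo_mulop: "xo i * mulop g = mulop (rpd (Inr i) g - rpd (Inl i) g) + mulop g * xo i"
  unfolding xo_def by (simp add: algebra_simps pdop_mulop mulop_diff)

interpretation kx: dhom "rsub sx" xo
  by standard (auto simp: rhom.hom_add[OF rhom_rsub[OF regS_UNIV[OF s0_sx]]] rhom.hom_mult[OF rhom_rsub[OF regS_UNIV[OF s0_sx]]]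
     comfam_xo xo_mulop chain_sx)

interpretation ky: dhom "rsub sy" zo
  by standard (auto simp: rhom.hom_add[OF rhom_rsub[OF regS_UNIV[OF s0_sy]]] rhom.hom_mult[OF rhom_rsub[OF regS_UNIV[OF s0_sy]]]
     comfam_zo zo_def pdop_mulop chain_sy)

interpretation kxy: dhom "rsub sxy" "case_sum xo zo"
proof
  show "comfam (case_sum xo zo)"
    unfolding comfam_def using comfam_xo comfam_zo by (auto simp: comfam_def xo_zo split: sum.splits)
  fix i :: "'a + 'a" and g show "case_sum xo zo i * mulop (rsub sxy g) = mulop (rsub sxy (rpd i g)) + mulop (rsub sxy g) * case_sum xo zo i"
    by (cases i) (auto simp: xo_mulop zo_def pdop_mulop chain_sxy)
qed (auto simp: rhom.hom_add[OF rhom_rsub[OF regS_UNIV[OF sxy_inv]]] rhom.hom_mult[OF rhom_rsub[OF regS_UNIV[OF sxy_inv]]])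

abbreviation "kapx \<equiv> dmap (rsub sx) xo"
abbreviation "kapy \<equiv> dmap (rsub sy) zo"

lemma weyl_UNIV: "P : weyl ==> P : dopS UNIV"
  unfolding weyl_dopS using dopS_mono[of "range rpol" UNIV] by blast

lemma coord_change_dmap: "P : weyl ==> coord_change P = dmap (rsub sxy) (case_sum xo zo) P"
proof -
  have 1: "case_sum (%i. varop (Inr i)) (%i. varop (Inr i) + varop (Inl i)) = (%i. polop (sxy i))"
    by (auto simp: fun_eq_iff varop_def sxy_def sx_def sy_def polop_add split: sum.splits)
  have 2: "case_sum (%i. pdop (Inr i) - pdop (Inl i)) (%i. pdop (Inl i)) = case_sum xo zo"
    by (auto simp: fun_eq_iff xo_def zo_def split: sum.splits)
  show "P : weyl ==> ?thesis" unfolding coord_change_def 1 2 by (rule weyl_subst_dmap)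
qed

text \<open>Renaming the variables by j and then changing coordinates is a single substitution. With
  j = \<open>Inl\<close> and j = \<open>Inr\<close> this expresses the generators in
  \<open>G4\<close> through \<open>kapx\<close> and \<open>kapy\<close>.\<close>

lemma coord_change_comp:
  fixes P :: "('k::field_char_0, 'n::{finite,linorder}) dop" and j :: "'n => 'n + 'n"
  assumes P: "P : weyl"
  shows "weyl_subst (%i. varop (j i)) (%i. pdop (j i)) P : weyl"
    "coord_change (weyl_subst (%i. varop (j i)) (%i. pdop (j i)) P) = dmap (rsub (%i. sxy (j i))) (%i. case_sum xo zo (j i)) P"
proof -
  have coef: "\<exists>q. Poly_Mapping.lookup (dcoeffs P) \<alpha> = rpol q" for \<alpha>
    using dopS_coeffs(2)[of P "range rpol" \<alpha>] P by (auto simp: weyl_dopS)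
  have e: "weyl_subst (%i. varop (j i)) (%i. pdop (j i)) P = dmap (rsub (%i. mvar (j i))) (%i. pdop (j i)) P"
    unfolding varop_def by (rule weyl_subst_dmap[OF P])
  have com: "comfam (%i. pdop (j i) :: ('k, 'n + 'n) dop)" "comfam (%i. case_sum xo zo (j i) :: ('k, 'n + 'n) dop)"
    using comfam_pdop kxy.Ycom unfolding comfam_def by blast+
  have mon: "monom_at (%i. pdop (j i)) \<alpha> : (weyl :: ('k, 'n + 'n) dop set) &
     dmap (rsub sxy) (case_sum xo zo) (monom_at (%i. pdop (j i)) \<alpha> :: ('k, 'n + 'n) dop) = monom_at (%i. case_sum xo zo (j i)) \<alpha>" for \<alpha>
  proof (induction \<alpha> rule: expo_induct)
    case (step \<alpha> i)
    show ?case unfolding monom_at_step[OF com(1)] monom_at_step[OF com(2)]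
      using step by (simp add: weyl_mult weyl_pdop kxy.H_pdop_mult weyl_UNIV)
  qed (simp add: weyl_1 kxy.H_1)
  have tm: "mulop (rsub (%i. mvar (j i)) (Poly_Mapping.lookup (dcoeffs P) \<alpha>)) * monom_at (%i. pdop (j i)) \<alpha> : (weyl :: ('k, 'n + 'n) dop set)"
   "dmap (rsub sxy) (case_sum xo zo) (mulop (rsub (%i. mvar (j i)) (Poly_Mapping.lookup (dcoeffs P) \<alpha>)) * monom_at (%i. pdop (j i)) \<alpha>) =
    mulop (rsub (%i. sxy (j i)) (Poly_Mapping.lookup (dcoeffs P) \<alpha>)) * monom_at (%i. case_sum xo zo (j i)) \<alpha>" for \<alpha>
  proof -
    obtain q where q: "Poly_Mapping.lookup (dcoeffs P) \<alpha> = rpol q" using coef by blast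
    show "mulop (rsub (%i. mvar (j i)) (Poly_Mapping.lookup (dcoeffs P) \<alpha>)) * monom_at (%i. pdop (j i)) \<alpha> : (weyl :: ('k, 'n + 'n) dop set)"
      unfolding q rsub_rpol polop_eq[symmetric] using mon by (intro weyl_mult weyl_polop) auto
    show "dmap (rsub sxy) (case_sum xo zo) (mulop (rsub (%i. mvar (j i)) (Poly_Mapping.lookup (dcoeffs P) \<alpha>)) * monom_at (%i. pdop (j i)) \<alpha>) =
      mulop (rsub (%i. sxy (j i)) (Poly_Mapping.lookup (dcoeffs P) \<alpha>)) * monom_at (%i. case_sum xo zo (j i)) \<alpha>"
      unfolding q rsub_rpol using mon[of \<alpha>] by (simp add: kxy.H_mulop_mult weyl_UNIV msubst_msubst)
  qed
  show w: "weyl_subst (%i. varop (j i)) (%i. pdop (j i)) P : weyl"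
    unfolding e dmap_def by (rule sum_in_set) (auto intro: weyl_0 weyl_add tm)
  show "coord_change (weyl_subst (%i. varop (j i)) (%i. pdop (j i)) P) = dmap (rsub (%i. sxy (j i))) (%i. case_sum xo zo (j i)) P"
    unfolding coord_change_dmap[OF w] unfolding e unfolding dmap_def[of "rsub (%i. mvar (j i))"]
    by (subst kxy.H_sum) (auto intro: weyl_UNIV tm simp: tm(2), simp add: dmap_def)
qed

lemma coord_in_x: "P : weyl ==> coord_change (in_x P) = kapx P"
  and coord_in_y: "P : weyl ==> coord_change (in_y P) = kapy P"
  using coord_change_comp(2)[of P Inl] coord_change_comp(2)[of P Inr] by (simp_all add: in_x_def in_y_def sxy_def)

lemma z0_meval: "z0 p = (%j. meval p (s0 j))"
  by (auto simp: z0_def s0_def fun_eq_iff meval.hom_0 split: sum.splits)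

lemma ratf_z0_rsub: "ratf_z0 = rsub s0"
  by (simp add: fun_eq_iff ratf_z0_def rsub_def mpol_z0_def s0_def)

section \<open>Polynomial families and the annihilator of the powers of f\<close>

text \<open>Polynomial functions of an integer m with coefficients in D, standing for D[s]. Products
  are pointwise, which is consistent because integers are central.\<close>

inductive_set pf :: "'a::ring_1 set => (int => 'a) set" for D where
  const: "c : D ==> (%_. c) : pf D"
| add: "G : pf D ==> G' : pf D ==> (%m. G m + G' m) : pf D"
| mult: "G : pf D ==> (%m. of_int m * G m) : pf D"

lemma pf_mono: "G : pf D ==> D \<subseteq> D' ==> G : pf D'"
  by (induction rule: pf.induct) (auto intro: pf.intros)

locale subring =
  fixes D :: "'a::ring_1 set"
  assumes D1: "1 : D" and Dadd: "!!x y. x : D ==> y : D ==> x + y : D"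
    and Dmult: "!!x y. x : D ==> y : D ==> x * y : D" and Dneg: "!!x. x : D ==> - x : D"
begin

lemma D_of_int: "of_int m : D"
proof -
  have z: "0 : D" using Dadd[OF D1 Dneg[OF D1]] by simp
  have "of_nat k : D" for k by (induction k) (auto intro: z D1 Dadd)
  then show ?thesis by (cases m rule: int_cases2) (auto intro: Dneg)
qed

lemma pf_D: "G : pf D ==> G m : D"
  by (induction rule: pf.induct) (auto intro: Dadd Dmult D_of_int)

lemma pf_lmult: "G : pf D ==> P : D ==> (%m. P * G m) : pf D"
proof (induction rule: pf.induct)
  case (mult G)
  have "(%m. P * (of_int m * G m)) = (%m. of_int m * (P * G m))"
    using of_int_central[of _ P] by (simp add: fun_eq_iff flip: mult.assoc)
  then show ?case using mult by (auto intro: pf.mult)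
qed (auto simp: distrib_left intro: pf.intros Dmult)

lemma pf_mul: "G : pf D ==> G' : pf D ==> (%m. G m * G' m) : pf D"
proof (induction rule: pf.induct)
  case (const c) then show ?case by (rule pf_lmult[rotated])
next
  case (mult G) then show ?case using pf.mult[of "%m. G m * G' m" D] by (simp add: mult.assoc)
qed (auto simp: distrib_right intro: pf.intros)

lemma pf_int: "(%m. of_int (m - j)) : pf D"
  using pf.add[OF pf.mult[OF pf.const[OF D1]] pf.const[OF D_of_int[of "- j"]]] by simp

lemma pf_uminus: "G : pf D ==> (%m. - G m) : pf D"
  using pf_lmult[of G "-1"] Dneg[OF D1] by simp

lemma pf_diff: "G : pf D ==> G' : pf D ==> (%m. G m - G' m) : pf D"
  using pf.add[OF _ pf_uminus[of G'], of G] by simp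

lemma pf_shift: "G : pf D ==> (%m. G (m - j)) : pf D"
proof (induction rule: pf.induct)
  case (mult G) then show ?case by (intro pf_mul pf_int)
qed (auto intro: pf.intros)

lemma pf_reflect: "G : pf D ==> (%m. G (- m - 1)) : pf D"
proof (induction rule: pf.induct)
  case (mult G)
  have "(%m. of_int (- m - 1)) : pf D" using pf_uminus[OF pf_int[of "-1"]] by simp
  then show ?case using mult by (intro pf_mul)
qed (auto intro: pf.intros)

text \<open>The remainder theorem; centrality of the integers makes it valid over a noncommutative
  ring.\<close>

lemma pf_factor: "G : pf D ==> \<exists>w\<in>pf D. \<forall>m. G m - G n = of_int (m - n) * w m"
proof (induction rule: pf.induct)
  case (const c) then show ?case using pf.const[OF D_of_int[of 0]] by (intro bexI[of _ "%_. 0"]) auto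
next
  case (add G G')
  then obtain w w' where "w : pf D" "w' : pf D" "\<forall>m. G m - G n = of_int (m - n) * w m" "\<forall>m. G' m - G' n = of_int (m - n) * w' m" by blast
  then have "\<forall>m. (G m + G' m) - (G n + G' n) = of_int (m - n) * (w m + w' m)"
    by (metis add_diff_add distrib_left)
  then show ?case using pf.add \<open>w : pf D\<close> \<open>w' : pf D\<close> by (intro bexI[of _ "%m. w m + w' m"]) auto
next
  case (mult G)
  then obtain w where w: "w : pf D" "!!m. G m - G n = of_int (m - n) * w m" by blast
  have "of_int m * G m - of_int n * G n = of_int (m - n) * (G m + of_int n * w m)" for m
  proof -
    have "of_int m * G m - of_int n * G n = of_int (m - n) * G m + of_int n * (G m - G n)"
      by (simp add: algebra_simps)
    also have "of_int n * (G m - G n) = of_int (m - n) * (of_int n * w m)"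
      unfolding w(2) by (metis mult.assoc of_int_central)
    finally show ?thesis by (simp add: distrib_left)
  qed
  then show ?case using pf.add[OF mult(1) pf_lmult[OF w(1) D_of_int[of n]]]
    by (intro bexI[of _ "%m. G m + of_int n * w m"]) auto
qed

end

lemma subring_dopS: "dring S ==> subring (dopS S)"
  by standard (auto intro: dring.dopS_1 dring.dopS_add dring.dopS_mult dring.dopS_minus)

lemma subring_dring: "dring S ==> subring S"
  by standard (auto intro: dring.S1 dring.Sadd dring.Smult dring.Sneg)

lemma subring_weyl: "subring (weyl :: ('k::field, 'n::{finite,linorder}) dop set)"
  unfolding weyl_dopS by (rule subring_dopS[OF dring_rpol])

lemma subring_Dop: "subring (Dop (U :: ('n::{finite,linorder} => 'k::field) set))"
  unfolding Dop_dopS by (rule subring_dopS[OF dring_reg])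

lemma pf_mulop: "G : pf S ==> (!!g. g : S ==> mulop g : D) ==> (%m. mulop (G m)) : pf D"
  by (induction rule: pf.induct) (auto simp: mulop_add mulop_mult mulop_of_int intro: pf.intros)

section \<open>The annihilator of f^s in terms of integer exponents\<close>

definition psum :: "('k::field, 'n::{finite,linorder}) dop poly => int => ('k, 'n) dop" where
  "psum P m = (\<Sum>k\<le>degree P. of_int m ^ k * coeff P k)"

lemma psum_superset: "degree P \<le> N ==> psum P m = (\<Sum>k\<le>N. of_int m ^ k * coeff P k)"
  unfolding psum_def by (intro sum.mono_neutral_left) (auto simp: coeff_eq_0)

lemma psum_add: "psum (P + Q) m = psum P m + psum Q m"
  using psum_superset[of P "max (degree P) (degree Q)"] psum_superset[of Q "max (degree P) (degree Q)"]
    psum_superset[of "P + Q" "max (degree P) (degree Q)"] degree_add_le_max[of P Q]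
  by (simp add: distrib_left sum.distrib)

lemma psum_pCons: "psum (pCons c P) m = c + of_int m * psum P m"
proof -
  have "psum (pCons c P) m = (\<Sum>k\<le>Suc (degree P). of_int m ^ k * coeff (pCons c P) k)"
    by (rule psum_superset) (simp add: degree_pCons_le)
  also have "\<dots> = c + (\<Sum>k\<le>degree P. of_int m * (of_int m ^ k * coeff P k))"
    by (subst sum.atMost_Suc_shift) (simp add: mult.assoc)
  finally show ?thesis by (simp add: psum_def sum_distrib_left)
qed

lemma pf_psum: "G : pf D ==> 0 : D ==> (!!x y. x : D ==> y : D ==> x + y : D) ==> \<exists>P. (\<forall>k. coeff P k : D) & G = psum P"
proof (induction rule: pf.induct)
  case (const c)
  then show ?case by (intro exI[of _ "[:c:]"]) (auto simp: psum_pCons psum_def[of 0] coeff_pCons split: nat.splits)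
next
  case (add G G')
  then obtain P Q where "\<forall>k. coeff P k : D" "\<forall>k. coeff Q k : D" "G = psum P" "G' = psum Q" by blast
  then show ?case using add by (intro exI[of _ "P + Q"]) (auto simp: psum_add)
next
  case (mult G)
  then obtain P where "\<forall>k. coeff P k : D" "G = psum P" by blast
  then show ?case using mult by (intro exI[of _ "pCons 0 P"]) (auto simp: psum_pCons coeff_pCons split: nat.splits)
qed

lemma psum_pf:
  fixes P :: "('k::field, 'n::{finite,linorder}) dop poly"
  shows "(!!k. coeff P k : D) ==> psum P : pf D"
proof (induction P)
  case 0
  have "psum 0 = (%_. 0 :: ('k, 'n) dop)" by (simp add: fun_eq_iff psum_def)
  then show ?case using 0[of 0] pf.const[of 0 D] by simp
next
  case (pCons c P)
  have "c : D" "!!k. coeff P k : D" using pCons(3)[of 0] pCons(3)[of "Suc _"] by auto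
  moreover have "psum (pCons c P) = (%m. c + of_int m * psum P m)" by (simp add: fun_eq_iff psum_pCons)
  ultimately show ?case using pf.add[OF pf.const[of c D] pf.mult[OF pCons(2)]] by simp
qed

lemma ratf_of_int_inj: "(of_int m :: ('k::field_char_0, 'n::linorder) ratf) = of_int n \<longleftrightarrow> m = n"
proof -
  have n: "of_nat k = rpol (mconst (of_nat k)) " for k
    by (induction k) (auto simp: mconst.hom_0 rpol.hom_0 mconst.hom_add rpol.hom_add mconst.hom_1 rpol.hom_1)
  have e: "(of_int m :: ('k, 'n) ratf) = rpol (mconst (of_int m :: 'k))" for m
    by (cases m rule: int_cases2) (simp_all add: n mconst.hom_minus rpol.hom_minus)
  have "(mconst (of_int m) :: ('k, 'n) mpol) = mconst (of_int n) \<longleftrightarrow> m = n"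
    using inj_eq[OF inj_single, of "0 :: 'n \<Rightarrow>\<^sub>0 nat" "of_int m :: 'k" "of_int n"] by (simp add: mconst_def)
  then show ?thesis unfolding e rpol_inj .
qed

interpretation dapp: dact app
  by standard (auto simp: app_plus app_add app_times)

lemma rpd_poly: "rpd i (poly g (of_int m)) = poly (map_poly (rpd i) g) (of_int m)"
  by (induction g) (auto simp: map_poly_pCons rpd_add rpd_mult rpd_of_int)

text \<open>At s = m the formal generator becomes the actual power f^m: the extra term s f_i/f of
  the connection is the logarithmic derivative of that power.\<close>

lemma fs_act_eval:
  fixes f :: "('k::field_char_0, 'n::{finite,linorder}) mpol"
  assumes f: "f ~= 0" and P: "P : weyl"
  shows "poly (fs_act f P g) (of_int m) * rpol f powi m = app P (poly g (of_int m) * rpol f powi m)"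
proof -
  let ?E = "%g. poly g (of_int m) * rpol f powi m"
  have F: "rpol f ~= 0" using f by simp
  have "?E (fs_act f P g) - app P (?E g) : {0}"
    unfolding fs_act_def
  proof (rule dapp.conn_act_cong[OF dring_rpol _ _ _ _ _ P[unfolded weyl_dopS], where A=UNIV])
    fix v i
    have p: "rpol f powi m = rpol f powi (m - 1) * rpol f"
      using power_int_add_1[of "rpol f" "m - 1"] F by simp
    have "app (pdop i) (?E v) = poly (map_poly (rpd i) v) (of_int m) * rpol f powi m + poly v (of_int m) * (of_int m * rpol f powi (m - 1) * rpd i (rpol f))"
      by (simp add: rpd_mult rpd_powi[OF F] rpd_poly)
    also have "\<dots> = ?E (map_poly (rpd i) v + [:0, 1:] * smult (rpd i (rpol f) / rpol f) v)"
      using F by (simp add: algebra_simps p)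
    finally show "map_poly (rpd i) v + [:0, 1:] * smult (rpd i (rpol f) / rpol f) v : UNIV &
      ?E (map_poly (rpd i) v + [:0, 1:] * smult (rpd i (rpol f) / rpol f) v) - app (pdop i) (?E v) : {0}" by simp
  qed (auto simp: nsub_def algebra_simps)
  then show ?thesis by simp
qed

text \<open>A polynomial in s over K(x) with all integers as roots is zero, because K(x) has
  characteristic zero. Hence annihilation of f^s can be tested on the integer powers, negative ones
  included.\<close>

lemma fs_ann_iff:
  fixes f :: "('k::field_char_0, 'n::{finite,linorder}) mpol"
  assumes f: "f ~= 0"
  shows "P : fs_ann f \<longleftrightarrow> (\<forall>k. coeff P k : weyl) & (\<forall>m. app (psum P m) (rpol f powi m) = 0)"
proof (cases "\<forall>k. coeff P k : weyl")
  case True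
  let ?G = "\<Sum>k\<le>degree P. monom 1 k * fs_act f (coeff P k) 1"
  have F: "rpol f powi m ~= 0" for m using f by simp
  have ev: "poly ?G (of_int m) * rpol f powi m = app (psum P m) (rpol f powi m)" for m
  proof -
    have oi1: "app (of_int m) h = of_int m * h" for h :: "('k, 'n) ratf"
      by (metis app_mulop mulop_of_int)
    have oi: "app (of_int m ^ k) h = of_int m ^ k * h" for k and h :: "('k, 'n) ratf"
      by (induction k) (simp_all add: app_times oi1 mult.assoc)
    have "poly ?G (of_int m) * rpol f powi m = (\<Sum>k\<le>degree P. of_int m ^ k * (poly (fs_act f (coeff P k) 1) (of_int m) * rpol f powi m))"
      by (simp add: poly_sum poly_monom sum_distrib_right mult.assoc)
    also have "\<dots> = (\<Sum>k\<le>degree P. of_int m ^ k * app (coeff P k) (rpol f powi m))"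
      using fs_act_eval[OF f, of _ 1 m] True by simp
    finally show ?thesis by (simp add: psum_def app_sum app_times oi)
  qed
  have "?G = 0 \<longleftrightarrow> (\<forall>m. poly ?G (of_int m) = 0)"
  proof
    assume z: "\<forall>m::int. poly ?G (of_int m) = 0"
    have "range (of_int :: int => ('k, 'n) ratf) \<subseteq> {x. poly ?G x = 0}" using z by auto
    moreover have "infinite (range (of_int :: int => ('k, 'n) ratf))"
      using finite_imageD[of of_int UNIV] ratf_of_int_inj infinite_UNIV_int by (auto simp: inj_on_def)
    ultimately show "?G = 0" using poly_roots_finite infinite_super by blast
  qed simp
  also have "\<dots> \<longleftrightarrow> (\<forall>m. app (psum P m) (rpol f powi m) = 0)"
    unfolding ev[symmetric] mult_eq_0_iff using F by blast
  finally show ?thesis using True by (simp add: fs_ann_def)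
next
  case False
  then show ?thesis unfolding fs_ann_def by blast
qed

lemma fs_ann_at_eq:
  fixes f :: "('k::field_char_0, 'n::{finite,linorder}) mpol"
  assumes f: "f ~= 0"
  shows "fs_ann_at f \<nu> = {G \<nu> | G. G : pf weyl & (\<forall>m. app (G m) (rpol f powi m) = 0)}"
proof -
  have "fs_ann_at f \<nu> = {psum P \<nu> | P. P : fs_ann f}" by (simp add: fs_ann_at_def psum_def)
  also have "\<dots> = {G \<nu> | G. G : pf weyl & (\<forall>m. app (G m) (rpol f powi m) = 0)}"
  proof (intro equalityI subsetI)
    fix x assume "x : {psum P \<nu> | P. P : fs_ann f}"
    then show "x : {G \<nu> | G. G : pf weyl & (\<forall>m. app (G m) (rpol f powi m) = 0)}"
      unfolding fs_ann_iff[OF f] using psum_pf by blast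
  next
    fix x assume "x : {G \<nu> | G. G : pf weyl & (\<forall>m. app (G m) (rpol f powi m) = 0)}"
    then obtain G where G: "x = G \<nu>" "G : pf weyl" "\<forall>m. app (G m) (rpol f powi m) = 0" by blast
    obtain P where "\<forall>k. coeff P k : weyl" "G = psum P" using pf_psum[OF G(2) weyl_0 weyl_add] by blast
    then show "x : {psum P \<nu> | P. P : fs_ann f}" unfolding fs_ann_iff[OF f] using G by blast
  qed
  finally show ?thesis .
qed

text \<open>Membership in \<open>dopS UNIV\<close> singles out the operators of finite order among
  all additive maps; these are linear over K, so the scalars c(m) pass through them.\<close>

lemma const_commute: "T : dopS UNIV ==> T * polop (mconst c) = polop (mconst c) * T"
  for T :: "('k::field_char_0, 'n::{finite,linorder}) dop"
proof (induction T rule: dring.dopS_induct[OF dring_UNIV, consumes 1, case_names zero add monom])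
  case (monom g \<alpha>)
  have p: "polop (mconst c) * pdop i = pdop i * polop (mconst c)" for i :: 'n
    by (simp add: polop_eq pdop_mulop)
  have "monom_at pdop \<alpha> * polop (mconst c) = polop (mconst c) * monom_at pdop \<alpha>"
    by (rule commute_monom_at[symmetric]) (rule p)
  then have "mulop g * monom_at pdop \<alpha> * polop (mconst c) = (mulop g * polop (mconst c)) * monom_at pdop \<alpha>"
    by (simp only: mult.assoc)
  also have "\<dots> = polop (mconst c) * (mulop g * monom_at pdop \<alpha>)"
    unfolding polop_eq mulop_commute[of g] by (simp only: mult.assoc)
  finally show ?case .
qed (auto simp: distrib_left distrib_right)

lemma dopS_UNIV: "P : dopS S ==> P : dopS UNIV"
  using dopS_mono[of S UNIV] by blast

lemma app_const: "T : dopS UNIV ==> app T (rpol (mconst c) * u) = rpol (mconst c) * app T u"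
  for T :: "('k::field_char_0, 'n::{finite,linorder}) dop"
  using arg_cong[OF const_commute[of T c], of "%P. app P u"] by (simp add: app_times polop_eq)

lemma mconst_of_int: "mconst (of_int m) = of_int m"
proof -
  have n: "of_nat k = mconst (of_nat k) " for k
    by (induction k) (auto simp: mconst.hom_0 mconst.hom_add mconst.hom_1)
  show ?thesis
    by (cases m rule: int_cases2) (simp_all add: n mconst.hom_minus)
qed

lemma rpol_of_int: "rpol (of_int m) = of_int m"
proof -
  have n: "of_nat k = rpol (of_nat k) " for k
    by (induction k) (auto simp: rpol.hom_0 rpol.hom_add rpol.hom_1)
  show ?thesis
    by (cases m rule: int_cases2) (simp_all add: n rpol.hom_minus)
qed

definition Kp :: "'k::field_char_0 poly => int => ('k, 'n::{finite,linorder}) ratf" where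
  "Kp c m = rpol (mconst (poly c (of_int m)))"

lemma Kp_pf:
  fixes S :: "('k::field_char_0, 'n::{finite,linorder}) ratf set"
  assumes "!!c. rpol (mconst c) : S" shows "Kp c : pf S"
proof (induction c)
  case 0
  have "(Kp 0 :: int => ('k, 'n) ratf) = (%_. rpol (mconst 0))" by (simp add: fun_eq_iff Kp_def)
  then show ?case using pf.const[OF assms[of 0]] by simp
next
  case (pCons a c)
  have "(Kp (pCons a c) :: int => ('k, 'n) ratf) = (%m. rpol (mconst a) + of_int m * Kp c m)"
    by (simp add: fun_eq_iff Kp_def mconst.hom_add mconst.hom_mult rpol.hom_add rpol.hom_mult mconst_of_int rpol_of_int)
  then show ?case using pf.add[OF pf.const[OF assms] pf.mult[OF pCons(2)]] by simp
qed

section \<open>The cyclic module generated by a power of f\<close>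

text \<open>Below \<nu> the polynomial \<open>bf\<close> has no integer root, so there the
  functional equation can be solved for the lower power. Both h and R depend on the point.\<close>

locale powers =
  fixes f :: "('k::field_char_0, 'n::{finite,linorder}) mpol" and bf :: "'k poly" and \<nu> :: int
  assumes f0: "f ~= 0" and bmin: "!!m. poly bf (of_int m) = 0 ==> \<nu> \<le> m"
    and FE: "!!p. \<exists>h R. meval p h ~= 0 & R : pf weyl &
      (\<forall>m. app (R m) (rpol f powi (m + 1)) = rpol h * Kp bf m * rpol f powi m)"
begin

abbreviation "Fp m \<equiv> rpol f powi (m :: int)"
abbreviation "J \<equiv> fs_ann_at f \<nu>"

lemma F0: "rpol f ~= 0" using f0 by simp

lemma Fp_add: "Fp (m + n) = Fp m * Fp n" using F0 by (simp add: power_int_add)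

lemma J_kill: "P : J ==> app P (Fp \<nu>) = 0" unfolding fs_ann_at_eq[OF f0] by blast

lemma J_weyl: "J \<subseteq> weyl"
  unfolding fs_ann_at_eq[OF f0] using subring.pf_D[OF subring_weyl] by blast

lemma J_nsub: "nsub J"
proof -
  have "0 : J" unfolding fs_ann_at_eq[OF f0] using pf.const[OF weyl_0] by force
  moreover have "x + y : J" if xy: "x : J" "y : J" for x y
  proof -
    obtain G G' where "x = G \<nu>" "G : pf weyl" "\<forall>m. app (G m) (Fp m) = 0" "y = G' \<nu>" "G' : pf weyl" "\<forall>m. app (G' m) (Fp m) = 0"
      using xy unfolding fs_ann_at_eq[OF f0] by blast
    then show ?thesis unfolding fs_ann_at_eq[OF f0] using pf.add[of G weyl G'] by (force simp: app_plus)
  qed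
  moreover have "- x : J" if x: "x : J" for x
  proof -
    obtain G where "x = G \<nu>" "G : pf weyl" "\<forall>m. app (G m) (Fp m) = 0"
      using x unfolding fs_ann_at_eq[OF f0] by blast
    then show ?thesis unfolding fs_ann_at_eq[OF f0] using subring.pf_uminus[OF subring_weyl, of G] by (force simp: app_uminus)
  qed
  ultimately show ?thesis by (simp add: nsub_def)
qed

lemma J_act: assumes "R : weyl" "x : J" shows "R * x : J"
proof -
  obtain G where "x = G \<nu>" "G : pf weyl" "\<forall>m. app (G m) (Fp m) = 0"
    using assms(2) unfolding fs_ann_at_eq[OF f0] by blast
  then show ?thesis unfolding fs_ann_at_eq[OF f0] using subring.pf_lmult[OF subring_weyl, of G R] assms(1)
    by (force simp: app_times)
qed

lemma lower: "\<exists>P\<in>Dop {p}. app P (Fp \<nu>) = Fp (\<nu> - int k)"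
proof (induction k)
  case 0 then show ?case using Dop_1 by (intro bexI[of _ 1]) auto
next
  case (Suc k)
  then obtain P where P: "P : Dop {p}" "app P (Fp \<nu>) = Fp (\<nu> - int k)" by blast
  \<comment> \<open>Strictly below \<nu>, hence not a root of \<open>bf\<close>.\<close>
  let ?m = "\<nu> - int (Suc k)"
  obtain h R where h: "meval p h ~= 0" "R : pf weyl" "!!m. app (R m) (Fp (m + 1)) = rpol h * Kp bf m * Fp m"
    using FE[of p] by blast
  let ?c = "poly bf (of_int ?m)"
  have c: "?c ~= 0" using bmin[of ?m] by auto
  let ?g = "h * mconst ?c"
  have g: "meval p ?g ~= 0" using h c by (simp add: meval.hom_mult)
  have "?g ~= 0" by (rule meval_nz[OF g])
  then have g0: "rpol ?g ~= 0" by (simp only: rpol_eq_0 not_False_eq_True)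
  have "app (R ?m) (app P (Fp \<nu>)) = rpol ?g * Fp ?m"
    using h(3)[of ?m] P(2) by (simp add: Kp_def rpol.hom_mult)
  then have "app (mulop (inverse (rpol ?g)) * (R ?m * P)) (Fp \<nu>) = Fp ?m"
    using g0 by (simp add: app_times)
  moreover have "mulop (inverse (rpol ?g)) * (R ?m * P) : Dop {p}"
    using subring.pf_D[OF subring_weyl h(2)] P(1) g by (intro Dop_mult Dop_mulop inverse_reg) (auto intro: weyl_Dop)
  ultimately show ?case by blast
qed

text \<open>The version of \<open>lower\<close> for a variable exponent. The values of
  \<open>bf\<close> along the way cannot be inverted for all m at once, so their product c(m) stays
  on the right; only c(\<nu>) has to be nonzero.\<close>

lemma lower_family:
  "\<exists>S c. S : pf (Dop {p}) & poly c (of_int \<nu>) ~= 0 & (\<forall>m. app (S m) (Fp m) = Kp c m * Fp (m - int k))"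
proof (induction k)
  case 0
  show ?case using pf.const[OF Dop_1]
    by (intro exI[of _ "%_. 1"] exI[of _ 1]) (auto simp: Kp_def mconst.hom_1 rpol.hom_1)
next
  case (Suc k)
  then obtain S c where S: "S : pf (Dop {p})" "poly c (of_int \<nu>) ~= 0" "!!m. app (S m) (Fp m) = Kp c m * Fp (m - int k)" by blast
  obtain h R where h: "meval p h ~= 0" "R : pf weyl" "!!m. app (R m) (Fp (m + 1)) = rpol h * Kp bf m * Fp m"
    using FE[of p] by blast
  \<comment> \<open>\<open>?b\<close> is m \<mapsto> bf(m - k - 1), the factor contributed by the
    next step down.\<close>
  let ?R = "%m. R (m - int (Suc k))" and ?b = "pcompose bf [:- of_nat (Suc k), 1:]"
  let ?S = "%m. mulop (inverse (rpol h)) * (?R m * S m)"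
  have hn: "rpol h ~= 0" using h(1) by auto
  have R: "R : pf (Dop {p})" using h(2) pf_mono weyl_Dop by blast
  have "?S : pf (Dop {p})"
    by (intro subring.pf_lmult[OF subring_Dop] subring.pf_mul[OF subring_Dop] subring.pf_shift[OF subring_Dop] R S Dop_mulop inverse_reg)
      (use h in auto)
  moreover have b: "poly ?b (of_int m) = poly bf (of_int (m - int (Suc k)))" for m
    by (simp add: poly_pcompose algebra_simps)
  have "poly (?b * c) (of_int \<nu>) ~= 0"
    using S(2) b bmin[of "\<nu> - int (Suc k)"] by (auto simp: poly_mult)
  moreover have "app (?S m) (Fp m) = Kp (?b * c) m * Fp (m - int (Suc k))" for m
  proof -
    have "app (?R m) (app (S m) (Fp m)) = Kp c m * app (?R m) (Fp (m - int (Suc k) + 1))"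
      unfolding S(3) Kp_def
      by (subst app_const) (use subring.pf_D[OF subring_weyl h(2)] weyl_UNIV in auto)
    also have "\<dots> = rpol h * (Kp (?b * c) m * Fp (m - int (Suc k)))"
      unfolding h(3) by (simp only: Kp_def poly_mult b mconst.hom_mult rpol.hom_mult mult_ac)
    finally show ?thesis using hn by (simp add: app_times)
  qed
  ultimately show ?case by blast
qed

text \<open>Each derivative lowers the exponent of f by one and brings down a factor linear in m, so
  the coefficient u is polynomial in m and k bounds the loss uniformly.\<close>

lemma app_family:
  assumes "P : Dop {p}"
  shows "\<exists>k u. u : pf (reg {p}) & (\<forall>m. app P (Fp m) = u m * Fp (m - int k))"
proof -
  interpret reg: dring "reg {p}" by (rule dring_reg)
  interpret sr: subring "reg {p}" by (rule subring_dring[OF dring_reg])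
  have raise: "(%m. u m * rpol f ^ l) : pf (reg {p})" if "u : pf (reg {p})" for u l
    by (rule sr.pf_mul[OF that pf.const]) (rule reg.Spow[OF rpol_reg])
  have Fl: "Fp (m - int k) = rpol f ^ l * Fp (m - int (k + l))" for m k l
    using Fp_add[of "int l" "m - int (k + l)"] by (simp add: algebra_simps)
  have d: "(%m. rpd i (u m)) : pf (reg {p})" if "u : pf (reg {p})" for u i
    using that by (induction rule: pf.induct) (auto simp: rpd_add rpd_mult rpd_of_int intro: pf.intros reg.Sd)
  show ?thesis using assms
  proof (induction P rule: Dop_induct)
    case zero
    then show ?case using pf.const[OF reg.S0] by (intro exI[of _ 0] exI[of _ "%_. 0"]) auto
  next
    case (add P Q)
    obtain k u where k: "u : pf (reg {p})" "!!m. app P (Fp m) = u m * Fp (m - int k)" using add(3) by blast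
    obtain l v where l: "v : pf (reg {p})" "!!m. app Q (Fp m) = v m * Fp (m - int l)" using add(4) by blast
    have "app (P + Q) (Fp m) = (u m * rpol f ^ l + v m * rpol f ^ k) * Fp (m - int (k + l))" for m
      using Fl[of m k l] Fl[of m l k] by (simp add: app_plus k l algebra_simps)
    then show ?case using pf.add[OF raise[OF k(1), of l] raise[OF l(1), of k]] by blast
  next
    case (monom g \<alpha>)
    have "\<exists>k u. u : pf (reg {p}) & (\<forall>m. app (monom_at pdop \<alpha>) (Fp m) = u m * Fp (m - int k))"
    proof (induction \<alpha> rule: expo_induct)
      case 0
      then show ?case using pf.const[OF reg.S1] by (intro exI[of _ 0] exI[of _ "%_. 1"]) auto
    next
      case (step \<alpha> i)
      then obtain k u where k: "u : pf (reg {p})" "!!m. app (monom_at pdop \<alpha>) (Fp m) = u m * Fp (m - int k)" by blast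
      let ?v = "%m. rpd i (u m) * rpol f ^ 1 + u m * of_int (m - int k) * rpd i (rpol f)"
      have "app (monom_at pdop (\<alpha> + Poly_Mapping.single i 1)) (Fp m) = ?v m * Fp (m - int (k + 1))" for m
      proof -
        have e: "m - int k - 1 = m - int (k + 1)" by simp
        have "app (monom_at pdop (\<alpha> + Poly_Mapping.single i 1)) (Fp m) = rpd i (u m * Fp (m - int k))"
          unfolding monom_at_step[OF comfam_pdop] by (simp add: app_times k)
        also have "\<dots> = rpd i (u m) * Fp (m - int k) + u m * (of_int (m - int k) * Fp (m - int (k + 1)) * rpd i (rpol f))"
          unfolding rpd_mult rpd_powi[OF F0] e ..
        finally show ?thesis unfolding Fl[of m k 1] by (simp add: algebra_simps)
      qed
      moreover have "?v : pf (reg {p})"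
        by (intro pf.add raise d k sr.pf_mul sr.pf_int pf.const reg.Sd rpol_reg)
      ultimately show ?case by blast
    qed
    then obtain k u where k: "u : pf (reg {p})" "!!m. app (monom_at pdop \<alpha>) (Fp m) = u m * Fp (m - int k)" by blast
    then show ?case using sr.pf_lmult[OF k(1) monom] by (intro exI[of _ k] exI[of _ "%m. g * u m"]) (auto simp: app_times)
  qed
qed

lemma pf_clear: "G : pf (Dop {p :: 'n => 'k}) ==> \<exists>h. meval p h ~= 0 & (%m. polop h * G m) : pf weyl"
proof (induction rule: pf.induct)
  case (const c)
  then show ?case using Dop_clear[of c p] pf.const by blast
next
  case (add G G')
  then obtain h h' where h: "meval p h ~= 0" "(%m. polop h * G m) : pf weyl" "meval p h' ~= 0" "(%m. polop h' * G' m) : pf weyl" by blast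
  have "(%m. polop (h * h') * (G m + G' m)) = (%m. polop h' * (polop h * G m) + polop h * (polop h' * G' m))"
    by (simp only: polop_mult distrib_left mult.assoc[symmetric] polop_commute[of h h'])
  also have "\<dots> : pf weyl" by (intro pf.add subring.pf_lmult[OF subring_weyl] h weyl_polop)
  finally show ?case using h by (intro exI[of _ "h * h'"]) (auto simp: meval.hom_mult)
next
  case (mult G)
  then obtain h where h: "meval p h ~= 0" "(%m. polop h * G m) : pf weyl" by blast
  have "(%m. polop h * (of_int m * G m)) = (%m. of_int m * (polop h * G m))"
    using of_int_central[of _ "polop h"] by (simp add: fun_eq_iff flip: mult.assoc)
  then show ?case using h pf.mult[OF h(2)] by auto
qed

text \<open>Near p the ideal \<open>J\<close> is the whole annihilator of f^\<nu>. If P f^m = u(m)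
  f^{m-k}, then u(\<nu>) = 0 gives u(m) = (m - \<nu>) w(m), and S(m) f^m = c(m) f^{m-k} by
  \<open>lower_family\<close>. So c(m) P - (m - \<nu>) w(m) S(m) kills every f^m, and its value at
  \<nu> is the nonzero constant c(\<nu>) times P.\<close>

lemma kill_J:
  assumes P: "P : Dop {p}" and 0: "app P (Fp \<nu>) = 0"
  shows "\<exists>h. meval p h ~= 0 & polop h * P : J"
proof -
  obtain k u where u: "u : pf (reg {p})" "!!m. app P (Fp m) = u m * Fp (m - int k)" using app_family[OF P] by blast
  have u0: "u \<nu> = 0" using 0 u(2)[of \<nu>] F0 by simp
  obtain w where w: "w : pf (reg {p})" "!!m. u m = of_int (m - \<nu>) * w m"
    using subring.pf_factor[OF subring_dring[OF dring_reg] u(1), of \<nu>] u0 by auto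
  obtain S c where S: "S : pf (Dop {p})" "poly c (of_int \<nu>) ~= 0" "!!m. app (S m) (Fp m) = Kp c m * Fp (m - int k)"
    using lower_family[of p k] by blast
  have "Kp c : pf (reg {p})" by (rule Kp_pf) (rule rpol_reg)
  then obtain \<gamma> where g: "\<gamma> : pf (reg {p})" "!!m. Kp c m - Kp c \<nu> = of_int (m - \<nu>) * \<gamma> m"
    using subring.pf_factor[OF subring_dring[OF dring_reg], of "Kp c" "{p}" \<nu>] by auto
  let ?Q = "%m. mulop (w m) * S m - mulop (\<gamma> m) * P"
  \<comment> \<open>Here c(m) is written as c(\<nu>) + (m - \<nu>) \<gamma>(m), which collects all
    terms divisible by m - \<nu> and makes the value at \<nu> visible.\<close>
  let ?G = "%m. polop (mconst (poly c (of_int \<nu>))) * P - of_int (m - \<nu>) * ?Q m"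
  have Q: "?Q : pf (Dop {p})"
    by (intro subring.pf_diff[OF subring_Dop] subring.pf_mul[OF subring_Dop] pf.const P S pf_mulop[OF w(1)] pf_mulop[OF g(1)] Dop_mulop)
  have G: "?G : pf (Dop {p})"
    by (intro subring.pf_diff[OF subring_Dop] subring.pf_mul[OF subring_Dop] subring.pf_int[OF subring_Dop] pf.const Dop_mult Dop_polop P Q)
  have kill: "app (?G m) (Fp m) = 0" for m
  proof -
    let ?i = "of_int (m - \<nu>) :: ('k, 'n) ratf" and ?F = "Fp (m - int k)"
    have oi: "app (of_int (m - \<nu>)) h = ?i * h" for h by (metis app_mulop mulop_of_int)
    have "app (?G m) (Fp m) = Kp c \<nu> * (?i * w m * ?F) - ?i * (w m * (Kp c m * ?F) - \<gamma> m * (?i * w m * ?F))"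
      by (simp only: app_diff app_times oi app_mulop polop_eq S(3) u(2) w(2) Kp_def)
    also have "\<dots> = ?i * w m * ?F * (Kp c \<nu> - Kp c m + ?i * \<gamma> m)" by (simp only: algebra_simps)
    also have "\<dots> = 0" using g(2)[of m] by (simp add: algebra_simps)
    finally show ?thesis .
  qed
  obtain h where h: "meval p h ~= 0" "(%m. polop h * ?G m) : pf weyl" using pf_clear[OF G] by blast
  have "polop h * ?G \<nu> : J"
    unfolding fs_ann_at_eq[OF f0] using h(2) kill by (intro CollectI exI[of _ "%m. polop h * ?G m"]) (auto simp: app_times)
  then have "polop (h * mconst (poly c (of_int \<nu>))) * P : J" by (simp add: polop_mult mult.assoc)
  then show ?thesis using h(1) S(2) by (intro exI[of _ "h * mconst (poly c (of_int \<nu>))"]) (auto simp: meval.hom_mult)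
qed

section \<open>Comparison of O[f^{-1}] with the module defined by J_f(\<nu>)\<close>

sublocale Jq: weyl_quot "(*)" weyl J
  by standard (use J_act J_weyl J_nsub in \<open>auto simp: algebra_simps nsub_def weyl_0 weyl_add weyl_minus weyl_mult\<close>)

lemma JRQ_iff: fixes p :: "'n => 'k" assumes "c : Dop {p}" shows "c : Jq.RQ p \<longleftrightarrow> app c (Fp \<nu>) = 0"
proof
  assume "c : Jq.RQ p"
  then obtain h where "meval p h ~= 0" "polop h * c : J" by (auto simp: Jq.RQ_def)
  then show "app c (Fp \<nu>) = 0" using J_kill[of "polop h * c"] by (auto simp: app_times polop_eq)
qed (use kill_J[OF assms] in \<open>auto simp: Jq.RQ_def\<close>)

lemma JCQ: fixes p :: "'n => 'k" shows "Jq.CQ p = Dop {p}"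
proof (intro equalityI subsetI)
  fix c assume "c : Jq.CQ p"
  then obtain h w where h: "meval p h ~= 0" "w : weyl" "c = mulop (inverse (rpol h)) * w" unfolding Jq.CQ_def by blast
  show "c : Dop {p}" unfolding h(3) by (rule Dop_mult[OF Dop_mulop[OF inverse_reg] weyl_Dop[OF h(2)]]) (use h(1) in simp)
next
  fix c assume "c : Dop {p}"
  then show "c : Jq.CQ p" using Jq.CQ_act[OF _ weyl_1, of c p] by simp
qed

lemma Fp_Oloc: "Fp m : Oloc f U"
proof (cases m rule: int_cases2)
  case (nonneg n)
  then show ?thesis using reg_Oloc dring.Spow[OF dring_reg rpol_reg] by (metis power_int_of_nat subsetD)
next
  case (nonpos n)
  then have "Fp m = 1 / rpol f ^ n" by (simp add: power_int_minus divide_inverse)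
  then show ?thesis unfolding Oloc_def using dring.S1[OF dring_reg] by blast
qed

lemma Oloc_lift: assumes "g : Oloc f U" "p : U" shows "\<exists>c\<in>Dop {p}. app c (Fp \<nu>) = g"
proof -
  obtain h k where h: "h : reg U" "g = h / rpol f ^ k" using assms unfolding Oloc_def by blast
  \<comment> \<open>\<open>lower\<close> reaches the exponent \<nu> - j with j = |\<nu>| + k;
    multiplying by f^e with e = |\<nu>| - \<nu> \<ge> 0 brings it to exactly -k.\<close>
  let ?e = "nat (\<bar>\<nu>\<bar> - \<nu>)" and ?j = "nat \<bar>\<nu>\<bar> + k"
  obtain P where P: "P : Dop {p}" "app P (Fp \<nu>) = Fp (\<nu> - int ?j)" using lower by blast
  have "rpol f ^ ?e * Fp (\<nu> - int ?j) = Fp (int ?e + (\<nu> - int ?j))" by (simp only: Fp_add power_int_of_nat)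
  also have "int ?e + (\<nu> - int ?j) = - int k" by simp
  finally have "h * rpol f ^ ?e * Fp (\<nu> - int ?j) = g" by (simp add: h power_int_minus divide_inverse mult.assoc)
  then have "app (mulop (h * rpol f ^ ?e) * P) (Fp \<nu>) = g" by (simp add: app_times P)
  moreover have "h : reg {p}" using h(1) reg_antimono[of "{p}" U] assms(2) by blast
  then have "mulop (h * rpol f ^ ?e) * P : Dop {p}"
    by (intro Dop_mult Dop_mulop P dring.Smult[OF dring_reg] dring.Spow[OF dring_reg] rpol_reg)
  ultimately show ?thesis by blast
qed

text \<open>A function is described by any operator regular at p that produces it from f^\<nu>; by
  \<open>JRQ_iff\<close> the ambiguity is \<open>Jq.RQ p\<close>.\<close>

definition RlO :: "('n => 'k) => ('n => 'k) set => ('k, 'n) ratf => ('k, 'n) dop => bool" where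
  "RlO p U s c \<longleftrightarrow> zopen U & p : U & s : Oloc f U & c : Dop {p} & app c (Fp \<nu>) = s"

lemma O_psh: "carr (sec (O_loc_psh f) U) = Oloc f U" "addm (sec (O_loc_psh f) U) = (+)"
  "zerom (sec (O_loc_psh f) U) = 0" "smul (sec (O_loc_psh f) U) = app" "res (O_loc_psh f) U V g = g"
  by (simp_all add: O_loc_psh_def Oloc_def)

lemma O_loc_model: "model (%p. p) (O_loc_psh f) Jq.CQ Jq.RQ (*) RlO"
proof
  fix U :: "('n => 'k) set" and p s assume U: "zopen U" "p : U" "s : carr (sec (O_loc_psh f) U)"
  then have s: "s : Oloc f U" by (simp add: O_psh)
  obtain c where c: "c : Dop {p}" "app c (Fp \<nu>) = s" using Oloc_lift[OF s U(2)] by blast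
  obtain V where V: "zopen V" "p : V" "c : Dop V" using Dop_germ[OF c(1)] by blast
  have "RlO q U s c" if "q : U \<inter> V" for q
    unfolding RlO_def using s c U V(3) that Dop_antimono[of "{q}" V] by auto
  then show "\<exists>U' c. zopen U' & p : U' & U' \<subseteq> U & c : Jq.CQ p & (\<forall>q. q : U' --> RlO q U s c)"
    using U V c zopen_Int[OF U(1) V(1)] unfolding JCQ by blast
next
  fix p c assume "c : Jq.CQ p"
  then have "c : Dop {p}" by (simp add: JCQ)
  then obtain V where V: "zopen V" "p : V" "c : Dop V" using Dop_germ by blast
  have "app c (Fp \<nu>) : Oloc f V"
    using dring.dopS_app[OF dring_Oloc[OF f0] _ Fp_Oloc] V(3) dopS_mono[OF reg_Oloc] unfolding Dop_dopS by blast
  then have "RlO q V (app c (Fp \<nu>)) c" if "q : V" for q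
    unfolding RlO_def using V that Dop_antimono[of "{q}" V] by auto
  then show "\<exists>U s. zopen U & p : U & (\<forall>q. q : U --> RlO q U s c)" using V by blast
next
  fix p U s c V t c' assume "RlO p U s c" "RlO p V t c'"
  then have *: "zopen U" "p : U" "c : Dop {p}" "app c (Fp \<nu>) = s" "zopen V" "p : V" "c' : Dop {p}" "app c' (Fp \<nu>) = t"
    by (auto simp: RlO_def)
  have "c - c' : Jq.RQ p \<longleftrightarrow> s = t"
    unfolding JRQ_iff[OF Dop_diff[OF *(3,7)]] using * by (simp add: app_diff)
  then show "c - c' : Jq.RQ p \<longleftrightarrow> (\<exists>W. zopen W & p : W & W \<subseteq> U \<inter> V & res (O_loc_psh f) U W s = res (O_loc_psh f) V W t)"
    using zopen_Int[OF *(1,5)] * unfolding O_psh by blast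
next
  fix p U s c t c' assume "RlO p U s c" "RlO p U t c'"
  then show "RlO p U (addm (sec (O_loc_psh f) U) s t) (c + c')"
    by (auto simp: RlO_def O_psh app_plus intro: dring.Sadd[OF dring_Oloc[OF f0]] Dop_add)
next
  fix p U s c P assume a: "RlO p U s c" "P : Dop ((%p. p) -` U)"
  then have P: "P : Dop {p}" "P : dopS (Oloc f U)"
    using Dop_antimono[of "{p}" U] dopS_mono[OF reg_Oloc] by (auto simp: RlO_def Dop_dopS)
  then show "RlO p U (smul (sec (O_loc_psh f) U) P s) (P * c)"
    using a by (auto simp: RlO_def O_psh app_times intro: dring.dopS_app[OF dring_Oloc[OF f0]] Dop_mult)
qed (use subsetD[OF Oloc_antimono] in \<open>auto simp: Jq.RQ_nsub RlO_def O_psh zopen_UNIV Dop_0 intro: dring.S0[OF dring_Oloc[OF f0]]\<close>)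

lemma O_loc_iso: "dmod_iso (O_loc f) (D_tensor (quot weyl_mod J))"
proof -
  have "quot weyl_mod J = Jq.Q" by (simp add: Jq.Q_def weyl_mod_def)
  then show ?thesis unfolding O_loc_def D_tensor_def sheafify_def
    using dmod_iso_models[OF O_loc_model Jq.T.model] by simp
qed

end

section \<open>The functional equation\<close>

lemma (in dact) lspan_stable:
  assumes W: "nsub W" "!!P w. P : weyl ==> w : W ==> act P w : W" and S: "S \<subseteq> W"
  defines "L \<equiv> lspan (natmod act W) weyl S"
  shows "nsub L" "L \<subseteq> W" "S \<subseteq> L" "P : weyl ==> w : L ==> act P w : L"
proof -
  let ?T = "{act r x | r x. r : weyl & x : S}"
  have L: "L = addspan (natmod act W) ?T" by (simp add: L_def lspan_def)
  show n: "nsub L" unfolding L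
  proof (rule addspan_natmod_nsub)
    fix y assume "y : ?T"
    then obtain r x where r: "r : weyl" "x : S" "y = act r x" by blast
    have "- y = act (- r) x" by (simp add: r act_minusl)
    then show "- y : ?T" using r weyl_minus by blast
  qed
  show "L \<subseteq> W" unfolding L using addspan_sub[OF _ W(1)] W(2) S by blast
  have g: "act r x : L" if "r : weyl" "x : S" for r x
    unfolding L by (rule addspan_gen) (use that in blast)
  then show "S \<subseteq> L" using weyl_1 act_1 by (metis subsetI)
  assume P: "P : weyl"
  have V: "nsub {w. act P w : L}"
    using nsubD[OF n] by (auto simp: nsub_def act_addr act_minusr)
  assume "w : L"
  then have "w : {w. act P w : L}" unfolding L
  proof (rule addspan_sub)
    show "nsub {w. act P w : addspan (natmod act W) ?T}" using V unfolding L .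
    have "act P (act r x) : L" if "r : weyl" "x : S" for r x
      using g[OF weyl_mult[OF P that(1)] that(2)] by (simp add: act_mult)
    then show "?T \<subseteq> {w. act P w : addspan (natmod act W) ?T}" unfolding L by blast
  qed
  then show "act P w : L" by simp
qed

interpretation dmul: dact "(*)"
  by standard (auto simp: algebra_simps)

lemma common_denominator:
  assumes "finite A" "!!x. x : A ==> g x : reg {p}"
  shows "\<exists>h. meval p h ~= 0 & (\<forall>x\<in>A. \<exists>d. rpol h * g x = rpol (d :: ('k::field, 'n::{finite,linorder}) mpol))"
  using assms
proof (induction A)
  case empty then show ?case by (intro exI[of _ 1]) (simp add: meval.hom_1)
next
  case (insert x A)
  then obtain h where h: "meval p h ~= 0" "!!x. x : A ==> \<exists>d. rpol h * g x = rpol d" by blast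
  obtain a b where ab: "meval p b ~= 0" "g x = rpol a / rpol b" using insert(4)[of x] unfolding reg_pt by blast
  then have "b ~= 0" by auto
  then have "rpol (h * b) * g x = rpol (h * a)" by (simp add: ab rpol.hom_mult)
  moreover have "\<exists>d. rpol (h * b) * g y = rpol d" if y: "y : A" for y
  proof -
    obtain d where "rpol h * g y = rpol d" using h(2)[OF y] by blast
    then have "rpol (h * b) * g y = rpol (b * d)" by (simp add: rpol.hom_mult mult_ac)
    then show ?thesis by blast
  qed
  ultimately show ?case using h(1) ab(1) by (intro exI[of _ "h * b"]) (auto simp: meval.hom_mult)
qed

locale graph =
  fixes f :: "('k::field_char_0, 'n::{finite,linorder}) mpol"
  assumes f0: "f ~= 0"
begin

text \<open>\<open>ix\<close> regards a function of x as a function of (t, x), and \<open>sg\<close>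
  puts t = f(x). The functions in \<open>L\<close> have no pole along the graph, and
  \<open>delta\<close> = 1/(t - f) modulo \<open>L\<close> plays the delta function.\<close>

definition ix :: "'n => ('k, unit + 'n) mpol" where "ix = (%i. mvar (Inr i))"
definition sg :: "unit + 'n => ('k, 'n) mpol" where "sg = case_sum (%_. f) mvar"
definition tt :: "('k, unit + 'n) ratf" where "tt = rpol (mvar (Inl ()))"
definition tau :: "('k, unit + 'n) ratf" where "tau = tt - rpol (msubst ix f)"
abbreviation "delta \<equiv> inverse tau"
abbreviation "dt \<equiv> rpd (Inl ()) :: ('k, unit + 'n) ratf => _"
abbreviation "\<iota> q \<equiv> rpol (msubst ix q)"
abbreviation "L \<equiv> regS sg"
abbreviation "Fp m \<equiv> rpol f powi (m :: int)"

interpretation L: dring L by (rule dring_regS)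

lemma F0: "rpol f ~= 0" using f0 by simp

lemma sg_ix: "msubst sg (msubst ix q) = q"
  by (simp add: msubst_msubst sg_def ix_def msubst_id)

lemma d_iota: "dt (\<iota> q) = 0" "rpd (Inr i) (\<iota> q) = \<iota> (mpd i q)"
proof -
  show "dt (\<iota> q) = 0" by (simp add: rpd_rpol mpd_msubst ix_def mpd_mvar)
  have s: "(\<Sum>j\<in>UNIV. msubst ix (mpd j q) * (if i = j then 1 else 0)) = msubst ix (mpd i q)"
    by (simp add: if_distrib[where f="%x. _ * x"] cong: if_cong)
  show "rpd (Inr i) (\<iota> q) = \<iota> (mpd i q)" using s by (simp add: rpd_rpol mpd_msubst ix_def mpd_mvar)
qed

lemma d_tt: "dt tt = 1" "rpd (Inr i) tt = 0"
  by (simp_all add: tt_def rpd_rpol mpd_mvar rpol.hom_1 rpol.hom_0)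

lemma d_tau: "dt tau = 1" "rpd (Inr i) tau = - \<iota> (mpd i f)"
  by (simp_all add: tau_def rpd_diff d_tt d_iota)

lemma tau0: "tau ~= 0" using d_tau(1) by auto

lemma iota_L: "\<iota> q : L" "rsub sg (\<iota> q) = rpol q"
  by (simp_all add: rpol_regS sg_ix)

lemma tt_L: "tt : L" "rsub sg tt = rpol f"
  by (simp_all add: tt_def rpol_regS sg_def)

lemma tau_L: "tau : L" "rsub sg tau = 0"
  by (simp_all add: tau_def rsub_diff L.Sdiff iota_L tt_L sg_ix)

lemma tt0: "tt ~= 0" using d_tt(1) by auto

lemma ttp_L: "tt powi m : L" "rsub sg (tt powi m) = Fp m"
proof -
  have n: "tt ^ k : L" "rsub sg (tt ^ k) = rpol f ^ k" for k
    using rsub_power[OF tt_L(1), of k] tt_L(2) by auto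
  have i: "inverse (tt ^ k) : L" "rsub sg (inverse (tt ^ k)) = inverse (rpol f ^ k)" for k
    using rsub_inverse[OF n(1)[of k]] n(2)[of k] F0 by auto
  show "tt powi m : L" "rsub sg (tt powi m) = Fp m"
    by (cases m rule: int_cases2; simp add: n i power_int_minus)+
qed

lemma chain_sg: "g : L ==> rpd i (rsub sg g) = rsub sg (rpd (Inr i) g) + rpol (mpd i f) * rsub sg (dt g)"
proof -
  assume g: "g : L"
  have s: "(\<Sum>j\<in>UNIV. rsub sg (rpd (Inr j) g) * rpol (mpd i (sg (Inr j)))) = rsub sg (rpd (Inr i) g)"
    by (subst sum.remove[of _ i]) (auto simp: sg_def mpd_mvar rpol.hom_1 rpol.hom_0 intro!: sum.neutral)
  show ?thesis unfolding rsub_chain[OF g] sum_UNIV_sum s by (simp add: sg_def UNIV_unit mult.commute)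
qed

subsection \<open>Residues along the graph\<close>

lemma dtk_L: "v : L ==> (dt ^^ k) v : L"
  by (induction k) (auto intro: L.Sd)

lemma dtk_tau: "(dt ^^ Suc k) (tau * v) = tau * (dt ^^ Suc k) v + of_nat (Suc k) * (dt ^^ k) v"
proof (induction k)
  case (Suc k)
  have c: "dt (of_nat n) = 0" for n using rpd_of_int[of "Inl ()" "int n"] by simp
  have "(dt ^^ Suc (Suc k)) (tau * v) = dt (tau * (dt ^^ Suc k) v + of_nat (Suc k) * (dt ^^ k) v)"
    using Suc by simp
  then show ?case by (simp add: rpd_add rpd_mult d_tau c algebra_simps del: of_nat_Suc) (simp add: algebra_simps)
qed (simp add: rpd_mult d_tau)

lemma dtk_iota: "(dt ^^ k) (\<iota> q * v) = \<iota> q * (dt ^^ k) v"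
  by (induction k) (simp_all add: rpd_mult d_iota)

lemma dtk_add: "(dt ^^ k) (u + v) = (dt ^^ k) u + (dt ^^ k) v"
  by (induction k) (simp_all add: rpd_add)

text \<open>The k-th Taylor coefficient of v in t at t = f(x), which is the residue of v/(t -
  f)^{k+1}.\<close>

definition rk :: "nat => ('k, unit + 'n) ratf => ('k, 'n) ratf" where
  "rk k v = rsub sg ((dt ^^ k) v) / of_nat (fact k)"

lemma of_nat_ratf: "(of_nat (Suc k) :: ('k, 'n) ratf) ~= 0"
  using ratf_of_int_inj[of "int (Suc k)" 0, where 'k='k and 'n='n] by simp

lemma rk_tau: assumes "v : L" shows "rk (Suc k) (tau * v) = rk k v"
proof -
  have "of_nat j : L & rsub sg (of_nat j) = of_nat j" for j
    by (induction j) (auto simp: rsub_ring regS_0 regS_1)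
  then have n: "of_nat (Suc k) : L" "rsub sg (of_nat (Suc k)) = of_nat (Suc k)" by blast+
  have "rsub sg ((dt ^^ Suc k) (tau * v)) = of_nat (Suc k) * rsub sg ((dt ^^ k) v)"
    unfolding dtk_tau
    using dtk_L[OF assms, of k] dtk_L[OF assms, of "Suc k"] n tau_L by (simp only: rsub_ring L.Smult mult_zero_left add_0_left)
  moreover have "(of_nat (fact (Suc k)) :: ('k, 'n) ratf) = of_nat (Suc k) * of_nat (fact k)"
    by (simp only: fact_Suc of_nat_mult of_nat_id)
  ultimately show ?thesis unfolding rk_def using of_nat_ratf[of k] by (simp del: of_nat_Suc)
qed

text \<open>The residue as a relation: any k bounding the pole order may be used, and
  \<open>rk_tau\<close> makes the value independent of it.\<close>

definition Mom :: "('k, unit + 'n) ratf => ('k, 'n) ratf => bool" where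
  "Mom w r \<longleftrightarrow> (\<exists>k. tau ^ Suc k * w : L & r = rk k (tau ^ Suc k * w))"

lemma Mom_raise: "tau ^ Suc k * w : L ==> tau ^ Suc (k + j) * w : L & rk (k + j) (tau ^ Suc (k + j) * w) = rk k (tau ^ Suc k * w)"
proof (induction j)
  case (Suc j)
  then have *: "tau ^ Suc (k + j) * w : L" "rk (k + j) (tau ^ Suc (k + j) * w) = rk k (tau ^ Suc k * w)" by auto
  have e: "tau ^ Suc (k + Suc j) * w = tau * (tau ^ Suc (k + j) * w)" by (simp add: mult.assoc)
  show ?case unfolding e using L.Smult[OF tau_L(1) *(1)] rk_tau[OF *(1)] *(2) by simp
qed simp

lemma Mom_common:
  assumes "Mom w r" "Mom w' r'"
  shows "\<exists>k. tau ^ Suc k * w : L & r = rk k (tau ^ Suc k * w) & tau ^ Suc k * w' : L & r' = rk k (tau ^ Suc k * w')"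
proof -
  obtain k l where k: "tau ^ Suc k * w : L" "r = rk k (tau ^ Suc k * w)" and l: "tau ^ Suc l * w' : L" "r' = rk l (tau ^ Suc l * w')"
    using assms by (auto simp: Mom_def)
  show ?thesis using Mom_raise[OF k(1), of l] Mom_raise[OF l(1), of k] k(2) l(2)
    by (intro exI[of _ "k + l"]) (simp add: add.commute)
qed

lemma Mom_uniq: "Mom w r ==> Mom w r' ==> r = r'"
  using Mom_common by blast

lemma Mom_add: assumes "Mom w r" "Mom w' r'" shows "Mom (w + w') (r + r')"
proof -
  obtain k where k: "tau ^ Suc k * w : L" "r = rk k (tau ^ Suc k * w)" "tau ^ Suc k * w' : L" "r' = rk k (tau ^ Suc k * w')"
    using Mom_common[OF assms] by blast
  have "rk k (tau ^ Suc k * (w + w')) = r + r'"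
    unfolding k(2,4) rk_def distrib_left dtk_add
    using dtk_L[OF k(1), of k] dtk_L[OF k(3), of k] by (simp only: rsub_ring add_divide_distrib)
  then show ?thesis unfolding Mom_def using L.Sadd[OF k(1,3)] by (metis distrib_left)
qed

lemma Mom_L: assumes "w : L" shows "Mom w 0"
proof -
  have "tau ^ Suc 0 * w : L" using L.Smult[OF tau_L(1) assms] by simp
  moreover have "rk 0 (tau ^ Suc 0 * w) = 0" using assms tau_L by (simp add: rk_def rsub_ring)
  ultimately show ?thesis unfolding Mom_def by metis
qed

lemma Mom_scale: assumes "Mom w r" shows "Mom (\<iota> q * w) (rpol q * r)"
proof -
  obtain k where k: "tau ^ Suc k * w : L" "r = rk k (tau ^ Suc k * w)" using assms by (auto simp: Mom_def)
  have e: "tau ^ Suc k * (\<iota> q * w) = \<iota> q * (tau ^ Suc k * w)" by (simp only: mult_ac)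
  have "rk k (\<iota> q * (tau ^ Suc k * w)) = rpol q * r"
    unfolding k(2) rk_def dtk_iota using rsub_ring(4)[OF iota_L(1) dtk_L[OF k(1)]] iota_L(2) by simp
  then show ?thesis unfolding Mom_def using L.Smult[OF iota_L(1) k(1)] e by metis
qed

lemma iota_int: "\<iota> (of_int m) = of_int m"
  by (simp only: mconst_of_int[symmetric] msubst_mconst) (simp only: mconst_of_int rpol_of_int)

lemma Mom_int: "Mom w r ==> Mom (of_int m * w) (of_int m * r)"
  using Mom_scale[of w r "of_int m"] by (simp only: iota_int rpol_of_int)

lemma Mom_diff: "Mom w r ==> Mom w' r' ==> Mom (w - w') (r - r')"
  using Mom_add[of w r "- w'" "- r'"] Mom_int[of w' r' "-1"] by simp

text \<open>A t-derivative has no residue. With v = tau^{k+1} w one has tau^{k+2} dt w = tau dt v -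
  (k+1) v, and in the derivative of order k+1 of this everything cancels except a multiple of
  tau.\<close>

lemma Mom_dt: assumes "Mom w r" shows "Mom (dt w) 0"
proof -
  obtain k where k: "tau ^ Suc k * w : L" using assms by (auto simp: Mom_def)
  let ?v = "tau ^ Suc k * w"
  have e: "tau ^ Suc (Suc k) * dt w = tau * dt ?v - of_int (int (Suc k)) * ?v"
  proof -
    have d: "dt ?v = of_nat (Suc k) * tau ^ k * w + tau ^ Suc k * dt w"
      by (simp only: rpd_mult rpd_power d_tau) simp
    show ?thesis unfolding d by (simp add: algebra_simps)
  qed
  have nL: "of_int n : L" for n by (rule L.S_of_int)
  have L: "dt ?v : L" "?v : L" using k L.Sd by auto
  have d: "(dt ^^ Suc k) (of_int n * u) = of_int n * (dt ^^ Suc k) u" for n u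
    using dtk_iota[of "Suc k" "of_int n" u] by (simp only: iota_int)
  have m: "(dt ^^ Suc k) (- u) = - (dt ^^ Suc k) u" for u using d[of "-1" u] by simp
  have "(dt ^^ Suc k) (tau * dt ?v - of_int (int (Suc k)) * ?v) = tau * (dt ^^ Suc k) (dt ?v)"
    unfolding diff_conv_add_uminus dtk_add m d dtk_tau by (simp add: funpow_swap1)
  then have "rk (Suc k) (tau ^ Suc (Suc k) * dt w) = 0"
    unfolding e rk_def using rsub_ring(4)[OF tau_L(1) dtk_L[OF L(1), of "Suc k"]] tau_L(2) by simp
  moreover have "tau ^ Suc (Suc k) * dt w : L" unfolding e
    by (intro L.Sdiff L.Smult tau_L L nL)
  ultimately show ?thesis unfolding Mom_def by metis
qed

lemma Mom_di: assumes "Mom w r" shows "Mom (rpd (Inr i) w) (rpd i r)"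
proof -
  \<comment> \<open>The vector field tangent to the graph: it kills tau, commutes with dt, and
    becomes \<partial>_i under t = f(x). Its difference from \<partial>_i is a function of x times a
    t-derivative, which has residue 0.\<close>
  let ?D = "%u. rpd (Inr i) u + \<iota> (mpd i f) * dt u"
  obtain k where k: "tau ^ Suc k * w : L" "r = rk k (tau ^ Suc k * w)" using assms by (auto simp: Mom_def)
  let ?v = "tau ^ Suc k * w"
  have e: "tau ^ Suc k * ?D w = ?D ?v"
    unfolding rpd_mult rpd_power d_tau by (simp add: algebra_simps)
  have DL: "?D u : L" if "u : L" for u using that by (intro L.Sadd L.Smult L.Sd iota_L)
  have dD: "(dt ^^ j) (?D u) = ?D ((dt ^^ j) u)" for j u
  proof (induction j)
    case (Suc j)
    have "dt (?D v) = ?D (dt v)" for v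
      by (simp only: rpd_add rpd_mult d_iota rpd_commute[of "Inl ()" "Inr i"] mult_zero_left add_0_left)
    then show ?case using Suc by simp
  qed simp
  have sD: "rsub sg (?D u) = rpd i (rsub sg u)" if "u : L" for u
    unfolding chain_sg[OF that] using that L.Sd[OF that] iota_L by (simp only: rsub_ring L.Smult)
  have c: "rpd i (x / of_nat n) = rpd i x / of_nat n" for x :: "('k, 'n) ratf" and n
  proof (cases "(of_nat n :: ('k, 'n) ratf) = 0")
    case False
    have "rpd i (of_nat n :: ('k, 'n) ratf) = 0" using rpd_of_int[of i "int n"] by simp
    then show ?thesis using False by (simp add: rpd_divide power2_eq_square)
  qed simp
  have "rk k (?D ?v) = rpd i r"
    unfolding k(2) rk_def dD sD[OF dtk_L[OF k(1)]] c ..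
  then have "Mom (?D w) (rpd i r)" unfolding Mom_def using DL[OF k(1)] e by metis
  moreover have "Mom (\<iota> (mpd i f) * dt w) (rpol (mpd i f) * 0)" by (rule Mom_scale[OF Mom_dt[OF assms]])
  ultimately show ?thesis using Mom_diff by fastforce
qed

subsection \<open>Moments\<close>

text \<open>\<open>M w \<phi>\<close> says that \<open>\<phi> m\<close> is the residue of t^m w along the graph t = f. The moments of
  1/(t - f) are the powers of f.\<close>

definition M :: "('k, unit + 'n) ratf => (int => ('k, 'n) ratf) => bool" where
  "M w \<phi> \<longleftrightarrow> (\<forall>m. Mom (tt powi m * w) (\<phi> m))"

lemma M_uniq: "M w \<phi> ==> M w \<phi>' ==> \<phi> = \<phi>'"
  unfolding M_def fun_eq_iff using Mom_uniq by blast

lemma M_add: "M w \<phi> ==> M w' \<phi>' ==> M (w + w') (%m. \<phi> m + \<phi>' m)"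
  unfolding M_def distrib_left using Mom_add by blast

lemma M_scale: "M w \<phi> ==> M (\<iota> q * w) (%m. rpol q * \<phi> m)"
  unfolding M_def using Mom_scale[of "tt powi _ * w" _ q] by (simp only: mult.left_commute[of "\<iota> q"]) simp

lemma M_int: "M w \<phi> ==> M (of_int n * w) (%m. of_int n * \<phi> m)"
  using M_scale[of w \<phi> "of_int n"] by (simp only: iota_int rpol_of_int)

lemma M_L: assumes "w : L" shows "M w (%_. 0)"
  unfolding M_def using Mom_L[OF L.Smult[OF ttp_L(1) assms]] by blast

lemma ttp_add: "tt powi (m + n) = tt powi m * tt powi n"
  using tt0 by (simp add: power_int_add)

lemma M_t: assumes "M w \<phi>" shows "M (tt * w) (%m. \<phi> (m + 1))"
proof -
  have e: "tt powi m * (tt * w) = tt powi (m + 1) * w" for m by (simp add: ttp_add mult.assoc)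
  show ?thesis using assms unfolding M_def e by blast
qed

text \<open>Integration by parts: the derivative of t^m w in t has residue 0.\<close>

lemma M_dt: assumes "M w \<phi>" shows "M (dt w) (%m. - (of_int m * \<phi> (m - 1)))"
  unfolding M_def
proof
  fix m
  have e: "tt powi m * dt w = dt (tt powi m * w) - of_int m * (tt powi (m - 1) * w)"
    by (simp add: rpd_mult rpd_powi[OF tt0] d_tt mult.assoc)
  have "Mom (dt (tt powi m * w)) 0" using assms Mom_dt unfolding M_def by blast
  moreover have "Mom (of_int m * (tt powi (m - 1) * w)) (of_int m * \<phi> (m - 1))"
    using assms Mom_int unfolding M_def by blast
  ultimately show "Mom (tt powi m * dt w) (- (of_int m * \<phi> (m - 1)))"
    unfolding e using Mom_diff by fastforce
qed

lemma M_di: assumes "M w \<phi>" shows "M (rpd (Inr i) w) (%m. rpd i (\<phi> m))"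
  unfolding M_def
proof
  fix m
  have "tt powi m * rpd (Inr i) w = rpd (Inr i) (tt powi m * w)"
    by (simp add: rpd_mult rpd_powi[OF tt0] d_tt)
  then show "Mom (tt powi m * rpd (Inr i) w) (rpd i (\<phi> m))" using assms Mom_di unfolding M_def by metis
qed

lemma M_delta: "M delta (%m. Fp m)"
  unfolding M_def
proof
  fix m
  have e: "tau ^ Suc 0 * (tt powi m * delta) = tt powi m" using tau0 by simp
  show "Mom (tt powi m * delta) (Fp m)" unfolding Mom_def
    by (rule exI[of _ 0], unfold e) (simp add: rk_def ttp_L)
qed

text \<open>Families obtained by applying a polynomial family of operators to f^m, respectively to
  f^{m+1}. The functions in \<open>W0\<close> and \<open>W1\<close>, whose moments are of these
  kinds, mirror F_Y^0(D) u and F_Y^{-1}(D) u for the delta function u.\<close>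

definition R0 :: "(int => ('k, 'n) ratf) set" where "R0 = {\<phi>. \<exists>R\<in>pf weyl. \<forall>m. \<phi> m = app (R m) (Fp m)}"
definition R1 :: "(int => ('k, 'n) ratf) set" where "R1 = {\<phi>. \<exists>R\<in>pf weyl. \<forall>m. \<phi> m = app (R m) (Fp (m + 1))}"

interpretation w: subring "weyl :: ('k, 'n) dop set" by (rule subring_weyl)

lemma R_add:
  assumes "R : pf weyl" "R' : pf weyl" "!!m. \<phi> m = app (R m) (g m)" "!!m. \<phi>' m = app (R' m) (g m)"
  shows "\<exists>R\<in>pf weyl. \<forall>m. \<phi> m + \<phi>' m = app (R m) (g m :: ('k, 'n) ratf)"
  using pf.add[OF assms(1,2)] assms(3,4) by (intro bexI[of _ "%m. R m + R' m"]) (auto simp: app_plus)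

lemma R_act:
  assumes "R : pf weyl" "G : pf weyl" "!!m. \<phi> m = app (R m) (g m)"
  shows "\<exists>R\<in>pf weyl. \<forall>m. app (G m) (\<phi> m) = app (R m) (g m :: ('k, 'n) ratf)"
  using w.pf_mul[OF assms(2,1)] assms(3) by (intro bexI[of _ "%m. G m * R m"]) (auto simp: app_times)

lemma R_ops:
  "\<phi> : R0 ==> \<phi>' : R0 ==> (%m. \<phi> m + \<phi>' m) : R0"
  "\<phi> : R1 ==> \<phi>' : R1 ==> (%m. \<phi> m + \<phi>' m) : R1"
  "G : pf weyl ==> \<phi> : R0 ==> (%m. app (G m) (\<phi> m)) : R0"
  "G : pf weyl ==> \<phi> : R1 ==> (%m. app (G m) (\<phi> m)) : R1"
proof -
  { assume a: "\<phi> : R0" "\<phi>' : R0"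
    obtain R R' where R: "R : pf weyl" "R' : pf weyl" "!!m. \<phi> m = app (R m) (Fp m)" "!!m. \<phi>' m = app (R' m) (Fp m)"
      using a unfolding R0_def by blast
    show "(%m. \<phi> m + \<phi>' m) : R0" unfolding R0_def by (rule CollectI) (rule R_add[OF R]) }
  { assume a: "\<phi> : R1" "\<phi>' : R1"
    obtain R R' where R: "R : pf weyl" "R' : pf weyl" "!!m. \<phi> m = app (R m) (Fp (m + 1))" "!!m. \<phi>' m = app (R' m) (Fp (m + 1))"
      using a unfolding R1_def by blast
    show "(%m. \<phi> m + \<phi>' m) : R1" unfolding R1_def by (rule CollectI) (rule R_add[OF R]) }
  assume G: "G : pf weyl"
  { assume a: "\<phi> : R0"
    obtain R where R: "R : pf weyl" "!!m. \<phi> m = app (R m) (Fp m)" using a unfolding R0_def by blast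
    show "(%m. app (G m) (\<phi> m)) : R0" unfolding R0_def by (rule CollectI) (rule R_act[OF R(1) G R(2)]) }
  { assume a: "\<phi> : R1"
    obtain R where R: "R : pf weyl" "!!m. \<phi> m = app (R m) (Fp (m + 1))" using a unfolding R1_def by blast
    show "(%m. app (G m) (\<phi> m)) : R1" unfolding R1_def by (rule CollectI) (rule R_act[OF R(1) G R(2)]) }
qed

lemma R0_shift: assumes "\<phi> : R0" shows "(%m. \<phi> (m + 1)) : R1"
proof -
  obtain R where R: "R : pf weyl" "!!m. \<phi> m = app (R m) (Fp m)" using assms by (auto simp: R0_def)
  show ?thesis unfolding R1_def using w.pf_shift[OF R(1), of "-1"] R(2) by force
qed

text \<open>f^{m+2} is f times f^{m+1}, and the surplus factor f is absorbed into the
  operator.\<close>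

lemma R1_shift: assumes "\<phi> : R1" shows "(%m. \<phi> (m + 1)) : R1"
proof -
  obtain R where R: "R : pf weyl" "!!m. \<phi> m = app (R m) (Fp (m + 1))" using assms by (auto simp: R1_def)
  have A: "(%m. R (m + 1) * polop f) : pf weyl"
    using w.pf_mul[OF w.pf_shift[OF R(1), of "-1"] pf.const[OF weyl_polop]] by simp
  have B: "\<phi> (m + 1) = app (R (m + 1) * polop f) (Fp (m + 1))" for m
  proof -
    have e: "Fp (m + 1 + 1) = rpol f * Fp (m + 1)" using power_int_add_1[of "rpol f" "m + 1"] F0 by (simp only: mult.commute) simp
    show ?thesis unfolding R(2) e by (simp only: app_times polop_eq app_mulop)
  qed
  show ?thesis unfolding R1_def by (rule CollectI, rule bexI[OF _ A]) (rule allI, rule B)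
qed

definition W0 :: "('k, unit + 'n) ratf set" where "W0 = {w. \<exists>\<phi>\<in>R0. M w \<phi>}"
definition W1 :: "('k, unit + 'n) ratf set" where "W1 = {w. \<exists>\<phi>\<in>R1. M w \<phi>}"

lemma W0_add: "w : W0 ==> w' : W0 ==> w + w' : W0"
  and W1_add: "w : W1 ==> w' : W1 ==> w + w' : W1"
  unfolding W0_def W1_def using M_add R_ops(1,2) by blast+

lemma W1_iota: "w : W1 ==> \<iota> q * w : W1"
proof -
  assume "w : W1"
  then obtain \<phi> where p: "\<phi> : R1" "M w \<phi>" by (auto simp: W1_def)
  have "(%m. rpol q * \<phi> m) : R1" using R_ops(4)[OF pf.const[OF weyl_polop[of q]] p(1)] by (simp add: polop_eq)
  then show ?thesis unfolding W1_def using M_scale[OF p(2)] by blast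
qed

lemma W1_rpol: "w : W1 ==> rpol d * w : W1"
proof (induction d arbitrary: w rule: mpol_induct)
  case (const c) then show ?case using W1_iota[of w "mconst c"] by simp
next
  case (var i)
  show ?case
  proof (cases i)
    case (Inl u)
    obtain \<phi> where p: "\<phi> : R1" "M w \<phi>" using var by (auto simp: W1_def)
    then have "tt * w : W1" unfolding W1_def using M_t R1_shift by blast
    then show ?thesis by (simp add: Inl tt_def)
  next
    case (Inr j)
    then show ?thesis using W1_iota[OF var, of "mvar j"] by (simp add: ix_def)
  qed
next
  case (add p q) then show ?case by (simp add: rpol.hom_add distrib_right W1_add)
next
  case (mult p q) then show ?case by (simp add: rpol.hom_mult mult.assoc)
qed

lemma W1_zero: "0 : W1"
proof -
  have "(%_. 0) : R1" unfolding R1_def using pf.const[OF weyl_0] by force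
  then show ?thesis unfolding W1_def using M_L[OF regS_0] by blast
qed

lemma W1_L: assumes "w : L" shows "w : W1"
proof -
  have "(%_. 0) : R1" unfolding R1_def using pf.const[OF weyl_0] by force
  then show ?thesis unfolding W1_def using M_L[OF assms] by blast
qed

lemma W0_int: "w : W0 ==> of_int n * w : W0"
proof -
  assume "w : W0"
  then obtain \<phi> where p: "\<phi> : R0" "M w \<phi>" by (auto simp: W0_def)
  have "(%m. of_int n * \<phi> m) : R0" using R_ops(3)[OF pf.const[OF weyl_of_int[of n]] p(1)] by (simp add: mulop_of_int[symmetric])
  then show ?thesis unfolding W0_def using M_int[OF p(2)] by blast
qed

lemma W0_theta: "w : W0 ==> tt * dt w : W0"
proof -
  assume "w : W0"
  then obtain \<phi> where p: "\<phi> : R0" "M w \<phi>" by (auto simp: W0_def)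
  have "(%m. of_int (- m - 1)) : pf (weyl :: ('k, 'n) dop set)"
    using w.pf_uminus[OF w.pf_int[of "-1"]] by simp
  from R_ops(3)[OF this p(1)] have "(%m. of_int (- m - 1) * \<phi> m) : R0" by (simp only: mulop_of_int[symmetric] app_mulop)
  moreover have "M (tt * dt w) (%m. of_int (- m - 1) * \<phi> m)"
  proof -
    have e: "(%m. - (of_int (m + 1) * \<phi> (m + 1 - 1))) = (%m. of_int (- m - 1) * \<phi> m)"
      by (simp add: fun_eq_iff algebra_simps)
    show ?thesis using M_t[OF M_dt[OF p(2)]] unfolding e .
  qed
  ultimately show ?thesis unfolding W0_def by blast
qed

lemma W0_di: "w : W0 ==> rpd (Inr i) w : W0"
proof -
  assume "w : W0"
  then obtain \<phi> where p: "\<phi> : R0" "M w \<phi>" by (auto simp: W0_def)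
  have "(%m. rpd i (\<phi> m)) : R0" using R_ops(3)[OF pf.const[OF weyl_pdop[of i]] p(1)] by simp
  then show ?thesis unfolding W0_def using M_di[OF p(2)] by blast
qed

lemma W0_delta: "delta : W0"
  unfolding W0_def R0_def using M_delta pf.const[OF weyl_1] by force

text \<open>t^b dt^b is a polynomial in t dt, by the recursion t^{b+1} dt^{b+1} w = (t dt - b) t^b
  dt^b w.\<close>

lemma W0_tb: assumes "w : W0" shows "tt ^ b * (dt ^^ b) w : W0"
proof (induction b)
  case (Suc b)
  let ?u = "tt ^ b * (dt ^^ b) w"
  let ?D = "(dt ^^ b) w"
  have t: "tt * (of_nat b * tt ^ (b - 1)) = of_nat b * tt ^ b" by (cases b) auto
  have d: "dt ?u = of_nat b * tt ^ (b - 1) * ?D + tt ^ b * dt ?D"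
    by (simp only: rpd_mult rpd_power d_tt) simp
  have "tt * dt ?u = (tt * (of_nat b * tt ^ (b - 1))) * ?D + (tt * tt ^ b) * dt ?D"
    by (simp only: d distrib_left mult.assoc)
  then have "tt ^ Suc b * (dt ^^ Suc b) w = tt * dt ?u + of_int (- int b) * ?u"
    unfolding t by simp
  then show ?case using W0_add[OF W0_theta[OF Suc] W0_int[OF Suc]] by metis
qed (use assms in simp)

lemma W0_W1: "w : W0 ==> tt * w : W1"
  unfolding W0_def W1_def using M_t R0_shift by blast

lemma W0_monom:
  assumes "Poly_Mapping.lookup \<gamma> (Inl ()) = 0" shows "app (monom_at pdop \<gamma>) delta : W0"
  using assms
proof (induction \<gamma> rule: expo_induct)
  case (step \<gamma> i)
  show ?case
  proof (cases i)
    case (Inl u) then show ?thesis using step(2) by (simp add: lookup_add)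
  next
    case (Inr j)
    then have "Poly_Mapping.lookup \<gamma> (Inl ()) = 0" using step(2) by (simp add: lookup_add lookup_single)
    then show ?thesis unfolding monom_at_step[OF comfam_pdop] using W0_di[OF step(1)] by (simp add: app_times Inr)
  qed
qed (simp add: W0_delta)

lemma expo_split:
  fixes \<gamma> :: "unit + 'n \<Rightarrow>\<^sub>0 nat"
  defines "b \<equiv> Poly_Mapping.lookup \<gamma> (Inl ())"
  obtains \<gamma>' where "\<gamma> = Poly_Mapping.single (Inl ()) b + \<gamma>'" "Poly_Mapping.lookup \<gamma>' (Inl ()) = 0"
proof
  show "\<gamma> = Poly_Mapping.single (Inl ()) b + (\<gamma> - Poly_Mapping.single (Inl ()) b)"
    by (rule poly_mapping_eqI) (auto simp: lookup_add lookup_minus lookup_single when_def b_def)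
  show "Poly_Mapping.lookup (\<gamma> - Poly_Mapping.single (Inl ()) b) (Inl ()) = 0"
    by (simp add: lookup_minus b_def)
qed

lemma dt_pow: "app (pdop (Inl ()) ^ b) h = (dt ^^ b) h"
  by (induction b) (simp_all add: app_times)

text \<open>Of the b + 1 factors t, where b is the order in \<partial>_t, b are matched with
  \<partial>_t^b inside \<open>W0\<close>, and the last one leads from \<open>W0\<close> to
  \<open>W1\<close>.\<close>

lemma W1_term: "tt ^ Suc (Poly_Mapping.lookup \<gamma> (Inl ())) * app (monom_at pdop \<gamma>) delta : W1"
proof -
  let ?b = "Poly_Mapping.lookup \<gamma> (Inl ())"
  obtain \<gamma>' where g: "\<gamma> = Poly_Mapping.single (Inl ()) ?b + \<gamma>'" "Poly_Mapping.lookup \<gamma>' (Inl ()) = 0" by (rule expo_split)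
  have "app (monom_at pdop \<gamma>) delta = (dt ^^ ?b) (app (monom_at pdop \<gamma>') delta)"
    by (subst g(1)) (simp only: monom_at_add[OF comfam_pdop] monom_at_single app_times dt_pow)
  then show ?thesis using W0_W1[OF W0_tb[OF W0_monom[OF g(2)], of ?b]] by (simp add: mult.assoc)
qed

abbreviation "Th \<equiv> varop (Inl ()) * pdop (Inl ()) :: ('k, unit + 'n) dop"

text \<open>t \<partial>_t multiplies the m-th moment by -(m + 1); this is the origin of b_f(s) =
  b(-s-1).\<close>

lemma M_theta: "M (app (theta_poly c) delta) (%m. Kp c (- m - 1) * Fp m)"
proof -
  have 1: "M (app (Th ^ k) delta) (%m. of_int (- m - 1) ^ k * Fp m)" for k
  proof (induction k)
    case (Suc k)
    have "M (tt * dt (app (Th ^ k) delta)) (%m. - (of_int (m + 1) * (of_int (- (m + 1 - 1) - 1) ^ k * Fp (m + 1 - 1))))"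
      by (rule M_t[OF M_dt[OF Suc]])
    moreover have "app (Th ^ Suc k) delta = tt * dt (app (Th ^ k) delta)"
      by (simp add: app_times varop_def polop_eq tt_def)
    moreover have "- (of_int (m + 1) * (of_int (- (m + 1 - 1) - 1) ^ k * Fp (m + 1 - 1))) = of_int (- m - 1) ^ Suc k * Fp m" for m
      by (simp add: algebra_simps)
    ultimately show ?case by simp
  qed (simp add: M_delta)
  have 2: "M (\<Sum>k\<in>A. rpol (mconst (coeff c k)) * app (Th ^ k) delta) (%m. \<Sum>k\<in>A. rpol (mconst (coeff c k)) * (of_int (- m - 1) ^ k * Fp m))"
    if "finite A" for A
    using that
  proof (induction A)
    case empty then show ?case using M_L[OF regS_0] by simp
  next
    case (insert k A)
    then show ?case using M_add[OF M_scale[OF 1[of k], of "mconst (coeff c k)"]] by simp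
  qed
  have k: "Kp c m = (\<Sum>k\<le>degree c. rpol (mconst (coeff c k)) * of_int m ^ k)" for m
    by (simp add: Kp_def poly_altdef mconst.hom_sum rpol.hom_sum mconst.hom_mult rpol.hom_mult mconst.hom_power rpol.hom_power mconst_of_int rpol_of_int)
  have "app (theta_poly c) delta = (\<Sum>k\<le>degree c. rpol (mconst (coeff c k)) * app (Th ^ k) delta)"
    by (simp add: theta_poly_def app_sum app_times polop_eq)
  then show ?thesis using 2[of "{..degree c}"] by (simp only: k sum_distrib_right mult.assoc finite_atMost)
qed

lemma Kp_weyl: "(%m. mulop (Kp c (- m - 1))) : pf (weyl :: ('k, 'n) dop set)"
proof -
  have "(%m. Kp c m :: ('k, 'n) ratf) : pf (range rpol)" by (rule Kp_pf) simp
  from subring.pf_reflect[OF subring_dring[OF dring_rpol] this]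
  show ?thesis by (rule pf_mulop) (use weyl_polop in \<open>auto simp: polop_eq\<close>)
qed

text \<open>t - f sends \<open>delta\<close> to 1 and the remaining generators send it to 0.
  Polynomials are regular along the graph, so the ideal is invisible to moments.\<close>

lemma graph_kill: assumes "P : graph_ideal f" shows "app P delta : range rpol"
proof -
  let ?V = "{P. app P delta : range rpol} :: ('k, unit + 'n) dop set"
  interpret r: dring "range rpol :: ('k, unit + 'n) ratf set" by (rule dring_rpol)
  have V: "nsub ?V"
    unfolding nsub_def by (simp add: app_plus app_uminus r.S0 r.Sadd r.Sneg)
  have 1: "app (varop (Inl ()) - polop (msubst (%i. mvar (Inr i)) f)) delta = 1"
    using tau0 by (simp add: varop_def app_diff polop_eq tau_def tt_def ix_def flip: left_diff_distrib)
  have 2: "app (pdop (Inr i) + polop (msubst (%i. mvar (Inr i)) (mpd i f)) * pdop (Inl ())) delta = 0" for i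
    by (simp add: app_plus app_times rpd_inverse d_tau polop_eq ix_def)
  have g: "app g delta : range rpol" if "g : insert (varop (Inl ()) - polop (msubst (%i. mvar (Inr i)) f))
        (range (%i. pdop (Inr i) + polop (msubst (%i. mvar (Inr i)) (mpd i f)) * pdop (Inl ())))" for g
    using that 1 2 r.S0 r.S1 by auto
  have "P : ?V"
    using assms unfolding graph_ideal_def lspan_def weyl_mod_def
  proof (rule addspan_sub[OF _ V])
    show "{smul (natmod (*) weyl) r x | r x. r : weyl & x : insert (varop (Inl ()) - polop (msubst (%i. mvar (Inr i)) f))
        (range (%i. pdop (Inr i) + polop (msubst (%i. mvar (Inr i)) (mpd i f)) * pdop (Inl ())))} \<subseteq> ?V"
      using r.dopS_app[OF _ g] unfolding weyl_dopS[symmetric] by (auto simp: app_times)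
  qed
  then show ?thesis by simp
qed

section \<open>From the b-function to the functional equation\<close>

lemma pow_single: "mvar i ^ b = Poly_Mapping.single (Poly_Mapping.single i b) 1"
  by (induction b) (simp_all add: mvar_def mult_single single_add[symmetric])

text \<open>With b the exponent of t in \<gamma>, the monomial of exponent \<gamma> lies in J_Y^b,
  so an operator of filtration degree -1 sends it to a multiple of t^{b+1}. These sets of multiples
  satisfy the closure conditions of \<open>dop_of_coeff_mem\<close>, which carries the divisibility
  over to the coefficients.\<close>

lemma V_coeff:
  fixes p :: "unit + 'n => 'k"
  assumes "dop_of a : V_filt (- 1) p"
  shows "\<exists>g\<in>reg {p}. Poly_Mapping.lookup a \<gamma> = tt ^ Suc (Poly_Mapping.lookup \<gamma> (Inl ())) * g"
proof -
  interpret r: dring "reg {p}" by (rule dring_reg)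
  define S where "S \<gamma> = {tt ^ Suc (Poly_Mapping.lookup \<gamma> (Inl ())) * g | g. g : reg {p}}" for \<gamma> :: "unit + 'n \<Rightarrow>\<^sub>0 nat"
  have I: "tt ^ Suc (Poly_Mapping.lookup \<gamma> (Inl ())) * g : S \<gamma>" if "g : reg {p}" for \<gamma> g
    unfolding S_def using that by blast
  have x: "\<exists>q. rpol (Poly_Mapping.single \<gamma> (1::'k)) = tt ^ Poly_Mapping.lookup \<gamma> (Inl ()) * rpol q" for \<gamma> :: "unit + 'n \<Rightarrow>\<^sub>0 nat"
  proof -
    let ?b = "Poly_Mapping.lookup \<gamma> (Inl ())"
    obtain \<gamma>' where g: "\<gamma> = Poly_Mapping.single (Inl ()) ?b + \<gamma>'" by (rule expo_split)
    have "Poly_Mapping.single \<gamma> (1::'k) = mvar (Inl ()) ^ ?b * Poly_Mapping.single \<gamma>' 1"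
      by (subst g) (simp add: pow_single mult_single)
    then show ?thesis by (metis rpol.hom_mult rpol.hom_power tt_def)
  qed
  have "Poly_Mapping.lookup a \<gamma> : S \<gamma>"
  proof (rule dop_of_coeff_mem)
    show "0 : S \<gamma>" for \<gamma> using I[OF r.S0, of \<gamma>] by simp
  next
    fix \<gamma> g h assume "g : S \<gamma>" "h : S \<gamma>"
    then obtain u v where "u : reg {p}" "v : reg {p}" "g = tt ^ Suc (Poly_Mapping.lookup \<gamma> (Inl ())) * u" "h = tt ^ Suc (Poly_Mapping.lookup \<gamma> (Inl ())) * v"
      by (auto simp: S_def)
    then show "g + h : S \<gamma>" using I[OF r.Sadd, of u v \<gamma>] by (simp add: distrib_left)
  next
    fix \<gamma> g and c :: 'k assume "g : S \<gamma>"
    then obtain u where u: "u : reg {p}" "g = tt ^ Suc (Poly_Mapping.lookup \<gamma> (Inl ())) * u" by (auto simp: S_def)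
    then show "g * rpol (mconst c) : S \<gamma>" using I[OF r.Smult[OF u(1) rpol_reg], of \<gamma>] by (simp add: mult.assoc)
  next
    fix \<alpha> \<beta> :: "unit + 'n \<Rightarrow>\<^sub>0 nat" and g assume "g : S \<alpha>"
    then obtain u where u: "u : reg {p}" "g = tt ^ Suc (Poly_Mapping.lookup \<alpha> (Inl ())) * u" by (auto simp: S_def)
    obtain q where q: "rpol (Poly_Mapping.single \<beta> (1::'k)) = tt ^ Poly_Mapping.lookup \<beta> (Inl ()) * rpol q" using x by blast
    have "g * rpol (Poly_Mapping.single \<beta> 1) = tt ^ Suc (Poly_Mapping.lookup (\<alpha> + \<beta>) (Inl ())) * (u * rpol q)"
      unfolding u(2) q by (simp add: lookup_add power_add mult_ac)
    then show "g * rpol (Poly_Mapping.single \<beta> 1) : S (\<alpha> + \<beta>)" using I[OF r.Smult[OF u(1) rpol_reg], of "\<alpha> + \<beta>"] by simp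
  next
    fix \<gamma> :: "unit + 'n \<Rightarrow>\<^sub>0 nat"
    let ?b = "Poly_Mapping.lookup \<gamma> (Inl ())"
    obtain q where q: "rpol (Poly_Mapping.single \<gamma> (1::'k)) = tt ^ ?b * rpol q" using x by blast
    have "rpol (Poly_Mapping.single \<gamma> (1::'k)) : J_pow p (int ?b)"
      unfolding q J_pow_def using rpol_reg by (cases "?b = 0") (auto simp: tt_def)
    then have "app (dop_of a) (rpol (Poly_Mapping.single \<gamma> 1)) : J_pow p (int ?b - (- 1))"
      using assms unfolding V_filt_def by (force dest: spec[of _ "int ?b"])
    then show "app (dop_of a) (rpol (Poly_Mapping.single \<gamma> 1)) : S \<gamma>"
      unfolding J_pow_def S_def tt_def by (auto simp: nat_add_distrib)
  qed
  then show ?thesis by (auto simp: S_def)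
qed

definition st0 :: "unit + 'n => ('k, 'n) mpol" where "st0 = case_sum (%_. 0) mvar"

lemma st0_split: "\<exists>h'. h = msubst ix (msubst st0 h) + mvar (Inl ()) * h'"
proof (induction h rule: mpol_induct)
  case (const c) show ?case by (intro exI[of _ 0]) simp
next
  case (var i)
  show ?case
  proof (cases i)
    case (Inl u) then show ?thesis by (intro exI[of _ 1]) (simp add: st0_def msubst.hom_0)
  next
    case (Inr j) then show ?thesis by (intro exI[of _ 0]) (simp add: st0_def ix_def)
  qed
next
  case (add p q)
  then obtain p' q' where "p = msubst ix (msubst st0 p) + mvar (Inl ()) * p'" "q = msubst ix (msubst st0 q) + mvar (Inl ()) * q'" by blast
  then have "p + q = msubst ix (msubst st0 (p + q)) + mvar (Inl ()) * (p' + q')"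
    unfolding msubst.hom_add by algebra
  then show ?case by blast
next
  case (mult p q)
  then obtain p' q' where "p = msubst ix (msubst st0 p) + mvar (Inl ()) * p'" "q = msubst ix (msubst st0 q) + mvar (Inl ()) * q'" by blast
  then have "p * q = msubst ix (msubst st0 (p * q)) + mvar (Inl ()) * (p' * q + msubst ix (msubst st0 p) * q')"
    unfolding msubst.hom_mult by algebra
  then show ?case by blast
qed

lemma local_equation:
  fixes x0 :: "'n => 'k"
  defines "p \<equiv> case_sum (%_. 0) x0"
  assumes Q: "Q : V_filt (- 1) p" and h1: "meval p h1 ~= 0"
    and I: "polop h1 * (theta_poly c - Q) : graph_ideal f"
  shows "\<exists>h R. meval x0 h ~= 0 & R : pf weyl & (\<forall>m. app (R m) (Fp (m + 1)) = rpol h * Kp c (- m - 1) * Fp m)"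
proof -
  obtain a where a: "Q = dop_of a" using Q by (auto simp: V_filt_def Dop_def)
  have "\<exists>g. \<forall>\<gamma>. g \<gamma> : reg {p} & Poly_Mapping.lookup a \<gamma> = tt ^ Suc (Poly_Mapping.lookup \<gamma> (Inl ())) * g \<gamma>"
    by (rule choice) (use V_coeff[OF Q[unfolded a]] in blast)
  then obtain g where g: "!!\<gamma>. g \<gamma> : reg {p}" "!!\<gamma>. Poly_Mapping.lookup a \<gamma> = tt ^ Suc (Poly_Mapping.lookup \<gamma> (Inl ())) * g \<gamma>" by blast
  obtain h2 where h2: "meval p h2 ~= 0" "\<forall>\<gamma>\<in>Poly_Mapping.keys a. \<exists>d. rpol h2 * g \<gamma> = rpol d"
    using common_denominator[of "Poly_Mapping.keys a" g p] g(1) by auto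
  let ?u = "app (theta_poly c) delta"
  \<comment> \<open>Applied to \<open>delta\<close>, the relation modulo the ideal holds up to a
    polynomial q, whose moments are zero.\<close>
  obtain q where q: "rpol h1 * (?u - app Q delta) = rpol q"
    using graph_kill[OF I] by (auto simp: app_times polop_eq app_diff)
  have "rpol h2 * app Q delta = (\<Sum>\<gamma>\<in>Poly_Mapping.keys a. (rpol h2 * g \<gamma>) * (tt ^ Suc (Poly_Mapping.lookup \<gamma> (Inl ())) * app (monom_at pdop \<gamma>) delta))"
    unfolding a dop_of_def by (simp add: app_sum app_times g(2) sum_distrib_left mult_ac del: power_Suc)
  also have "\<dots> : W1"
  proof (rule sum_in_set[OF W1_zero W1_add])
    fix \<gamma> assume "\<gamma> : Poly_Mapping.keys a"
    then obtain d where "rpol h2 * g \<gamma> = rpol d" using h2(2) by blast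
    then show "(rpol h2 * g \<gamma>) * (tt ^ Suc (Poly_Mapping.lookup \<gamma> (Inl ())) * app (monom_at pdop \<gamma>) delta) : W1"
      using W1_rpol[OF W1_term] by metis
  qed
  finally have "rpol h1 * (rpol h2 * app Q delta) + rpol (h2 * q) : W1"
    by (rule W1_add[OF W1_rpol W1_L[OF rpol_regS]])
  moreover have "rpol h1 * (rpol h2 * app Q delta) + rpol (h2 * q) = rpol (h1 * h2) * ?u"
    unfolding rpol.hom_mult q[symmetric] by (simp add: algebra_simps)
  ultimately have W: "rpol (h1 * h2) * ?u : W1" by simp
  \<comment> \<open>The factor h1 h2 may involve t. Its value at t = 0 can replace it, because the
    remainder is a multiple of t and t maps \<open>W0\<close> into \<open>W1\<close>.\<close>
  let ?h = "msubst st0 (h1 * h2)"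
  obtain h' where h': "h1 * h2 = msubst ix ?h + mvar (Inl ()) * h'" using st0_split by blast
  have "(%m. Kp c (- m - 1) * Fp m) : R0"
    unfolding R0_def using Kp_weyl[of c] by (intro CollectI bexI[of _ "%m. mulop (Kp c (- m - 1))"]) auto
  then have "?u : W0" unfolding W0_def using M_theta by blast
  then have "rpol (- h') * (tt * ?u) : W1" by (intro W1_rpol W0_W1)
  then have "rpol (h1 * h2) * ?u + rpol (- h') * (tt * ?u) : W1" by (rule W1_add[OF W])
  moreover have "rpol (h1 * h2) * ?u + rpol (- h') * (tt * ?u) = \<iota> ?h * ?u"
    by (subst h') (simp add: rpol.hom_add rpol.hom_mult rpol.hom_minus tt_def algebra_simps)
  ultimately obtain \<phi> where \<phi>: "\<phi> : R1" "M (\<iota> ?h * ?u) \<phi>" by (auto simp: W1_def)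
  \<comment> \<open>The moments are known from \<open>M_theta\<close>; by uniqueness, membership in
    \<open>W1\<close> is the functional equation itself.\<close>
  then have e: "\<phi> = (%m. rpol ?h * (Kp c (- m - 1) * Fp m))" using M_uniq M_scale[OF M_theta] by blast
  obtain R where R: "R : pf weyl" "!!m. \<phi> m = app (R m) (Fp (m + 1))" using \<phi>(1) by (auto simp: R1_def)
  have "(%i. meval x0 (st0 i)) = p" by (auto simp: p_def st0_def fun_eq_iff meval.hom_0 split: sum.splits)
  then have "meval x0 ?h = meval p (h1 * h2)" by (simp add: meval_msubst)
  then have "meval x0 ?h ~= 0" using h1 h2(1) by (simp add: meval.hom_mult)
  then show ?thesis using R e by (intro exI[of _ ?h] exI[of _ R]) (auto simp: mult.assoc)
qed

sublocale G: weyl_quot "(*)" weyl "graph_ideal f"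
proof -
  let ?S = "insert (varop (Inl ()) - polop (msubst (%i. mvar (Inr i)) f))
        (range (%i. pdop (Inr i) + polop (msubst (%i. mvar (Inr i)) (mpd i f)) * pdop (Inl ()))) :: ('k, unit + 'n) dop set"
  interpret wr: subring "weyl :: ('k, unit + 'n) dop set" by (rule subring_weyl)
  have W: "nsub (weyl :: ('k, unit + 'n) dop set)" by (simp add: nsub_def weyl_0 weyl_add weyl_minus)
  have v: "(varop i :: ('k, unit + 'n) dop) : weyl" for i :: "unit + 'n" by (simp add: varop_def weyl_polop)
  have S: "?S \<subseteq> weyl"
    using wr.Dadd[OF v wr.Dneg[OF weyl_polop]] by (auto intro!: weyl_add weyl_mult weyl_pdop weyl_polop)
  note L = dmul.lspan_stable[OF W weyl_mult S]
  show "weyl_quot (*) weyl (graph_ideal f)"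
    unfolding graph_ideal_def weyl_mod_def
    by (intro weyl_quot.intro dmul.dact_axioms weyl_quot_axioms.intro W weyl_mult L)
qed

lemma functional_equation:
  assumes b: "is_graph_b f b" and b0: "b ~= 0"
  shows "\<exists>h R. meval x0 h ~= 0 & R : pf weyl & (\<forall>m. app (R m) (Fp (m + 1)) = rpol h * Kp b (- m - 1) * Fp m)"
proof (cases "meval x0 f = 0")
  case False
  \<comment> \<open>Where f does not vanish, h = f and the scalar b(-m-1) solve the
    equation.\<close>
  have "app (mulop (Kp b (- m - 1))) (Fp (m + 1)) = rpol f * Kp b (- m - 1) * Fp m" for m
    using F0 by (simp add: power_int_add_1)
  then show ?thesis using False Kp_weyl[of b] by blast
next
  case True
  let ?p = "case_sum (%_. 0) x0 :: unit + 'n => 'k"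
  let ?u = "D_tensor_elem G.Q (G.cs 1)"
  interpret m: model "%p. p" "D_tensor G.Q" G.CQ G.RQ "(*)" G.RlD by (rule G.D_model)
  have Q: "quot weyl_mod (graph_ideal f) = G.Q" by (simp add: G.Q_def weyl_mod_def)
  have cs: "coset weyl_mod (graph_ideal f) 1 = G.cs 1" by (simp add: weyl_mod_def)
  have gb: "is_global_b (D_tensor G.Q) ?u b" using b by (simp add: is_graph_b_def Q cs Let_def)
  have "\<exists>c. is_local_b (D_tensor G.Q) ?u ?p c"
  \<comment> \<open>A monic polynomial of least degree is chosen if there is one; otherwise the
    local b-function is 0 by convention.\<close>
  proof (cases "\<exists>c\<in>b_ideal (D_tensor G.Q) ?u ?p. lead_coeff c = 1")
    case True
    then obtain c where "c : b_ideal (D_tensor G.Q) ?u ?p & lead_coeff c = 1"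
      "!!d. d : b_ideal (D_tensor G.Q) ?u ?p & lead_coeff d = 1 ==> degree c \<le> degree d"
      using exists_least_iff[of "%n. \<exists>c\<in>b_ideal (D_tensor G.Q) ?u ?p. lead_coeff c = 1 & degree c = n"] by (metis not_less)
    then show ?thesis unfolding is_local_b_def by blast
  qed (auto simp: is_local_b_def)
  then obtain c where c: "is_local_b (D_tensor G.Q) ?u ?p c" by blast
  have dv: "c dvd b"
    by (rule gb[unfolded is_global_b_def, THEN conjunct1, rule_format, OF _ c]) simp
  then have "c ~= 0" using b0 by auto
  then have ci: "c : b_ideal (D_tensor G.Q) ?u ?p" using c unfolding is_local_b_def by blast
  have Rl: "G.RlD ?p UNIV ?u 1" by (rule G.D_tensor_elem_Rl[OF weyl_1])
  then have g: "germ (D_tensor G.Q) ?p UNIV ?u = m.gcl ?p 1" by (rule m.germ_gcl)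
  have r1: "m.rel ?p 1" using Rl unfolding m.rel_def by blast
  have st: "smul (stalk (%p. p) (D_tensor G.Q) ?p) P (m.gcl ?p 1) = m.gcl ?p P" if "P : Dop {?p}" for P
    using m.stalk_smul[OF r1 that] by simp
  \<comment> \<open>The generator u lies in F_Y^0(D) u, so a member c of the b-ideal yields one
    operator Q of filtration degree -1 with c(t \<partial>_t) u = Q u at the point.\<close>
  have "1 : V_filt 0 ?p" by (simp add: V_filt_def Dop_1)
  then have "m.gcl ?p 1 : V_stalk (D_tensor G.Q) ?u 0 ?p"
    unfolding V_stalk_def g using st[OF Dop_1] by (intro CollectI exI[of _ 1]) simp
  have th: "theta_poly c : Dop {?p}"
    unfolding theta_poly_def varop_def by (intro Dop_sum Dop_mult Dop_power Dop_polop Dop_pdop)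
  from \<open>m.gcl ?p 1 : _\<close> have "smul (stalk (%p. p) (D_tensor G.Q) ?p) (theta_poly c) (m.gcl ?p 1) : V_stalk (D_tensor G.Q) ?u (- 1) ?p"
    using ci unfolding b_ideal_def by blast
  from this obtain Q where Q: "Q : V_filt (- 1) ?p" "m.gcl ?p (theta_poly c) = m.gcl ?p Q"
  proof -
    assume a: "smul (stalk (%p. p) (D_tensor G.Q) ?p) (theta_poly c) (m.gcl ?p 1) : V_stalk (D_tensor G.Q) ?u (- 1) ?p"
    then obtain Q where Q: "Q : V_filt (- 1) ?p" "m.gcl ?p (theta_poly c) = smul (stalk (%p. p) (D_tensor G.Q) ?p) Q (m.gcl ?p 1)"
      unfolding V_stalk_def g st[OF th] by blast
    have "Q : Dop {?p}" using Q(1) unfolding V_filt_def by blast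
    then have "m.gcl ?p (theta_poly c) = m.gcl ?p Q" using Q(2) st by simp
    with Q(1) show ?thesis by (rule that)
  qed
  have "m.rel ?p (theta_poly c)" using m.rel_smul[OF r1 th] by simp
  then have "theta_poly c - Q : G.RQ ?p" using m.gcl_eq Q(2) by blast
  then obtain h1 where h1: "meval ?p h1 ~= 0" "polop h1 * (theta_poly c - Q) : graph_ideal f" by (auto simp: G.RQ_def)
  obtain h R where h: "meval x0 h ~= 0" "R : pf weyl" "!!m. app (R m) (Fp (m + 1)) = rpol h * Kp c (- m - 1) * Fp m"
    using local_equation[OF Q(1) h1] by blast
  \<comment> \<open>The local b-function c divides b, and the cofactor enters as the scalar
    e(-m-1).\<close>
  obtain e where e: "b = c * e" using dv by (auto simp: dvd_def)
  have "Kp b m = (Kp c m * Kp e m :: ('k, 'n) ratf)" for m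
    by (simp add: e Kp_def mconst.hom_mult rpol.hom_mult)
  then have "app (mulop (Kp e (- m - 1)) * R m) (Fp (m + 1)) = rpol h * Kp b (- m - 1) * Fp m" for m
    by (simp add: app_times h(3) mult_ac)
  then show ?thesis using h(1) w.pf_mul[OF Kp_weyl[of e] h(2)] by blast
qed

end

section \<open>Restriction to the diagonal\<close>

abbreviation actv :: "('k::field_char_0, 'n::{finite,linorder}) dop => ('k, 'n) dop ^ 'r => ('k, 'n) dop ^ 'r" where
  "actv P v \<equiv> (\<chi> j. P * v $ j)"

interpretation vact: dact actv
  by standard (simp_all add: vec_eq_iff distrib_left distrib_right mult.assoc)

lemma weyl_vecs_nsub: "nsub (weyl_vecs :: (('k::field_char_0, 'n::{finite,linorder}) dop ^ 'r) set)"
  by (simp add: nsub_def weyl_vecs_def weyl_0 weyl_add weyl_minus)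

lemma weyl_vecs_act: "P : weyl ==> w : weyl_vecs ==> actv P w : weyl_vecs"
  for P :: "('k::field_char_0, 'n::{finite,linorder}) dop"
  by (simp add: weyl_vecs_def weyl_mult)

lemma weyl_vec_quot:
  fixes N :: "(('k::field_char_0, 'n::{finite,linorder}) dop ^ 'r) set"
  assumes "nsub N" "N \<subseteq> weyl_vecs" "!!P w. P : weyl ==> w : N ==> actv P w : N"
  shows "weyl_quot actv weyl_vecs N"
  by (intro weyl_quot.intro vact.dact_axioms weyl_quot_axioms.intro weyl_vecs_nsub weyl_vecs_act assms)

lemma vec_clear:
  fixes v :: "('k::field_char_0, 'n::{finite,linorder}) dop ^ 'r"
  assumes "!!j. v $ j : Dop {p}"
  shows "\<exists>h. meval p h ~= 0 & actv (polop h) v : weyl_vecs"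
proof -
  have "\<exists>h. meval p h ~= 0 & (\<forall>j\<in>A. polop h * v $ j : weyl)" if "finite A" for A
    using that
  proof (induction A)
    case empty then show ?case by (intro exI[of _ 1]) (simp add: meval.hom_1)
  next
    case (insert i A)
    then obtain h where h: "meval p h ~= 0" "!!j. j : A ==> polop h * v $ j : weyl" by blast
    obtain h' where h': "meval p h' ~= 0" "polop h' * v $ i : weyl" using Dop_clear[OF assms] by blast
    have "polop (h' * h) * v $ j : weyl" if "j : A" for j
      using weyl_mult[OF weyl_polop h(2)[OF that]] by (simp add: polop_mult mult.assoc)
    moreover have "polop (h' * h) * v $ i : weyl"
      using weyl_mult[OF weyl_polop h'(2), of h] by (simp add: mult.commute[of h'] polop_mult mult.assoc)
    ultimately show ?case using h(1) h'(1) by (intro exI[of _ "h' * h"]) (auto simp: meval.hom_mult)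
  qed
  from this[of UNIV] show ?thesis by (auto simp: weyl_vecs_def)
qed

lemma vec_CQ:
  fixes v :: "('k::field_char_0, 'n::{finite,linorder}) dop ^ 'r" and p :: "'n => 'k"
    and N' :: "(('k, 'n) dop ^ 'r) set"
  assumes "weyl_quot actv weyl_vecs N'"
  shows "v : weyl_quot.CQ actv weyl_vecs p \<longleftrightarrow> (\<forall>j. v $ j : Dop {p})"
proof -
  interpret q: weyl_quot actv weyl_vecs N' by (rule assms)
  show ?thesis
  proof
    assume "v : q.CQ p"
    then obtain h w where h: "meval p h ~= 0" "w : weyl_vecs" "v = actv (mulop (inverse (rpol h))) w" by (auto simp: q.CQ_def)
    then show "\<forall>j. v $ j : Dop {p}"
      using Dop_mult[OF Dop_mulop[OF inverse_reg[of "{p}" h]] weyl_Dop] by (simp add: weyl_vecs_def)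
  next
    assume "\<forall>j. v $ j : Dop {p}"
    then obtain h where h: "meval p h ~= 0" "actv (polop h) v : weyl_vecs" using vec_clear by blast
    then have "h ~= 0" by auto
    then have "v = actv (mulop (inverse (rpol h))) (actv (polop h) v)"
      by (simp add: vec_eq_iff mulop_inverse flip: mult.assoc)
    then show "v : q.CQ p" unfolding q.CQ_def using h by blast
  qed
qed

abbreviation "Ls \<equiv> regS s0"

lemma sx_Ls: "rsub sx g : Ls" "rsub s0 (rsub sx g) = g" and sy_Ls: "rsub sy g : Ls" "rsub s0 (rsub sy g) = g"
  using rsub_rsub[of s0 sx] rsub_rsub[of s0 sy] s0_sx s0_sy by blast+

lemma rhom_sx: "rhom (rsub sx)" and rhom_sy: "rhom (rsub sy)"
  by (rule rhom_rsub[OF regS_UNIV[OF s0_sx]], rule rhom_rsub[OF regS_UNIV[OF s0_sy]])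

lemma sx_reg: "g : reg {p} ==> rsub sx g : reg {z0 p}" and sy_reg: "g : reg {p} ==> rsub sy g : reg {z0 p}"
proof -
  have "(%i. meval (z0 p) (sx i)) = p" "(%i. meval (z0 p) (sy i)) = p"
    by (simp_all add: sx_def sy_def z0_def fun_eq_iff meval.hom_add)
  then show "g : reg {p} ==> rsub sx g : reg {z0 p}" "g : reg {p} ==> rsub sy g : reg {z0 p}"
    using rsub_reg(2)[of g "z0 p" sx] rsub_reg(2)[of g "z0 p" sy] by auto
qed

lemma reg_Ls: "a : reg {z0 p} ==> a : Ls" "a : reg {z0 p} ==> rsub s0 a : reg {p}"
  unfolding z0_meval using rsub_reg by auto

abbreviation "D2 \<equiv> dopS Ls"

lemma Dop_D2: "Dop {z0 p} \<subseteq> D2"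
  unfolding Dop_dopS using reg_Ls by (intro dopS_mono) auto

lemmas D2_mult = dring.dopS_mult[OF dring_regS[of s0]]
  and D2_add = dring.dopS_add[OF dring_regS[of s0]]
  and D2_sum = dring.dopS_sum[OF dring_regS[of s0]]
  and D2_mulop = dring.dopS_mulop[OF dring_regS[of s0]]
  and D2_pdop = dring.dopS_pdop[OF dring_regS[of s0]]
  and D2_app = dring.dopS_app[OF dring_regS[of s0]]

lemma monom_at_mem:
  assumes "comfam Y" "1 : D" "!!i P. P : D ==> Y i * P : D" shows "monom_at Y \<alpha> : D"
  by (induction \<alpha> rule: expo_induct) (simp_all add: monom_at_step[OF assms(1)] assms del: One_nat_def)

lemma dmap_mem:
  assumes "comfam Y" "subring D" "!!\<alpha>. mulop (\<xi> (Poly_Mapping.lookup (dcoeffs P) \<alpha>)) : D" "!!i. Y i : D"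
  shows "dmap \<xi> Y P : D"
proof -
  interpret subring D by (rule assms(2))
  have "0 : D" using Dadd[OF D1 Dneg[OF D1]] by simp
  have "monom_at Y \<alpha> : D" for \<alpha> using monom_at_mem[OF assms(1) D1] Dmult assms(4) by blast
  then show ?thesis unfolding dmap_def
    by (intro sum_in_set \<open>0 : D\<close>) (auto intro: Dadd Dmult assms(3))
qed

section \<open>Operators in x and in y, written in the coordinates (z, x)\<close>

lemma xo_mem: "xo i : weyl" "xo i : Dop U" and zo_mem: "zo i : weyl" "zo i : Dop U"
  for U :: "('n::{finite,linorder} + 'n => 'k::field_char_0) set"
proof -
  show "xo i : weyl" unfolding xo_def using weyl_add[OF weyl_pdop weyl_minus[OF weyl_pdop]] by simp
  show "zo i : weyl" unfolding zo_def by (rule weyl_pdop)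
  show "xo i : Dop U" "zo i : Dop U" unfolding xo_def zo_def by (intro Dop_diff Dop_pdop)+
qed

lemma kap_weyl:
  fixes P :: "('k::field_char_0, 'n::{finite,linorder}) dop"
  shows "P : weyl ==> kapx P : weyl" "P : weyl ==> kapy P : weyl"
proof -
  assume P: "P : weyl"
  have c: "\<exists>q. Poly_Mapping.lookup (dcoeffs P) \<alpha> = rpol q" for \<alpha>
    using dopS_coeffs(2)[of P "range rpol" \<alpha>] P by (auto simp: weyl_dopS)
  have m: "mulop (rsub \<sigma> (Poly_Mapping.lookup (dcoeffs P) \<alpha>)) : weyl"
    for \<sigma> :: "'n => ('k, 'n + 'n) mpol" and \<alpha>
  proof -
    obtain q where "Poly_Mapping.lookup (dcoeffs P) \<alpha> = rpol q" using c by blast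
    then show ?thesis using weyl_polop[of "msubst \<sigma> q"] by (simp add: polop_eq)
  qed
  show "kapx P : weyl" "kapy P : weyl"
    by (rule dmap_mem[where \<xi>="rsub sx", OF comfam_xo subring_weyl m xo_mem(1)],
        rule dmap_mem[where \<xi>="rsub sy", OF comfam_zo subring_weyl m zo_mem(1)])
qed

lemma kapx_Dop: "P : Dop {p} ==> kapx P : Dop {z0 p}"
  unfolding Dop_dopS[of "{p}"]
  by (intro dmap_mem comfam_xo subring_Dop xo_mem Dop_mulop sx_reg dopS_coeffs(2))

lemma zo_monom: "(monom_at zo \<beta> :: ('k, 'n + 'n) dop) = kapy (monom_at pdop \<beta>)" "monom_at zo \<beta> : Dop U"
  "(monom_at zo \<beta> :: ('k, 'n + 'n) dop) : weyl"
  for U :: "('n::{finite,linorder} + 'n => 'k::field_char_0) set"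
proof -
  show "(monom_at zo \<beta> :: ('k, 'n + 'n) dop) = kapy (monom_at pdop \<beta>)"
    using ky.H_monom[of "1 :: ('k, 'n) ratf" \<beta>] by (simp add: rhom.hom_1[OF rhom_sy])
  show w: "(monom_at zo \<beta> :: ('k, 'n + 'n) dop) : weyl"
    by (rule monom_at_mem[OF comfam_zo weyl_1]) (intro weyl_mult zo_mem)
  from w show "monom_at zo \<beta> : Dop U" by (rule weyl_Dop)
qed

lemma commute_mult: "a * z = z * a ==> b * z = z * b ==> a * b * z = z * (a * b)" for a :: "'a::semigroup_mult"
  by (metis mult.assoc)

text \<open>In the old coordinates an operator in x commutes with \<partial>_y, and by
  \<open>kapx_sy\<close> also with functions of y. The coordinates (z, x) hide this, so it is
  checked on coefficients and derivations.\<close>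

lemma kapx_zo:
  fixes P :: "('k::field_char_0, 'n::{finite,linorder}) dop"
  shows "P : dopS UNIV ==> kapx P * monom_at zo \<beta> = monom_at zo \<beta> * kapx P"
proof (induction P rule: dring.dopS_induct[OF dring_UNIV, consumes 1, case_names zero add monom])
  case (monom g \<alpha>)
  have x: "(xo i :: ('k, 'n + 'n) dop) * monom_at zo \<beta> = monom_at zo \<beta> * xo i" for i by (rule commute_monom_at) (rule xo_zo)
  have m: "mulop (rsub sx g) * zo i = zo i * mulop (rsub sx g)" for i
    by (simp add: zo_def pdop_mulop chain_sx)
  have m': "mulop (rsub sx g) * monom_at zo \<beta> = monom_at zo \<beta> * mulop (rsub sx g)"
    by (rule commute_monom_at) (rule m)
  have "(monom_at zo \<beta> :: ('k, 'n + 'n) dop) * monom_at xo \<alpha> = monom_at xo \<alpha> * monom_at zo \<beta>"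
    by (rule commute_monom_at) (rule x[symmetric])
  then show ?case unfolding kx.H_monom by (intro commute_mult m') simp
qed (auto simp: kx.H_0 kx.H_add distrib_left distrib_right)

lemma kapx_sy:
  fixes P :: "('k::field_char_0, 'n::{finite,linorder}) dop"
  shows "P : dopS UNIV ==> kapx P * mulop (rsub sy q) = mulop (rsub sy q) * kapx P"
proof (induction P rule: dring.dopS_induct[OF dring_UNIV, consumes 1, case_names zero add monom])
  case (monom g \<alpha>)
  have x: "mulop (rsub sy q) * xo i = xo i * mulop (rsub sy q)" for i
    by (simp add: xo_mulop chain_sy)
  have "mulop (rsub sy q) * monom_at xo \<alpha> = monom_at xo \<alpha> * mulop (rsub sy q)"
    by (rule commute_monom_at) (rule x)
  then show ?case unfolding kx.H_monom by (intro commute_mult mulop_commute) simp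
qed (auto simp: kx.H_0 kx.H_add distrib_left distrib_right)

subsection \<open>Operators divisible by the coordinates z\<close>

abbreviation zv :: "'n => ('k::field_char_0, 'n::{finite,linorder} + 'n) ratf" where "zv i \<equiv> rpol (mvar (Inl i))"

text \<open>The right ideal z_1 D + ... + z_n D in the stalk at a point of the diagonal; the
  transfer module is the quotient by it.\<close>

definition ZD :: "('n::{finite,linorder} => 'k::field_char_0) => ('k, 'n + 'n) dop set" where
  "ZD p = {\<Sum>i\<in>UNIV. mulop (zv i) * T i | T. \<forall>i. T i : Dop {z0 p}}"

lemma ZD_nsub: "nsub (ZD p)"
proof -
  have "0 : ZD p" unfolding ZD_def using Dop_0 by (intro CollectI exI[of _ "%_. 0"]) simp
  moreover have "x + y : ZD p" if xy: "x : ZD p" "y : ZD p" for x y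
  proof -
    obtain T T' where "x = (\<Sum>i\<in>UNIV. mulop (zv i) * T i)" "\<forall>i. T i : Dop {z0 p}" "y = (\<Sum>i\<in>UNIV. mulop (zv i) * T' i)" "\<forall>i. T' i : Dop {z0 p}"
      using xy unfolding ZD_def by blast
    then show ?thesis unfolding ZD_def
      by (intro CollectI exI[of _ "%i. T i + T' i"]) (auto simp: sum.distrib distrib_left Dop_add)
  qed
  moreover have "- x : ZD p" if x: "x : ZD p" for x
  proof -
    obtain T where "x = (\<Sum>i\<in>UNIV. mulop (zv i) * T i)" "\<forall>i. T i : Dop {z0 p}"
      using x unfolding ZD_def by blast
    then show ?thesis unfolding ZD_def
      by (intro CollectI exI[of _ "%i. - T i"]) (auto simp: sum_negf Dop_minus)
  qed
  ultimately show ?thesis by (simp add: nsub_def)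
qed

lemma ZD_mult: assumes "x : ZD p" "P : Dop {z0 p}" shows "x * P : ZD p"
proof -
  obtain T where "x = (\<Sum>i\<in>UNIV. mulop (zv i) * T i)" "\<forall>i. T i : Dop {z0 p}"
    using assms unfolding ZD_def by blast
  then show ?thesis unfolding ZD_def
    using assms(2) by (intro CollectI exI[of _ "%i. T i * P"]) (auto simp: sum_distrib_right mult.assoc Dop_mult)
qed

lemma z_split:
  fixes u :: "('k::field_char_0, 'n::{finite,linorder} + 'n) mpol"
  shows "\<exists>w. u = msubst sx (msubst s0 u) + (\<Sum>i\<in>UNIV. mvar (Inl i) * w i)"
proof (induction u rule: mpol_induct)
  case (const c) show ?case by (intro exI[of _ "%_. 0"]) simp
next
  case (var j)
  show ?case
  proof (cases j)
    case (Inl i)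
    have "(\<Sum>k\<in>UNIV. mvar (Inl k) * (if k = i then 1 else 0)) = (mvar (Inl i) :: ('k, 'n + 'n) mpol)"
      by (simp add: if_distrib[where f="%x. _ * x"] cong: if_cong)
    then show ?thesis by (intro exI[of _ "%k. if k = i then 1 else 0"]) (simp add: Inl s0_def msubst.hom_0)
  next
    case (Inr i) then show ?thesis by (intro exI[of _ "%_. 0"]) (simp add: s0_def sx_def)
  qed
next
  case (add p q)
  then obtain v w where vw: "p = msubst sx (msubst s0 p) + (\<Sum>i\<in>UNIV. mvar (Inl i) * v i)" "q = msubst sx (msubst s0 q) + (\<Sum>i\<in>UNIV. mvar (Inl i) * w i)" by blast
  have "(\<Sum>i\<in>UNIV. mvar (Inl i) * (v i + w i)) = (\<Sum>i\<in>UNIV. mvar (Inl i) * v i) + (\<Sum>i\<in>UNIV. mvar (Inl i) * w i)"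
    by (simp add: distrib_left sum.distrib)
  then show ?case
    unfolding msubst.hom_add using vw by (intro exI[of _ "%i. v i + w i"]) algebra
next
  case (mult p q)
  then obtain v w where vw: "p = msubst sx (msubst s0 p) + (\<Sum>i\<in>UNIV. mvar (Inl i) * v i)" "q = msubst sx (msubst s0 q) + (\<Sum>i\<in>UNIV. mvar (Inl i) * w i)" by blast
  let ?p = "msubst sx (msubst s0 p)"
  have "(\<Sum>i\<in>UNIV. mvar (Inl i) * (v i * q + ?p * w i)) = (\<Sum>i\<in>UNIV. mvar (Inl i) * v i) * q + ?p * (\<Sum>i\<in>UNIV. mvar (Inl i) * w i)"
    by (simp add: distrib_left sum.distrib sum_distrib_left sum_distrib_right mult_ac)
  then show ?case
    unfolding msubst.hom_mult using vw by (intro exI[of _ "%i. v i * q + ?p * w i"]) algebra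
qed

lemma ZD_function:
  assumes "a : reg {z0 p}" "rsub s0 a = 0" shows "mulop a : ZD p"
proof -
  obtain u v where uv: "meval (z0 p) v ~= 0" "a = rpol u / rpol v" using assms(1) unfolding reg_pt by blast
  have v0: "msubst s0 v ~= 0" using uv(1) unfolding z0_meval meval_msubst[symmetric] by auto
  then have "msubst s0 u = 0" using assms(2) unfolding uv(2) rsub_frac[OF v0] by simp
  then obtain w where w: "u = (\<Sum>i\<in>UNIV. mvar (Inl i) * w i)" using z_split[of u] by (auto simp: msubst.hom_0)
  have "mulop a = (\<Sum>i\<in>UNIV. mulop (zv i) * mulop (rpol (w i) / rpol v))"
    unfolding uv(2) w rpol.hom_sum rpol.hom_mult
    by (rule app_eqI) (simp add: app_sum app_times sum_divide_distrib sum_distrib_right sum_distrib_left mult_ac)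
  moreover have "rpol (w i) / rpol v : reg {z0 p}" for i
    using uv(1) unfolding reg_pt by blast
  ultimately show ?thesis unfolding ZD_def
    by (intro CollectI exI[of _ "%i. mulop (rpol (w i) / rpol v)"]) (auto intro: Dop_mulop)
qed

text \<open>Operators that modulo z are sums of A(x, \<partial>_x) \<partial>_y^\<beta> in the old
  coordinates; \<open>Dop_XD\<close> shows that nothing else occurs.\<close>

inductive_set XD :: "('n::{finite,linorder} => 'k::field_char_0) => ('k, 'n + 'n) dop set" for p where
  z: "T : ZD p ==> T : XD p"
| gen: "A : Dop {p} ==> kapx A * monom_at zo \<beta> : XD p"
| add: "T : XD p ==> T' : XD p ==> T + T' : XD p"

lemma Dop_UNIV: "P : Dop U ==> P : dopS UNIV"
  unfolding Dop_dopS by (rule dopS_UNIV)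

lemma XD_pdop:
  fixes p :: "'n::{finite,linorder} => 'k::field_char_0"
  assumes "T : XD p" shows "T * xo i : XD p" "T * zo i : XD p"
  using assms
proof (induction rule: XD.induct)
  case (z T)
  { case 1 show ?case by (rule XD.z[OF ZD_mult[OF z xo_mem(2)]]) }
  { case 2 show ?case by (rule XD.z[OF ZD_mult[OF z zo_mem(2)]]) }
next
  case (gen A \<beta>)
  { case 1
    have "(monom_at zo \<beta> :: ('k, 'n + 'n) dop) * xo i = xo i * monom_at zo \<beta>" by (rule commute_monom_at[symmetric]) (rule xo_zo)
    then have "kapx A * monom_at zo \<beta> * xo i = kapx (A * pdop i) * monom_at zo \<beta>"
      using gen by (simp add: kx.H_mult Dop_UNIV dring.dopS_pdop[OF dring_UNIV] kx.H_pdop mult.assoc)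
    then show ?case using XD.gen[OF Dop_mult[OF gen Dop_pdop[of i]], of \<beta>] by simp }
  { case 2
    show ?case using XD.gen[OF gen, of "\<beta> + Poly_Mapping.single i 1"] unfolding monom_at_step'[OF comfam_zo] by (simp add: mult.assoc) }
next
  case (add T T')
  { case 1 show ?case using XD.add[OF add(3,5)] by (simp add: distrib_right) }
  { case 2 show ?case using XD.add[OF add(4,6)] by (simp add: distrib_right) }
qed

text \<open>Modulo z a coefficient a(z, x) equals a(0, x). The derivations \<partial>_z and
  \<partial>_x of the new coordinates are the old \<partial>_y and \<partial>_x + \<partial>_y, and
  they can be appended on the right because \<open>ZD p\<close> is a right ideal.\<close>

lemma Dop_XD:
  fixes p :: "'n::{finite,linorder} => 'k::field_char_0"
  shows "T : Dop {z0 p} ==> T : XD p"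
proof (induction T rule: Dop_induct)
  case zero show ?case by (rule XD.z[OF nsubD(1)[OF ZD_nsub]])
next
  case (add P Q) then show ?case by (intro XD.add)
next
  case (monom a \<gamma>)
  let ?a = "rsub s0 a"
  have a: "?a : reg {p}" by (rule reg_Ls(2)[OF monom])
  have "mulop (a - rsub sx ?a) : ZD p"
    using monom sx_reg[OF a] reg_Ls(1)[OF monom]
    by (intro ZD_function dring.Sdiff[OF dring_reg]) (auto simp: rsub_diff sx_Ls)
  from XD.add[OF XD.z[OF this] XD.gen[OF Dop_mulop[OF a], of 0]]
  have ma: "mulop a : XD p" by (simp add: kx.H_mulop mulop_diff)
  have pd: "(pdop (Inl i) :: ('k, 'n + 'n) dop) = zo i" "(pdop (Inr i) :: ('k, 'n + 'n) dop) = xo i + zo i" for i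
    by (simp_all add: zo_def xo_def)
  show ?case
  proof (induction \<gamma> rule: expo_induct)
    case (step \<gamma> j)
    have "mulop a * monom_at pdop \<gamma> * pdop j : XD p"
      using XD_pdop[OF step] XD.add[OF XD_pdop[OF step]] by (cases j) (simp_all only: pd distrib_left)
    then show ?case unfolding monom_at_step'[OF comfam_pdop] mult.assoc .
  qed (simp add: ma)
qed

text \<open>B is defined for all exponents and zero outside S, so that several such sums can be
  brought to one index set.\<close>

lemma XD_sum:
  assumes "T : XD p"
  shows "\<exists>S B. finite S & (\<forall>\<beta>. B \<beta> : Dop {p}) & (\<forall>\<beta>. \<beta> \<notin> S --> B \<beta> = 0) &
    T - (\<Sum>\<beta>\<in>S. kapx (B \<beta>) * monom_at zo \<beta>) : ZD p"
  using assms
proof (induction rule: XD.induct)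
  case (z T)
  then show ?case using Dop_0 by (intro exI[of _ "{}"] exI[of _ "%_. 0"]) auto
next
  case (gen A \<beta>)
  then show ?case using Dop_0 nsubD(1)[OF ZD_nsub] by (intro exI[of _ "{\<beta>}"] exI[of _ "%\<gamma>. if \<gamma> = \<beta> then A else 0"]) auto
next
  case (add T T')
  obtain S B where S: "finite S" "!!\<beta>. B \<beta> : Dop {p}" "!!\<beta>. \<beta> \<notin> S ==> B \<beta> = 0" "T - (\<Sum>\<beta>\<in>S. kapx (B \<beta>) * monom_at zo \<beta>) : ZD p"
    using add(3) by blast
  obtain S' B' where S': "finite S'" "!!\<beta>. B' \<beta> : Dop {p}" "!!\<beta>. \<beta> \<notin> S' ==> B' \<beta> = 0" "T' - (\<Sum>\<beta>\<in>S'. kapx (B' \<beta>) * monom_at zo \<beta>) : ZD p"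
    using add(4) by blast
  let ?U = "S \<union> S'"
  have 1: "(\<Sum>\<beta>\<in>S. kapx (B \<beta>) * monom_at zo \<beta>) = (\<Sum>\<beta>\<in>?U. kapx (B \<beta>) * monom_at zo \<beta>)"
    by (rule sum.mono_neutral_left) (use S S' in \<open>auto simp: kx.H_0\<close>)
  have 2: "(\<Sum>\<beta>\<in>S'. kapx (B' \<beta>) * monom_at zo \<beta>) = (\<Sum>\<beta>\<in>?U. kapx (B' \<beta>) * monom_at zo \<beta>)"
    by (rule sum.mono_neutral_left) (use S S' in \<open>auto simp: kx.H_0\<close>)
  have "(\<Sum>\<beta>\<in>?U. kapx (B \<beta> + B' \<beta>) * monom_at zo \<beta>) = (\<Sum>\<beta>\<in>?U. kapx (B \<beta>) * monom_at zo \<beta>) + (\<Sum>\<beta>\<in>?U. kapx (B' \<beta>) * monom_at zo \<beta>)"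
    by (simp add: kx.H_add Dop_UNIV[OF S(2)] Dop_UNIV[OF S'(2)] distrib_right sum.distrib)
  then have "T + T' - (\<Sum>\<beta>\<in>?U. kapx (B \<beta> + B' \<beta>) * monom_at zo \<beta>) : ZD p"
    using nsubD(2)[OF ZD_nsub S(4) S'(4)] unfolding 1 2 by (simp add: algebra_simps)
  then show ?case using S S'
    by (intro exI[of _ ?U] exI[of _ "%\<beta>. B \<beta> + B' \<beta>"]) (auto intro: Dop_add)
qed

subsection \<open>The restriction map\<close>

context powers
begin

definition "uu = rsub sx (Fp \<nu>)"

text \<open>An operator T on the product is sent to the operator \<open>h \<mapsto> (T (f(x)^\<nu> h(y)))|y=x\<close>.\<close>

definition psi :: "('k, 'n + 'n) dop => ('k, 'n) dop" where
  "psi T = Endo (%h. rsub s0 (app T (uu * rsub sy h)))"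

lemma test_Ls: "uu * rsub sy h : Ls"
  unfolding uu_def using sx_Ls(1) sy_Ls(1) by (rule rsub_ring(3))

lemma psi_app: assumes "T : D2" shows "app (psi T) h = rsub s0 (app T (uu * rsub sy h))"
  unfolding psi_def
  by (subst app_Endo) (simp_all add: rhom.hom_add[OF rhom_sy] distrib_left app_add rsub_ring(2) D2_app[OF assms test_Ls])

lemma psi_add: "T : D2 ==> T' : D2 ==> psi (T + T') = psi T + psi T'"
  by (rule app_eqI) (simp add: psi_app D2_add app_plus rsub_ring D2_app test_Ls)

lemma psi_0: "psi 0 = 0"
  by (rule app_eqI) (simp add: psi_app dring.dopS_0[OF dring_regS])

lemma psi_diff: "T : D2 ==> T' : D2 ==> psi (T - T') = psi T - psi T'"
  by (rule app_eqI) (simp add: psi_app dring.dopS_diff[OF dring_regS] app_diff rsub_diff D2_app test_Ls)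

lemma psi_sum: "(!!x. x : A ==> T x : D2) ==> psi (sum T A) = (\<Sum>x\<in>A. psi (T x))"
  by (induction A rule: infinite_finite_induct) (auto simp: psi_0 psi_add D2_sum)

lemma psi_mulop: "g : Ls ==> T : D2 ==> psi (mulop g * T) = mulop (rsub s0 g) * psi T"
  by (rule app_eqI) (simp add: psi_app D2_mult D2_mulop app_times rsub_ring D2_app test_Ls)

lemma psi_pdop: "T : D2 ==> psi (pdop (Inr i) * T) = pdop i * psi T"
  by (rule app_eqI) (simp add: psi_app D2_mult D2_pdop app_times chain_s0 D2_app test_Ls)

lemma kapx_test: "P : dopS UNIV ==> app (kapx P) (rsub sx u * rsub sy h) = rsub sx (app P u) * rsub sy h"
  by (rule kx.H_app[where \<theta>="%u. rsub sx u * rsub sy h"])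
    (simp_all add: rhom.hom_add[OF rhom_sx] rhom.hom_mult[OF rhom_sx] distrib_right mult.assoc xo_def app_diff rpd_mult chain_sx chain_sy)

lemma kapy_test: "P : dopS UNIV ==> app (kapy P) (uu * rsub sy h) = uu * rsub sy (app P h)"
  by (rule ky.H_app[where \<theta>="%h. uu * rsub sy h"])
    (simp_all add: uu_def rhom.hom_add[OF rhom_sy] rhom.hom_mult[OF rhom_sy] distrib_left mult_ac zo_def rpd_mult chain_sx chain_sy)

lemma kap_D2:
  fixes P :: "('k, 'n) dop"
  shows "kapx P : D2" "kapy P : D2"
proof -
  have o: "(xo i :: ('k, 'n + 'n) dop) : D2" "(zo i :: ('k, 'n + 'n) dop) : D2" for i
    unfolding xo_def zo_def by (intro dring.dopS_diff[OF dring_regS] D2_pdop)+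
  show "kapx P : D2"
    by (rule dmap_mem[where \<xi>="rsub sx", OF comfam_xo subring_dopS[OF dring_regS]]) (intro D2_mulop sx_Ls o)+
  show "kapy P : D2"
    by (rule dmap_mem[where \<xi>="rsub sy", OF comfam_zo subring_dopS[OF dring_regS]]) (intro D2_mulop sy_Ls o)+
qed

text \<open>The rightmost operator acts first; being an operator in x it meets only
  f(x)^\<nu>.\<close>

lemma psi_kapx: "T : D2 ==> P : dopS UNIV ==> app P (Fp \<nu>) = 0 ==> psi (T * kapx P) = 0"
  by (rule app_eqI) (simp add: psi_app D2_mult kap_D2 app_times uu_def kapx_test)

text \<open>An operator in y acts first and meets only h(y), hence it becomes composition on the
  right.\<close>

lemma psi_kapy: "T : D2 ==> Q : dopS UNIV ==> psi (T * kapy Q) = psi T * Q"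
  by (rule app_eqI) (simp add: psi_app D2_mult kap_D2 app_times kapy_test)

lemma psi_gen: assumes "A : dopS UNIV" shows "psi (kapx A * monom_at zo \<beta>) = mulop (app A (Fp \<nu>)) * monom_at pdop \<beta>"
proof -
  have "psi (kapx A) = mulop (app A (Fp \<nu>))"
    by (rule app_eqI) (simp add: psi_app kap_D2 uu_def kapx_test assms rsub_ring sx_Ls sy_Ls)
  then show ?thesis unfolding zo_monom(1)
    using psi_kapy[OF kap_D2(1) dring.dopS_pdmonom[OF dring_UNIV]] by simp
qed

lemma psi_z: "T : ZD p ==> psi T = 0"
proof -
  assume "T : ZD p"
  then obtain B where B: "T = (\<Sum>i\<in>UNIV. mulop (zv i) * B i)" "!!i. B i : Dop {z0 p}" unfolding ZD_def by blast
  have z: "(zv i :: ('k, 'n + 'n) ratf) : Ls" "rsub s0 (zv i :: ('k, 'n + 'n) ratf) = 0" for i by (simp_all add: rpol_regS s0_def rpol.hom_0)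
  have BD: "B i : D2" for i using B(2) Dop_D2 by blast
  have "psi T = (\<Sum>i\<in>UNIV. psi (mulop (zv i) * B i))"
    unfolding B(1) by (rule psi_sum) (intro D2_mult D2_mulop z BD)
  then show ?thesis using psi_mulop[OF z(1) BD] z(2) by (simp add: rpol.hom_0)
qed

lemma ZD_D2: "T : ZD p ==> T : Dop {z0 p}"
  unfolding ZD_def by (auto intro!: Dop_sum Dop_mult Dop_mulop rpol_reg)

lemma gen_Dop: "A : Dop {p} ==> kapx A * monom_at zo \<beta> : Dop {z0 p}"
  by (intro Dop_mult kapx_Dop zo_monom)

text \<open>By \<open>Dop_XD\<close> only the operators A(x) \<partial>_y^\<beta> count, and these
  go to (A f^\<nu>) \<partial>^\<beta>, whose coefficient has a pole along f at worst.\<close>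

lemma psi_Oloc: assumes "T : Dop {z0 p}" shows "psi T : dopS (Oloc f {p})"
proof -
  interpret O: dring "Oloc f {p}" by (rule dring_Oloc[OF f0])
  have "psi T : dopS (Oloc f {p}) & T : Dop {z0 p}" using Dop_XD[OF assms]
  proof (induction rule: XD.induct)
    case (z T) then show ?case by (simp add: psi_z ZD_D2 O.dopS_0)
  next
    case (gen A \<beta>)
    have "app A (Fp \<nu>) : Oloc f {p}"
      using O.dopS_app[OF _ Fp_Oloc] gen dopS_mono[OF reg_Oloc] unfolding Dop_dopS by blast
    then show ?case using gen by (simp add: psi_gen Dop_UNIV O.dopS_monom gen_Dop)
  next
    case (add T T') then show ?case using Dop_D2[of p] by (auto simp: psi_add O.dopS_add Dop_add subset_iff)
  qed
  then show ?thesis by blast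
qed

lemma psi_surj: assumes "P : dopS (Oloc f {p})" shows "\<exists>T\<in>Dop {z0 p}. psi T = P"
  using assms
proof (induction P rule: dring.dopS_induct[OF dring_Oloc[OF f0], consumes 1, case_names zero add monom])
  case zero show ?case using psi_0 Dop_0 by blast
next
  case (add P Q)
  then obtain T T' where "T : Dop {z0 p}" "psi T = P" "T' : Dop {z0 p}" "psi T' = Q" by blast
  then show ?case using psi_add[of T T'] Dop_D2[of p] Dop_add by (intro bexI[of _ "T + T'"]) auto
next
  case (monom g \<beta>)
  obtain A where "A : Dop {p}" "app A (Fp \<nu>) = g" using Oloc_lift[OF monom] by blast
  then show ?case using psi_gen[of A \<beta>] gen_Dop[of A p \<beta>] Dop_UNIV by blast
qed

end

section \<open>The module defined by I_4 and its stalks on the diagonal\<close>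

locale diag = powers f bf \<nu>
  for f :: "('k::field_char_0, 'n::{finite,linorder}) mpol" and bf \<nu> +
  fixes N :: "(('k, 'n) dop ^ 'r) set" and SJ SN
  assumes N: "lsubmodule weyl_vec_mod weyl N" and SJ: "lspan weyl_mod weyl SJ = fs_ann_at f \<nu>"
    and SN: "lspan weyl_vec_mod weyl SN = N"
begin

lemma N_props: "nsub N" "N \<subseteq> weyl_vecs" "P : weyl ==> w : N ==> actv P w : N"
proof -
  show w: "P : weyl ==> w : N ==> actv P w : N" for P w using N by (auto simp: lsubmodule_def weyl_vec_mod_def)
  have "- x : N" if "x : N" for x using w[OF weyl_minus[OF weyl_1] that] by (simp add: vec_eq_iff uminus_vec_def)
  then show "nsub N" using N by (auto simp: nsub_def lsubmodule_def weyl_vec_mod_def)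
  show "N \<subseteq> weyl_vecs" using N by (simp add: lsubmodule_def weyl_vec_mod_def)
qed

sublocale NQ: localized actv weyl_vecs N f
  by (intro localized.intro weyl_vec_quot N_props localized_axioms.intro f0)

abbreviation "I4 \<equiv> lspan weyl_vec_mod weyl (G4 SJ SN)"

lemma SJ_J: "SJ \<subseteq> J"
proof
  fix x assume "x : SJ"
  then have "1 * x : lspan weyl_mod weyl SJ"
    unfolding lspan_def weyl_mod_def by (intro addspan_gen) (use weyl_1 in force)
  then show "x : J" using SJ by simp
qed

lemma SN_N: "SN \<subseteq> N"
proof
  fix x assume "x : SN"
  then have "actv 1 x : lspan weyl_vec_mod weyl SN"
    unfolding lspan_def weyl_vec_mod_def by (intro addspan_gen) (use weyl_1 in force)
  then show "x : N" using SN by simp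
qed

lemma G4_eq: "G4 SJ SN = {axis j (kapx P) | P j. P : SJ} \<union> {\<chi> j. kapy (Q $ j) | Q. Q : SN}"
proof -
  have c0: "coord_change 0 = (0 :: ('k, 'n + 'n) dop)" by (simp only: coord_change_dmap[OF weyl_0] kxy.H_0)
  have a: "(\<chi> i. coord_change (axis j (in_x P) $ i)) = axis j (kapx P)" if "P : SJ" for j :: 'r and P
    using coord_in_x[of P] that SJ_J J_weyl by (auto simp: vec_eq_iff axis_def c0)
  have b: "(\<chi> j. coord_change (in_y (Q $ j))) = (\<chi> j. kapy (Q $ j))" if "Q : SN" for Q
    using coord_in_y that SN_N N_props(2) by (auto simp: vec_eq_iff weyl_vecs_def)
  have "G4 SJ SN = {\<chi> i. coord_change (axis j (in_x P) $ i) | P j. P : SJ} \<union> {\<chi> j. coord_change (in_y (Q $ j)) | Q. Q : SN}"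
    unfolding G4_def G3_def by force
  also have "\<dots> = {axis j (kapx P) | P j. P : SJ} \<union> {\<chi> j. kapy (Q $ j) | Q. Q : SN}"
    using a b by (intro arg_cong2[where f="(\<union>)"] Collect_cong) (metis, metis)
  finally show ?thesis .
qed

lemma G4_weyl: "G4 SJ SN \<subseteq> weyl_vecs"
proof -
  have "axis j (kapx P) : weyl_vecs" if "P : SJ" for j :: 'r and P
    using that SJ_J J_weyl kap_weyl(1)[of P] by (auto simp: weyl_vecs_def axis_def weyl_0)
  moreover have "(\<chi> j. kapy (Q $ j)) : weyl_vecs" if "Q : SN" for Q
    using that SN_N N_props(2) kap_weyl(2) by (auto simp: weyl_vecs_def)
  ultimately show ?thesis unfolding G4_eq by blast
qed

lemma I4_props: "nsub I4" "I4 \<subseteq> weyl_vecs" "G4 SJ SN \<subseteq> I4" "P : weyl ==> w : I4 ==> actv P w : I4"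
proof -
  note L = vact.lspan_stable[OF weyl_vecs_nsub _ G4_weyl, folded weyl_vec_mod_def]
  show "nsub I4" by (rule L(1)) (rule weyl_vecs_act)
  show "I4 \<subseteq> weyl_vecs" by (rule L(2)) (rule weyl_vecs_act)
  show "G4 SJ SN \<subseteq> I4" by (rule L(3)) (rule weyl_vecs_act)
  show "P : weyl ==> w : I4 ==> actv P w : I4" by (rule L(4)) (rule weyl_vecs_act)
qed

text \<open>Inverting 1 changes nothing; this instance supplies \<open>MS\<close> and
  \<open>rep\<close> for the module defined by I_4.\<close>

sublocale IQ: localized actv weyl_vecs I4 1
  by (intro localized.intro weyl_vec_quot I4_props localized_axioms.intro one_neq_zero)

lemma I4_J: assumes "P : J" shows "axis j (kapx P) : I4"
proof -
  let ?V = "{P : weyl. axis j (kapx P) : I4}"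
  have V: "nsub ?V"
  proof -
    have [simp]: "axis j (0 :: ('k, 'n + 'n) dop) = 0" and "axis j (a + b) = axis j a + axis j b" "axis j (- a) = - axis j a" for a b :: "('k, 'n + 'n) dop"
      by (simp_all add: axis_def vec_eq_iff)
    then show ?thesis unfolding nsub_def
      using nsubD[OF I4_props(1)] by (auto simp: weyl_0 weyl_add weyl_minus kx.H_0 kx.H_add kx.H_minus weyl_UNIV)
  qed
  have "P : addspan (natmod (*) weyl) {smul (natmod (*) weyl) r x | r x. r : weyl & x : SJ}"
    using assms SJ by (simp add: weyl_mod_def lspan_def)
  then have "P : ?V"
  proof (rule addspan_sub[OF _ V])
    have "r * x : ?V" if r: "r : weyl" "x : SJ" for r x
    proof -
      have x: "x : weyl" using r SJ_J J_weyl by blast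
      have "axis j (kapx (r * x)) = actv (kapx r) (axis j (kapx x))"
        using r x by (simp add: kx.H_mult weyl_UNIV vec_eq_iff axis_def)
      also have "\<dots> : I4"
        by (rule I4_props(4)[OF kap_weyl(1)[OF r(1)] subsetD[OF I4_props(3)]]) (use r in \<open>auto simp: G4_eq\<close>)
      finally show ?thesis using weyl_mult[OF r(1) x] by simp
    qed
    then show "{smul (natmod (*) weyl) r x | r x. r : weyl & x : SJ} \<subseteq> ?V" by auto
  qed
  then show ?thesis by simp
qed

lemma I4_N: assumes "n : N" shows "(\<chi> j. kapy (n $ j)) : I4"
proof -
  let ?V = "{n : weyl_vecs. (\<chi> j. kapy (n $ j)) : I4}"
  have V: "nsub ?V"
  proof -
    have "(\<chi> j. kapy ((0 :: ('k, 'n) dop ^ 'r) $ j)) = 0" by (simp add: vec_eq_iff ky.H_0)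
    moreover have "(\<chi> j. kapy ((x + y) $ j)) = (\<chi> j. kapy (x $ j)) + (\<chi> j. kapy (y $ j))" "(\<chi> j. kapy ((- x) $ j)) = - (\<chi> j. kapy (x $ j))"
      if "x : weyl_vecs" "y : weyl_vecs" for x y :: "('k, 'n) dop ^ 'r"
      using that by (simp_all add: vec_eq_iff weyl_vecs_def ky.H_add ky.H_minus weyl_UNIV)
    ultimately show ?thesis unfolding nsub_def
      using nsubD[OF I4_props(1)] nsubD[OF weyl_vecs_nsub[where 'k='k and 'n='n and 'r='r]] by simp
  qed
  have "n : addspan (natmod actv weyl_vecs) {smul (natmod actv weyl_vecs) r x | r x. r : weyl & x : SN}"
    using assms SN by (simp add: weyl_vec_mod_def lspan_def)
  then have "n : ?V"
  proof (rule addspan_sub[OF _ V])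
    have "actv r x : ?V" if r: "r : weyl" "x : SN" for r x
    proof -
      have x: "x : weyl_vecs" using r SN_N N_props(2) by blast
      have "(\<chi> j. kapy (actv r x $ j)) = actv (kapy r) (\<chi> j. kapy (x $ j))"
        using r x by (simp add: ky.H_mult weyl_UNIV vec_eq_iff weyl_vecs_def)
      also have "\<dots> : I4"
        by (rule I4_props(4)[OF kap_weyl(2)[OF r(1)] subsetD[OF I4_props(3)]]) (use r in \<open>auto simp: G4_eq\<close>)
      finally show ?thesis using weyl_vecs_act[OF r(1) x] by simp
    qed
    then show "{smul (natmod actv weyl_vecs) r x | r x. r : weyl & x : SN} \<subseteq> ?V" by auto
  qed
  then show ?thesis by simp
qed

definition psiv :: "('k, 'n + 'n) dop ^ 'r => ('k, 'n) dop ^ 'r" where "psiv c = (\<chi> j. psi (c $ j))"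

abbreviation "D2v \<equiv> {c :: ('k, 'n + 'n) dop ^ 'r. \<forall>j. c $ j : D2}"

lemma ICQ: "v : IQ.CQ q \<longleftrightarrow> (\<forall>j. v $ j : Dop {q})"
  by (rule vec_CQ[OF IQ.weyl_quot_axioms])

lemma NCQ: "v : NQ.CQ q \<longleftrightarrow> (\<forall>j. v $ j : Dop {q})"
  by (rule vec_CQ[OF NQ.weyl_quot_axioms])

lemma IRQ_Dop: assumes "c : IQ.RQ q" shows "c $ j : Dop {q}"
proof -
  obtain h where h: "meval q h ~= 0" "actv (polop h) c : I4" using assms by (auto simp: IQ.RQ_def)
  then have "polop h * c $ j : weyl" using I4_props(2) by (auto simp: weyl_vecs_def)
  then have "polop h * c $ j : Dop {q}" by (rule weyl_Dop)
  moreover have "h ~= 0" using h(1) by (auto simp: meval.hom_0)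
  ultimately show ?thesis using h(1) Dop_unclear[of h "c $ j" "{q}"] by simp
qed

text \<open>A vector has finitely many entries, so one power of f clears the poles of all of
  them.\<close>

lemma NCL: "v : NQ.CL p \<longleftrightarrow> (\<forall>j. v $ j : dopS (Oloc f {p}))"
proof
  assume "v : NQ.CL p"
  then obtain c k where c: "v = actv (mulop (NQ.fi k)) c" "c : NQ.CQ p" by (auto simp: NQ.CL_def)
  then have "c $ j : dopS (Oloc f {p})" for j using c(2) unfolding NCQ by (intro subsetD[OF NQ.Dop_L]) simp
  then show "\<forall>j. v $ j : dopS (Oloc f {p})"
    unfolding c(1) using dring.dopS_mulop_mult[OF dring_Oloc[OF f0] _ NQ.fi_Oloc] by simp
next
  assume v: "\<forall>j. v $ j : dopS (Oloc f {p})"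
  have "\<exists>k. \<forall>j\<in>A. polop (f ^ k) * v $ j : Dop {p}" if "finite A" for A
    using that
  proof (induction A)
    case (insert i A)
    then obtain k where k: "!!j. j : A ==> polop (f ^ k) * v $ j : Dop {p}" by blast
    obtain l where l: "polop (f ^ l) * v $ i : Dop {p}" using Oloc_clear[OF f0 spec[OF v]] by blast
    have "polop (f ^ (l + k)) * v $ j : Dop {p}" if "j : A" for j
      using Dop_mult[OF Dop_polop k[OF that], of "f ^ l"] by (simp add: power_add polop_mult mult.assoc)
    moreover have "polop (f ^ (l + k)) * v $ i : Dop {p}"
      using Dop_mult[OF Dop_polop l, of "f ^ k"] by (simp add: add.commute[of l] power_add polop_mult mult.assoc)
    ultimately show ?case by blast
  qed simp
  from this[of UNIV] obtain k where k: "!!j. polop (f ^ k) * v $ j : Dop {p}" by auto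
  have "v = actv (mulop (NQ.fi k)) (actv (polop (f ^ k)) v)"
    using NQ.fi_mult(4)[of k] by (simp add: vec_eq_iff polop_eq flip: mult.assoc mulop_mult)
  moreover have "actv (polop (f ^ k)) v : NQ.CQ p" using k by (simp add: NCQ)
  ultimately show "v : NQ.CL p" unfolding NQ.CL_def by blast
qed

lemma psiv_ops: "c : D2v ==> d : D2v ==> psiv (c + d) = psiv c + psiv d"
  "c : D2v ==> d : D2v ==> psiv (c - d) = psiv c - psiv d"
  "c : D2v ==> g : Ls ==> psiv (actv (mulop g) c) = actv (mulop (rsub s0 g)) (psiv c)"
  "c : D2v ==> psiv (actv (pdop (Inr i)) c) = actv (pdop i) (psiv c)"
  by (simp_all add: psiv_def vec_eq_iff psi_add psi_diff psi_mulop psi_pdop)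

text \<open>A multiple of a generator from J_f(\<nu>) goes to 0, since that generator kills f^\<nu>.
  A multiple r Q(y) of a generator from N goes to psi(r) Q, a multiple of an element of N by an
  operator with poles along f.\<close>

lemma I4_psi: assumes "w : I4" shows "psiv w : NQ.RL p"
proof -
  let ?V = "{w : weyl_vecs. psiv w : NQ.RL p}"
  have wD2: "w : D2v" if "w : weyl_vecs" for w :: "('k, 'n + 'n) dop ^ 'r"
    using that weyl_Dop[of _ "{z0 p}"] Dop_D2[of p] by (auto simp: weyl_vecs_def)
  note W = nsubD[OF weyl_vecs_nsub[where 'k='k and 'n="'n + 'n" and 'r='r]] and RLd = nsubD[OF NQ.RL_nsub[of p]]
  have V: "nsub ?V"
    unfolding nsub_def
  proof (intro conjI ballI)
    have "psiv 0 = 0" by (simp add: psiv_def vec_eq_iff psi_0)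
    then show "0 : ?V" using W RLd(1) nsubD(1)[OF NQ.RL_nsub] by simp
    fix x assume x: "x : ?V"
    have "psiv (- x) = - psiv x" using psiv_ops(2)[OF wD2 wD2, of 0 x] x W \<open>psiv 0 = 0\<close> by simp
    then show "- x : ?V" using x W RLd by simp
    fix y assume "y : ?V"
    then show "x + y : ?V" using x W RLd psiv_ops(1)[OF wD2 wD2, of x y] by simp
  qed
  have "actv r g : ?V" if r: "r : weyl" "g : G4 SJ SN" for r g
  proof -
    have rD: "r : Dop {z0 p}" "r : D2" using weyl_Dop[OF r(1), of "{z0 p}"] Dop_D2[of p] by blast+
    have g: "(\<exists>P j. g = axis j (kapx P) & P : SJ) \<or> (\<exists>Q. g = (\<chi> j. kapy (Q $ j)) & Q : SN)"
      using r(2) unfolding G4_eq by blast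
    have "psiv (actv r g) : NQ.RL p"
    proof (use g in \<open>elim disjE exE conjE\<close>)
      fix P j assume g: "g = axis j (kapx P)" "P : SJ"
      have "psi (r * kapx P) = 0"
        by (rule psi_kapx[OF rD(2)]) (use g SJ_J J_weyl J_kill in \<open>auto intro: weyl_UNIV\<close>)
      then have "psiv (actv r g) = 0" by (simp add: g(1) psiv_def vec_eq_iff axis_def psi_0)
      then show ?thesis using nsubD(1)[OF NQ.RL_nsub] by simp
    next
      fix Q assume g: "g = (\<chi> j. kapy (Q $ j))" "Q : SN"
      have Q: "Q : N" "!!j. Q $ j : weyl" using g SN_N N_props(2) by (auto simp: weyl_vecs_def)
      have "psiv (actv r g) = actv (psi r) Q"
        by (simp add: g(1) psiv_def vec_eq_iff psi_kapy rD Q weyl_UNIV)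
      also have "\<dots> : NQ.RL p"
        using NQ.RL_act[OF psi_Oloc[OF rD(1)]] NQ.N_RQ[OF Q(1)] NQ.RQ_RL by blast
      finally show ?thesis .
    qed
    then show ?thesis using weyl_vecs_act[OF r(1)] r(2) G4_weyl by auto
  qed
  then have "w : ?V" using assms unfolding lspan_def weyl_vec_mod_def
    by (elim addspan_sub[OF _ V]) auto
  then show ?thesis by simp
qed

lemma IRQ_psi: assumes "c : IQ.RQ (z0 p)" shows "psiv c : NQ.RL p"
proof -
  obtain h where h: "meval (z0 p) h ~= 0" "actv (polop h) c : I4" using assms by (auto simp: IQ.RQ_def)
  have c: "c : D2v" using IRQ_Dop[OF assms] Dop_D2[of p] by auto
  have m: "meval p (msubst s0 h) ~= 0" using h(1) by (simp add: z0_meval meval_msubst)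
  then have m0: "rpol (msubst s0 h) ~= 0" by auto
  have "actv (mulop (rpol (msubst s0 h))) (psiv c) : NQ.RL p"
    using I4_psi[OF h(2), of p] psiv_ops(3)[OF c rpol_regS[of h]] by (simp add: polop_eq)
  from NQ.RL_act[OF subsetD[OF NQ.Dop_L Dop_mulop[OF inverse_reg[of "{p}" "msubst s0 h"]]] this]
  show ?thesis using m m0 by (simp add: vec_eq_iff flip: mult.assoc mulop_mult)
qed

lemma psiv_CL: "c : IQ.CQ (z0 p) ==> psiv c : NQ.CL p"
  unfolding ICQ NCL using psi_Oloc by (simp add: psiv_def)

lemma psiv_surj: assumes "c : NQ.CL p" shows "\<exists>d\<in>IQ.CQ (z0 p). psiv d = c"
proof -
  have "\<forall>j. \<exists>T. T : Dop {z0 p} & psi T = c $ j" using psi_surj assms unfolding NCL by blast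
  then obtain T where "!!j. T j : Dop {z0 p} & psi (T j) = c $ j" by metis
  then show ?thesis by (intro bexI[of _ "\<chi> j. T j"]) (auto simp: psiv_def vec_eq_iff ICQ)
qed

text \<open>By \<open>kill_J\<close> some h A lies in J_f(\<nu>). Since operators in x commute with
  \<partial>_y^\<beta>, that factor moves to the left, where I_4 absorbs it.\<close>

lemma IRQ_axis_J:
  assumes A: "A : Dop {p}" "app A (Fp \<nu>) = 0" shows "axis j (kapx A * monom_at zo \<beta>) : IQ.RQ (z0 p)"
proof -
  obtain h where h: "meval p h ~= 0" "polop h * A : J" using kill_J[OF A] by blast
  have hA: "kapx (polop h * A) = mulop (rpol (msubst sx h)) * kapx A"
    using A(1) by (simp add: polop_eq kx.H_mulop_mult Dop_UNIV)
  have "actv (polop (msubst sx h)) (axis j (kapx A * monom_at zo \<beta>)) = actv (monom_at zo \<beta>) (axis j (kapx (polop h * A)))"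
  proof -
    have "polop h * A : dopS UNIV" using h(2) J_weyl weyl_UNIV by blast
    then have "mulop (rpol (msubst sx h)) * (kapx A * monom_at zo \<beta>) = monom_at zo \<beta> * kapx (polop h * A)"
      unfolding mult.assoc[symmetric] hA[symmetric] by (rule kapx_zo)
    then show ?thesis by (simp add: vec_eq_iff axis_def polop_eq)
  qed
  also have "\<dots> : I4" by (rule I4_props(4)[OF zo_monom(3) I4_J[OF h(2)]])
  finally have I: "actv (polop (msubst sx h)) (axis j (kapx A * monom_at zo \<beta>)) : I4" .
  have "meval (z0 p) (msubst sx h) = meval p h"
    by (simp add: meval_msubst sx_def z0_def)
  then show ?thesis unfolding IQ.RQ_def using h(1) I by (intro CollectI exI[of _ "msubst sx h"]) simp
qed

lemma kernel:
  assumes c: "c : IQ.CQ (z0 p)" and R: "psiv c : NQ.RL p"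
  shows "\<exists>d. (\<forall>i. d i : IQ.CQ (z0 p)) & c - (\<Sum>i\<in>UNIV. actv (mulop (zv i)) (d i)) : IQ.RQ (z0 p)"
proof -
  have cD: "c $ j : Dop {z0 p}" for j using c by (simp add: ICQ)
  from choice[OF allI[OF XD_sum[OF Dop_XD[OF cD]]]] obtain S0 where
    "\<forall>j. \<exists>B. finite (S0 j) & (\<forall>\<beta>. B \<beta> : Dop {p}) & (\<forall>\<beta>. \<beta> \<notin> S0 j --> B \<beta> = 0) &
      c $ j - (\<Sum>\<beta>\<in>S0 j. kapx (B \<beta>) * monom_at zo \<beta>) : ZD p" ..
  from choice[OF this] obtain B where "\<forall>j. finite (S0 j) & (\<forall>\<beta>. B j \<beta> : Dop {p}) & (\<forall>\<beta>. \<beta> \<notin> S0 j --> B j \<beta> = 0) &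
      c $ j - (\<Sum>\<beta>\<in>S0 j. kapx (B j \<beta>) * monom_at zo \<beta>) : ZD p" ..
  then have S0: "!!j. finite (S0 j)" "!!j \<beta>. B j \<beta> : Dop {p}" "!!j \<beta>. \<beta> \<notin> S0 j ==> B j \<beta> = 0"
    "!!j. c $ j - (\<Sum>\<beta>\<in>S0 j. kapx (B j \<beta>) * monom_at zo \<beta>) : ZD p" by simp_all
  \<comment> \<open>A common index set for all entries of the vector.\<close>
  define S where "S = (\<Union>j. S0 j)"
  have S: "finite S" "!!j \<beta>. \<beta> \<notin> S ==> B j \<beta> = 0" using S0(1,3) by (auto simp: S_def)
  let ?v = "%j. \<Sum>\<beta>\<in>S. kapx (B j \<beta>) * monom_at zo \<beta>"
  have "(\<Sum>\<beta>\<in>S0 j. kapx (B j \<beta>) * monom_at zo \<beta>) = ?v j" for j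
    by (rule sum.mono_neutral_left) (use S S0(3) in \<open>auto simp: S_def kx.H_0\<close>)
  then have cv: "c $ j - ?v j : ZD p" for j using S0(4)[of j] by simp
  let ?u = "%j \<beta>. app (B j \<beta>) (Fp \<nu>)"
  have gD: "kapx (B j \<beta>) * monom_at zo \<beta> : D2" for j \<beta> using gen_Dop[OF S0(2)] Dop_D2 by blast
  have vD: "?v j : D2" for j by (rule D2_sum) (rule gD)
  have psic: "psi (c $ j) = (\<Sum>\<beta>\<in>S. mulop (?u j \<beta>) * monom_at pdop \<beta>)" for j
  proof -
    have "psi (c $ j) - psi (?v j) = psi (c $ j - ?v j)"
      by (rule psi_diff[symmetric]) (use cD Dop_D2[of p] vD in auto)
    also have "\<dots> = 0" by (rule psi_z[OF cv])
    finally have "psi (c $ j) = psi (?v j)" by simp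
    also have "\<dots> = (\<Sum>\<beta>\<in>S. mulop (?u j \<beta>) * monom_at pdop \<beta>)"
      using psi_sum[of S "%\<beta>. kapx (B j \<beta>) * monom_at zo \<beta>"] gD psi_gen[OF Dop_UNIV[OF S0(2)]] by simp
    finally show ?thesis .
  qed
  obtain l h where h: "meval p h ~= 0" "actv (polop h) (actv (polop (f ^ l)) (psiv c)) : N"
    using R by (auto simp: NQ.RL_def NQ.RQ_def)
  \<comment> \<open>The multiplier w = h f^l removes both the denominator at p and the pole along f,
    so that n lies in N and has polynomial coefficients.\<close>
  define n where "n = actv (polop (h * f ^ l)) (psiv c)"
  have nN: "n : N" using h(2) by (simp add: n_def polop_mult mult.assoc)
  let ?w = "rpol (h * f ^ l)"
  define a where "a j = (\<Sum>\<beta>\<in>S. Poly_Mapping.single \<beta> (?w * ?u j \<beta>))" for j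
  have la: "Poly_Mapping.lookup (a j) \<beta> = ?w * ?u j \<beta>" for j \<beta>
    using S by (cases "\<beta> : S") (auto simp: a_def lookup_sum lookup_single when_def)
  have "dop_of (sum g T) = (\<Sum>\<beta>\<in>T. dop_of (g \<beta>))" for g :: "_ => _ \<Rightarrow>\<^sub>0 ('k, 'n) ratf" and T :: "('n \<Rightarrow>\<^sub>0 nat) set"
    by (induction T rule: infinite_finite_induct) (auto simp: dop_of_add)
  then have "dop_of (a j) = (\<Sum>\<beta>\<in>S. mulop (?w * ?u j \<beta>) * monom_at pdop \<beta>)" for j
    by (simp add: a_def dop_of_single)
  then have na: "n $ j = dop_of (a j)" for j
    by (simp add: n_def psiv_def psic polop_eq mulop_mult sum_distrib_left mult.assoc)
  have "n $ j : weyl" for j using nN N_props(2) by (auto simp: weyl_vecs_def)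
  then have "\<exists>q. Poly_Mapping.lookup (a j) \<beta> = rpol q" for j \<beta>
    using dopS_coeffs(2)[of "n $ j" "range rpol" \<beta>] by (auto simp: na weyl_dopS)
  then have ex: "\<exists>r. ?w * ?u j \<beta> = rpol r" for j \<beta> unfolding la .
  define q where "q j \<beta> = (SOME r. ?w * ?u j \<beta> = rpol r)" for j \<beta>
  have q: "?w * ?u j \<beta> = rpol (q j \<beta>)" for j \<beta> unfolding q_def by (rule someI_ex[OF ex])
  have q0: "q j \<beta> = 0" if "\<beta> \<notin> S" for j \<beta> using q[of j \<beta>] S(2)[OF that] by simp
  have w0: "?w ~= 0" using h(1) f0 by auto
  \<comment> \<open>1/w has only a unit at p and a power of f in its denominator, hence it can be
    produced from f^\<nu> by an operator P1 regular at p.\<close>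
  have "inverse ?w = inverse (rpol h) / rpol f ^ l" by (simp add: rpol.hom_mult rpol.hom_power divide_inverse)
  moreover have "inverse (rpol h) : reg {p}" using h(1) by (intro inverse_reg) simp
  ultimately have "inverse ?w : Oloc f {p}" unfolding Oloc_def by blast
  then obtain P1 where P1: "P1 : Dop {p}" "app P1 (Fp \<nu>) = inverse ?w" using Oloc_lift by blast
  \<comment> \<open>B f^\<nu> = q/w = q P1 f^\<nu>, so A kills f^\<nu>.\<close>
  define A where "A j \<beta> = B j \<beta> - polop (q j \<beta>) * P1" for j \<beta>
  have A: "A j \<beta> : Dop {p}" for j \<beta> unfolding A_def by (intro Dop_diff Dop_mult S0 Dop_polop P1)
  have A0: "app (A j \<beta>) (Fp \<nu>) = 0" for j \<beta>
    unfolding A_def using w0 by (simp add: app_diff app_times polop_eq P1(2) flip: q)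
  let ?A = "%j. \<Sum>\<beta>\<in>S. kapx (A j \<beta>) * monom_at zo \<beta>"
  let ?x = "%j. \<Sum>\<beta>\<in>S. mulop (rsub sx (rpol (q j \<beta>))) * (kapx P1 * monom_at zo \<beta>)"
  let ?y = "%j. \<Sum>\<beta>\<in>S. mulop (rsub sy (rpol (q j \<beta>))) * (kapx P1 * monom_at zo \<beta>)"
  have v_split: "?v j = ?A j + ?x j" for j
  proof -
    have "kapx (A j \<beta>) = kapx (B j \<beta>) - mulop (rsub sx (rpol (q j \<beta>))) * kapx P1" for \<beta>
      unfolding A_def polop_eq
      by (subst kx.H_diff) (simp_all add: kx.H_mulop_mult Dop_UNIV[OF P1(1)] Dop_UNIV[OF S0(2)] dring.dopS_mulop_mult[OF dring_UNIV])
    then show ?thesis by (simp add: sum.distrib[symmetric] left_diff_distrib mult.assoc)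
  qed
  have P1z: "kapx P1 * monom_at zo \<beta> : Dop {z0 p}" for \<beta> by (rule gen_Dop[OF P1(1)])
  \<comment> \<open>q(x) - q(y) vanishes on the diagonal, so it is a combination of the z_i.\<close>
  have xy: "?x j - ?y j : ZD p" for j
  proof -
    have "mulop (rsub sx (rpol (q j \<beta>)) - rsub sy (rpol (q j \<beta>))) : ZD p" for \<beta>
      by (intro ZD_function dring.Sdiff[OF dring_reg] sx_reg sy_reg rpol_reg) (simp only: rsub_diff sx_Ls sy_Ls diff_self)
    then have "(\<Sum>\<beta>\<in>S. mulop (rsub sx (rpol (q j \<beta>)) - rsub sy (rpol (q j \<beta>))) * (kapx P1 * monom_at zo \<beta>)) : ZD p"
      using P1z by (intro sum_in_set nsubD[OF ZD_nsub] ZD_mult) auto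
    then show ?thesis by (simp add: sum_subtractf[symmetric] mulop_diff left_diff_distrib)
  qed
  \<comment> \<open>q(y) commutes with P1(x); once P1 is taken out on the left, what remains is n in
    the variable y.\<close>
  have y_eq: "?y j = kapx P1 * kapy (n $ j)" for j
  proof -
    have "dop_of (a j) = (\<Sum>\<beta>\<in>S. mulop (rpol (q j \<beta>)) * monom_at pdop \<beta>)"
      using \<open>!!j. dop_of (a j) = _\<close>[of j] by (simp only: q)
    then have "kapy (n $ j) = (\<Sum>\<beta>\<in>S. mulop (rsub sy (rpol (q j \<beta>))) * monom_at zo \<beta>)"
      unfolding na by (simp only: ky.H_sum[OF dring.dopS_monom[OF dring_UNIV UNIV_I]] ky.H_monom)
    then have "kapx P1 * kapy (n $ j) = (\<Sum>\<beta>\<in>S. kapx P1 * mulop (rsub sy (rpol (q j \<beta>))) * monom_at zo \<beta>)"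
      by (simp add: sum_distrib_left mult.assoc)
    then show ?thesis by (simp only: kapx_sy[OF Dop_UNIV[OF P1(1)]] mult.assoc)
  qed
  have r1: "(\<chi> j. ?A j) : IQ.RQ (z0 p)"
  proof -
    have "(\<Sum>\<beta>\<in>S. \<Sum>j\<in>UNIV. axis j (kapx (A j \<beta>) * monom_at zo \<beta>)) : IQ.RQ (z0 p)"
      by (intro sum_in_set nsubD[OF IQ.RQ_nsub] IRQ_axis_J A A0)
    moreover have "(\<Sum>\<beta>\<in>S. \<Sum>j\<in>UNIV. axis j (kapx (A j \<beta>) * monom_at zo \<beta>)) = (\<chi> j. ?A j)"
      by (simp add: vec_eq_iff axis_def)
    ultimately show ?thesis by simp
  qed
  have r2: "(\<chi> j. ?y j) : IQ.RQ (z0 p)"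
    using IQ.RQ_act[OF kapx_Dop[OF P1(1)] IQ.N_RQ[OF I4_N[OF nN]]] by (simp only: y_eq vec_lambda_beta)
  have "c $ j - ?A j - ?y j : ZD p" for j
    using nsubD(2)[OF ZD_nsub cv[of j] xy[of j]] by (simp add: v_split algebra_simps)
  then have "\<forall>j. \<exists>T. c $ j - ?A j - ?y j = (\<Sum>i\<in>UNIV. mulop (zv i) * T i) & (\<forall>i. T i : Dop {z0 p})"
    unfolding ZD_def mem_Collect_eq by (rule allI)
  from choice[OF this] obtain T where "\<forall>j. c $ j - ?A j - ?y j = (\<Sum>i\<in>UNIV. mulop (zv i) * T j i) & (\<forall>i. T j i : Dop {z0 p})" ..
  then have T: "!!j. c $ j - ?A j - ?y j = (\<Sum>i\<in>UNIV. mulop (zv i) * T j i)" "!!j i. T j i : Dop {z0 p}" by blast+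
  let ?d = "%i. \<chi> j. T j i"
  have "c - (\<Sum>i\<in>UNIV. actv (mulop (zv i)) (?d i)) = (\<chi> j. ?A j) + (\<chi> j. ?y j)"
    using T(1) by (simp add: vec_eq_iff algebra_simps)
  then have "c - (\<Sum>i\<in>UNIV. actv (mulop (zv i)) (?d i)) : IQ.RQ (z0 p)"
    using nsubD(2)[OF IQ.RQ_nsub r1 r2] by simp
  moreover have "\<forall>i. ?d i : IQ.CQ (z0 p)" using T(2) by (simp add: ICQ)
  ultimately show ?thesis by (intro exI[of _ ?d]) (rule conjI)
qed

end

section \<open>The restriction functor\<close>

subsection \<open>Quotients of quotients\<close>

text \<open>The cohomology is a cokernel of tensor products, hence a quotient of a quotient.
  \<open>Kq\<close> consists of the elements of A that become zero in the end, those in B +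
  T.\<close>

locale dquot =
  fixes \<sigma> :: "'d => 'x::ab_group_add => 'x" and A T B :: "'x set"
  assumes A: "nsub A" and T: "nsub T" "T \<subseteq> A" and B: "nsub B" "B \<subseteq> A"
begin

abbreviation "c1 \<equiv> coset (natmod \<sigma> A) T"
abbreviation "M1 \<equiv> quot (natmod \<sigma> A) T"
definition "Kq = {x : A. \<exists>y\<in>B. x - y : T}"
definition "cl x = coset M1 (c1 ` B) (c1 x)"

lemma q1: "quotient (natmod \<sigma> A) T" by (rule quotient_natmod[OF A T])

lemma BA: "b : B ==> b : A" using B(2) by blast

lemma c1_carr: "carr M1 = c1 ` A" by (simp add: quotient.quot_carr[OF q1])
lemma c1_add: "x : A ==> y : A ==> addm M1 (c1 x) (c1 y) = c1 (x + y)"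
  using quotient.quot_add[OF q1, of x y] by simp
lemma c1_zero: "zerom M1 = c1 0" by (simp add: quotient.quot_zero[OF q1])
lemma c1_eq: "x : A ==> y : A ==> c1 x = c1 y \<longleftrightarrow> x - y : T" by (rule coset_natmod_eq[OF A T])

lemma q2: "quotient M1 (c1 ` B)"
proof
  show "agrp M1" by (rule quotient.quot_agrp[OF q1])
  have "\<exists>t\<in>B. addm M1 (c1 b) (c1 t) = zerom M1" if "b : B" for b
    using that nsubD(3)[OF B(1) that] by (intro bexI[of _ "- b"]) (auto simp: c1_add BA c1_zero)
  moreover have "addm M1 (c1 a) (c1 b) : c1 ` B" if "a : B" "b : B" for a b
    using that nsubD(2)[OF B(1)] by (auto simp: c1_add BA)
  moreover have "zerom M1 : c1 ` B" using nsubD(1)[OF B(1)] by (simp add: c1_zero)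
  ultimately show "asub M1 (c1 ` B)" by (auto simp: asub_def c1_carr BA)
qed

lemma cl_carr: "carr (quot M1 (c1 ` B)) = cl ` A"
  by (simp add: quotient.quot_carr[OF q2] c1_carr image_image cl_def)

lemma cl_zero: "zerom (quot M1 (c1 ` B)) = cl 0"
  by (simp add: quotient.quot_zero[OF q2] c1_zero cl_def)

lemma cl_add: "x : A ==> y : A ==> addm (quot M1 (c1 ` B)) (cl x) (cl y) = cl (x + y)"
  unfolding cl_def by (subst quotient.quot_add[OF q2]) (auto simp: c1_carr c1_add)

lemma cl_eq: assumes xy: "x : A" "y : A" shows "cl x = cl y \<longleftrightarrow> x - y : Kq"
proof -
  have "cl x = cl y \<longleftrightarrow> (\<exists>b\<in>B. c1 y = c1 (x + b))"
    unfolding cl_def using xy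
    by (subst quotient.coset_eq_iff[OF q2]) (auto simp: c1_carr c1_add BA)
  also have "\<dots> \<longleftrightarrow> (\<exists>b\<in>B. y - (x + b) : T)"
    using xy BA nsubD(2)[OF A] by (intro bex_cong refl c1_eq) auto
  also have "\<dots> \<longleftrightarrow> x - y : Kq"
  proof
    assume "\<exists>b\<in>B. y - (x + b) : T"
    then obtain b where b: "b : B" "y - (x + b) : T" ..
    have "x - y - (- b) : T" using nsubD(3)[OF T(1) b(2)] by (simp add: algebra_simps)
    then show "x - y : Kq" unfolding Kq_def using nsubD(3)[OF B(1) b(1)] nsubD(4)[OF A xy] by blast
  next
    assume "x - y : Kq"
    then obtain b where b: "b : B" "x - y - b : T" by (auto simp: Kq_def)
    have "y - (x + - b) : T" using nsubD(3)[OF T(1) b(2)] by (simp add: algebra_simps)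
    then show "\<exists>b\<in>B. y - (x + b) : T" using nsubD(3)[OF B(1) b(1)] by blast
  qed
  finally show ?thesis .
qed

lemma cl_map:
  assumes p: "dquot A' T' B'" and a: "!!x y. \<phi> (x + y) = \<phi> x + \<phi> y"
    and \<phi>: "!!x. x : A' ==> \<phi> x : A" "!!x. x : T' ==> \<phi> x : T" "!!x. x : B' ==> \<phi> x : B" and x: "x : A'"
  shows "quot_map M1 (c1 ` B) (quot_map (natmod \<sigma> A) T \<phi>) (dquot.cl \<sigma>' A' T' B' x) = cl (\<phi> x)"
proof -
  interpret p: dquot \<sigma>' A' T' B' by (rule p)
  let ?\<phi> = "quot_map (natmod \<sigma> A) T \<phi>"
  have q: "?\<phi> (p.c1 a) = c1 (\<phi> a)" if "a : A'" for a
    by (rule quotient.quot_map_coset[OF q1 p.q1]) (use \<phi> that a in auto)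
  have "quot_map M1 (c1 ` B) ?\<phi> (coset p.M1 (p.c1 ` B') (p.c1 x)) = coset M1 (c1 ` B) (?\<phi> (p.c1 x))"
  proof (rule quotient.quot_map_coset[OF q2 p.q2])
    show "p.c1 x : carr p.M1" using x by (simp add: p.c1_carr)
  next
    fix X assume "X : carr p.M1"
    then show "?\<phi> X : carr M1" using \<phi>(1) by (auto simp: p.c1_carr c1_carr q)
  next
    fix X s assume "X : carr p.M1" "s : p.c1 ` B'"
    then obtain u b where u: "u : A'" "X = p.c1 u" "b : B'" "s = p.c1 b" by (auto simp: p.c1_carr)
    have b: "b : A'" by (rule p.BA[OF u(3)])
    have "?\<phi> (addm p.M1 X s) = c1 (\<phi> (u + b))"
      unfolding u(2,4) p.c1_add[OF u(1) b] by (rule q[OF nsubD(2)[OF p.A u(1) b]])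
    also have "\<dots> = addm M1 (?\<phi> X) (c1 (\<phi> b))"
      unfolding u(2) q[OF u(1)] a c1_add[OF \<phi>(1)[OF u(1)] \<phi>(1)[OF b]] by (rule refl)
    finally show "\<exists>t\<in>c1 ` B. ?\<phi> (addm p.M1 X s) = addm M1 (?\<phi> X) t"
      using \<phi>(3)[OF u(3)] by blast
  qed
  then show ?thesis unfolding p.cl_def cl_def q[OF x] .
qed

lemma cl_smul:
  assumes "!!x y. \<sigma> P (x + y) = \<sigma> P x + \<sigma> P y"
    "!!x. x : A ==> \<sigma> P x : A" "!!x. x : T ==> \<sigma> P x : T" "!!x. x : B ==> \<sigma> P x : B" "x : A"
  shows "smul (quot M1 (c1 ` B)) P (cl x) = cl (\<sigma> P x)"
  unfolding quotient.smul_quot_map[OF q2] quotient.smul_quot_map[OF q1] natmod_sel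
  by (rule cl_map[OF dquot_axioms]) (use assms in auto)

end

subsection \<open>The transfer module\<close>

lemma conn_act_commute:
  fixes E :: "'v::ab_group_add => 'w::ab_group_add"
  assumes a: "!!v w. E (v + w) = E v + E w" and n: "!!i v. E (nab i v) = nab' i (E v)"
    and m: "!!g v. E (mul g v) = mul' g (E v)"
  shows "E (conn_act mul nab P v) = conn_act mul' nab' P (E v)"
proof -
  have E0: "E 0 = 0" using a[of 0 0] by simp
  have Esum: "E (sum g I) = (\<Sum>x\<in>I. E (g x))" for g :: "'x => 'v" and I
    by (induction I rule: infinite_finite_induct) (auto simp: a E0)
  have pw: "E ((nab i ^^ k) v) = (nab' i ^^ k) (E v)" for i k v
    by (induction k) (auto simp: n)
  have "E (fold (%i. nab i ^^ Poly_Mapping.lookup \<alpha> i) xs v) = fold (%i. nab' i ^^ Poly_Mapping.lookup \<alpha> i) xs (E v)" for \<alpha> xs v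
    by (induction xs arbitrary: v) (auto simp: pw)
  then show ?thesis by (simp add: conn_act_def Esum m)
qed

abbreviation "OYm U \<equiv> natmod app (reg (z0 -` U)) :: (('k::field_char_0, 'n::{finite,linorder}) dop, ('k, 'n) ratf) lmod"
abbreviation "DDm U \<equiv> natmod (*) (Dop U) :: (('k::field_char_0, 'n::{finite,linorder} + 'n) dop, ('k, 'n + 'n) dop) lmod"
abbreviation "ROz U \<equiv> mulop ` reg U :: ('k::field_char_0, 'n::{finite,linorder} + 'n) dop set"

definition FX :: "('n::{finite,linorder} + 'n => 'k::field_char_0) set => (('k, 'n) ratf \<times> ('k, 'n + 'n) dop \<Rightarrow>\<^sub>0 int) set" where
  "FX U = frags (reg (z0 -` U)) (Dop U)"

definition TX :: "('n::{finite,linorder} + 'n => 'k::field_char_0) set => (('k, 'n) ratf \<times> ('k, 'n + 'n) dop \<Rightarrow>\<^sub>0 int) set" where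
  "TX U = tensor_rel (ROz U) (OYm U) OY_right (DDm U)"

definition ct :: "('n::{finite,linorder} + 'n => 'k::field_char_0) set => (('k, 'n) ratf \<times> ('k, 'n + 'n) dop \<Rightarrow>\<^sub>0 int)
    => (('k, 'n) ratf \<times> ('k, 'n + 'n) dop \<Rightarrow>\<^sub>0 int) set" where
  "ct U = coset (free_mod transfer_act (OYm U) (DDm U)) (TX U)"

definition rt :: "('k::field_char_0, 'n::{finite,linorder} + 'n) dop => (('k, 'n) ratf \<times> ('k, 'n + 'n) dop \<Rightarrow>\<^sub>0 int)
    => (('k, 'n) ratf \<times> ('k, 'n + 'n) dop \<Rightarrow>\<^sub>0 int)" where
  "rt P = frag_extend (%(g, Q). frag_of (g, Q * P))"

lemma T_sec: "sec transfer_psh U = tensor (ROz U) (OYm U) OY_right (DDm U) transfer_act"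
  by (simp add: transfer_psh_def tensor_psh_def OY_psh_def D_psh_def)

lemma rt_add: "rt P (x + y) = rt P x + rt P y" and rt_diff: "rt P (x - y) = rt P x - rt P y"
  by (simp_all add: rt_def frag_extend_add frag_extend_diff)

text \<open>Right multiplication leaves the function factor alone and commutes with multiplication
  from the left, so the transfer module is a bimodule.\<close>

lemma rt_transfer:
  fixes x :: "('k::field_char_0, 'n::{finite,linorder}) ratf \<times> ('k, 'n + 'n) dop \<Rightarrow>\<^sub>0 int"
  shows "rt P (transfer_act R x) = transfer_act R (rt P x)"
proof -
  have x: "x : frags UNIV UNIV" for x :: "('k, 'n) ratf \<times> ('k, 'n + 'n) dop \<Rightarrow>\<^sub>0 int" by (simp add: frags_def)
  show ?thesis unfolding transfer_act_def leibniz_act_def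
  proof (rule conn_act_commute[OF rt_add])
    fix i and v :: "('k, 'n) ratf \<times> ('k, 'n + 'n) dop \<Rightarrow>\<^sub>0 int"
    show "rt P (frag_extend (%(g, m). frag_of (rpd i g, m) + frag_of (g, pdop (Inr i) * m)) v) =
      frag_extend (%(g, m). frag_of (rpd i g, m) + frag_of (g, pdop (Inr i) * m)) (rt P v)"
      using x[of v] by (induction v rule: frags_induct) (simp_all add: rt_def frag_extend_diff frag_extend_add mult.assoc)
  next
    fix g and v :: "('k, 'n) ratf \<times> ('k, 'n + 'n) dop \<Rightarrow>\<^sub>0 int"
    show "rt P (frag_extend (%(h, m). frag_of (g * h, m)) v) = frag_extend (%(h, m). frag_of (g * h, m)) (rt P v)"
      using x[of v] by (induction v rule: frags_induct) (simp_all add: rt_def frag_extend_diff)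
  qed
qed

lemma OY_right_mulop: "OY_right g (mulop a) = g * rsub s0 a"
  by (simp add: OY_right_def ratf_z0_rsub)

text \<open>A function regular on U is certain to restrict to Y' only if U meets Y'.\<close>

locale tmod =
  fixes U :: "('n::{finite,linorder} + 'n => 'k::field_char_0) set"
  assumes meets: "\<exists>p. z0 p : U"
begin

lemma reg_restrict: assumes "a : reg U" shows "a : Ls" "rsub s0 a : reg (z0 -` U)"
proof -
  have p: "a : reg {z0 p}" if "z0 p : U" for p using assms reg_antimono[of "{z0 p}" U] that by auto
  show "a : Ls" using meets p reg_Ls(1) by blast
  show "rsub s0 a : reg (z0 -` U)" unfolding reg_iff[of _ "z0 -` U"] using reg_Ls(2)[OF p] by blast
qed

sublocale lb: leibniz "ROz U" "OYm U" OY_right "DDm U" "%i Q. pdop (Inr i) * Q" "reg (z0 -` U)" "%i r. mulop (rpd (Inr i) (app r 1))"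
proof
  fix b :: "('k, 'n) ratf" and r i assume b: "b : carr (OYm U)" and "r : ROz U"
  then obtain a where a: "a : reg U" "r = mulop a" by auto
  show "OY_right b r : carr (OYm U)"
    using b reg_restrict(2)[OF a(1)] dring.Smult[OF dring_reg] by (simp add: a(2) OY_right_mulop)
  show "rpd i (OY_right b r) = OY_right (rpd i b) r + OY_right b (mulop (rpd (Inr i) (app r 1)))"
    by (simp add: a(2) OY_right_mulop rpd_mult chain_s0 reg_restrict(1)[OF a(1)])
next
  fix m :: "('k, 'n + 'n) dop" and r i assume m: "m : carr (DDm U)" and "r : ROz U"
  then obtain a where a: "a : reg U" "r = mulop a" by auto
  show "smul (DDm U) r m : carr (DDm U)" using m Dop_mult[OF Dop_mulop[OF a(1)]] by (simp add: a(2))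
  show "pdop (Inr i) * smul (DDm U) r m = addm (DDm U) (smul (DDm U) (mulop (rpd (Inr i) (app r 1))) m) (smul (DDm U) r (pdop (Inr i) * m))"
    by (simp add: a(2) pdop_mulop distrib_right flip: mult.assoc)
next
  fix a b :: "('k, 'n) ratf" and r assume "r : ROz U"
  then show "a * OY_right b r = OY_right (a * b) r" by (auto simp: OY_right_mulop)
next
  fix r :: "('k, 'n + 'n) dop" and i assume "r : ROz U"
  then show "mulop (rpd (Inr i) (app r 1)) : ROz U" by (auto intro!: imageI dring.Sd[OF dring_reg])
qed (auto intro: dring.Sadd[OF dring_reg] dring.Sd[OF dring_reg] dring.Smult[OF dring_reg] Dop_add Dop_mult Dop_pdop simp: distrib_left)

lemma FX_nsub: "nsub (FX U)" unfolding FX_def by (rule nsub_frags)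

lemma T_carr: "carr (sec transfer_psh U) = ct U ` FX U"
  unfolding T_sec ct_def TX_def FX_def using lb.tensor_carr by simp

lemma ct_mem: "x : FX U ==> ct U x : carr (sec transfer_psh U)" by (simp add: T_carr)

lemma T_eq: "x : FX U ==> y : FX U ==> ct U x = ct U y \<longleftrightarrow> x - y : TX U"
  unfolding ct_def TX_def FX_def by (rule lb.tensor_coset_eq) simp_all

lemma T_add: "x : FX U ==> y : FX U ==> addm (sec transfer_psh U) (ct U x) (ct U y) = ct U (x + y)"
  unfolding T_sec ct_def TX_def FX_def by (rule lb.tensor_add) simp_all

lemma transfer_FX: "P : Dop (z0 -` U) ==> x : FX U ==> transfer_act P x : FX U"
  unfolding FX_def transfer_act_def using lb.leibniz_Fr by (simp add: Dop_dopS)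

lemma T_smul:
  assumes "P : Dop (z0 -` U)" "x : FX U"
  shows "smul (sec transfer_psh U) P (ct U x) = ct U (transfer_act P x)"
proof -
  have P: "P : dopS (reg (z0 -` U))" using assms(1) by (simp add: Dop_dopS)
  show ?thesis unfolding T_sec ct_def TX_def
    by (rule lb.tensor_smul)
      (use assms(2) lb.leibniz_Fr[OF P] lb.leibniz_TR[OF P] in \<open>auto simp: transfer_act_def leibniz_additive FX_def\<close>)
qed

lemma rt_FX: "P : Dop U ==> x : FX U ==> rt P x : FX U"
  unfolding FX_def rt_def by (erule frag_extend_in[OF _ nsub_frags]) (auto intro: frags_of Dop_mult)

lemma rt_TX: assumes "P : Dop U" "x : TX U" shows "rt P x : TX U"
  using assms(2) unfolding TX_def
proof (rule tensor_rel_induct[OF _ nsub_tensor_rel rt_diff])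
  fix b b' :: "('k, 'n) ratf" and m :: "('k, 'n + 'n) dop" assume "b : carr (OYm U)" "b' : carr (OYm U)" "m : carr (DDm U)"
  then show "rt P (frag_of (addm (OYm U) b b', m)) - rt P (frag_of (b, m)) - rt P (frag_of (b', m)) : lb.TR"
    using tr_addl[of b "OYm U" b' "m * P" "DDm U"] assms(1) by (simp add: rt_def Dop_mult)
next
  fix b :: "('k, 'n) ratf" and m m' :: "('k, 'n + 'n) dop" assume "b : carr (OYm U)" "m : carr (DDm U)" "m' : carr (DDm U)"
  then show "rt P (frag_of (b, addm (DDm U) m m')) - rt P (frag_of (b, m)) - rt P (frag_of (b, m')) : lb.TR"
    using tr_addr[of b "OYm U" "m * P" "DDm U" "m' * P"] assms(1) by (simp add: rt_def Dop_mult distrib_right)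
next
  fix b :: "('k, 'n) ratf" and r m :: "('k, 'n + 'n) dop" assume "b : carr (OYm U)" "r : ROz U" "m : carr (DDm U)"
  then show "rt P (frag_of (OY_right b r, m)) - rt P (frag_of (b, smul (DDm U) r m)) : lb.TR"
    using tr_bal[of b "OYm U" r "ROz U" "m * P" "DDm U"] assms(1) by (simp add: rt_def Dop_mult mult.assoc)
qed

lemma T_right: "P : Dop U ==> x : FX U ==> transfer_right U (ct U x) P = ct U (rt P x)"
  unfolding transfer_right_def OY_psh_def D_psh_def psh.simps ct_def TX_def rt_def[symmetric]
  by (rule lb.tensor_quot_map[OF lb.bimod_axioms])
    (use rt_FX[of P] rt_TX[of P] in \<open>auto simp: rt_add FX_def TX_def\<close>)

end

lemma FX_mono:
  fixes U V :: "('n::{finite,linorder} + 'n => 'k::field_char_0) set"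
  shows "V \<subseteq> U ==> FX U \<subseteq> FX V"
  using Dop_antimono[of V U] reg_antimono[of "z0 -` V" "z0 -` U"] unfolding FX_def frags_def by fastforce

lemma TX_mono:
  fixes U V :: "('n::{finite,linorder} + 'n => 'k::field_char_0) set"
  assumes "V \<subseteq> U" shows "TX U \<subseteq> TX V"
proof -
  have r: "reg (z0 -` U) \<subseteq> (reg (z0 -` V) :: ('k, 'n) ratf set)" by (rule reg_antimono) (use assms in auto)
  note s = subsetD[OF r] subsetD[OF Dop_antimono[OF assms]] subsetD[OF reg_antimono[OF assms]]
  show ?thesis unfolding TX_def
    by (rule tensor_rel_sub[OF nsub_tensor_rel])
      (auto simp: bilin_gens_def s intro!: tr_addl[where B="OYm V", simplified] tr_addr[where B="OYm V" and M="DDm V", simplified]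
        tr_bal[where B="OYm V" and M="DDm V", simplified])
qed

lemma T_res:
  assumes "tmod U" "tmod V" "V \<subseteq> U" "x : FX U"
  shows "res transfer_psh U V (ct U x) = ct V x"
proof -
  interpret u: tmod U by (rule assms(1))
  interpret v: tmod V by (rule assms(2))
  have f: "frag_extend (%(b, m). frag_of (b, m)) = (%x :: ('b, 'a) ratf \<times> ('b, 'a + 'a) dop \<Rightarrow>\<^sub>0 int. x)"
  proof (rule ext)
    fix x :: "('b, 'a) ratf \<times> ('b, 'a + 'a) dop \<Rightarrow>\<^sub>0 int"
    have "(%(b, m). frag_of (b, m)) = (frag_of :: ('b, 'a) ratf \<times> ('b, 'a + 'a) dop => _)" by (simp add: fun_eq_iff)
    then show "frag_extend (%(b, m). frag_of (b, m)) x = x" using frag_expansion[of x] by metis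
  qed
  show ?thesis
    unfolding transfer_psh_def tensor_psh_def OY_psh_def D_psh_def psh.simps f ct_def TX_def
    by (rule v.lb.tensor_quot_map[OF u.lb.bimod_axioms])
      (use assms(4) FX_mono[OF assms(3)] TX_mono[OF assms(3)] in \<open>auto simp: FX_def TX_def\<close>)
qed

subsection \<open>Free modules\<close>

abbreviation "actp P \<equiv> Poly_Mapping.map ((*) P)"

lemma lookup_actp: "Poly_Mapping.lookup (actp P v) i = P * Poly_Mapping.lookup v i"
  for v :: "'i \<Rightarrow>\<^sub>0 'a::ring_1"
  by (simp add: Poly_Mapping.map.rep_eq when_def)

interpretation actp: dact "actp :: ('k::field_char_0, 'n::{finite,linorder}) dop => (nat \<Rightarrow>\<^sub>0 ('k, 'n) dop) => _"
  by standard (auto intro!: poly_mapping_eqI simp: lookup_actp lookup_add distrib_left distrib_right mult.assoc)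

definition DFA :: "nat => ('n::{finite,linorder} => 'k::field_char_0) set => (nat \<Rightarrow>\<^sub>0 ('k, 'n) dop) set" where
  "DFA m U = {v. Poly_Mapping.keys v \<subseteq> {..<m} & (\<forall>i. Poly_Mapping.lookup v i : Dop U)}"

definition DFP where "DFP m = \<lparr>sec = (%U. natmod actp (DFA m U)), res = (%_ _ v. v)\<rparr>"

definition DFC where "DFC m p = {v. \<exists>U. zopen U & p : U & v : DFA m U}"

lemma D_free_eq: "D_free m = sheafify (DFP m)"
  by (simp add: D_free_def DFP_def DFA_def)

lemma DFA_keys: "Poly_Mapping.keys v \<subseteq> {..<m} \<longleftrightarrow> (\<forall>i\<ge>m. Poly_Mapping.lookup v i = 0)"
  for v :: "nat \<Rightarrow>\<^sub>0 'a::zero"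
  by (auto simp: subset_iff in_keys_iff not_less[symmetric])

lemma DFA_nsub: "nsub (DFA m U)"
  by (auto simp: nsub_def DFA_def DFA_keys lookup_add Dop_0 Dop_add Dop_minus)

lemma DF_classes: "classes actp (%p. p) (DFP m) (DFC m) (%_. {0}) (DFA m) (%_. {0}) (%_ x. x) (%_ _ x. x) (%_ _ x. x)
  (%_ :: ('n::{finite,linorder} => 'k::field_char_0) set. actp)"
proof
  fix U :: "('n => 'k) set" and p :: "'n => 'k" and x assume "zopen U" "p : U" "x : DFA m U"
  then show "\<exists>V c. zopen V & p : V & V \<subseteq> U & c : DFC m p & (\<forall>q. q : V --> x - c : {0})"
    by (intro exI[of _ U] exI[of _ x]) (auto simp: DFC_def)
next
  fix c and p :: "'n => 'k" assume "c : DFC m p"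
  then show "\<exists>U x. zopen U & p : U & x : DFA m U & (\<forall>q. q : U --> x - c : {0})"
    by (auto simp: DFC_def)
next
  fix U V :: "('n => 'k) set" and x assume "V \<subseteq> U" "x : DFA m U"
  then show "x : DFA m V" using Dop_antimono[of V U] by (auto simp: DFA_def)
next
  fix U :: "('n => 'k) set" and x and P assume "x : DFA m U" "P : Dop ((%p. p) -` U)"
  then show "actp P x : DFA m U" by (simp add: DFA_def DFA_keys lookup_actp Dop_mult)
qed (auto simp: DFP_def DFA_nsub, auto simp: nsub_def)

text \<open>Sections of the free module are described by sequences of operators with no relations.
  This yields closure of the sections under the operations and under restriction.\<close>

lemma DF_model: "\<exists>Rl. model (%p :: 'n::{finite,linorder} => 'k::field_char_0. p) (D_free m) (DFC m) (%_. {0}) actp Rl"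
  unfolding D_free_eq using model_sheafify[OF classes.model[OF DF_classes]] by blast

lemma DF_closed:
  fixes U :: "('n::{finite,linorder} => 'k::field_char_0) set"
  assumes "zopen U" "p : U" "s : carr (sec (D_free m) U)"
  shows "t : carr (sec (D_free m) U) ==> addm (sec (D_free m) U) s t : carr (sec (D_free m) U)"
    "P : Dop U ==> smul (sec (D_free m) U) P s : carr (sec (D_free m) U)"
    "zopen V ==> q : V ==> V \<subseteq> U ==> res (D_free m) U V s : carr (sec (D_free m) V)"
proof -
  obtain Rl where "model (%p :: 'n => 'k. p) (D_free m) (DFC m) (%_. {0}) actp Rl" using DF_model ..
  then interpret M: model "%p. p" "D_free m" "DFC m" "%_. {0}" actp Rl .
  have ex: "\<exists>c. Rl r U u c" if "u : carr (sec (D_free m) U)" "r : U" for u r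
    using M.M1[OF assms(1) that(2,1)] by blast
  obtain c where c: "Rl p U s c" using ex[OF assms(3,2)] by blast
  show "addm (sec (D_free m) U) s t : carr (sec (D_free m) U)" if "t : carr (sec (D_free m) U)"
    using ex[OF that assms(2)] M.M0[OF M.M4[OF c]] by blast
  show "smul (sec (D_free m) U) P s : carr (sec (D_free m) U)" if "P : Dop U"
    using M.M0[OF M.M5[OF c]] that by simp
  show "res (D_free m) U V s : carr (sec (D_free m) V)" if V: "zopen V" "q : V" "V \<subseteq> U"
    using ex[OF assms(3), of q] M.M0[OF M.M7[OF _ V]] V by blast
qed

lemma DF_nonempty:
  fixes U :: "('n::{finite,linorder} => 'k::field_char_0) set"
  assumes "zopen U" "p : U" shows "\<exists>s. s : carr (sec (D_free m) U)"
proof -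
  obtain Rl where "model (%p :: 'n => 'k. p) (D_free m) (DFC m) (%_. {0}) actp Rl" using DF_model ..
  then interpret M: model "%p. p" "D_free m" "DFC m" "%_. {0}" actp Rl .
  show ?thesis using M.M0[OF M.M7[OF M.M6[of p] assms]] by auto
qed

lemma DF_res: "res (D_free m) U V s = restrict s V"
  unfolding D_free_def sheafify_def inv_image_sheaf_def by simp

lemma DF_ext: "s : carr (sec (D_free m) U) ==> s : extensional U"
  unfolding D_free_def sheafify_def inv_image_sheaf_def by simp

lemma DF_res_self: "s : carr (sec (D_free m) U) ==> res (D_free m) U U s = s"
  using extensional_restrict[OF DF_ext] by (simp add: DF_res)

lemma DF_res_res: "W \<subseteq> V ==> res (D_free m) V W (res (D_free m) U V s) = res (D_free m) U W s"
  by (auto simp: DF_res restrict_def fun_eq_iff)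

lemma DF_res_op:
  assumes "V \<subseteq> U"
  shows "res (D_free m) U V (addm (sec (D_free m) U) s t) = addm (sec (D_free m) V) (res (D_free m) U V s) (res (D_free m) U V t)"
    "res (D_free m) U V (smul (sec (D_free m) U) P s) = smul (sec (D_free m) V) P (res (D_free m) U V s)"
  unfolding D_free_def sheafify_def inv_image_sheaf_def using assms by (auto simp: restrict_def fun_eq_iff)

subsection \<open>The cokernel of the restricted resolution\<close>

text \<open>Functoriality of the tensor product in both factors and in the ring; it covers
  restriction maps, the left action and the differential.\<close>

lemma tensor_map:
  assumes \<alpha>: "!!b. b : carr B ==> \<alpha> b : carr B'"
      "!!b b'. b : carr B ==> b' : carr B ==> \<alpha> (addm B b b') = addm B' (\<alpha> b) (\<alpha> b')"
    and \<beta>: "!!v. v : carr M ==> \<beta> v : carr M'"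
      "!!v w. v : carr M ==> w : carr M ==> \<beta> (addm M v w) = addm M' (\<beta> v) (\<beta> w)"
    and R: "R \<subseteq> R'" "!!b r. b : carr B ==> r : R ==> \<alpha> (\<rho> b r) = \<rho>' (\<alpha> b) r"
      "!!r v. v : carr M ==> r : R ==> \<beta> (smul M r v) = smul M' r (\<beta> v)"
  shows "x : frags (carr B) (carr M) ==> frag_extend (%(b, v). frag_of (\<alpha> b, \<beta> v)) x : frags (carr B') (carr M')"
    "x : tensor_rel R B \<rho> M ==> frag_extend (%(b, v). frag_of (\<alpha> b, \<beta> v)) x : tensor_rel R' B' \<rho>' M'"
proof -
  let ?F = "frag_extend (%(b, v). frag_of (\<alpha> b, \<beta> v))"
  show "x : frags (carr B) (carr M) ==> ?F x : frags (carr B') (carr M')"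
    by (erule frag_extend_in[OF _ nsub_frags]) (auto intro: frags_of \<alpha> \<beta>)
  assume "x : tensor_rel R B \<rho> M"
  then show "?F x : tensor_rel R' B' \<rho>' M'"
  proof (rule tensor_rel_induct[OF _ nsub_tensor_rel frag_extend_diff])
    fix b b' m assume b: "b : carr B" "b' : carr B" "m : carr M"
    show "?F (frag_of (addm B b b', m)) - ?F (frag_of (b, m)) -
      ?F (frag_of (b', m)) : tensor_rel R' B' \<rho>' M'"
      using tr_addl[OF \<alpha>(1)[OF b(1)] \<alpha>(1)[OF b(2)] \<beta>(1)[OF b(3)]] by (simp add: \<alpha>(2)[OF b(1,2)])
  next
    fix b m m' assume b: "b : carr B" "m : carr M" "m' : carr M"
    show "?F (frag_of (b, addm M m m')) - ?F (frag_of (b, m)) -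
      ?F (frag_of (b, m')) : tensor_rel R' B' \<rho>' M'"
      using tr_addr[OF \<alpha>(1)[OF b(1)] \<beta>(1)[OF b(2)] \<beta>(1)[OF b(3)]] by (simp add: \<beta>(2)[OF b(2,3)])
  next
    fix b r m assume b: "b : carr B" "r : R" "m : carr M"
    show "?F (frag_of (\<rho> b r, m)) - ?F (frag_of (b, smul M r m)) : tensor_rel R' B' \<rho>' M'"
      using tr_bal[OF \<alpha>(1)[OF b(1)] subsetD[OF R(1) b(2)] \<beta>(1)[OF b(3)], of \<rho>'] by (simp add: R(2)[OF b(1,2)] R(3)[OF b(3,2)])
  qed
qed

section \<open>The diagonal embedding and extension of functions off the diagonal\<close>

lemma zopen_subst:
  fixes \<sigma> :: "'n::finite => ('k::{comm_ring_1,idom}, 'm::finite) mpol"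
  assumes "zopen U" shows "zopen {p. (%i. meval p (\<sigma> i)) : U}"
proof -
  obtain S where "U = {p. \<exists>q\<in>S. meval p q ~= 0}" using assms unfolding zopen_def by blast
  then have "{p. (%i. meval p (\<sigma> i)) : U} = {p. \<exists>q\<in>msubst \<sigma> ` S. meval p q ~= 0}" by (simp add: meval_msubst)
  then show ?thesis unfolding zopen_def by blast
qed

lemma z0_open: "zopen U ==> zopen (z0 -` U)"
  for U :: "('n::{finite,linorder} + 'n => 'k::field_char_0) set"
  using zopen_subst[of U s0] by (simp add: vimage_def z0_meval)

abbreviation pr :: "('n + 'n => 'k) => 'n => 'k" where "pr z \<equiv> %i. z (Inr i)"

lemma pr_meval: "pr z = (%i. meval z (sx i))" for z :: "'n::{finite,linorder} + 'n => 'k::field_char_0"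
  by (simp add: sx_def fun_eq_iff)

lemma pr_open: "zopen V ==> zopen (pr -` V)"
  for V :: "('n::{finite,linorder} => 'k::field_char_0) set"
  using zopen_subst[of V "sx :: 'n => ('k, 'n + 'n) mpol"] by (simp add: vimage_def pr_meval)

lemma pr_z0: "pr (z0 p) = p" by (simp add: z0_def fun_eq_iff)

text \<open>A neighbourhood of U \<inter> Y' whose points project into U \<inter> Y'. A function
  regular on U \<inter> Y' extends to it by making it constant in z.\<close>

definition lift_dom :: "('n + 'n => 'k::field_char_0) set => ('n::{finite,linorder} + 'n => 'k) set" where
  "lift_dom U = U \<inter> pr -` (z0 -` U)"

lemma lift_dom:
  fixes U :: "('n::{finite,linorder} + 'n => 'k::field_char_0) set"
  shows "zopen U ==> zopen (lift_dom U)" "lift_dom U \<subseteq> U" "z0 p : U ==> z0 p : lift_dom U"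
    "g : reg (z0 -` U) ==> rsub sx g : reg (lift_dom U)"
proof -
  show "zopen U ==> zopen (lift_dom U)" unfolding lift_dom_def by (intro zopen_Int pr_open z0_open)
  show "lift_dom U \<subseteq> U" by (auto simp: lift_dom_def)
  show "z0 p : U ==> z0 p : lift_dom U" by (simp add: lift_dom_def pr_z0)
  assume g: "g : reg (z0 -` U)"
  have "rsub sx g : reg {z}" if z: "z : lift_dom U" for z
  proof (rule rsub_reg(2))
    have "pr z : z0 -` U" using z by (simp add: lift_dom_def)
    then show "g : reg {%i. meval z (sx i)}" using g unfolding pr_meval[symmetric] reg_iff[of _ "z0 -` U"] by blast
  qed
  then show "rsub sx g : reg (lift_dom U)" unfolding reg_iff[of _ "lift_dom U"] by blast
qed

section \<open>Tensor products of the transfer module with free modules\<close>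

abbreviation TS :: "('n::{finite,linorder} + 'n => 'k::field_char_0) set => _" where "TS U \<equiv> sec transfer_psh U"
abbreviation "A2 k U \<equiv> frags (carr (TS U)) (carr (sec (D_free k) U))"
abbreviation "TR2 k U \<equiv> tensor_rel (Dop U) (TS U) (transfer_right U) (sec (D_free k) U)"
abbreviation "rs2 k U V \<equiv> frag_extend (%(b, v). frag_of (res transfer_psh U V b, res (D_free k) U V v))"

lemma tmodI: "z0 p : U ==> tmod U" by (auto simp: tmod_def)

lemma bimod2:
  assumes U: "zopen U" "z0 p : U" shows "bimod (Dop U) (TS U) (transfer_right U) (sec (D_free k) U)"
proof -
  interpret tmod U by (rule tmodI[OF U(2)])
  show ?thesis
  proof
    fix b r assume "b : carr (TS U)" and r: "r : Dop U"
    then obtain x where "x : FX U" "b = ct U x" by (auto simp: T_carr)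
    then show "transfer_right U b r : carr (TS U)" using T_right[OF r] rt_FX[OF r] ct_mem by simp
  next
    fix b b' assume "b : carr (TS U)" "b' : carr (TS U)"
    then obtain x y where "x : FX U" "b = ct U x" "y : FX U" "b' = ct U y" by (auto simp: T_carr)
    then show "addm (TS U) b b' : carr (TS U)" using T_add ct_mem nsubD(2)[OF FX_nsub] by simp
  qed (rule DF_closed[OF U]; assumption)+
qed

lemma lact2:
  assumes U: "zopen U" "z0 p : U" and P: "P : Dop (z0 -` U)"
  shows "x : A2 k U ==> left_act (TS U) P x : A2 k U" "x : TR2 k U ==> left_act (TS U) P x : TR2 k U"
proof -
  interpret tmod U by (rule tmodI[OF U(2)])
  have 1: "smul (TS U) P b : carr (TS U)" if "b : carr (TS U)" for b
    using that T_smul[OF P] transfer_FX[OF P] by (auto simp: T_carr)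
  have 2: "smul (TS U) P (addm (TS U) b b') = addm (TS U) (smul (TS U) P b) (smul (TS U) P b')"
    if "b : carr (TS U)" "b' : carr (TS U)" for b b'
  proof -
    obtain x y where x: "x : FX U" "b = ct U x" and y: "y : FX U" "b' = ct U y" using \<open>b : _\<close> \<open>b' : _\<close> by (auto simp: T_carr)
    show ?thesis unfolding x(2) y(2) T_add[OF x(1) y(1)] T_smul[OF P x(1)] T_smul[OF P y(1)]
        T_smul[OF P nsubD(2)[OF FX_nsub x(1) y(1)]] T_add[OF transfer_FX[OF P x(1)] transfer_FX[OF P y(1)]]
      by (simp add: transfer_act_def leibniz_additive)
  qed
  have 3: "smul (TS U) P (transfer_right U b r) = transfer_right U (smul (TS U) P b) r" if b: "b : carr (TS U)" and r: "r : Dop U" for b r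
  proof -
    obtain x where x: "x : FX U" "b = ct U x" using b by (auto simp: T_carr)
    show ?thesis unfolding x(2) T_right[OF r x(1)] T_smul[OF P x(1)] T_right[OF r transfer_FX[OF P x(1)]]
        T_smul[OF P rt_FX[OF r x(1)]] rt_transfer by (rule refl)
  qed
  note m = tensor_map[where \<alpha>="smul (TS U) P" and \<beta>="%v. v" and R="Dop U" and R'="Dop U" and B="TS U" and B'="TS U"
    and M="sec (D_free k) U" and M'="sec (D_free k) U" and \<rho>="transfer_right U" and \<rho>'="transfer_right U", OF 1 2 _ _ _ 3]
  show "x : A2 k U ==> left_act (TS U) P x : A2 k U" "x : TR2 k U ==> left_act (TS U) P x : TR2 k U"
    unfolding left_act_def by (rule m; simp)+
qed

lemma T_res_carr:
  assumes "z0 p : V" "V \<subseteq> U" "b : carr (TS U)" shows "\<exists>x\<in>FX U. x : FX V & b = ct U x & res transfer_psh U V b = ct V x"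
proof -
  have U: "tmod U" "tmod V" using assms tmodI by blast+
  obtain x where x: "x : FX U" "b = ct U x" using assms(3) tmod.T_carr[OF U(1)] by auto
  then show ?thesis using T_res[OF U assms(2) x(1)] FX_mono[OF assms(2)] by blast
qed

lemma rs2_mem:
  assumes U: "zopen U" "zopen V" "z0 p : V" "V \<subseteq> U"
  shows "x : A2 k U ==> rs2 k U V x : A2 k V" "x : TR2 k U ==> rs2 k U V x : TR2 k V"
proof -
  have pU: "z0 p : U" using U by blast
  interpret u: tmod U by (rule tmodI[OF pU])
  interpret v: tmod V by (rule tmodI[OF U(3)])
  note F = subsetD[OF FX_mono[OF U(4)]] and r = T_res[OF u.tmod_axioms v.tmod_axioms U(4)] and D = subsetD[OF Dop_antimono[OF U(4)]]
  have 1: "res transfer_psh U V b : carr (TS V)" if "b : carr (TS U)" for b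
    using that r F by (auto simp: u.T_carr v.T_carr)
  have 2: "res transfer_psh U V (addm (TS U) b b') = addm (TS V) (res transfer_psh U V b) (res transfer_psh U V b')"
    if "b : carr (TS U)" "b' : carr (TS U)" for b b'
  proof -
    obtain x y where x: "x : FX U" "b = ct U x" and y: "y : FX U" "b' = ct U y" using \<open>b : _\<close> \<open>b' : _\<close> by (auto simp: u.T_carr)
    show ?thesis unfolding x(2) y(2) u.T_add[OF x(1) y(1)] r[OF x(1)] r[OF y(1)] r[OF nsubD(2)[OF u.FX_nsub x(1) y(1)]]
        v.T_add[OF F[OF x(1)] F[OF y(1)]] by (rule refl)
  qed
  have 3: "res transfer_psh U V (transfer_right U b s) = transfer_right V (res transfer_psh U V b) s" if b: "b : carr (TS U)" and s: "s : Dop U" for b s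
  proof -
    obtain x where x: "x : FX U" "b = ct U x" using b by (auto simp: u.T_carr)
    show ?thesis unfolding x(2) u.T_right[OF s x(1)] r[OF x(1)] v.T_right[OF D[OF s] F[OF x(1)]] r[OF u.rt_FX[OF s x(1)]] by (rule refl)
  qed
  note m = tensor_map[where \<alpha>="res transfer_psh U V" and \<beta>="res (D_free k) U V" and R="Dop U" and R'="Dop V" and B="TS U" and B'="TS V"
    and M="sec (D_free k) U" and M'="sec (D_free k) V" and \<rho>="transfer_right U" and \<rho>'="transfer_right V",
    OF 1 2 DF_closed(3)[OF U(1) pU _ U(2,3,4)] DF_res_op(1)[OF U(4)] Dop_antimono[OF U(4)] 3 DF_res_op(2)[OF U(4)]]
  show "x : A2 k U ==> rs2 k U V x : A2 k V" "x : TR2 k U ==> rs2 k U V x : TR2 k V"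
    by (rule m; assumption)+
qed

definition one_T :: "('n::{finite,linorder} + 'n => 'k::field_char_0) set => _" where
  "one_T V = ct V (frag_of (1, 1))"

context tmod
begin

lemma FX_of: "g : reg (z0 -` U) ==> Q : Dop U ==> frag_of (g, Q) : FX U"
  unfolding FX_def by (rule frags_of)

lemma one_FX: "Q : Dop U ==> frag_of (1, Q) : FX U"
  by (rule FX_of[OF dring.S1[OF dring_reg]])

lemma one_mem: "one_T U : carr (TS U)" unfolding one_T_def by (rule ct_mem[OF one_FX[OF Dop_1]])

lemma one_right: "P : Dop U ==> transfer_right U (one_T U) P = ct U (frag_of (1, P))"
  unfolding one_T_def by (subst T_right) (auto intro: one_FX Dop_1 simp: rt_def)

lemma zero_FX: "0 : FX U" by (rule nsubD(1)[OF FX_nsub])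

lemma ct_zero: "x : FX U ==> x : TX U ==> ct U x = ct U 0"
  using T_eq[OF _ zero_FX] by simp

lemma TX_10: "frag_of (1, 0) : TX U"
proof -
  have "frag_of (1, 0 + 0) - frag_of (1, 0) - frag_of (1, 0) : TX U"
    using tr_addr[of 1 "OYm U" 0 "DDm U" 0 "ROz U" OY_right] dring.S1[OF dring_reg, of "z0 -` U"] Dop_0[of U]
    unfolding TX_def by simp
  then have "- frag_of (1, 0) : TX U" by simp
  from nsubD(3)[OF nsub_tensor_rel this[unfolded TX_def]] show ?thesis by (simp add: TX_def)
qed

lemma TX_01: assumes "Q : Dop U" shows "frag_of (0, Q) : TX U"
proof -
  have "frag_of (0 + 0, Q) - frag_of (0, Q) - frag_of (0, Q) : TX U"
    using tr_addl[of 0 "OYm U" 0 Q "DDm U" "ROz U" OY_right] dring.S0[OF dring_reg, of "z0 -` U"] assms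
    unfolding TX_def by simp
  then have "- frag_of (0, Q) : TX U" by simp
  from nsubD(3)[OF nsub_tensor_rel this[unfolded TX_def]] show ?thesis by (simp add: TX_def)
qed

lemma ct_move: assumes "a : reg U" "Q : Dop U" shows "ct U (frag_of (rsub s0 a, Q)) = ct U (frag_of (1, mulop a * Q))"
proof -
  have "frag_of (OY_right 1 (mulop a), Q) - frag_of (1, smul (DDm U) (mulop a) Q) : TX U"
    unfolding TX_def by (rule tr_bal) (use assms dring.S1[OF dring_reg, of "z0 -` U"] in auto)
  then show ?thesis
    by (subst T_eq) (use assms reg_restrict(2)[OF assms(1)] in \<open>auto intro: FX_of one_FX Dop_mult Dop_mulop simp: OY_right_mulop\<close>)
qed

lemma one_minus: "addm (TS U) (one_T U) (transfer_right U (one_T U) (- 1)) = ct U 0"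
proof -
  have m1: "- 1 : Dop U" by (rule Dop_minus[OF Dop_1])
  have t: "frag_of (1, 0) - frag_of (1, 1) - frag_of (1, - 1) : TX U"
    using tr_addr[of 1 "OYm U" 1 "DDm U" "- 1" "ROz U" OY_right] dring.S1[OF dring_reg, of "z0 -` U"] Dop_1[of U] m1
    unfolding TX_def by simp
  from nsubD(4)[OF nsub_tensor_rel TX_10[unfolded TX_def] t[unfolded TX_def]]
  have "frag_of (1, 1) + frag_of (1, - 1) : TX U" by (simp add: TX_def algebra_simps)
  then have "ct U (frag_of (1, 1) + frag_of (1, - 1)) = ct U 0"
    by (intro ct_zero nsubD(2)[OF FX_nsub] one_FX Dop_1 m1)
  then show ?thesis unfolding one_right[OF m1] unfolding one_T_def T_add[OF one_FX[OF Dop_1] one_FX[OF m1]] .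
qed

end

lemma one_res: "z0 p : V ==> V \<subseteq> U ==> res transfer_psh U V (one_T U) = one_T V"
  unfolding one_T_def by (rule T_res) (auto intro: tmodI tmod.one_FX[OF tmodI] Dop_1)

text \<open>Near Y', every element of the tensor product is of the form \<open>1 \<otimes> v\<close>.\<close>

definition Gd :: "nat => ('n::{finite,linorder} + 'n => 'k::field_char_0) set => _" where
  "Gd k V = {y. \<exists>v\<in>carr (sec (D_free k) V). y - frag_of (one_T V, v) : TR2 k V}"

locale tmod2 = tmod U for U :: "('n::{finite,linorder} + 'n => 'k::field_char_0) set" +
  fixes k :: nat assumes opn: "zopen U"
begin

abbreviation "Dk \<equiv> sec (D_free k) U"
abbreviation "TR \<equiv> TR2 k U"

lemmas TRd = nsubD[OF nsub_tensor_rel[of "Dop U" "TS U" "transfer_right U" "sec (D_free k) U"]]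

lemma Dk_closed: "v : carr Dk ==> w : carr Dk ==> addm Dk v w : carr Dk" "v : carr Dk ==> P : Dop U ==> smul Dk P v : carr Dk"
  using meets DF_closed(1,2)[OF opn] by blast+

lemma t_0l: assumes "v : carr Dk" shows "frag_of (ct U 0, v) : TR"
proof -
  have "frag_of (addm (TS U) (ct U 0) (ct U 0), v) - frag_of (ct U 0, v) - frag_of (ct U 0, v) : TR"
    by (rule tr_addl) (use assms ct_mem[OF zero_FX] in auto)
  then have "- frag_of (ct U 0, v) : TR" by (simp add: T_add zero_FX)
  from TRd(3)[OF this] show ?thesis by simp
qed

lemma t_one: "v : carr Dk ==> P : Dop U ==> frag_of (ct U (frag_of (1, P)), v) - frag_of (one_T U, smul Dk P v) : TR"
  using tr_bal[OF one_mem, of P "Dop U" v Dk "transfer_right U"] by (simp add: one_right)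

lemma t_kill: assumes "v : carr Dk" "P : Dop U" "frag_of (1, P) : TX U" shows "frag_of (one_T U, smul Dk P v) : TR"
proof -
  have "ct U (frag_of (1, P)) = ct U 0" by (rule ct_zero[OF one_FX assms(3)]) (rule assms)
  then have "frag_of (ct U 0, v) - frag_of (one_T U, smul Dk P v) : TR" using t_one[OF assms(1,2)] by simp
  from TRd(4)[OF t_0l[OF assms(1)] this] show ?thesis by simp
qed

lemma Gd_nsub: "nsub (Gd k U)"
proof -
  obtain v0 where v0: "v0 : carr Dk" using meets DF_nonempty[OF opn] by blast
  have "0 : Gd k U"
    unfolding Gd_def using TRd(3)[OF t_kill[OF v0 Dop_0 TX_10]] Dk_closed(2)[OF v0 Dop_0] by auto
  moreover have "x + y : Gd k U" if x: "x : Gd k U" and y: "y : Gd k U" for x y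
  proof -
    obtain v where v: "v : carr Dk" "x - frag_of (one_T U, v) : TR" using x by (auto simp: Gd_def)
    obtain w where w: "w : carr Dk" "y - frag_of (one_T U, w) : TR" using y by (auto simp: Gd_def)
    have "(x - frag_of (one_T U, v)) + (y - frag_of (one_T U, w)) -
        (frag_of (one_T U, addm Dk v w) - frag_of (one_T U, v) - frag_of (one_T U, w)) : TR"
      by (intro TRd(4) TRd(2) v w tr_addr one_mem)
    then have "x + y - frag_of (one_T U, addm Dk v w) : TR" by (simp add: algebra_simps)
    then show ?thesis unfolding Gd_def using Dk_closed(1)[OF v(1) w(1)] by blast
  qed
  moreover have "- x : Gd k U" if x: "x : Gd k U" for x
  proof -
    obtain v where v: "v : carr Dk" "x - frag_of (one_T U, v) : TR" using x by (auto simp: Gd_def)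
    \<comment> \<open>The negative of a tensor is found by moving the operator -1 from the first
      factor to the second.\<close>
    have m1: "- 1 : Dop U" by (rule Dop_minus[OF Dop_1])
    let ?b = "transfer_right U (one_T U) (- 1)"
    have b: "?b : carr (TS U)" unfolding one_right[OF m1] by (rule ct_mem[OF one_FX[OF m1]])
    have 1: "frag_of (ct U 0, v) - frag_of (one_T U, v) - frag_of (?b, v) : TR"
      using tr_addl[OF one_mem b v(1)] by (simp only: one_minus)
    have 2: "frag_of (?b, v) - frag_of (one_T U, smul Dk (- 1) v) : TR" by (rule tr_bal[OF one_mem m1 v(1)])
    have "(frag_of (ct U 0, v) - frag_of (one_T U, v) - frag_of (?b, v)) - frag_of (ct U 0, v) +
       (frag_of (?b, v) - frag_of (one_T U, smul Dk (- 1) v)) - (x - frag_of (one_T U, v)) : TR"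
      by (intro TRd(4) TRd(2) 1 2 v(2) t_0l[OF v(1)])
    then have "- x - frag_of (one_T U, smul Dk (- 1) v) : TR" by (subst minus_diff_commute) simp
    then show ?thesis unfolding Gd_def using Dk_closed(2)[OF v(1) m1] by blast
  qed
  ultimately show ?thesis by (simp add: nsub_def)
qed

lemmas Gdd = nsubD[OF Gd_nsub]

lemma Gd_TR: assumes "y : TR" shows "y : Gd k U"
proof -
  obtain v where v: "v : carr Dk" "0 - frag_of (one_T U, v) : TR" using Gdd(1) by (auto simp: Gd_def)
  show ?thesis unfolding Gd_def using v(1) TRd(2)[OF assms v(2)] by auto
qed

text \<open>If g' extends g constantly in z, then g \<otimes> Q = 1 \<otimes> g' Q, and g' Q can be
  passed on to the free module. The set B collects functions whose extension is regular on all of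
  U.\<close>

lemma Gd_ct:
  assumes "y : frags B (Dop U)" "!!g. g : B ==> g : reg (z0 -` U) & rsub sx g : reg U" and w: "w : carr Dk"
  shows "y : FX U & frag_of (ct U y, w) : Gd k U"
  using assms(1)
proof (induction y rule: frags_induct)
  case zero show ?case using zero_FX Gd_TR[OF t_0l[OF w]] by simp
next
  case (one g Q)
  have g: "g : reg (z0 -` U)" "rsub sx g : reg U" using assms(2)[OF one(1)] by auto
  have P: "mulop (rsub sx g) * Q : Dop U" by (intro Dop_mult Dop_mulop g one)
  have "ct U (frag_of (g, Q)) = ct U (frag_of (1, mulop (rsub sx g) * Q))"
    using ct_move[OF g(2) one(2)] by (simp add: sx_Ls)
  then have "frag_of (ct U (frag_of (g, Q)), w) : Gd k U"
    unfolding Gd_def using t_one[OF w P] Dk_closed(2)[OF w P] by auto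
  then show ?case using FX_of[OF g(1) one(2)] by simp
next
  case (diff x y)
  have xy: "x - y : FX U" by (rule nsubD(4)[OF FX_nsub]) (use diff in auto)
  have "frag_of (addm (TS U) (ct U (x - y)) (ct U y), w) - frag_of (ct U (x - y), w) - frag_of (ct U y, w) : TR"
    by (rule tr_addl) (use diff xy w ct_mem in auto)
  then have "frag_of (ct U x, w) - frag_of (ct U (x - y), w) - frag_of (ct U y, w) : TR" using T_add[OF xy, of y] diff by simp
  from Gdd(4)[OF Gdd(4)[OF conjunct2[OF diff(3)] conjunct2[OF diff(4)]] Gd_TR[OF this]]
  show ?case using xy by simp
qed

end

lemma tmod2I: "zopen U ==> z0 p : U ==> tmod2 U"
  by (intro tmod2.intro tmod2_axioms.intro tmodI)

lemma normal_form2: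
  assumes U: "zopen U" "z0 p : U" and x: "x : A2 k U"
  shows "rs2 k U (lift_dom U) x : Gd k (lift_dom U)"
proof -
  let ?V = "lift_dom U"
  note V = lift_dom(1)[OF U(1)] lift_dom(3)[OF U(2)] lift_dom(2)[of U]
  interpret v: tmod2 ?V k by (rule tmod2I[OF V(1,2)])
  have z: "z0 -` ?V \<subseteq> z0 -` U" using V(3) by blast
  show ?thesis using x
  proof (rule frag_extend_in[OF _ v.Gd_nsub])
    fix b w assume b: "b : carr (TS U)" and w: "w : carr (sec (D_free k) U)"
    obtain y where y: "y : FX U" "res transfer_psh U ?V b = ct ?V y" using T_res_carr[OF V(2,3) b] by blast
    have yf: "y : frags (reg (z0 -` U)) (Dop ?V)" using y(1) Dop_antimono[OF V(3)] by (auto simp: FX_def frags_def)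
    have "frag_of (ct ?V y, res (D_free k) U ?V w) : Gd k ?V"
      by (rule conjunct2[OF v.Gd_ct[OF yf]])
        (use reg_antimono[OF z] lift_dom(4)[of _ U] DF_closed(3)[OF U w V] in auto)
    then show "(case (b, w) of (b, v) => frag_of (res transfer_psh U ?V b, res (D_free k) U ?V v)) : Gd k ?V"
      by (simp add: y(2))
  qed
qed

section \<open>A free resolution and the evaluation of its restriction\<close>

locale resolved = diag f bf \<nu> N SJ SN
  for f :: "('k::field_char_0, 'n::{finite,linorder}) mpol" and bf \<nu> and N :: "(('k, 'n) dop ^ 'r) set" and SJ SN +
  fixes m d \<epsilon>
  assumes resol: "free_resolution m d \<epsilon> IQ.MS"
begin

abbreviation "D0 U \<equiv> sec (D_free (m 0)) U"
abbreviation "D1 U \<equiv> sec (D_free (m (Suc 0))) U"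

lemma eps_hom:
  assumes "zopen U"
  shows "v : carr (D0 U) ==> \<epsilon> U v : carr (sec IQ.MS U)"
    "v : carr (D0 U) ==> w : carr (D0 U) ==> \<epsilon> U (addm (D0 U) v w) = addm (sec IQ.MS U) (\<epsilon> U v) (\<epsilon> U w)"
    "v : carr (D0 U) ==> P : Dop U ==> \<epsilon> U (smul (D0 U) P v) = smul (sec IQ.MS U) P (\<epsilon> U v)"
    "v : carr (D0 U) ==> zopen V ==> V \<subseteq> U ==> \<epsilon> V (res (D_free (m 0)) U V v) = res IQ.MS U V (\<epsilon> U v)"
  using conjunct1[OF resol[unfolded free_resolution_def]] assms unfolding dmod_hom_def Pi_iff by simp_all

lemma d_hom:
  assumes "zopen U"
  shows "v : carr (D1 U) ==> d 0 U v : carr (D0 U)"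
    "v : carr (D1 U) ==> w : carr (D1 U) ==> d 0 U (addm (D1 U) v w) = addm (D0 U) (d 0 U v) (d 0 U w)"
    "v : carr (D1 U) ==> P : Dop U ==> d 0 U (smul (D1 U) P v) = smul (D0 U) P (d 0 U v)"
    "v : carr (D1 U) ==> zopen V ==> V \<subseteq> U ==> d 0 V (res (D_free (m (Suc 0))) U V v) = res (D_free (m 0)) U V (d 0 U v)"
  using spec[OF conjunct1[OF conjunct2[OF resol[unfolded free_resolution_def]]], of 0] assms
  unfolding dmod_hom_def Pi_iff by simp_all

lemma eps_surj: "zopen U ==> s : carr (sec IQ.MS U) ==> p : U ==>
    \<exists>V. zopen V & p : V & V \<subseteq> U & (\<exists>t\<in>carr (D0 V). \<epsilon> V t = res IQ.MS U V s)"
  using resol unfolding free_resolution_def sheaf_surj_def by simp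

lemma eps_exact: "zopen U ==> s : carr (D0 U) ==> \<epsilon> U s = zerom (sec IQ.MS U) \<longleftrightarrow>
    (\<forall>p\<in>U. \<exists>V. zopen V & p : V & V \<subseteq> U & (\<exists>t\<in>carr (D1 V). d 0 V t = res (D_free (m 0)) U V s))"
  using resol unfolding free_resolution_def sheaf_exact_def by simp

lemma MS_zerom: "res IQ.MS UNIV U (zerom (sec IQ.MS UNIV)) = zerom (sec IQ.MS U)"
  unfolding D_tensor_def sheafify_def inv_image_sheaf_def by (simp add: restrict_def fun_eq_iff)

text \<open>A concrete vector describing the germ of \<epsilon> v at the diagonal point over
  q.\<close>

definition cc :: "('n => 'k) => _ => _ => ('k, 'n + 'n) dop ^ 'r" where
  "cc q U v = IQ.rep (z0 q) U (\<epsilon> U v)"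

lemma cc:
  assumes "zopen U" "z0 q : U" "v : carr (D0 U)"
  shows "cc q U v : IQ.CQ (z0 q)" "IQ.RlD (z0 q) U (\<epsilon> U v) (cc q U v)"
  unfolding cc_def by (rule IQ.rep[OF assms(1,2) eps_hom(1)[OF assms(1,3)]])+

lemma cc_cong: "IQ.RlD (z0 q) U (\<epsilon> U v) c ==> cc q U v - c : IQ.RQ (z0 q)"
  unfolding cc_def by (rule IQ.rep_cong)

lemma cc_add:
  assumes "zopen U" "z0 q : U" "v : carr (D0 U)" "w : carr (D0 U)"
  shows "cc q U (addm (D0 U) v w) - (cc q U v + cc q U w) : IQ.RQ (z0 q)"
  by (rule cc_cong) (unfold eps_hom(2)[OF assms(1,3,4)], rule IQ.MD.M4[OF cc(2)[OF assms(1-3)] cc(2)[OF assms(1,2,4)]])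

lemma cc_smul:
  assumes "zopen U" "z0 q : U" "v : carr (D0 U)" "P : Dop U"
  shows "cc q U (smul (D0 U) P v) - actv P (cc q U v) : IQ.RQ (z0 q)"
  by (rule cc_cong) (unfold eps_hom(3)[OF assms(1,3,4)], rule IQ.MD.M5[OF cc(2)[OF assms(1-3)]], simp add: assms)

lemma cc_res:
  assumes "zopen U" "zopen V" "z0 q : V" "V \<subseteq> U" "v : carr (D0 U)"
  shows "cc q V (res (D_free (m 0)) U V v) - cc q U v : IQ.RQ (z0 q)"
proof (rule cc_cong)
  have "z0 q : U" using assms by blast
  then show "IQ.RlD (z0 q) V (\<epsilon> V (res (D_free (m 0)) U V v)) (cc q U v)"
    unfolding eps_hom(4)[OF assms(1,5,2,4)] by (intro IQ.MD.M7[OF cc(2)] assms)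
qed

lemma cc_d:
  assumes "zopen U" "z0 q : U" "y : carr (D1 U)" shows "cc q U (d 0 U y) : IQ.RQ (z0 q)"
proof -
  have dy: "d 0 U y : carr (D0 U)" by (rule d_hom(1)[OF assms(1,3)])
  have "\<epsilon> U (d 0 U y) = zerom (sec IQ.MS U)"
    unfolding eps_exact[OF assms(1) dy] using assms(1,3) DF_res_self[OF dy] by (intro ballI exI[of _ U]) auto
  then have "IQ.RlD (z0 q) U (\<epsilon> U (d 0 U y)) 0"
    using IQ.MD.M7[OF IQ.MD.M6 assms(1,2) subset_UNIV] by (simp only: MS_zerom)
  then show ?thesis using cc_cong by fastforce
qed

subsubsection \<open>Evaluation of the first factor\<close>

text \<open>For fixed c the map g \<otimes> Q \<mapsto> g psi(Q c) is exactly compatible with the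
  relations of the transfer module; changing c by a relation changes the value by an element of
  \<open>NQ.RL q\<close>.\<close>

definition E :: "('k, 'n + 'n) dop ^ 'r => (('k, 'n) ratf \<times> ('k, 'n + 'n) dop \<Rightarrow>\<^sub>0 int) => ('k, 'n) dop ^ 'r" where
  "E c = vact.fev (%(g, Q). actv (mulop g) (psiv (actv Q c)))"

lemma E_of: "E c (frag_of (g, Q)) = (\<chi> j. mulop g * psi (Q * c $ j))"
  by (simp add: E_def psiv_def)

lemma E_diff: "E c (x - y) = E c x - E c y" and E_add: "E c (x + y) = E c x + E c y" and E_0: "E c 0 = 0"
  unfolding E_def by (rule vact.fev_diff, rule vact.fev_add, rule vact.fev_0)

lemma QD2: "Q : Dop U ==> z0 q : U ==> c : IQ.CQ (z0 q) ==> Q * c $ j : D2"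
  using Dop_mult[of Q "{z0 q}" "c $ j"] Dop_antimono[of "{z0 q}" U] Dop_D2[of q] by (auto simp: ICQ)

lemma E_cdiff:
  assumes "x : FX U" "z0 q : U" "c : IQ.CQ (z0 q)" "c' : IQ.CQ (z0 q)"
  shows "E (c - c') x = E c x - E c' x"
  using assms(1) unfolding FX_def
proof (induction x rule: frags_induct)
  case (one g Q)
  show ?case
    by (simp add: E_of vec_eq_iff right_diff_distrib psi_diff QD2[OF one(2) assms(2,3)] QD2[OF one(2) assms(2,4)])
qed (simp_all add: E_0 E_diff)

lemma E_RQ:
  assumes "x : FX U" "z0 q : U" "c : IQ.RQ (z0 q)" shows "E c x : NQ.RL q"
  using assms(1) unfolding E_def FX_def
proof (rule vact.fev_in[OF _ NQ.RL_nsub])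
  fix g Q assume "g : reg (z0 -` U)" "Q : Dop U"
  then have g: "g : reg {q}" "Q : Dop {z0 q}"
    using reg_antimono[of "{q}" "z0 -` U"] Dop_antimono[of "{z0 q}" U] assms(2) by auto
  show "(case (g, Q) of (g, Q) => actv (mulop g) (psiv (actv Q c))) : NQ.RL q"
    unfolding prod.case
    by (rule NQ.RL_act[OF subsetD[OF NQ.Dop_L Dop_mulop[OF g(1)]] IRQ_psi[OF IQ.RQ_act[OF g(2) assms(3)]]])
qed

lemma nsub_0: "nsub {0}" by (simp add: nsub_def)

lemma E_TX:
  assumes "x : TX U" "z0 q : U" "c : IQ.CQ (z0 q)" shows "E c x = 0"
proof -
  interpret tmod U by (rule tmodI[OF assms(2)])
  have "E c x : {0}"
    using assms(1) unfolding TX_def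
  proof (rule tensor_rel_induct[OF _ nsub_0 E_diff])
    fix b b' :: "('k, 'n) ratf" and m :: "('k, 'n + 'n) dop"
    show "E c (frag_of (addm (OYm U) b b', m)) - E c (frag_of (b, m)) - E c (frag_of (b', m)) : {0}"
      by (simp add: E_of vec_eq_iff mulop_add distrib_right)
  next
    fix b :: "('k, 'n) ratf" and m m' :: "('k, 'n + 'n) dop" assume m: "m : carr (DDm U)" "m' : carr (DDm U)"
    then have "m * c $ j : D2" "m' * c $ j : D2" for j using QD2[OF _ assms(2,3)] by simp_all
    then show "E c (frag_of (b, addm (DDm U) m m')) - E c (frag_of (b, m)) - E c (frag_of (b, m')) : {0}"
      by (simp add: E_of vec_eq_iff distrib_left distrib_right psi_add)
  next
    fix b :: "('k, 'n) ratf" and r m :: "('k, 'n + 'n) dop" assume m: "m : carr (DDm U)" and "r : ROz U"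
    then obtain a where a: "a : reg U" "r = mulop a" by auto
    have "m * c $ j : D2" for j using m QD2[OF _ assms(2,3)] by simp
    then show "E c (frag_of (OY_right b r, m)) - E c (frag_of (b, smul (DDm U) r m)) : {0}"
      using reg_restrict(1)[OF a(1)] by (simp add: E_of vec_eq_iff a(2) OY_right_mulop psi_mulop mult.assoc mulop_mult)
  qed
  then show ?thesis by simp
qed

lemma E_rt: "E c (rt P x) = E (actv P c) x"
proof -
  have "x : frags UNIV UNIV" by (simp add: frags_def)
  then show ?thesis
    by (induction x rule: frags_induct) (simp_all add: rt_def frag_extend_diff E_diff E_of E_0 mult.assoc)
qed

text \<open>By \<open>psi_pdop\<close> the derivation \<partial>_{x_i} of the coordinates (z, x)
  becomes \<partial>_i on the left, which is how the left structure of the transfer module was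
  defined.\<close>

lemma E_transfer:
  assumes U: "z0 q : U" "c : IQ.CQ (z0 q)" and P: "P : Dop (z0 -` U)" and x: "x : FX U"
  shows "E c (transfer_act P x) = actv P (E c x)"
proof -
  interpret tmod U by (rule tmodI[OF U(1)])
  have n: "E c (lb.nabf i v) - actv (pdop i) (E c v) = 0" if "v : FX U" for i v
    using that unfolding FX_def
  proof (induction v rule: frags_induct)
    case (one g Q)
    have Q: "Q * c $ j : D2" for j by (rule QD2[OF one(2) U])
    show ?case
      by (simp add: E_add E_of vec_eq_iff mult.assoc psi_pdop[OF Q] pdop_mulop distrib_right flip: mult.assoc[of "pdop i"])
  qed (simp_all add: vec_eq_iff frag_extend_diff E_diff E_0 right_diff_distrib algebra_simps)
  have f: "E c (lb.mulf g v) - actv (mulop g) (E c v) = 0" if "v : FX U" for g v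
    using that unfolding FX_def
  proof (induction v rule: frags_induct)
    case (one b Q) then show ?case by (simp add: vec_eq_iff E_of mulop_mult mult.assoc)
  qed (simp_all add: vec_eq_iff frag_extend_diff E_diff E_0 right_diff_distrib)
  have "E c (transfer_act P x) - actv P (E c x) : {0}"
    unfolding transfer_act_def leibniz_act_def
  proof (rule vact.conn_act_cong[OF dring_reg nsub_0 _ E_add, where A="FX U"])
    fix v i assume v: "v : FX U"
    then show "lb.nabf i v : FX U & E c (lb.nabf i v) - actv (pdop i) (E c v) : {0}"
      using lb.nabf_Fr[of v i] n[OF v, of i] by (simp add: FX_def)
  next
    fix v g assume "v : FX U"
    then show "E c (lb.mulf g v) - actv (mulop g) (E c v) : {0}" using f by simp
  next
    show "P : dopS (reg (z0 -` U))" using P by (simp add: Dop_dopS)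
  qed (use x in \<open>auto simp: vec_eq_iff\<close>)
  then show ?thesis by simp
qed

definition tau :: "('n + 'n => 'k) set => _ => (('k, 'n) ratf \<times> ('k, 'n + 'n) dop \<Rightarrow>\<^sub>0 int)" where
  "tau U b = (SOME x. x : FX U & b = ct U x)"

lemma tau: assumes "z0 q : U" "b : carr (TS U)" shows "tau U b : FX U" "ct U (tau U b) = b"
proof -
  have "\<exists>x. x : FX U & b = ct U x" using assms(2) tmod.T_carr[OF tmodI[OF assms(1)]] by auto
  then have "tau U b : FX U & b = ct U (tau U b)" unfolding tau_def by (rule someI_ex)
  then show "tau U b : FX U" "ct U (tau U b) = b" by auto
qed

lemma E_tau:
  assumes "z0 q : U" "c : IQ.CQ (z0 q)" "x : FX U" shows "E c (tau U (ct U x)) = E c x"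
proof -
  interpret tmod U by (rule tmodI[OF assms(1)])
  note t = tau[OF assms(1) ct_mem[OF assms(3)]]
  have "tau U (ct U x) - x : TX U" using t(2) T_eq[OF t(1) assms(3)] by simp
  from E_TX[OF this assms(1,2)] show ?thesis by (simp add: E_diff)
qed

subsubsection \<open>Evaluation of the tensor product\<close>

definition eh where "eh q U = (%(b, v). E (cc q U v) (tau U b))"

definition ev where "ev q U x = vact.fev (eh q U) x"

lemma ev_diff: "ev q U (x - y) = ev q U x - ev q U y" and ev_of: "ev q U (frag_of (b, v)) = E (cc q U v) (tau U b)"
  unfolding ev_def by (rule vact.fev_diff) (simp add: eh_def)

lemma E_RQ_diff:
  assumes "x : FX U" "z0 q : U" "c : IQ.CQ (z0 q)" "c' : IQ.CQ (z0 q)" "c - c' : IQ.RQ (z0 q)"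
  shows "E c x - E c' x : NQ.RL q"
  using E_RQ[OF assms(1,2,5)] unfolding E_cdiff[OF assms(1-4)] .

lemma ev_TR:
  assumes x: "x : TR2 (m 0) U" and U: "zopen U" "z0 q : U" shows "ev q U x : NQ.RL q"
proof -
  interpret tmod U by (rule tmodI[OF U(2)])
  note cU = cc(1)[OF U] and D = DF_closed[OF U, where m="m 0"] and cq = nsubD[OF IQ.CQ_nsub]
  show ?thesis using x
  proof (rule tensor_rel_induct[OF _ NQ.RL_nsub ev_diff])
    fix b b' v assume b: "b : carr (TS U)" "b' : carr (TS U)" and v: "v : carr (D0 U)"
    note t = tau[OF U(2) b(1)] tau[OF U(2) b(2)]
    have "addm (TS U) b b' = ct U (tau U b + tau U b')" using T_add[OF t(1,3)] by (simp add: t(2,4))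
    then have "E (cc q U v) (tau U (addm (TS U) b b')) = E (cc q U v) (tau U b) + E (cc q U v) (tau U b')"
      using E_tau[OF U(2) cU[OF v] nsubD(2)[OF FX_nsub t(1,3)]] by (simp add: E_add)
    then show "ev q U (frag_of (addm (TS U) b b', v)) - ev q U (frag_of (b, v)) - ev q U (frag_of (b', v)) : NQ.RL q"
      using nsubD(1)[OF NQ.RL_nsub] by (simp add: ev_of)
  next
    fix b v w assume b: "b : carr (TS U)" and v: "v : carr (D0 U)" "w : carr (D0 U)"
    note t = tau[OF U(2) b]
    have s: "cc q U v + cc q U w : IQ.CQ (z0 q)" by (rule cq(2)[OF cU[OF v(1)] cU[OF v(2)]])
    have "E (cc q U v + cc q U w) (tau U b) = E (cc q U v) (tau U b) + E (cc q U w) (tau U b)"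
      using E_cdiff[OF t(1) U(2) s cU[OF v(2)]] by simp
    then show "ev q U (frag_of (b, addm (D0 U) v w)) - ev q U (frag_of (b, v)) - ev q U (frag_of (b, w)) : NQ.RL q"
      using E_RQ_diff[OF t(1) U(2) cU[OF D(1)[OF v]] s cc_add[OF U v]] by (simp add: ev_of algebra_simps)
  next
    fix b P v assume b: "b : carr (TS U)" and P: "P : Dop U" and v: "v : carr (D0 U)"
    note t = tau[OF U(2) b]
    have a: "actv P (cc q U v) : IQ.CQ (z0 q)"
      using cU[OF v] P Dop_antimono[of "{z0 q}" U] U(2) unfolding ICQ by (auto intro!: Dop_mult)
    have "transfer_right U b P = ct U (rt P (tau U b))" using T_right[OF P t(1)] by (simp add: t(2))
    then have "E (cc q U v) (tau U (transfer_right U b P)) = E (actv P (cc q U v)) (tau U b)"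
      using E_tau[OF U(2) cU[OF v] rt_FX[OF P t(1)]] by (simp add: E_rt)
    then show "ev q U (frag_of (transfer_right U b P, v)) - ev q U (frag_of (b, smul (D0 U) P v)) : NQ.RL q"
      using nsubD(3)[OF NQ.RL_nsub E_RQ_diff[OF t(1) U(2) cU[OF D(2)[OF v P]] a cc_smul[OF U v P]]] by (simp add: ev_of)
  qed
qed

section \<open>The cokernel presheaf in degree zero\<close>

abbreviation "Dm U \<equiv> frag_extend (%(b, v). frag_of (b, d 0 U v))"
abbreviation "A0 U \<equiv> A2 (m 0) U"
abbreviation "A1 U \<equiv> A2 (m (Suc 0)) U"
abbreviation "BB U \<equiv> Dm U ` A1 U"

lemma Dm_mem:
  assumes U: "zopen U"
  shows "x : A1 U ==> Dm U x : A0 U" "x : TR2 (m (Suc 0)) U ==> Dm U x : TR2 (m 0) U"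
proof -
  note m = tensor_map[where \<alpha>="%b. b" and \<beta>="d 0 U" and R="Dop U" and R'="Dop U" and B="TS U" and B'="TS U"
    and M="D1 U" and M'="D0 U" and \<rho>="transfer_right U" and \<rho>'="transfer_right U", OF _ _ d_hom(1,2)[OF U] subset_refl _ d_hom(3)[OF U]]
  show "x : A1 U ==> Dm U x : A0 U" "x : TR2 (m (Suc 0)) U ==> Dm U x : TR2 (m 0) U"
    by (rule m; simp)+
qed

lemma dq: assumes U: "zopen U" "z0 p : U" shows "dquot (A0 U) (TR2 (m 0) U) (BB U)"
proof
  show "TR2 (m 0) U \<subseteq> A0 U" by (rule bimod.TR_Fr[OF bimod2[OF U]])
  show "BB U \<subseteq> A0 U" using Dm_mem(1)[OF U(1)] by auto
  note n = nsubD[OF nsub_frags[of "carr (TS U)" "carr (D1 U)"]]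
  have "Dm U x + Dm U y : BB U" "- Dm U x : BB U" if "x : A1 U" "y : A1 U" for x y
    using imageI[OF n(2)[OF that], of "Dm U"] imageI[OF n(3)[OF that(1)], of "Dm U"] by (simp_all add: frag_extend_add frag_extend_minus)
  moreover have "0 : BB U" using imageI[OF n(1), of "Dm U"] by simp
  ultimately show "nsub (BB U)" by (auto simp: nsub_def)
qed (rule nsub_frags nsub_tensor_rel)+

abbreviation "hcl U \<equiv> dquot.cl (left_act (TS U)) (A0 U) (TR2 (m 0) U) (BB U)"
abbreviation "hK U \<equiv> dquot.Kq (A0 U) (TR2 (m 0) U) (BB U)"
abbreviation "QQ U \<equiv> quot (natmod (left_act (TS U)) (A0 U)) (TR2 (m 0) U)"
abbreviation "IM U \<equiv> coset (natmod (left_act (TS U)) (A0 U)) (TR2 (m 0) U) ` BB U"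

lemma restr_term_sec: "sec (restr_term k) U = tensor (Dop U) (TS U) (transfer_right U) (sec (D_free k) U) (left_act (TS U))"
  by (simp add: restr_term_def tensor_psh_def)

lemma restr_im:
  assumes U: "zopen U" "z0 p : U"
  shows "restr_diff (m 0) (d 0) U ` carr (sec (restr_term (m (Suc 0))) U) = IM U"
proof -
  have "restr_diff (m 0) (d 0) U (coset (free_mod (left_act (TS U)) (TS U) (D1 U)) (TR2 (m (Suc 0)) U) y) =
    coset (free_mod (left_act (TS U)) (TS U) (D0 U)) (TR2 (m 0) U) (Dm U y)" if "y : A1 U" for y
    unfolding restr_diff_def
    by (rule bimod.tensor_quot_map[OF bimod2[OF U] bimod2[OF U] that frag_extend_add Dm_mem[OF U(1)]])
  then show ?thesis unfolding restr_term_sec bimod.tensor_carr[OF bimod2[OF U]] image_image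
    by (intro image_cong) (simp_all add: free_mod_frags)
qed

lemma H_sec:
  assumes U: "zopen U" "z0 p : U" shows "sec (restr_H0_psh m d) U = quot (QQ U) (IM U)"
  unfolding restr_H0_psh_def Let_def psh.simps restr_im[OF U] by (simp add: restr_term_sec tensor_def free_mod_frags)

lemma H_res:
  assumes U: "zopen U" "zopen V" "z0 p : V" "V \<subseteq> U"
  shows "res (restr_H0_psh m d) U V = quot_map (QQ V) (IM V) (quot_map (natmod (left_act (TS V)) (A0 V)) (TR2 (m 0) V) (rs2 (m 0) U V))"
  unfolding restr_H0_psh_def Let_def psh.simps restr_im[OF U(2,3)]
  by (simp add: restr_term_sec tensor_def free_mod_frags) (simp add: restr_term_def tensor_psh_def free_mod_frags)

lemma left_act_add: "left_act B P (x + y) = left_act B P x + left_act B P y"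
  by (simp add: left_act_def frag_extend_add)

lemma BB_lact:
  assumes U: "zopen U" "z0 p : U" "P : Dop (z0 -` U)" "x : BB U" shows "left_act (TS U) P x : BB U"
proof -
  obtain y where y: "y : A1 U" "x = Dm U y" using assms(4) by blast
  have "left_act (TS U) P (Dm U y) = Dm U (left_act (TS U) P y)"
    using y(1) by (induction y rule: frags_induct) (simp_all add: left_act_def frag_extend_diff)
  then show ?thesis unfolding y(2) using imageI[OF lact2(1)[OF U(1-3) y(1)], of "Dm U"] by simp
qed

lemma BB_rs:
  assumes U: "zopen U" "zopen V" "z0 p : V" "V \<subseteq> U" "x : BB U" shows "rs2 (m 0) U V x : BB V"
proof -
  obtain y where y: "y : A1 U" "x = Dm U y" using assms(5) by blast
  have "rs2 (m 0) U V (Dm U y) = Dm V (rs2 (m (Suc 0)) U V y)"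
    using y(1) by (induction y rule: frags_induct) (simp_all add: frag_extend_diff d_hom(4)[OF U(1) _ U(2,4)])
  then show ?thesis unfolding y(2) using imageI[OF rs2_mem(1)[OF U(1-4) y(1)], of "Dm V"] by simp
qed

text \<open>A boundary is a sum of b \<otimes> d t, and \<epsilon> d t = 0, so each summand is
  evaluated at a vector that is zero modulo I_4.\<close>

lemma ev_K:
  assumes U: "zopen U" "z0 p : U" and x: "x : hK U" shows "ev p U x : NQ.RL p"
proof -
  obtain y where y: "y : A1 U" "x - Dm U y : TR2 (m 0) U"
    using x unfolding dquot.Kq_def[OF dq[OF U]] by blast
  have "vact.fev (eh p U) (Dm U y) - vact.fev (%_. 0) y : NQ.RL p"
    using y(1)
  proof (rule vact.fev_extend_cong[OF _ NQ.RL_nsub])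
    fix b v assume b: "b : carr (TS U)" "v : carr (D1 U)"
    have "E (cc p U (d 0 U v)) (tau U b) : NQ.RL p"
      by (rule E_RQ[OF tau(1)[OF U(2) b(1)] U(2) cc_d[OF U b(2)]])
    then show "vact.fev (eh p U) (case (b, v) of (b, v) => frag_of (b, d 0 U v)) - 0 : NQ.RL p" by (simp add: eh_def)
  qed
  moreover have "vact.fev (%_. 0) y = (0 :: ('k, 'n) dop ^ 'r)" by (simp add: vact.fev_def vec_eq_iff)
  ultimately have "ev p U (Dm U y) : NQ.RL p" by (simp add: ev_def)
  from nsubD(2)[OF NQ.RL_nsub ev_TR[OF y(2) U] this] show ?thesis by (simp add: ev_diff)
qed

lemma ev_rs:
  assumes U: "zopen U" "zopen V" "z0 p : V" "V \<subseteq> U" and x: "x : A0 U"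
  shows "ev p V (rs2 (m 0) U V x) - ev p U x : NQ.RL p"
  unfolding ev_def using x
proof (rule vact.fev_extend_cong[OF _ NQ.RL_nsub])
  have pU: "z0 p : U" using U by blast
  fix b v assume b: "b : carr (TS U)" "v : carr (D0 U)"
  obtain y where y: "y : FX U" "y : FX V" "b = ct U y" "res transfer_psh U V b = ct V y" using T_res_carr[OF U(3,4) b(1)] by blast
  note c = cc(1)[OF U(1) pU b(2)] cc(1)[OF U(2,3) DF_closed(3)[OF U(1) pU b(2) U(2,3,4)]]
  have "E (cc p V (res (D_free (m 0)) U V v)) y - E (cc p U v) y : NQ.RL p"
    by (rule E_RQ_diff[OF y(1) pU c(2,1) cc_res[OF U b(2)]])
  then show "vact.fev (eh p V) (case (b, v) of (b, v) => frag_of (res transfer_psh U V b, res (D_free (m 0)) U V v)) - eh p U (b, v) : NQ.RL p"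
    using E_tau[OF U(3) c(2) y(2)] E_tau[OF pU c(1) y(1)] by (simp add: eh_def y(3)[symmetric] y(4))
qed

lemma ev_lact:
  assumes U: "zopen U" "z0 p : U" and P: "P : Dop (z0 -` U)" and x: "x : A0 U"
  shows "ev p U (left_act (TS U) P x) - actv P (ev p U x) : NQ.RL p"
  unfolding ev_def left_act_def using x
proof (rule vact.fev_extend_act[OF _ NQ.RL_nsub])
  interpret tmod U by (rule tmodI[OF U(2)])
  have "P : Dop {p}" using P Dop_antimono[of "{p}" "z0 -` U"] U(2) by auto
  then show "c : NQ.RL p ==> actv P c : NQ.RL p" for c using NQ.RL_act NQ.Dop_L by blast
  fix b v assume b: "b : carr (TS U)" "v : carr (D0 U)"
  note t = tau[OF U(2) b(1)] and c = cc(1)[OF U b(2)]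
  have "smul (TS U) P b = ct U (transfer_act P (tau U b))" using T_smul[OF P t(1)] by (simp add: t(2))
  then have "E (cc p U v) (tau U (smul (TS U) P b)) = actv P (E (cc p U v) (tau U b))"
    using E_tau[OF U(2) c transfer_FX[OF P t(1)]] E_transfer[OF U(2) c P t(1)] by simp
  then show "vact.fev (eh p U) (case (b, v) of (b, v) => frag_of (smul (TS U) P b, v)) - actv P (eh p U (b, v)) : NQ.RL p"
    using nsubD(1)[OF NQ.RL_nsub] by (simp add: eh_def)
qed

lemma ev_one: assumes "zopen U" "z0 p : U" "v : carr (D0 U)" shows "ev p U (frag_of (one_T U, v)) = psiv (cc p U v)"
proof -
  interpret tmod U by (rule tmodI[OF assms(2)])
  show ?thesis unfolding ev_of one_T_def E_tau[OF assms(2) cc(1)[OF assms] one_FX[OF Dop_1]]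
    by (simp add: E_of psiv_def)
qed

lemma psiv_RQ_diff:
  assumes "c : IQ.CQ (z0 p)" "c' : IQ.CQ (z0 p)" "c - c' : IQ.RQ (z0 p)" shows "psiv c - psiv c' : NQ.RL p"
proof -
  have "x : D2v" if "x : IQ.CQ (z0 p)" for x using that Dop_D2[of p] by (auto simp: ICQ)
  then show ?thesis using IRQ_psi[OF assms(3)] psiv_ops(2)[of c c'] assms(1,2) by simp
qed

text \<open>One section v serves for all diagonal points of V; describing a section of the sheaf
  requires such a uniform choice.\<close>

lemma normal_form:
  assumes U: "zopen U" "z0 p : U" and x: "x : A0 U"
  shows "\<exists>V v. zopen V & z0 p : V & V \<subseteq> U & v : carr (D0 V) & rs2 (m 0) U V x - frag_of (one_T V, v) : TR2 (m 0) V &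
    (\<forall>q. z0 q : V --> ev q U x - psiv (cc q V v) : NQ.RL q)"
proof -
  let ?V = "lift_dom U"
  note V = lift_dom(1)[OF U(1)] lift_dom(3)[OF U(2)] lift_dom(2)[of U]
  obtain v where v: "v : carr (D0 ?V)" "rs2 (m 0) U ?V x - frag_of (one_T ?V, v) : TR2 (m 0) ?V"
    using normal_form2[OF U x] unfolding Gd_def by blast
  have "ev q U x - psiv (cc q ?V v) : NQ.RL q" if q: "z0 q : ?V" for q
    using nsubD(4)[OF NQ.RL_nsub ev_TR[OF v(2) V(1) q] ev_rs[OF U(1) V(1) q V(3) x]]
    by (simp add: ev_diff ev_one[OF V(1) q v(1)])
  then show ?thesis using V v by blast
qed

text \<open>A section that is killed modulo z can be corrected, without changing its class, to lie in the kernel of \<open>\<epsilon>\<close>.\<close>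

lemma lift_zero:
  assumes V: "zopen V" "z0 p : V" "v : carr (D0 V)" and "finite I" and e: "!!i. e i : IQ.CQ (z0 p)"
  shows "\<exists>V' v'. zopen V' & z0 p : V' & V' \<subseteq> V & v' : carr (D0 V') &
    frag_of (one_T V', res (D_free (m 0)) V V' v) - frag_of (one_T V', v') : TR2 (m 0) V' &
    IQ.RlD (z0 p) V' (\<epsilon> V' v') (cc p V v - (\<Sum>i\<in>I. actv (mulop (zv i)) (e i)))"
  using \<open>finite I\<close>
proof (induction I)
  case empty
  show ?case using V cc(2)[OF V] DF_res_self[OF V(3)] nsubD(1)[OF nsub_tensor_rel]
    by (intro exI[of _ V] exI[of _ v]) auto
next
  case (insert i I)
  then obtain V1 v1 where V1: "zopen V1" "z0 p : V1" "V1 \<subseteq> V" "v1 : carr (D0 V1)"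
    "frag_of (one_T V1, res (D_free (m 0)) V V1 v) - frag_of (one_T V1, v1) : TR2 (m 0) V1"
    "IQ.RlD (z0 p) V1 (\<epsilon> V1 v1) (cc p V v - (\<Sum>i\<in>I. actv (mulop (zv i)) (e i)))" by blast
  \<comment> \<open>The vector e i is only a local class modulo I_4; surjectivity of \<epsilon>
    lifts it to the free module near p.\<close>
  obtain U s where U: "zopen U" "z0 p : U" "IQ.RlD (z0 p) U s (e i)" using IQ.MD.M2[OF e] by blast
  then obtain V0 w where V0: "zopen V0" "z0 p : V0" "V0 \<subseteq> U" "w : carr (D0 V0)" "\<epsilon> V0 w = res IQ.MS U V0 s"
    using eps_surj[OF U(1) _ U(2), of s] IQ.MD.M0[OF U(3)] by blast
  let ?W = "V1 \<inter> V0"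
  have W: "zopen ?W" "z0 p : ?W" using V1 V0 by (auto intro: zopen_Int)
  interpret tmod2 ?W "m 0" by (rule tmod2I[OF W])
  let ?v = "res (D_free (m 0)) V1 ?W v1" and ?w = "res (D_free (m 0)) V0 ?W w"
  have v: "?v : carr (D0 ?W)" by (rule DF_closed(3)[OF V1(1,2,4) W Int_lower1])
  have w: "?w : carr (D0 ?W)" by (rule DF_closed(3)[OF V0(1,2,4) W Int_lower2])
  let ?P = "mulop (- zv i) :: ('k, 'n + 'n) dop"
  have z: "- zv i : reg ?W" by (rule dring.Sneg[OF dring_reg rpol_reg])
  have P: "?P : Dop ?W" by (rule Dop_mulop[OF z])
  let ?u = "smul (D0 ?W) ?P ?w"
  have u: "?u : carr (D0 ?W)" by (rule Dk_closed(2)[OF w P])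
  have "IQ.RlD (z0 p) ?W (\<epsilon> ?W ?v) (cc p V v - (\<Sum>i\<in>I. actv (mulop (zv i)) (e i)))"
    unfolding eps_hom(4)[OF V1(1,4) W(1) Int_lower1] by (rule IQ.MD.M7[OF V1(6) W Int_lower1])
  moreover have "IQ.RlD (z0 p) ?W (\<epsilon> ?W ?u) (actv ?P (e i))"
    unfolding eps_hom(3)[OF W(1) w P] eps_hom(4)[OF V0(1,4) W(1) Int_lower2] V0(5)
    by (rule IQ.MD.M5[OF IQ.MD.M7[OF IQ.MD.M7[OF U(3) V0(1-3)] W Int_lower2]]) (simp add: P)
  ultimately have "IQ.RlD (z0 p) ?W (\<epsilon> ?W (addm (D0 ?W) ?v ?u)) (cc p V v - (\<Sum>i\<in>I. actv (mulop (zv i)) (e i)) + actv ?P (e i))"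
    unfolding eps_hom(2)[OF W(1) v u] by (rule IQ.MD.M4)
  moreover have "cc p V v - (\<Sum>i\<in>I. actv (mulop (zv i)) (e i)) + actv ?P (e i) = cc p V v - (\<Sum>i\<in>insert i I. actv (mulop (zv i)) (e i))"
    using insert(1,2) by (simp add: vec_eq_iff mulop_minus)
  ultimately have R: "IQ.RlD (z0 p) ?W (\<epsilon> ?W (addm (D0 ?W) ?v ?u)) (cc p V v - (\<Sum>i\<in>insert i I. actv (mulop (zv i)) (e i)))"
    by simp
  \<comment> \<open>z_i restricts to 0 on Y', so 1 \<otimes> z_i w vanishes and the correction does
    not change the tensor.\<close>
  have "rsub s0 (- zv i :: ('k, 'n + 'n) ratf) = 0"
    unfolding rsub_neg(2)[OF rpol_regS] by (simp add: s0_def rpol.hom_0)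
  then have "ct ?W (frag_of (1, ?P)) = ct ?W 0"
    using ct_move[OF z Dop_1] ct_zero[OF FX_of[OF dring.S0[OF dring_reg] Dop_1] TX_01[OF Dop_1]] by simp
  then have k: "frag_of (one_T ?W, ?u) : TR"
    using TRd(4)[OF t_0l[OF w] t_one[OF w P]] by simp
  have "rs2 (m 0) V1 ?W (frag_of (one_T V1, res (D_free (m 0)) V V1 v) - frag_of (one_T V1, v1)) : TR"
    by (rule rs2_mem(2)[OF V1(1) W Int_lower1 V1(5)])
  then have r: "frag_of (one_T ?W, res (D_free (m 0)) V ?W v) - frag_of (one_T ?W, ?v) : TR"
    by (simp add: frag_extend_diff one_res[OF W(2) Int_lower1] DF_res_res)
  have a: "frag_of (one_T ?W, addm (D0 ?W) ?v ?u) - frag_of (one_T ?W, ?v) - frag_of (one_T ?W, ?u) : TR"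
    by (rule tr_addr[OF one_mem v u])
  from TRd(4)[OF TRd(4)[OF r a] k]
  have "frag_of (one_T ?W, res (D_free (m 0)) V ?W v) - frag_of (one_T ?W, addm (D0 ?W) ?v ?u) : TR"
    by (simp add: algebra_simps)
  then show ?case using W R Dk_closed(1)[OF v u] V1(3) by (intro exI[of _ ?W] exI[of _ "addm (D0 ?W) ?v ?u"]) auto
qed

text \<open>If 1 \<otimes> v evaluates to zero, then by \<open>kernel\<close> the class \<epsilon> v
  is a combination of the z_i modulo I_4. After the correction by \<open>lift_zero\<close> the image
  under \<epsilon> vanishes near p, and exactness makes the corrected section a boundary.\<close>

lemma ev_inj:
  assumes U: "zopen U" "z0 p : U" and x: "x : A0 U" and e: "ev p U x : NQ.RL p"
  shows "\<exists>W. zopen W & z0 p : W & W \<subseteq> U & rs2 (m 0) U W x : hK W"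
proof -
  obtain V v where V: "zopen V" "z0 p : V" "V \<subseteq> U" "v : carr (D0 V)" "rs2 (m 0) U V x - frag_of (one_T V, v) : TR2 (m 0) V"
    "!!q. z0 q : V ==> ev q U x - psiv (cc q V v) : NQ.RL q"
    using normal_form[OF U x] by blast
  have "psiv (cc p V v) : NQ.RL p" using nsubD(4)[OF NQ.RL_nsub e V(6)[OF V(2)]] by simp
  then obtain g where g: "!!i. g i : IQ.CQ (z0 p)" "cc p V v - (\<Sum>i\<in>UNIV. actv (mulop (zv i)) (g i)) : IQ.RQ (z0 p)"
    using kernel[OF cc(1)[OF V(1,2,4)]] by blast
  obtain V' v' where V': "zopen V'" "z0 p : V'" "V' \<subseteq> V" "v' : carr (D0 V')"
    "frag_of (one_T V', res (D_free (m 0)) V V' v) - frag_of (one_T V', v') : TR2 (m 0) V'"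
    "IQ.RlD (z0 p) V' (\<epsilon> V' v') (cc p V v - (\<Sum>i\<in>UNIV. actv (mulop (zv i)) (g i)))"
    using lift_zero[where e=g and I=UNIV, OF V(1,2,4) finite g(1)] by blast
  obtain W where W: "zopen W" "z0 p : W" "W \<subseteq> V'" "res IQ.MS V' W (\<epsilon> V' v') = res IQ.MS UNIV W (zerom (sec IQ.MS UNIV))"
    using IQ.MD.M3[OF V'(6) IQ.MD.M6] g(2) by auto
  let ?v = "res (D_free (m 0)) V' W v'"
  have v: "?v : carr (D0 W)" by (rule DF_closed(3)[OF V'(1,2,4) W(1-3)])
  have "\<epsilon> W ?v = zerom (sec IQ.MS W)" unfolding eps_hom(4)[OF V'(1,4) W(1,3)] W(4) MS_zerom ..
  then obtain X t where X: "zopen X" "z0 p : X" "X \<subseteq> W" "t : carr (D1 X)" "d 0 X t = res (D_free (m 0)) W X ?v"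
    using eps_exact[OF W(1) v] W(2) by blast
  interpret tmod2 X "m 0" by (rule tmod2I[OF X(1,2)])
  have XV: "X \<subseteq> V'" "X \<subseteq> V" "X \<subseteq> U" using X W V' V by auto
  have dt: "d 0 X t = res (D_free (m 0)) V' X v'" unfolding X(5) by (rule DF_res_res[OF X(3)])
  have t: "frag_of (one_T X, t) : A1 X" by (rule frags_of[OF one_mem X(4)])
  have rr: "rs2 (m 0) V X (rs2 (m 0) U V x) = rs2 (m 0) U X x"
    using x
  proof (induction x rule: frags_induct)
    case (one b w)
    obtain y where y: "y : FX U" "y : FX V" "b = ct U y" "res transfer_psh U V b = ct V y" using T_res_carr[OF V(2,3) one(1)] by blast
    have "res transfer_psh V X (ct V y) = ct X y" "res transfer_psh U X (ct U y) = ct X y"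
      by (rule T_res[OF tmodI[OF V(2)] tmod_axioms XV(2) y(2)], rule T_res[OF tmodI[OF U(2)] tmod_axioms XV(3) y(1)])
    then show ?case using y(3,4) by (simp add: DF_res_res[OF XV(2)])
  qed (simp_all add: frag_extend_diff)
  have 1: "rs2 (m 0) U X x - frag_of (one_T X, res (D_free (m 0)) V X v) : TR"
    using rs2_mem(2)[OF V(1) X(1,2) XV(2) V(5)] by (simp add: frag_extend_diff rr one_res[OF X(2) XV(2)])
  have 2: "frag_of (one_T X, res (D_free (m 0)) V X v) - frag_of (one_T X, d 0 X t) : TR"
    using rs2_mem(2)[OF V'(1) X(1,2) XV(1) V'(5)] unfolding dt by (simp add: frag_extend_diff one_res[OF X(2) XV(1)] DF_res_res[OF XV(1)])
  have k: "rs2 (m 0) U X x - Dm X (frag_of (one_T X, t)) : TR" using TRd(2)[OF 1 2] by simp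
  have "rs2 (m 0) U X x : hK X"
    unfolding dquot.Kq_def[OF dq[OF X(1,2)]]
    by (intro CollectI conjI rs2_mem(1)[OF U(1) X(1,2) XV(3) x] bexI[where P="%y. rs2 (m 0) U X x - y : TR", OF k imageI[where f="Dm X", OF t]])
  then show ?thesis using X(1,2) XV(3) by (intro exI[of _ X]) simp
qed

lemma H_classes: "classes actv z0 (restr_H0_psh m d) NQ.CL NQ.RL A0 hK hcl (rs2 (m 0)) ev (%U. left_act (TS U))"
proof
  fix P :: "('k, 'n) dop" and p c assume "P : Dop {p}" "c : NQ.RL p"
  then show "actv P c : NQ.RL p" using NQ.RL_act NQ.Dop_L by blast
next
  \<comment> \<open>The cylinder over V induces V on the diagonal.\<close>
  fix V :: "('n => 'k) set" assume "zopen V"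
  then show "\<exists>U. zopen U & z0 -` U = V" using pr_open[of V] by (intro exI[of _ "pr -` V"]) (auto simp: pr_z0)
next
  fix U :: "('n + 'n => 'k) set" and p assume U: "zopen U" "z0 p : U"
  interpret q: dquot "left_act (TS U)" "A0 U" "TR2 (m 0) U" "BB U" by (rule dq[OF U])
  show "carr (sec (restr_H0_psh m d) U) = hcl U ` A0 U" unfolding H_sec[OF U] by (rule q.cl_carr)
  { fix x y assume xy: "x : A0 U" "y : A0 U"
    show "hcl U x = hcl U y \<longleftrightarrow> x - y : hK U" by (rule q.cl_eq[OF xy])
    show "addm (sec (restr_H0_psh m d) U) (hcl U x) (hcl U y) = hcl U (x + y)" unfolding H_sec[OF U] by (rule q.cl_add[OF xy]) }
  { fix x P assume x: "x : A0 U" and P: "P : Dop (z0 -` U)"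
    show "left_act (TS U) P x : A0 U" by (rule lact2(1)[OF U P x])
    show "smul (sec (restr_H0_psh m d) U) P (hcl U x) = hcl U (left_act (TS U) P x)"
      unfolding H_sec[OF U] by (rule q.cl_smul[OF left_act_add lact2[OF U P] BB_lact[OF U P] x])
    show "ev p U (left_act (TS U) P x) - actv P (ev p U x) : NQ.RL p" by (rule ev_lact[OF U P x]) }
  { fix x assume x: "x : A0 U"
    obtain V v where V: "zopen V" "z0 p : V" "V \<subseteq> U" "v : carr (D0 V)" "!!q. z0 q : V ==> ev q U x - psiv (cc q V v) : NQ.RL q"
      using normal_form[OF U x] by blast
    obtain W c where W: "zopen W" "z0 p : W" "W \<subseteq> V" "c : IQ.CQ (z0 p)" "!!q. q : W ==> IQ.RlD q V (\<epsilon> V v) c"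
      using IQ.MD.M1[OF V(1,2) eps_hom(1)[OF V(1,4)]] by blast
    have "ev q U x - psiv c : NQ.RL q" if q: "z0 q : W" for q
    proof -
      have qV: "z0 q : V" using q W by blast
      note r = cc_cong[OF W(5)[OF q]] and c = cc(1)[OF V(1) qV V(4)]
      \<comment> \<open>The vector c was chosen at p. At the nearby point q it differs from
        \<open>cc q V v\<close> by a relation, and relations have entries regular at that point, so
        c is admissible there as well.\<close>
      have "cc q V v - (cc q V v - c) : IQ.CQ (z0 q)"
        by (rule nsubD(4)[OF IQ.CQ_nsub c]) (use IRQ_Dop[OF r] in \<open>simp add: ICQ\<close>)
      then have "c : IQ.CQ (z0 q)" by simp
      from nsubD(2)[OF NQ.RL_nsub V(5)[OF qV] psiv_RQ_diff[OF c this r]] show ?thesis by simp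
    qed
    then show "\<exists>W c. zopen W & z0 p : W & W \<subseteq> U & c : NQ.CL p & (\<forall>q. z0 q : W --> ev q U x - c : NQ.RL q)"
      using W(1,2,3) V(3) psiv_CL[OF W(4)] by (intro exI[of _ W] exI[of _ "psiv c"]) auto }
next
  fix U V :: "('n + 'n => 'k) set" and p x assume U: "zopen U" "zopen V" "z0 p : V" "V \<subseteq> U" and x: "x : A0 U"
  have pU: "z0 p : U" using U by blast
  show "rs2 (m 0) U V x : A0 V" by (rule rs2_mem(1)[OF U x])
  show "res (restr_H0_psh m d) U V (hcl U x) = hcl V (rs2 (m 0) U V x)"
    unfolding H_res[OF U]
    by (rule dquot.cl_map[OF dq[OF U(2,3)] dq[OF U(1) pU] frag_extend_add rs2_mem[OF U] BB_rs[OF U] x])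
  show "ev p V (rs2 (m 0) U V x) - ev p U x : NQ.RL p" by (rule ev_rs[OF U x])
next
  fix U V W :: "('n + 'n => 'k) set" and p x
  assume U: "z0 p : W" "V \<subseteq> U" "W \<subseteq> V" and x: "x : A0 U"
  show "rs2 (m 0) V W (rs2 (m 0) U V x) = rs2 (m 0) U W x"
    using x
  proof (induction x rule: frags_induct)
    case (one b w)
    have p: "z0 p : V" "z0 p : U" "W \<subseteq> U" using U by auto
    obtain y where y: "y : FX U" "y : FX V" "b = ct U y" "res transfer_psh U V b = ct V y" using T_res_carr[OF p(1) U(2) one(1)] by blast
    have "res transfer_psh V W (ct V y) = ct W y" "res transfer_psh U W (ct U y) = ct W y"
      by (rule T_res[OF tmodI[OF p(1)] tmodI[OF U(1)] U(3) y(2)], rule T_res[OF tmodI[OF p(2)] tmodI[OF U(1)] p(3) y(1)])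
    then show ?case using y(3,4) by (simp add: DF_res_res[OF U(3)])
  qed (simp_all add: frag_extend_diff)
next
  fix p c assume "c : NQ.CL p"
  then obtain g where g: "g : IQ.CQ (z0 p)" "psiv g = c" using psiv_surj by blast
  obtain U s where U: "zopen U" "z0 p : U" "!!q. q : U ==> IQ.RlD q U s g" using IQ.MD.M2[OF g(1)] by blast
  obtain V v where V: "zopen V" "z0 p : V" "V \<subseteq> U" "v : carr (D0 V)" "\<epsilon> V v = res IQ.MS U V s"
    using eps_surj[OF U(1) _ U(2), of s] IQ.MD.M0[OF U(3)[OF U(2)]] by blast
  interpret tmod V by (rule tmodI[OF V(2)])
  have "ev q V (frag_of (one_T V, v)) - c : NQ.RL q" if q: "z0 q : V" for q
  proof -
    have "IQ.RlD (z0 q) V (\<epsilon> V v) g" unfolding V(5) by (rule IQ.MD.M7[OF U(3) V(1) q V(3)]) (use q V in blast)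
    note r = cc_cong[OF this] and c = cc(1)[OF V(1) q V(4)]
    have "cc q V v - (cc q V v - g) : IQ.CQ (z0 q)"
      by (rule nsubD(4)[OF IQ.CQ_nsub c]) (use IRQ_Dop[OF r] in \<open>simp add: ICQ\<close>)
    then have "g : IQ.CQ (z0 q)" by simp
    then show ?thesis using psiv_RQ_diff[OF c _ r] g(2) ev_one[OF V(1) q V(4)] by simp
  qed
  then show "\<exists>U x. zopen U & z0 p : U & x : A0 U & (\<forall>q. z0 q : U --> ev q U x - c : NQ.RL q)"
    using V(1,2) frags_of[OF one_mem V(4)] by blast
next
  have U: "zopen (UNIV :: ('n + 'n => 'k) set)" "z0 (%_. 0) : (UNIV :: ('n + 'n => 'k) set)" by (simp_all add: zopen_UNIV)
  show "zerom (sec (restr_H0_psh m d) UNIV) = hcl UNIV 0"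
    unfolding H_sec[OF U] by (rule dquot.cl_zero[OF dq[OF U]])
qed (auto simp: NQ.RL_nsub nsub_frags z0_open ev_diff ev_K ev_inj frag_extend_diff)

lemma H0_iso: "dmod_iso (mod_loc f NQ.MS) (restr_H0 m d)"
  unfolding NQ.mod_loc_eq sheafify_def restr_H0_def
  by (rule dmod_iso_models[OF NQ.mod_loc_model classes.model[OF H_classes]])

end

theorem mainTheorem4:
  fixes f :: "('k::{alg_closed_field,field_char_0}, 'n::{finite,linorder}) mpol"
    and N :: "(('k, 'n) dop ^ 'r) set"
    and b :: "'k poly" and \<nu> :: int
  defines "M \<equiv> D_tensor (quot weyl_vec_mod N)"
    and "b_f \<equiv> pcompose b [:-1, -1:]"
  assumes N: "lsubmodule weyl_vec_mod weyl N"
    and hol: "holonomic M"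
    and f: "f \<notin> range mconst"
    and b: "is_graph_b f b"
    and root: "poly b_f (of_int \<nu>) = 0"
    and min: "\<And>m::int. poly b_f (of_int m) = 0 \<Longrightarrow> \<nu> \<le> m"
  shows "dmod_iso (O_loc f) (D_tensor (quot weyl_mod (fs_ann_at f \<nu>))) \<and>
    (\<forall>SJ SN. finite SJ \<longrightarrow> lspan weyl_mod weyl SJ = fs_ann_at f \<nu> \<longrightarrow>
       finite SN \<longrightarrow> lspan weyl_vec_mod weyl SN = N \<longrightarrow>
       (\<forall>m d \<epsilon>. free_resolution m d \<epsilon>
            (D_tensor (quot weyl_vec_mod (lspan weyl_vec_mod weyl (G4 SJ SN)))) \<longrightarrow>
          dmod_iso (mod_loc f M) (restr_H0 m d)))"
proof -
  have f0: "f \<noteq> 0"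
  proof
    assume "f = 0"
    then have "f = mconst 0" by (simp add: mconst_def)
    then show False using f by blast
  qed
  \<comment> \<open>If b were zero, every integer would be a root of b_f, against the minimality of
    \<nu>.\<close>
  have b0: "b \<noteq> 0"
  proof
    assume "b = 0"
    then have "poly b_f (of_int (\<nu> - 1)) = 0" by (simp add: b_f_def)
    then show False using min by fastforce
  qed
  have bf: "poly b_f (of_int m) = poly b (of_int (- m - 1))" for m
  proof -
    have "- 1 - of_int m = (of_int (- m - 1) :: 'k)"
      by (simp only: of_int_diff of_int_minus of_int_1 minus_diff_commute[of 1])
    moreover have "poly b_f (of_int m) = poly b (- 1 - of_int m)" by (simp add: b_f_def poly_pcompose)
    ultimately show ?thesis by (simp only:)
  qed
  have FE: "\<exists>h R. meval p h \<noteq> 0 \<and> R \<in> pf weyl \<and>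
      (\<forall>m. app (R m) (rpol f powi (m + 1)) = rpol h * Kp b_f m * rpol f powi m)" for p
    using graph.functional_equation[OF graph.intro[OF f0] b b0, of p] unfolding Kp_def bf .
  interpret P: powers f b_f \<nu> by (intro powers.intro f0 min FE)
  show ?thesis
  proof (intro conjI allI impI)
    show "dmod_iso (O_loc f) (D_tensor (quot weyl_mod (fs_ann_at f \<nu>)))" by (rule P.O_loc_iso)
  next
    fix SJ SN m d \<epsilon>
    assume SJ: "lspan weyl_mod weyl SJ = fs_ann_at f \<nu>" and SN: "lspan weyl_vec_mod weyl SN = N"
      and res: "free_resolution m d \<epsilon> (D_tensor (quot weyl_vec_mod (lspan weyl_vec_mod weyl (G4 SJ SN))))"
    interpret D: diag f b_f \<nu> N SJ SN
      by (intro diag.intro P.powers_axioms diag_axioms.intro N SJ SN)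
    have Q: "quot weyl_vec_mod N = D.NQ.Q" "quot weyl_vec_mod (lspan weyl_vec_mod weyl (G4 SJ SN)) = D.IQ.Q"
      unfolding D.NQ.Q_def D.IQ.Q_def by (simp_all add: weyl_vec_mod_def)
    have "resolved f b_f \<nu> N SJ SN m d \<epsilon>"
      by (rule resolved.intro[OF D.diag_axioms resolved_axioms.intro]) (rule res[unfolded Q(2)])
    then show "dmod_iso (mod_loc f M) (restr_H0 m d)" unfolding M_def Q(1) by (rule resolved.H0_iso)
  qed
qed

end
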